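(* Let $T>0$ and let $(\Omega,\mathcal F,(\mathcal F_t)_{0\le t\le T},\mathbb P)$ be a filtered probability space satisfying the usual conditions. Let $S=(S_t)_{0\le t\le T}$ be a real-valued, càdlàg, adapted process. Then the following are equivalent: (1) For every sequence $(H^n)_{n\ge1}$ of simple integrands with $\lim_{n\to\infty}\|H^n\|_\infty=0$ and $\lim_{n\to\infty}\sup_{0\le t\le T}\big((H^n\cdot S)_t\big)^-=0$ in probability, we have $\lim_{n\to\infty}(H^n\cdot S)_T^+=0$ in probability. (2) $S$ is a semi-martingale, i.e. $S$ may be decomposed as $S=M+A$, where $M=(M_t)_{0\le t\le T}$ is a local martingale and $A=(A_t)_{0\le t\le T}$ is an adapted process of finite variation.
   Context: A simple integrand is a process $H=(H_t)_{0\le t\le T}$ of the form $H_t=\sum_{j=1}^n f_j\,\mathbf 1_{]\tau_{j-1},\tau_j]}(t)$, $0\le t\le T$, where $n$ is a finite number, $0=\tau_0\le\tau_1\le\dots\le\tau_n=T$ are stopping times, and $f_j\in L^\infty(\Omega,\mathcal F_{\tau_{j-1}},\mathbb P)$. For such $H$ one sets $(H\cdot S)_t=\sum_{j=1}^n f_j\,(S_{\tau_j\wedge t}-S_{\tau_{j-1}\wedge t})$ for $0\le t\le T$. The norm is $\|H\|_\infty=\sup_{0\le t\le T}\|H_t\|_{L^\infty(\mathbb P)}$; $x^+=\max(x,0)$ and $x^-=\max(-x,0)$. Local martingales are taken càdlàg; a finite variation process is a càdlàg adapted process with a.s. paths of finite total variation on $[0,T]$. *)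

theory Defs
  imports "HOL-Probability.Probability"
begin

text \<open>A filtration on \<open>[0,T]\<close> is given by a family \<open>F\<close> indexed by the reals of which only the
  members with index in \<open>[0,T]\<close> matter. The library notions of filtration, stopping time and
  \<open>\<sigma>\<close>-algebra of a stopping time require a family indexed by a whole type; they are applied
  to the family extended constantly outside \<open>[0,T]\<close>. For a \<open>[0,T]\<close>-valued stopping time the
  conditions at indices outside \<open>[0,T]\<close> then add nothing.\<close>

definition on_horizon :: "real \<Rightarrow> (real \<Rightarrow> 'b) \<Rightarrow> real \<Rightarrow> 'b" where
  "on_horizon T F t = F (max 0 (min T t))"

locale usual_filtered_prob_space =
  prob_space M + complete_measure M + filtration "space M" "on_horizon T F"
  for M :: "'a measure" and F :: "real \<Rightarrow> 'a measure" and T :: real +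
  assumes subalgebra_F: "\<And>t. t \<in> {0..T} \<Longrightarrow> subalgebra M (F t)"
    and null_sets_F0: "null_sets M \<subseteq> sets (F 0)"
    and right_continuous_F: "\<And>t. t \<in> {0..<T} \<Longrightarrow> sets (F t) = (\<Inter>s\<in>{t<..T}. sets (F s))"

definition stopping_time_upto :: "'a measure \<Rightarrow> (real \<Rightarrow> 'a measure) \<Rightarrow> real \<Rightarrow> ('a \<Rightarrow> real) \<Rightarrow> bool" where
  "stopping_time_upto M F T \<tau> \<longleftrightarrow>
     (\<forall>\<omega>\<in>space M. \<tau> \<omega> \<in> {0..T}) \<and> stopping_time (on_horizon T F) \<tau>"

definition stopped_sigma :: "'a measure \<Rightarrow> (real \<Rightarrow> 'a measure) \<Rightarrow> real \<Rightarrow> ('a \<Rightarrow> real) \<Rightarrow> 'a measure" where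
  "stopped_sigma M F T \<tau> = filtration.pre_sigma (space M) (on_horizon T F) \<tau>"

text \<open>Processes are functions \<open>X t \<omega>\<close>; only times \<open>t \<in> [0,T]\<close> and points of the sample space
  matter.\<close>

definition adapted_upto :: "(real \<Rightarrow> 'a measure) \<Rightarrow> real \<Rightarrow> (real \<Rightarrow> 'a \<Rightarrow> real) \<Rightarrow> bool" where
  "adapted_upto F T X \<longleftrightarrow> (\<forall>t\<in>{0..T}. X t \<in> borel_measurable (F t))"

definition cadlag_path :: "real \<Rightarrow> (real \<Rightarrow> real) \<Rightarrow> bool" where
  "cadlag_path T x \<longleftrightarrow>
     (\<forall>t\<in>{0..<T}. continuous (at_right t) x) \<and> (\<forall>t\<in>{0<..T}. \<exists>l. (x \<longlongrightarrow> l) (at_left t))"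

definition cadlag_process :: "'a measure \<Rightarrow> real \<Rightarrow> (real \<Rightarrow> 'a \<Rightarrow> real) \<Rightarrow> bool" where
  "cadlag_process M T X \<longleftrightarrow> (\<forall>\<omega>\<in>space M. cadlag_path T (\<lambda>t. X t \<omega>))"

definition finite_variation_path :: "real \<Rightarrow> (real \<Rightarrow> real) \<Rightarrow> bool" where
  "finite_variation_path T x \<longleftrightarrow>
     (\<exists>C. \<forall>n p. p ` {..n} \<subseteq> {0..T} \<and> mono_on {..n} p \<longrightarrow>
        (\<Sum>i<n. \<bar>x (p (Suc i)) - x (p i)\<bar>) \<le> C)"

definition finite_variation_process ::
  "'a measure \<Rightarrow> (real \<Rightarrow> 'a measure) \<Rightarrow> real \<Rightarrow> (real \<Rightarrow> 'a \<Rightarrow> real) \<Rightarrow> bool" where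
  "finite_variation_process M F T A \<longleftrightarrow>
     adapted_upto F T A \<and> cadlag_process M T A \<and>
     (AE \<omega> in M. finite_variation_path T (\<lambda>t. A t \<omega>))"

definition martingale_upto ::
  "'a measure \<Rightarrow> (real \<Rightarrow> 'a measure) \<Rightarrow> real \<Rightarrow> (real \<Rightarrow> 'a \<Rightarrow> real) \<Rightarrow> bool" where
  "martingale_upto M F T X \<longleftrightarrow>
     adapted_upto F T X \<and> (\<forall>t\<in>{0..T}. integrable M (X t)) \<and>
     (\<forall>s\<in>{0..T}. \<forall>t\<in>{s..T}. AE \<omega> in M. real_cond_exp M (F s) (X t) \<omega> = X s \<omega>)"

text \<open>On the closed interval \<open>[0,T]\<close> a localizing sequence must almost surely reach \<open>T\<close> after
  finitely many steps; \<open>\<sigma> k \<omega> \<longlonglongrightarrow> T\<close> alone would only localize on \<open>[0,T[\<close>. This corresponds to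
  localizing sequences with values in \<open>[0,T] \<union> {\<infinity>}\<close> increasing to \<open>\<infinity>\<close>. Stopped processes being
  martingales forces the initial value to be integrable; this does not affect the notion of
  semimartingale, as the initial value may be moved into the finite variation part.\<close>

definition local_martingale_upto ::
  "'a measure \<Rightarrow> (real \<Rightarrow> 'a measure) \<Rightarrow> real \<Rightarrow> (real \<Rightarrow> 'a \<Rightarrow> real) \<Rightarrow> bool" where
  "local_martingale_upto M F T X \<longleftrightarrow>
     adapted_upto F T X \<and> cadlag_process M T X \<and>
     (\<exists>\<sigma> :: nat \<Rightarrow> 'a \<Rightarrow> real.
        (\<forall>k. stopping_time_upto M F T (\<sigma> k)) \<and>
        (\<forall>k. \<forall>\<omega>\<in>space M. \<sigma> k \<omega> \<le> \<sigma> (Suc k) \<omega>) \<and>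
        (AE \<omega> in M. \<forall>\<^sub>F k in sequentially. \<sigma> k \<omega> = T) \<and>
        (\<forall>k. martingale_upto M F T (\<lambda>t \<omega>. X (min (\<sigma> k \<omega>) t) \<omega>)))"

definition semimartingale ::
  "'a measure \<Rightarrow> (real \<Rightarrow> 'a measure) \<Rightarrow> real \<Rightarrow> (real \<Rightarrow> 'a \<Rightarrow> real) \<Rightarrow> bool" where
  "semimartingale M F T S \<longleftrightarrow>
     (\<exists>X A. local_martingale_upto M F T X \<and> finite_variation_process M F T A \<and>
        (\<forall>t\<in>{0..T}. \<forall>\<omega>\<in>space M. S t \<omega> = X t \<omega> + A t \<omega>))"

text \<open>A simple integrand is carried together with a representation by the number of steps, the
  stopping times and the coefficients; its integral depends only on the process.\<close>

record 'a simple_rep =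
  steps :: nat
  times :: "nat \<Rightarrow> 'a \<Rightarrow> real"
  coeff :: "nat \<Rightarrow> 'a \<Rightarrow> real"

definition Linf_norm :: "'a measure \<Rightarrow> ('a \<Rightarrow> real) \<Rightarrow> ereal" where
  "Linf_norm M f = esssup M (\<lambda>\<omega>. ereal \<bar>f \<omega>\<bar>)"

definition simple_integrand ::
  "'a measure \<Rightarrow> (real \<Rightarrow> 'a measure) \<Rightarrow> real \<Rightarrow> 'a simple_rep \<Rightarrow> bool" where
  "simple_integrand M F T H \<longleftrightarrow>
     (\<forall>j\<le>steps H. stopping_time_upto M F T (times H j)) \<and>
     (\<forall>\<omega>\<in>space M. times H 0 \<omega> = 0 \<and> times H (steps H) \<omega> = T \<and>
        (\<forall>j\<in>{1..steps H}. times H (j - 1) \<omega> \<le> times H j \<omega>)) \<and>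
     (\<forall>j\<in>{1..steps H}. coeff H j \<in> borel_measurable (stopped_sigma M F T (times H (j - 1))) \<and>
        Linf_norm M (coeff H j) < \<infinity>)"

definition integrand_process :: "'a simple_rep \<Rightarrow> real \<Rightarrow> 'a \<Rightarrow> real" where
  "integrand_process H t \<omega> =
     (\<Sum>j=1..steps H. coeff H j \<omega> * indicator {times H (j - 1) \<omega> <.. times H j \<omega>} t)"

definition stoch_integral :: "'a simple_rep \<Rightarrow> (real \<Rightarrow> 'a \<Rightarrow> real) \<Rightarrow> real \<Rightarrow> 'a \<Rightarrow> real" where
  "stoch_integral H S t \<omega> =
     (\<Sum>j=1..steps H. coeff H j \<omega> * (S (min (times H j \<omega>) t) \<omega> - S (min (times H (j - 1) \<omega>) t) \<omega>))"

definition sup_norm :: "'a measure \<Rightarrow> real \<Rightarrow> (real \<Rightarrow> 'a \<Rightarrow> real) \<Rightarrow> ereal" where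
  "sup_norm M T X = (SUP t\<in>{0..T}. Linf_norm M (X t))"

definition pos_part :: "real \<Rightarrow> real" where
  "pos_part x = max x 0"

definition neg_part :: "real \<Rightarrow> real" where
  "neg_part x = max (- x) 0"

text \<open>To be used for measurable \<open>X n\<close> and \<open>Y\<close> only, as \<^const>\<open>measure\<close> vanishes on non-measurable
  sets. For a cadlag process, a pathwise supremum over \<open>[0,T]\<close> is finite, and measurable because it
  may be taken over the rational times and \<open>T\<close>.\<close>

definition tendsto_in_prob :: "'a measure \<Rightarrow> (nat \<Rightarrow> 'a \<Rightarrow> real) \<Rightarrow> ('a \<Rightarrow> real) \<Rightarrow> bool" where
  "tendsto_in_prob M X Y \<longleftrightarrow>
     (\<forall>\<epsilon>>0. (\<lambda>n. measure M {\<omega>\<in>space M. \<epsilon> < \<bar>X n \<omega> - Y \<omega>\<bar>}) \<longlonglongrightarrow> 0)"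

end

theory Submission
  imports Defs
begin

text \<open>Let condition (1) hold. Kill \<open>S\<close> when it exceeds a level, so that it becomes bounded. If the
  quadratic variations along the dyadic grids were not tight, integrating \<open>- 2 y\<close>, suitably scaled
  and stopped, would produce gains with vanishing losses; if the variations of the predictable parts
  of the discrete Doob decompositions were not tight, integrating their signs would. Hence the Doob
  decompositions, truncated where the predictable variation exceeds \<open>C\<close>, are bounded uniformly in
  the grid, and they have weak limits along a common filter finer than \<open>sequentially\<close>. The indicators of
  the truncation converge only weakly, to a decreasing process \<open>r\<close> that damps the killed process;
  multiplying by the increasing process \<open>1 / max r (1 / 2)\<close> removes the damping where \<open>r \<ge> 1 / 2\<close>.
  Right limits along the dyadic times give a cadlag martingale and a process of bounded variation
  that decompose \<open>S\<close> up to a stopping time, and these local decompositions are glued together along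
  stopping times that reach \<open>T\<close> with probability tending to one.

  Conversely, integrals against processes of finite variation are bounded pathwise by the sup norm
  of the integrand, and for martingales a weak-type estimate bounds the integral in probability: a
  terminal value splits into two nonnegative ones, and a nonnegative martingale \<open>X\<close> agrees with the
  bounded supermartingale \<open>min X l\<close> outside an event of probability at most \<open>E X / l\<close>.\<close>

subsection \<open>Bounded measurable functions\<close>

text \<open>Condition (1) speaks only of convergence in probability, so it yields tightness of the
  variations, never a bound on moments. Truncation restores bounded objects, but the truncation
  times depend on the grid and have no useful limit. Weak limits do exist, but they commute only
  with linear operations. Everything imposed on a decomposition is therefore kept linear:
  inequalities, expectations against a fixed indicator, and the product of the fixed process with
  the truncation indicator. The limit \<open>r\<close> of the indicators takes values in [0,1];
  since its terminal expectation stays close to 1, Markov's inequality makes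
  \<open>r < 1 / 2\<close> at the end unlikely, and monotonicity of \<open>r\<close> extends this to
  all earlier times. This is where 1/2 comes from. A filter is used because the limits must exist
  simultaneously for all real times and all integrable test functions, an index set for which no
  single subsequence need serve. Killing instead of stopping discards the jump at the level
  crossing, which need not be bounded; the discarded jump is a single finite random variable and
  disappears after division by scales tending to infinity.\<close>

definition bmeas :: "'a measure \<Rightarrow> ('a \<Rightarrow> real) set" where
  "bmeas N = {f \<in> borel_measurable N. \<exists>c. \<forall>x\<in>space N. \<bar>f x\<bar> \<le> c}"

lemma bmeasI: "f \<in> borel_measurable N \<Longrightarrow> (\<And>x. x \<in> space N \<Longrightarrow> \<bar>f x\<bar> \<le> c) \<Longrightarrow> f \<in> bmeas N"
  unfolding bmeas_def by blast

lemma bmeas_measurable: "f \<in> bmeas N \<Longrightarrow> f \<in> borel_measurable N"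
  unfolding bmeas_def by blast

lemma bmeas_bound:
  assumes "f \<in> bmeas N" shows "\<exists>c>0. \<forall>x\<in>space N. \<bar>f x\<bar> \<le> c"
proof -
  obtain c where "\<forall>x\<in>space N. \<bar>f x\<bar> \<le> c" using assms unfolding bmeas_def by blast
  then show ?thesis by (intro exI[of _ "\<bar>c\<bar> + 1"]) auto
qed

lemma bmeas_const [simp]: "(\<lambda>_. c) \<in> bmeas N"
  by (rule bmeasI[where c = "\<bar>c\<bar>"]) auto

lemma bmeas_indicator: "A \<in> sets N \<Longrightarrow> indicator A \<in> bmeas N"
  by (rule bmeasI[where c = 1]) (auto simp: indicator_def)

lemma bmeas_add: 
  assumes "f \<in> bmeas N" "g \<in> bmeas N" shows "(\<lambda>x. f x + g x) \<in> bmeas N"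
proof -
  obtain c where "c > 0" "\<And>x. x \<in> space N \<Longrightarrow> \<bar>f x\<bar> \<le> c" using bmeas_bound[OF assms(1)] by blast
  moreover obtain d where "d > 0" "\<And>x. x \<in> space N \<Longrightarrow> \<bar>g x\<bar> \<le> d" using bmeas_bound[OF assms(2)] by blast
  ultimately have "\<bar>f x + g x\<bar> \<le> c + d" if "x \<in> space N" for x
    using that by (intro order_trans[OF abs_triangle_ineq add_mono]) simp_all
  then show ?thesis
    using assms[THEN bmeas_measurable] by (intro bmeasI[where c = "c + d"] borel_measurable_add) auto
qed

lemma bmeas_mult: 
  assumes "f \<in> bmeas N" "g \<in> bmeas N" shows "(\<lambda>x. f x * g x) \<in> bmeas N"
proof -
  obtain c where "c > 0" "\<And>x. x \<in> space N \<Longrightarrow> \<bar>f x\<bar> \<le> c" using bmeas_bound[OF assms(1)] by blast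
  moreover obtain d where "d > 0" "\<And>x. x \<in> space N \<Longrightarrow> \<bar>g x\<bar> \<le> d" using bmeas_bound[OF assms(2)] by blast
  ultimately have "\<bar>f x * g x\<bar> \<le> c * d" if "x \<in> space N" for x using that
    by (simp add: abs_mult mult_mono)
  then show ?thesis
    using assms[THEN bmeas_measurable] by (intro bmeasI[where c = "c * d"] borel_measurable_times) auto
qed

lemma bmeas_uminus: "f \<in> bmeas N \<Longrightarrow> (\<lambda>x. - f x) \<in> bmeas N"
  using bmeas_mult[of "\<lambda>_. -1" N f] by simp

lemma bmeas_diff: "f \<in> bmeas N \<Longrightarrow> g \<in> bmeas N \<Longrightarrow> (\<lambda>x. f x - g x) \<in> bmeas N"
  using bmeas_add[of f N "\<lambda>x. - g x"] by (simp add: bmeas_uminus)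

lemma bmeas_abs: "f \<in> bmeas N \<Longrightarrow> (\<lambda>x. \<bar>f x\<bar>) \<in> bmeas N"
  unfolding bmeas_def by auto

lemma bmeas_sgn: "f \<in> bmeas N \<Longrightarrow> (\<lambda>x. sgn (f x)) \<in> bmeas N"
  by (rule bmeasI[where c = 1]) (auto dest!: bmeas_measurable simp: sgn_real_def)

lemma bmeas_sum: "(\<And>i. i \<in> I \<Longrightarrow> f i \<in> bmeas N) \<Longrightarrow> (\<lambda>x. \<Sum>i\<in>I. f i x) \<in> bmeas N"
  by (induction I rule: infinite_finite_induct) (auto intro: bmeas_add)

lemma bmeas_power: "f \<in> bmeas N \<Longrightarrow> (\<lambda>x. f x ^ n) \<in> bmeas N"
  by (induction n) (auto intro: bmeas_mult)

lemma bmeas_subalgebra: "subalgebra M G \<Longrightarrow> f \<in> bmeas G \<Longrightarrow> f \<in> bmeas M"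
  using bmeas_bound[of f G] measurable_from_subalg[of M G f borel] bmeas_measurable[of f G]
  by (auto simp: subalgebra_def intro: bmeasI)

lemmas bmeas_intros = bmeas_const bmeas_indicator bmeas_add bmeas_mult bmeas_uminus bmeas_diff
  bmeas_abs bmeas_sgn bmeas_sum bmeas_power

lemma (in prob_space) bmeas_integrable:
  assumes "f \<in> bmeas M" shows "integrable M f"
proof -
  obtain c where "\<forall>x\<in>space M. \<bar>f x\<bar> \<le> c" using bmeas_bound[OF assms] by blast
  then show ?thesis
    by (intro integrable_const_bound[where B = c]) (use assms in \<open>auto intro: bmeas_measurable\<close>)
qed

lemma (in prob_space) integrable_bmeas_mult:
  fixes X :: "'a \<Rightarrow> real"
  assumes f: "f \<in> bmeas M" and X: "integrable M X" shows "integrable M (\<lambda>x. f x * X x)"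
proof -
  obtain c where c: "c > 0" "\<And>x. x \<in> space M \<Longrightarrow> \<bar>f x\<bar> \<le> c" using bmeas_bound[OF f] by blast
  show ?thesis
  proof (rule Bochner_Integration.integrable_bound[where f = "\<lambda>x. c * X x"])
    show "AE x in M. norm (f x * X x) \<le> norm (c * X x)"
      using c by (intro AE_I2) (simp add: abs_mult mult_right_mono)
  qed (use X bmeas_measurable[OF f] in auto)
qed

text \<open>Clipping the conditional expectation makes the bound hold everywhere, not only almost everywhere.\<close>

lemma (in prob_space) bounded_cond_exp:
  assumes G: "subalgebra M G" and X: "X \<in> borel_measurable M" "\<And>x. x \<in> space M \<Longrightarrow> \<bar>X x\<bar> \<le> c"
  shows "\<exists>a\<in>borel_measurable G. (\<forall>x\<in>space M. \<bar>a x\<bar> \<le> c) \<and>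
    (\<forall>\<phi>\<in>bmeas G. expectation (\<lambda>x. \<phi> x * a x) = expectation (\<lambda>x. \<phi> x * X x))"
proof -
  interpret finite_measure_subalgebra M G by unfold_locales (rule G)
  have iX: "integrable M X" by (rule bmeas_integrable, rule bmeasI) (use X in auto)
  obtain x where x: "x \<in> space M" using not_empty by blast
  have c: "c \<ge> 0" using X(2)[OF x] by linarith
  let ?e = "real_cond_exp M G X"
  define a where "a x = max (-c) (min c (?e x))" for x
  have a: "a \<in> borel_measurable G" unfolding a_def by measurable
  have "AE x in M. ?e x \<le> c" by (rule real_cond_exp_le_c) (use X iX in \<open>auto simp: abs_le_iff\<close>)
  moreover have "AE x in M. - c \<le> ?e x" by (rule real_cond_exp_ge_c) (use X iX in \<open>fastforce simp: abs_le_iff\<close>)+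
  ultimately have ae: "AE x in M. a x = ?e x" by eventually_elim (auto simp: a_def)
  show ?thesis
  proof (intro bexI[OF _ a] conjI ballI)
    show "\<bar>a x\<bar> \<le> c" for x using c by (auto simp: a_def)
    fix \<phi> assume \<phi>: "\<phi> \<in> bmeas G"
    then have m: "\<phi> \<in> borel_measurable G" by (rule bmeas_measurable)
    have "expectation (\<lambda>x. \<phi> x * a x) = expectation (\<lambda>x. \<phi> x * ?e x)"
      by (rule integral_cong_AE) (use ae m a in \<open>auto intro!: borel_measurable_times measurable_from_subalg[OF G]\<close>)
    also have "\<dots> = expectation (\<lambda>x. \<phi> x * X x)"
      by (rule real_cond_exp_intg(2)) (use m X iX \<phi> in \<open>auto intro: integrable_bmeas_mult bmeas_subalgebra[OF G]\<close>)
    finally show "expectation (\<lambda>x. \<phi> x * a x) = expectation (\<lambda>x. \<phi> x * X x)" .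
  qed
qed

text \<open>Agreement on the indicators of \<open>G\<close> says that \<open>X\<close> and
  \<open>Y\<close> have the same conditional expectation given \<open>G\<close>, and a bounded
  \<open>G\<close>-measurable factor passes through conditioning. This replaces a monotone class
  argument.\<close>

lemma (in prob_space) expectation_bmeas_eqI:
  fixes X Y :: "'a \<Rightarrow> real"
  assumes G: "subalgebra M G" and X: "integrable M X" and Y: "integrable M Y"
    and eq: "\<And>A. A \<in> sets G \<Longrightarrow> expectation (\<lambda>x. indicator A x * X x) = expectation (\<lambda>x. indicator A x * Y x)"
    and \<phi>: "\<phi> \<in> bmeas G"
  shows "expectation (\<lambda>x. \<phi> x * X x) = expectation (\<lambda>x. \<phi> x * Y x)"
proof -
  interpret finite_measure_subalgebra M G by unfold_locales (rule G)
  let ?e = "real_cond_exp M G Y"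
  have "AE x in M. real_cond_exp M G X x = ?e x"
  proof (rule real_cond_exp_charact)
    fix A assume A: "A \<in> sets G"
    show "(\<integral>x\<in>A. X x \<partial>M) = (\<integral>x\<in>A. ?e x \<partial>M)"
      using eq[OF A] real_cond_exp_intA[OF Y A] by (simp add: set_lebesgue_integral_def)
  qed (use X Y in auto)
  then have "expectation (\<lambda>x. \<phi> x * real_cond_exp M G X x) = expectation (\<lambda>x. \<phi> x * ?e x)"
    by (intro integral_cong_AE)
      (use bmeas_measurable[OF \<phi>] in \<open>auto intro!: borel_measurable_times measurable_from_subalg[OF G]\<close>)
  then show ?thesis
    using real_cond_exp_intg(2)[OF integrable_bmeas_mult[OF bmeas_subalgebra[OF G \<phi>] X] bmeas_measurable[OF \<phi>]]
      real_cond_exp_intg(2)[OF integrable_bmeas_mult[OF bmeas_subalgebra[OF G \<phi>] Y] bmeas_measurable[OF \<phi>]] X Y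
    by simp
qed

subsection \<open>Discrete-time martingale differences\<close>

text \<open>The weights telescope up to the first index where \<open>P\<close> holds, so the sum is
  \<open>x\<close> stopped there. The weight at \<open>i\<close> inspects only indices up to
  \<open>i\<close>, which makes it predictable when \<open>P k\<close> is decided at time
  \<open>k\<close>; this turns stopping into a martingale transform.\<close>

lemma stopped_sum:
  fixes x :: "nat \<Rightarrow> real"
  shows "\<exists>k\<le>n. x 0 + (\<Sum>i<n. (if \<forall>k\<le>i. \<not> P k then 1 else 0) * (x (Suc i) - x i)) = x k \<and>
    ((\<exists>k\<le>n. P k) \<longrightarrow> P k) \<and> ((\<forall>k\<le>n. \<not> P k) \<longrightarrow> k = n)"
proof (induction n)
  case (Suc n)
  let ?e = "\<lambda>i. if \<forall>k\<le>i. \<not> P k then 1 else 0 :: real"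
  obtain k where k: "k \<le> n \<and> x 0 + (\<Sum>i<n. ?e i * (x (Suc i) - x i)) = x k \<and>
    ((\<exists>k\<le>n. P k) \<longrightarrow> P k) \<and> ((\<forall>k\<le>n. \<not> P k) \<longrightarrow> k = n)"
    using Suc.IH ..
  then have k2: "x 0 + (\<Sum>i<n. ?e i * (x (Suc i) - x i)) = x k" by (elim conjE)
  show ?case
  proof (cases "\<forall>k\<le>n. \<not> P k")
    case True
    then have "k = n" "?e n = 1" using k by simp_all
    then have "x 0 + (\<Sum>i<Suc n. ?e i * (x (Suc i) - x i)) = x (Suc n)"
      using k2 by (simp only: sum.lessThan_Suc) simp
    then show ?thesis using True by (intro exI[of _ "Suc n"]) (auto simp: le_Suc_eq)
  next
    case False
    then have "?e n = 0" "P k" using k by auto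
    then have "x 0 + (\<Sum>i<Suc n. ?e i * (x (Suc i) - x i)) = x k"
      using k2 by (simp only: sum.lessThan_Suc)
    then show ?thesis
      using k \<open>P k\<close> False by (intro exI[of _ k] conjI impI) (simp_all add: le_SucI, blast intro: le_SucI)
  qed
qed auto

locale discrete_filtration = prob_space M for M :: "'a measure" +
  fixes G :: "nat \<Rightarrow> 'a measure"
  assumes sub: "\<And>i. subalgebra M (G i)" and G_mono: "\<And>i j. i \<le> j \<Longrightarrow> sets (G i) \<subseteq> sets (G j)"
begin

lemma space_G: "space (G i) = space M"
  using sub by (auto simp: subalgebra_def)

lemma measurable_mono: "f \<in> borel_measurable (G i) \<Longrightarrow> i \<le> j \<Longrightarrow> f \<in> borel_measurable (G j)"
  using G_mono[of i j] by (auto simp: measurable_def space_G)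

lemma bmeas_mono:
  assumes "f \<in> bmeas (G i)" "i \<le> j" shows "f \<in> bmeas (G j)"
proof -
  obtain c where "\<forall>x\<in>space M. \<bar>f x\<bar> \<le> c" using bmeas_bound[OF assms(1)] by (auto simp: space_G)
  then show ?thesis
    using measurable_mono[OF bmeas_measurable[OF assms(1)] assms(2)]
    by (intro bmeasI[where c = c]) (auto simp: space_G)
qed

lemma bmeas_M: "f \<in> bmeas (G i) \<Longrightarrow> f \<in> bmeas M"
  using bmeas_subalgebra[OF sub] .

text \<open>Martingale differences in weak form: orthogonality to every bounded function of the past
  replaces conditional expectations, so transforms are computed under the integral. Only the first
  \<open>n\<close> differences are constrained because grids are finite.\<close>

definition mart_diff :: "(nat \<Rightarrow> 'a \<Rightarrow> real) \<Rightarrow> nat \<Rightarrow> bool" where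
  "mart_diff d n \<longleftrightarrow> (\<forall>i<n. d i \<in> bmeas (G (Suc i)) \<and> (\<forall>\<phi>\<in>bmeas (G i). expectation (\<lambda>x. \<phi> x * d i x) = 0))"

text \<open>The predictable factor is absorbed into the test function.\<close>

lemma mart_diff_mult:
  assumes "mart_diff d n" "\<And>i. i < n \<Longrightarrow> h i \<in> bmeas (G i)"
  shows "mart_diff (\<lambda>i x. h i x * d i x) n"
  unfolding mart_diff_def
proof (intro allI impI conjI ballI)
  fix i assume i: "i < n"
  show "(\<lambda>x. h i x * d i x) \<in> bmeas (G (Suc i))"
    using assms i by (intro bmeas_mult bmeas_mono[of "h i" i "Suc i"]) (auto simp: mart_diff_def)
  fix \<phi> assume "\<phi> \<in> bmeas (G i)"
  then have "(\<lambda>x. \<phi> x * h i x) \<in> bmeas (G i)" using assms(2)[OF i] by (rule bmeas_mult)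
  then have "expectation (\<lambda>x. (\<phi> x * h i x) * d i x) = 0" using assms(1) i by (auto simp: mart_diff_def)
  then show "expectation (\<lambda>x. \<phi> x * (h i x * d i x)) = 0" by (simp add: mult.assoc)
qed

lemma mart_diff_sum_bmeas: "mart_diff d n \<Longrightarrow> k \<le> n \<Longrightarrow> k \<le> j \<Longrightarrow> (\<lambda>x. \<Sum>i<k. d i x) \<in> bmeas (G j)"
  unfolding mart_diff_def by (intro bmeas_sum) (metis Suc_leI bmeas_mono lessThan_iff order_less_le_trans)

text \<open>Orthogonality: the partial sum is bounded and known at time \<open>n\<close>, hence an
  admissible test function for \<open>d n\<close>, and the cross term vanishes.\<close>

lemma mart_diff_square_sum:
  assumes "mart_diff d n"
  shows "expectation (\<lambda>x. (\<Sum>i<n. d i x)\<^sup>2) = (\<Sum>i<n. expectation (\<lambda>x. (d i x)\<^sup>2))"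
  using assms
proof (induction n)
  case (Suc n)
  let ?S = "\<lambda>x. \<Sum>i<n. d i x"
  have md: "mart_diff d n" using Suc.prems by (auto simp: mart_diff_def)
  have S: "?S \<in> bmeas (G n)" using mart_diff_sum_bmeas[OF md] by blast
  have d: "d n \<in> bmeas M" using Suc.prems bmeas_M by (auto simp: mart_diff_def)
  have z: "expectation (\<lambda>x. ?S x * d n x) = 0" using Suc.prems S by (auto simp: mart_diff_def)
  have i: "integrable M (\<lambda>x. (?S x)\<^sup>2)" "integrable M (\<lambda>x. ?S x * d n x)" "integrable M (\<lambda>x. (d n x)\<^sup>2)"
    using S d by (auto intro!: bmeas_integrable bmeas_power bmeas_mult intro: bmeas_M)
  have "(\<lambda>x. (\<Sum>i<Suc n. d i x)\<^sup>2) = (\<lambda>x. (?S x)\<^sup>2 + 2 * (?S x * d n x) + (d n x)\<^sup>2)"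
    by (auto simp: power2_sum algebra_simps)
  then show ?case using i z Suc.IH[OF md] by simp
qed simp

lemma prob_square_le:
  assumes f: "f \<in> bmeas M" and l: "l > 0" and A: "A \<subseteq> {x\<in>space M. \<bar>f x\<bar> \<ge> l}"
  shows "prob A \<le> expectation (\<lambda>x. (f x)\<^sup>2) / l\<^sup>2"
proof -
  have m: "f \<in> borel_measurable M" using f by (rule bmeas_measurable)
  have "prob A \<le> prob {x\<in>space M. \<bar>f x\<bar> \<ge> l}" using m A by (intro finite_measure_mono) auto
  also have "{x\<in>space M. \<bar>f x\<bar> \<ge> l} = {x\<in>space M. (f x)\<^sup>2 \<ge> l\<^sup>2}"
    using l by (auto simp: abs_le_square_iff[symmetric])
  also have "prob \<dots> \<le> expectation (\<lambda>x. (f x)\<^sup>2) / l\<^sup>2"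
    by (rule integral_Markov_inequality_measure[where A = "{}"])
      (use f l in \<open>auto intro!: bmeas_integrable bmeas_power\<close>)
  finally show ?thesis .
qed

text \<open>Kolmogorov's inequality. Stopping at the first index where a partial sum reaches
  \<open>l\<close> is a transform by 0/1 predictable weights, which cannot increase the second
  moment; Chebyshev's inequality is applied to the stopped sum.\<close>

lemma mart_diff_maximal:
  assumes d: "mart_diff d n" and l: "l > 0"
  shows "prob {x\<in>space M. \<exists>k\<le>n. \<bar>\<Sum>i<k. d i x\<bar> \<ge> l} \<le> (\<Sum>i<n. expectation (\<lambda>x. (d i x)\<^sup>2)) / l\<^sup>2"
proof -
  let ?S = "\<lambda>k x. \<Sum>i<k. d i x"
  define g where "g i x = (if \<forall>k\<le>i. \<not> \<bar>?S k x\<bar> \<ge> l then 1 else 0::real)" for i x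
  have g: "g i \<in> bmeas (G i)" if "i < n" for i
  proof (rule bmeasI[where c = 1])
    have [measurable]: "?S k \<in> borel_measurable (G i)" if "k \<le> i" for k
      using mart_diff_sum_bmeas[OF d, of k i] that \<open>i < n\<close> by (auto intro: bmeas_measurable)
    have "Measurable.pred (G i) (\<lambda>x. \<forall>k\<in>{..i}. \<not> \<bar>?S k x\<bar> \<ge> l)"
      by (intro pred_intros_finite) auto
    then show "g i \<in> borel_measurable (G i)" unfolding g_def by (auto intro!: measurable_If)
  qed (auto simp: g_def)
  note e = mart_diff_mult[OF d g]
  have "prob {x\<in>space M. \<exists>k\<le>n. \<bar>?S k x\<bar> \<ge> l} \<le> expectation (\<lambda>x. (\<Sum>i<n. g i x * d i x)\<^sup>2) / l\<^sup>2"
  proof (rule prob_square_le)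
    show "(\<lambda>x. \<Sum>i<n. g i x * d i x) \<in> bmeas M" using mart_diff_sum_bmeas[OF e, of n n] bmeas_M by auto
    show "{x\<in>space M. \<exists>k\<le>n. \<bar>?S k x\<bar> \<ge> l} \<subseteq> {x\<in>space M. \<bar>\<Sum>i<n. g i x * d i x\<bar> \<ge> l}"
    proof safe
      fix x k assume "x \<in> space M" "k \<le> n" "l \<le> \<bar>?S k x\<bar>"
      then show "l \<le> \<bar>\<Sum>i<n. g i x * d i x\<bar>"
        using stopped_sum[of n "\<lambda>k. ?S k x" "\<lambda>k. \<bar>?S k x\<bar> \<ge> l"] by (auto simp: g_def)
    qed
  qed (rule l)
  also have "\<dots> = (\<Sum>i<n. expectation (\<lambda>x. (g i x * d i x)\<^sup>2)) / l\<^sup>2"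
    by (simp add: mart_diff_square_sum[OF e])
  also have "\<dots> \<le> (\<Sum>i<n. expectation (\<lambda>x. (d i x)\<^sup>2)) / l\<^sup>2"
  proof (intro divide_right_mono sum_mono)
    fix i assume "i \<in> {..<n}"
    then have "d i \<in> bmeas M" "(\<lambda>x. g i x * d i x) \<in> bmeas M"
      using d e bmeas_M[of _ "Suc i"] unfolding mart_diff_def by blast+
    then show "expectation (\<lambda>x. (g i x * d i x)\<^sup>2) \<le> expectation (\<lambda>x. (d i x)\<^sup>2)"
      by (intro integral_mono bmeas_integrable bmeas_power) (auto simp: g_def)
  qed simp
  finally show ?thesis .
qed

text \<open>Pythagoras: \<open>a\<close> is the conditional expectation of \<open>Y\<close> given
  \<open>G i\<close>. Testing with \<open>(g x)\<^sup>2 * a x\<close> turns the cross term into the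
  weighted second moment of \<open>a\<close>, which is then dropped with its negative sign.\<close>

lemma doob_square_le:
  assumes Y: "Y \<in> bmeas M" and a: "a \<in> bmeas (G i)" and g: "g \<in> bmeas (G i)"
    and eq: "\<And>\<phi>. \<phi> \<in> bmeas (G i) \<Longrightarrow> expectation (\<lambda>x. \<phi> x * a x) = expectation (\<lambda>x. \<phi> x * Y x)"
  shows "expectation (\<lambda>x. (g x * (Y x - a x))\<^sup>2) \<le> expectation (\<lambda>x. (g x * Y x)\<^sup>2)"
proof -
  note M = Y a[THEN bmeas_M] g[THEN bmeas_M]
  have 1: "expectation (\<lambda>x. ((g x)\<^sup>2 * a x) * a x) = expectation (\<lambda>x. ((g x)\<^sup>2 * a x) * Y x)"
    by (intro eq bmeas_intros a g)
  have i: "integrable M (\<lambda>x. (g x * Y x)\<^sup>2)" "integrable M (\<lambda>x. ((g x)\<^sup>2 * a x) * Y x)"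
    "integrable M (\<lambda>x. ((g x)\<^sup>2 * a x) * a x)"
    by (intro bmeas_integrable bmeas_intros M)+
  have "expectation (\<lambda>x. (g x * (Y x - a x))\<^sup>2) =
    expectation (\<lambda>x. (g x * Y x)\<^sup>2 - 2 * (((g x)\<^sup>2 * a x) * Y x) + ((g x)\<^sup>2 * a x) * a x)"
    by (rule Bochner_Integration.integral_cong) (auto simp: power2_eq_square algebra_simps)
  also have "\<dots> = expectation (\<lambda>x. (g x * Y x)\<^sup>2) - expectation (\<lambda>x. ((g x)\<^sup>2 * a x) * a x)"
    using 1 i by simp
  also have "\<dots> \<le> expectation (\<lambda>x. (g x * Y x)\<^sup>2)"
    by (simp add: mult.assoc power2_eq_square[symmetric])
  finally show ?thesis .
qed

end

subsection \<open>Discrete-time estimates\<close>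

context discrete_filtration
begin

text \<open>Doob decomposition: \<open>a i\<close> is the predictable increment.\<close>

lemma doob_decomposition:
  assumes Y: "\<And>i. i \<le> n \<Longrightarrow> Y i \<in> borel_measurable (G i)" "\<And>i x. i \<le> n \<Longrightarrow> x \<in> space M \<Longrightarrow> \<bar>Y i x\<bar> \<le> K"
  shows "\<exists>a. (\<forall>i<n. a i \<in> borel_measurable (G i) \<and> (\<forall>x\<in>space M. \<bar>a i x\<bar> \<le> 2 * K) \<and>
    (\<forall>\<phi>\<in>bmeas (G i). expectation (\<lambda>x. \<phi> x * a i x) = expectation (\<lambda>x. \<phi> x * (Y (Suc i) x - Y i x)))) \<and>
    mart_diff (\<lambda>i x. Y (Suc i) x - Y i x - a i x) n"
proof -
  have "\<forall>i. \<exists>a. i < n \<longrightarrow> a \<in> borel_measurable (G i) \<and> (\<forall>x\<in>space M. \<bar>a x\<bar> \<le> 2 * K) \<and>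
    (\<forall>\<phi>\<in>bmeas (G i). expectation (\<lambda>x. \<phi> x * a x) = expectation (\<lambda>x. \<phi> x * (Y (Suc i) x - Y i x)))"
  proof (intro allI)
    fix i
    show "\<exists>a. i < n \<longrightarrow> a \<in> borel_measurable (G i) \<and> (\<forall>x\<in>space M. \<bar>a x\<bar> \<le> 2 * K) \<and>
      (\<forall>\<phi>\<in>bmeas (G i). expectation (\<lambda>x. \<phi> x * a x) = expectation (\<lambda>x. \<phi> x * (Y (Suc i) x - Y i x)))"
    proof (cases "i < n")
      case True
      have "(\<lambda>x. Y (Suc i) x - Y i x) \<in> borel_measurable M"
        using Y(1)[of "Suc i"] Y(1)[of i] True
        by (intro borel_measurable_diff) (auto intro: measurable_from_subalg[OF sub])
      moreover have "\<bar>Y (Suc i) x - Y i x\<bar> \<le> 2 * K" if "x \<in> space M" for x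
        using Y(2)[of "Suc i" x] Y(2)[of i x] True that by (auto simp: abs_le_iff)
      ultimately show ?thesis using bounded_cond_exp[OF sub, of _ "2 * K" i] by blast
    qed simp
  qed
  then obtain a where a: "\<And>i. i < n \<Longrightarrow> a i \<in> borel_measurable (G i)"
    "\<And>i x. i < n \<Longrightarrow> x \<in> space M \<Longrightarrow> \<bar>a i x\<bar> \<le> 2 * K"
    "\<And>i \<phi>. i < n \<Longrightarrow> \<phi> \<in> bmeas (G i) \<Longrightarrow>
      expectation (\<lambda>x. \<phi> x * a i x) = expectation (\<lambda>x. \<phi> x * (Y (Suc i) x - Y i x))"
    unfolding choice_iff by blast
  have bY: "Y i \<in> bmeas (G i)" if "i \<le> n" for i
    using Y that by (intro bmeasI[where c = K]) (auto simp: space_G)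
  have ba: "a i \<in> bmeas (G i)" if "i < n" for i
    using a that by (intro bmeasI[where c = "2 * K"]) (auto simp: space_G)
  have "mart_diff (\<lambda>i x. Y (Suc i) x - Y i x - a i x) n"
    unfolding mart_diff_def
  proof (intro allI impI conjI ballI)
    fix i assume i: "i < n"
    show "(\<lambda>x. Y (Suc i) x - Y i x - a i x) \<in> bmeas (G (Suc i))"
      using bY[of "Suc i"] bY[of i] ba[OF i] i
      by (intro bmeas_diff bmeas_mono[of "Y i" i "Suc i"] bmeas_mono[of "a i" i "Suc i"]) auto
    fix \<phi> assume \<phi>: "\<phi> \<in> bmeas (G i)"
    have [simp]: "integrable M (\<lambda>x. \<phi> x * (Y (Suc i) x - Y i x))" "integrable M (\<lambda>x. \<phi> x * a i x)"
      using bY[of "Suc i"] bY[of i] ba[OF i] \<phi> i by (auto intro!: bmeas_integrable bmeas_mult bmeas_diff intro: bmeas_M)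
    show "expectation (\<lambda>x. \<phi> x * (Y (Suc i) x - Y i x - a i x)) = 0"
      using a(3)[OF i \<phi>] by (subst right_diff_distrib) simp
  qed
  then show ?thesis using a by (intro exI[of _ a]) blast
qed

text \<open>Doob's maximal inequality by optional stopping: the martingale stopped at the first
  index with value at least \<open>l\<close> keeps the expectation of \<open>X 0\<close>, is
  nonnegative almost everywhere, and Markov's inequality applies to it.\<close>

lemma nonneg_mart_maximal:
  assumes X: "\<And>i. i \<le> n \<Longrightarrow> X i \<in> borel_measurable (G i)" "\<And>i. i \<le> n \<Longrightarrow> integrable M (X i)"
    "\<And>i. i \<le> n \<Longrightarrow> AE x in M. 0 \<le> X i x"
    and mart: "\<And>i \<phi>. i < n \<Longrightarrow> \<phi> \<in> bmeas (G i) \<Longrightarrow> expectation (\<lambda>x. \<phi> x * (X (Suc i) x - X i x)) = 0"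
    and l: "l > 0"
  shows "prob {x\<in>space M. \<exists>i\<le>n. X i x \<ge> l} \<le> expectation (X 0) / l"
proof -
  define g where "g i x = (if \<forall>k\<le>i. \<not> l \<le> X k x then 1 else 0::real)" for i x
  have [measurable]: "X i \<in> borel_measurable M" if "i \<le> n" for i
    using X(1)[OF that] measurable_from_subalg[OF sub] by blast
  have g: "g i \<in> bmeas (G i)" if "i < n" for i
  proof (rule bmeasI[where c = 1])
    have [measurable]: "X k \<in> borel_measurable (G i)" if "k \<le> i" for k
      using X(1)[of k] that \<open>i < n\<close> measurable_mono by auto
    have "Measurable.pred (G i) (\<lambda>x. \<forall>k\<in>{..i}. \<not> l \<le> X k x)" by (intro pred_intros_finite) auto
    then show "g i \<in> borel_measurable (G i)" unfolding g_def by (auto intro!: measurable_If)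
  qed (auto simp: g_def)
  let ?Z = "\<lambda>x. X 0 x + (\<Sum>i<n. g i x * (X (Suc i) x - X i x))"
  have ig: "integrable M (\<lambda>x. g i x * (X (Suc i) x - X i x))" if "i < n" for i
    using X(2)[of i] X(2)[of "Suc i"] that g[OF that] by (auto intro!: integrable_bmeas_mult bmeas_M)
  have iZ: "integrable M ?Z" using X(2)[of 0] ig by (intro Bochner_Integration.integrable_add Bochner_Integration.integrable_sum) auto
  have stop: "\<exists>k\<le>n. ?Z x = X k x \<and> ((\<exists>k\<le>n. l \<le> X k x) \<longrightarrow> l \<le> X k x)" for x
    using stopped_sum[of n "\<lambda>k. X k x" "\<lambda>k. l \<le> X k x"] unfolding g_def by blast
  have "AE x in M. \<forall>i\<in>{..n}. 0 \<le> X i x" using X(3) by (intro AE_finite_allI) auto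
  then have Z0: "AE x in M. 0 \<le> ?Z x"
  proof eventually_elim
    case (elim x) then show ?case using stop[of x] by auto
  qed
  have "prob {x\<in>space M. \<exists>i\<le>n. X i x \<ge> l} \<le> prob {x\<in>space M. ?Z x \<ge> l}"
  proof (rule finite_measure_mono)
    show "{x \<in> space M. \<exists>i\<le>n. l \<le> X i x} \<subseteq> {x \<in> space M. l \<le> ?Z x}"
    proof safe
      fix x i assume "i \<le> n" "l \<le> X i x"
      then show "l \<le> ?Z x" using stop[of x] by auto
    qed
    have [measurable]: "?Z \<in> borel_measurable M" using iZ by auto
    show "{x \<in> space M. l \<le> ?Z x} \<in> events" by measurable
  qed
  also have "\<dots> \<le> expectation ?Z / l"
    by (rule integral_Markov_inequality_measure[where A = "{}"]) (use iZ Z0 l in auto)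
  also have "expectation ?Z = expectation (X 0) + (\<Sum>i<n. expectation (\<lambda>x. g i x * (X (Suc i) x - X i x)))"
    using ig X(2)[of 0]
    by (subst Bochner_Integration.integral_add, simp, intro Bochner_Integration.integrable_sum, simp,
      subst Bochner_Integration.integral_sum) auto
  also have "\<dots> = expectation (X 0)" using mart[OF _ g] by simp
  finally show ?thesis .
qed

lemma prob_abs_le:
  assumes f: "integrable M f" and l: "l > 0" and A: "A \<subseteq> {x\<in>space M. \<bar>f x\<bar> \<ge> l}"
  shows "prob A \<le> expectation (\<lambda>x. \<bar>f x\<bar>) / l"
proof -
  have [measurable]: "f \<in> borel_measurable M" using f by auto
  have "prob A \<le> prob {x\<in>space M. \<bar>f x\<bar> \<ge> l}" using A by (intro finite_measure_mono) auto
  also have "\<dots> \<le> expectation (\<lambda>x. \<bar>f x\<bar>) / l"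
    by (rule integral_Markov_inequality_measure[where A = "{}"]) (use f l in auto)
  finally show ?thesis .
qed

text \<open>Up to the first time \<open>X\<close> exceeds \<open>l\<close> the transform of \<open>X\<close> agrees with that of the bounded
  supermartingale \<open>min X l\<close>, whose Doob decomposition is controlled by \<open>l\<close> alone.\<close>

lemma nonneg_mart_transform:
  assumes X: "\<And>i. i \<le> n \<Longrightarrow> X i \<in> borel_measurable (G i)" "\<And>i. i \<le> n \<Longrightarrow> integrable M (X i)"
    "\<And>i. i \<le> n \<Longrightarrow> AE x in M. 0 \<le> X i x"
    and mart: "\<And>i \<phi>. i < n \<Longrightarrow> \<phi> \<in> bmeas (G i) \<Longrightarrow> expectation (\<lambda>x. \<phi> x * (X (Suc i) x - X i x)) = 0"
    and h: "\<And>i. i < n \<Longrightarrow> h i \<in> borel_measurable (G i)" "\<And>i x. i < n \<Longrightarrow> x \<in> space M \<Longrightarrow> \<bar>h i x\<bar> \<le> K"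
    and l: "l > 0" and c: "c > 0" and K: "K \<ge> 0"
  shows "prob {x\<in>space M. \<bar>\<Sum>i<n. h i x * (X (Suc i) x - X i x)\<bar> \<ge> 2 * c} \<le>
    expectation (X 0) / l + 3 * K\<^sup>2 * l\<^sup>2 / c\<^sup>2 + K * l / c"
proof -
  \<comment> \<open>The outer \<open>max 0\<close> acts only on the null set where
    \<open>X i\<close> may be negative; it makes \<open>Y i\<close> bounded everywhere.\<close>
  define Y where "Y i x = max 0 (min (X i x) l)" for i x
  have mX[measurable]: "X i \<in> borel_measurable M" if "i \<le> n" for i
    using X(1)[OF that] measurable_from_subalg[OF sub] by blast
  have Y: "Y i \<in> borel_measurable (G i)" "\<bar>Y i x\<bar> \<le> l" if "i \<le> n" for i x
    using X(1)[OF that] l unfolding Y_def by auto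
  have bY: "Y i \<in> bmeas (G i)" if "i \<le> n" for i
    using Y that by (intro bmeasI[where c = l]) auto
  obtain a where a: "\<And>i. i < n \<Longrightarrow> a i \<in> borel_measurable (G i)"
    "\<And>i x. i < n \<Longrightarrow> x \<in> space M \<Longrightarrow> \<bar>a i x\<bar> \<le> 2 * l"
    "\<And>i \<phi>. i < n \<Longrightarrow> \<phi> \<in> bmeas (G i) \<Longrightarrow>
      expectation (\<lambda>x. \<phi> x * a i x) = expectation (\<lambda>x. \<phi> x * (Y (Suc i) x - Y i x))"
    and md: "mart_diff (\<lambda>i x. Y (Suc i) x - Y i x - a i x) n"
    using doob_decomposition[of n Y l] Y by blast
  have ba: "a i \<in> bmeas (G i)" if "i < n" for i
    using a that by (intro bmeasI[where c = "2 * l"]) (auto simp: space_G)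
  have bh: "h i \<in> bmeas (G i)" if "i < n" for i
    using h that by (intro bmeasI[where c = K]) (auto simp: space_G)
  have bYM: "Y i \<in> bmeas M" if "i \<le> n" for i using bY[OF that] by (rule bmeas_M)
  have baM: "a i \<in> bmeas M" if "i < n" for i using ba[OF that] by (rule bmeas_M)
  have bhM: "h i \<in> bmeas M" if "i < n" for i using bh[OF that] by (rule bmeas_M)
  \<comment> \<open>Concavity of \<open>min\<close> in integrated form: where \<open>X i\<close> is
    at most \<open>l\<close>, the increment of \<open>Y\<close> is at most that of \<open>X\<close>;
    where \<open>X i\<close> exceeds \<open>l\<close>, \<open>Y i\<close> already equals
    \<open>l\<close> and the increment is not positive.\<close>
  have super: "expectation (\<lambda>x. indicator B x * (Y (Suc i) x - Y i x)) \<le> 0" if i: "i < n" and B: "B \<in> sets (G i)" for i B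
  proof -
    let ?B = "B \<inter> {x\<in>space (G i). X i x \<le> l}"
    have B': "?B \<in> sets (G i)"
      using B X(1)[of i] i by (intro sets.Int) (auto intro!: borel_measurable_le)
    note bB = bmeas_M[OF bmeas_indicator[OF B]] bmeas_M[OF bmeas_indicator[OF B']]
    have "expectation (\<lambda>x. indicator B x * (Y (Suc i) x - Y i x)) \<le>
       expectation (\<lambda>x. indicator ?B x * (X (Suc i) x - X i x))"
    proof (rule integral_mono_AE)
      show "integrable M (\<lambda>x. indicator B x * (Y (Suc i) x - Y i x))"
        using i by (intro bmeas_integrable bmeas_mult bmeas_diff bB bYM) auto
      show "integrable M (\<lambda>x. indicator ?B x * (X (Suc i) x - X i x))"
        using i X(2) by (intro integrable_bmeas_mult bB) auto
      have "AE x in M. 0 \<le> X i x" "AE x in M. 0 \<le> X (Suc i) x" using X(3) i by auto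
      moreover have "AE x in M. x \<in> space M" by simp
      ultimately show "AE x in M. indicator B x * (Y (Suc i) x - Y i x) \<le> indicator ?B x * (X (Suc i) x - X i x)"
        by eventually_elim (auto simp: Y_def indicator_def space_G)
    qed
    also have "\<dots> = 0" using mart[OF i bmeas_indicator[OF B']] .
    finally show ?thesis .
  qed
  have Ea: "expectation (\<lambda>x. \<bar>a i x\<bar>) \<le> expectation (Y i) - expectation (Y (Suc i))" if i: "i < n" for i
  proof -
    let ?B = "{x\<in>space (G i). a i x > 0}"
    have B: "?B \<in> sets (G i)" using a(1)[OF i] by measurable
    note bB = bmeas_M[OF bmeas_indicator[OF B]]
    have [simp]: "integrable M (\<lambda>x. indicator ?B x * a i x)" "integrable M (a i)" "integrable M (Y i)" "integrable M (Y (Suc i))"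
      using i by (auto intro!: bmeas_integrable bmeas_mult bB baM bYM)
    \<comment> \<open>The positive part of the drift has nonpositive expectation by
      \<open>super\<close>, which leaves minus the expected drift; summed over \<open>i\<close> this
      telescopes to at most \<open>l\<close>.\<close>
    have "expectation (\<lambda>x. \<bar>a i x\<bar>) = expectation (\<lambda>x. 2 * (indicator ?B x * a i x) - a i x)"
      by (rule Bochner_Integration.integral_cong) (auto simp: indicator_def space_G)
    also have "\<dots> = 2 * expectation (\<lambda>x. indicator ?B x * a i x) - expectation (a i)" by simp
    also have "expectation (\<lambda>x. indicator ?B x * a i x) \<le> 0"
      using a(3)[OF i bmeas_indicator[OF B]] super[OF i B] by simp
    also have "expectation (a i) = expectation (Y (Suc i)) - expectation (Y i)"
      using a(3)[OF i bmeas_const[of 1]] by simp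
    finally show ?thesis by simp
  qed
  have sumEa: "(\<Sum>i<n. expectation (\<lambda>x. \<bar>a i x\<bar>)) \<le> l"
  proof -
    have "(\<Sum>i<n. expectation (\<lambda>x. \<bar>a i x\<bar>)) \<le> (\<Sum>i<n. expectation (Y i) - expectation (Y (Suc i)))"
      using Ea by (intro sum_mono) auto
    also have "\<dots> = expectation (Y 0) - expectation (Y n)" by (rule sum_lessThan_telescope')
    also have "\<dots> \<le> l - 0"
    proof (rule diff_mono)
      show "expectation (Y 0) \<le> l"
        using Y(2)[of 0] by (intro integral_le_const bmeas_integrable bYM) (auto simp: abs_le_iff intro!: AE_I2)
      show "0 \<le> expectation (Y n)" by (intro integral_nonneg_AE AE_I2) (simp add: Y_def)
    qed
    finally show ?thesis by simp
  qed
  define d where "d i x = Y (Suc i) x - Y i x - a i x" for i x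
  note mhd = mart_diff_mult[OF md bh, folded d_def]
  \<comment> \<open>A squared increment of \<open>Y\<close> is the increment of
    \<open>Y\<^sup>2\<close> minus \<open>2 * Y i\<close> times the increment. The first part
    telescopes to at most \<open>l\<^sup>2\<close>; in the second the increment may be replaced by
    \<open>a\<close>, at a total cost of \<open>2 * l\<^sup>2\<close>. Hence the factor 3.\<close>
  have sq: "(\<Sum>i<n. expectation (\<lambda>x. (h i x * d i x)\<^sup>2)) \<le> K\<^sup>2 * (3 * l\<^sup>2)"
  proof -
    have 1: "expectation (\<lambda>x. (h i x * d i x)\<^sup>2) \<le>
      K\<^sup>2 * (expectation (\<lambda>x. (Y (Suc i) x)\<^sup>2) - expectation (\<lambda>x. (Y i x)\<^sup>2) + 2 * l * expectation (\<lambda>x. \<bar>a i x\<bar>))"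
      if i: "i < n" for i
    proof -
      have "expectation (\<lambda>x. (h i x * d i x)\<^sup>2) \<le> expectation (\<lambda>x. (h i x * (Y (Suc i) x - Y i x))\<^sup>2)"
        unfolding d_def using i a(3)[OF i] bYM[of i] bYM[of "Suc i"] ba[OF i] bh[OF i]
        by (intro doob_square_le bmeas_diff) auto
      also have "\<dots> \<le> expectation (\<lambda>x. K\<^sup>2 * (Y (Suc i) x - Y i x)\<^sup>2)"
      proof (rule integral_mono)
        fix x assume "x \<in> space M"
        then have "(h i x)\<^sup>2 \<le> K\<^sup>2" using h(2)[OF i] K by (simp add: abs_le_square_iff[symmetric])
        then show "(h i x * (Y (Suc i) x - Y i x))\<^sup>2 \<le> K\<^sup>2 * (Y (Suc i) x - Y i x)\<^sup>2"
          by (auto simp: power_mult_distrib intro: mult_right_mono)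
      qed (use i in \<open>auto intro!: bmeas_integrable bmeas_intros bYM bhM\<close>)
      also have "\<dots> = K\<^sup>2 * expectation (\<lambda>x. (Y (Suc i) x)\<^sup>2 - (Y i x)\<^sup>2 - 2 * (Y i x * (Y (Suc i) x - Y i x)))"
        by (subst integral_mult_right_zero, rule arg_cong[where f = "\<lambda>y. K\<^sup>2 * y"], rule Bochner_Integration.integral_cong)
          (auto simp: power2_eq_square algebra_simps)
      also have "expectation (\<lambda>x. (Y (Suc i) x)\<^sup>2 - (Y i x)\<^sup>2 - 2 * (Y i x * (Y (Suc i) x - Y i x))) =
         expectation (\<lambda>x. (Y (Suc i) x)\<^sup>2) - expectation (\<lambda>x. (Y i x)\<^sup>2) - 2 * expectation (\<lambda>x. Y i x * a i x)"
      proof -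
        have [simp]: "integrable M (\<lambda>x. (Y (Suc i) x)\<^sup>2)" "integrable M (\<lambda>x. (Y i x)\<^sup>2)" "integrable M (\<lambda>x. Y i x * (Y (Suc i) x - Y i x))"
          using i by (auto intro!: bmeas_integrable bmeas_intros bYM)
        show ?thesis using a(3)[OF i bY] i by simp
      qed
      also have "- expectation (\<lambda>x. Y i x * a i x) \<le> expectation (\<lambda>x. l * \<bar>a i x\<bar>)"
      proof (subst integral_minus[symmetric], rule integral_mono)
        fix x
        have "- (Y i x * a i x) \<le> \<bar>Y i x\<bar> * \<bar>a i x\<bar>" by (simp add: abs_mult[symmetric])
        also have "\<dots> \<le> l * \<bar>a i x\<bar>" using Y(2)[of i x] i by (intro mult_right_mono) auto
        finally show "- (Y i x * a i x) \<le> l * \<bar>a i x\<bar>" .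
      qed (use i in \<open>auto intro!: bmeas_integrable bmeas_intros bYM baM\<close>)
      then have "expectation (\<lambda>x. (Y (Suc i) x)\<^sup>2) - expectation (\<lambda>x. (Y i x)\<^sup>2) - 2 * expectation (\<lambda>x. Y i x * a i x)
        \<le> expectation (\<lambda>x. (Y (Suc i) x)\<^sup>2) - expectation (\<lambda>x. (Y i x)\<^sup>2) + 2 * l * expectation (\<lambda>x. \<bar>a i x\<bar>)"
        by simp
      finally show ?thesis by (simp add: mult_left_mono)
    qed
    have "(\<Sum>i<n. expectation (\<lambda>x. (h i x * d i x)\<^sup>2)) \<le>
      (\<Sum>i<n. K\<^sup>2 * (expectation (\<lambda>x. (Y (Suc i) x)\<^sup>2) - expectation (\<lambda>x. (Y i x)\<^sup>2) + 2 * l * expectation (\<lambda>x. \<bar>a i x\<bar>)))"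
      using 1 by (intro sum_mono) auto
    also have "\<dots> = K\<^sup>2 * (expectation (\<lambda>x. (Y n x)\<^sup>2) - expectation (\<lambda>x. (Y 0 x)\<^sup>2) + 2 * l * (\<Sum>i<n. expectation (\<lambda>x. \<bar>a i x\<bar>)))"
      by (simp only: sum_distrib_left[symmetric] sum.distrib sum_lessThan_telescope[of "\<lambda>i. expectation (\<lambda>x. (Y i x)\<^sup>2)"])
    also have "\<dots> \<le> K\<^sup>2 * (l\<^sup>2 - 0 + 2 * l * l)"
    proof (intro mult_left_mono add_mono diff_mono sumEa)
      show "expectation (\<lambda>x. (Y n x)\<^sup>2) \<le> l\<^sup>2"
        using Y(2)[of n] l bYM by (intro integral_le_const bmeas_integrable bmeas_power) (auto simp: abs_le_square_iff[symmetric] intro!: AE_I2)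
    qed (use l in auto)
    finally show ?thesis by (simp add: power2_eq_square algebra_simps)
  qed
  \<comment> \<open>The three terms of the bound: \<open>X\<close> reaches \<open>l\<close>, the
    martingale part of the transform of \<open>Y\<close> reaches \<open>c\<close>, or its drift part
    does. Outside these events \<open>X = Y\<close> throughout and the transform stays below
    \<open>2 * c\<close>.\<close>
  let ?A1 = "{x\<in>space M. \<exists>i\<le>n. X i x \<ge> l}" and ?A2 = "{x\<in>space M. \<exists>k\<le>n. \<bar>\<Sum>i<k. h i x * d i x\<bar> \<ge> c}"
  let ?A3 = "{x\<in>space M. \<bar>\<Sum>i<n. K * \<bar>a i x\<bar>\<bar> \<ge> c}"
  have [measurable]: "d i \<in> borel_measurable M" "h i \<in> borel_measurable M" "a i \<in> borel_measurable M" if "i < n" for i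
    unfolding d_def using that bYM[of i, THEN bmeas_measurable] bYM[of "Suc i", THEN bmeas_measurable]
      baM[of i, THEN bmeas_measurable] bhM[of i, THEN bmeas_measurable]
    by (auto intro!: borel_measurable_diff)
  have m: "?A1 \<in> events" "?A2 \<in> events" "?A3 \<in> events"
  proof -
    have "{x\<in>space M. \<exists>i\<in>{..n}. X i x \<ge> l} \<in> events" by (intro sets.sets_Collect_finite_Ex) auto
    then show "?A1 \<in> events" by (simp add: Bex_def)
    have "(\<lambda>x. \<Sum>i<k. h i x * d i x) \<in> borel_measurable M" if "k \<le> n" for k
      using that by (intro borel_measurable_sum borel_measurable_times) auto
    then have "{x\<in>space M. \<exists>k\<in>{..n}. \<bar>\<Sum>i<k. h i x * d i x\<bar> \<ge> c} \<in> events" by (intro sets.sets_Collect_finite_Ex) auto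
    then show "?A2 \<in> events" by (simp add: Bex_def)
    have "(\<lambda>x. \<Sum>i<n. K * \<bar>a i x\<bar>) \<in> borel_measurable M" by (intro borel_measurable_sum) auto
    then show "?A3 \<in> events" by auto
  qed
  have "AE x in M. \<forall>i\<in>{..n}. 0 \<le> X i x" using X(3) by (intro AE_finite_allI) auto
  then have ae: "AE x in M. x \<in> {x\<in>space M. \<bar>\<Sum>i<n. h i x * (X (Suc i) x - X i x)\<bar> \<ge> 2 * c} \<longrightarrow> x \<in> ?A1 \<union> ?A2 \<union> ?A3"
  proof eventually_elim
    case (elim x)
    show ?case
    proof (intro impI, rule ccontr)
      assume x: "x \<in> {x\<in>space M. \<bar>\<Sum>i<n. h i x * (X (Suc i) x - X i x)\<bar> \<ge> 2 * c}" "x \<notin> ?A1 \<union> ?A2 \<union> ?A3"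
      then have sp: "x \<in> space M" by simp
      have XY: "X i x = Y i x" if "i \<le> n" for i 
      proof -
        have "x \<notin> ?A1" using x(2) by blast
        then have "X i x < l" using sp that by (metis (mono_tags, lifting) mem_Collect_eq not_le)
        then show ?thesis using elim that by (simp add: Y_def)
      qed
      have "(\<Sum>i<n. h i x * (X (Suc i) x - X i x)) = (\<Sum>i<n. h i x * (d i x + a i x))"
        using XY by (intro sum.cong) (auto simp: d_def)
      then have "(\<Sum>i<n. h i x * (X (Suc i) x - X i x)) = (\<Sum>i<n. h i x * d i x) + (\<Sum>i<n. h i x * a i x)"
        by (simp add: ring_distribs sum.distrib)
      moreover have "\<bar>\<Sum>i<n. h i x * a i x\<bar> \<le> (\<Sum>i<n. K * \<bar>a i x\<bar>)"
        using h(2) sp by (intro order_trans[OF sum_abs] sum_mono) (auto simp: abs_mult intro!: mult_right_mono)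
      moreover have "\<bar>\<Sum>i<n. h i x * d i x\<bar> < c" "\<bar>\<Sum>i<n. K * \<bar>a i x\<bar>\<bar> < c" using x sp by auto
      ultimately show False using x by (auto simp: abs_le_iff abs_less_iff)
    qed
  qed
  have "prob {x\<in>space M. \<bar>\<Sum>i<n. h i x * (X (Suc i) x - X i x)\<bar> \<ge> 2 * c} \<le> prob (?A1 \<union> ?A2 \<union> ?A3)"
    using m ae by (intro finite_measure_mono_AE) auto
  also have "\<dots> \<le> prob ?A1 + prob ?A2 + prob ?A3"
    using m by (intro order_trans[OF measure_Un_le] add_mono measure_Un_le) auto
  also have "prob ?A1 \<le> expectation (X 0) / l" by (rule nonneg_mart_maximal[OF X mart l])
  also have "prob ?A2 \<le> K\<^sup>2 * (3 * l\<^sup>2) / c\<^sup>2"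
    by (rule order_trans[OF mart_diff_maximal[OF mhd c] divide_right_mono[OF sq]]) auto
  also have "prob ?A3 \<le> expectation (\<lambda>x. \<bar>\<Sum>i<n. K * \<bar>a i x\<bar>\<bar>) / c"
    using c baM by (intro prob_abs_le Bochner_Integration.integrable_sum) (auto intro!: bmeas_integrable bmeas_intros)
  also have "expectation (\<lambda>x. \<bar>\<Sum>i<n. K * \<bar>a i x\<bar>\<bar>) = (\<Sum>i<n. K * expectation (\<lambda>x. \<bar>a i x\<bar>))"
    using K by (subst abs_of_nonneg, intro sum_nonneg, simp,
      subst Bochner_Integration.integral_sum) (auto intro!: bmeas_integrable bmeas_intros baM)
  also have "\<dots> / c \<le> K * l / c"
    using sumEa K c by (auto simp: sum_distrib_left[symmetric] intro!: divide_right_mono mult_left_mono)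
  finally show ?thesis by (simp add: mult.assoc mult.commute mult.left_commute)
qed

end

subsection \<open>Weak limits\<close>

text \<open>Tychonoff: the functions \<open>\<phi> m\<close> lie in a compact product of intervals
  and have a cluster point \<open>l\<close>. The index type is arbitrary, so convergence is obtained
  along a finer filter and not along a subsequence.\<close>

lemma pointwise_cluster_filter:
  fixes \<phi> :: "nat \<Rightarrow> 'i \<Rightarrow> real"
  assumes b: "\<And>m i. \<bar>\<phi> m i\<bar> \<le> b i"
  shows "\<exists>\<FF> l. \<FF> \<noteq> bot \<and> \<FF> \<le> sequentially \<and> (\<forall>i. ((\<lambda>m. \<phi> m i) \<longlongrightarrow> l i) \<FF>)"
proof -
  let ?K = "PiE UNIV (\<lambda>i. {- b i..b i})"
  have "compactin (product_topology (\<lambda>_. euclidean) UNIV) ?K" unfolding compactin_PiE by simp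
  then have "compact ?K" by (simp add: euclidean_product_topology)
  moreover have "\<forall>\<^sub>F x in filtermap \<phi> sequentially. x \<in> ?K"
    using b by (auto simp: eventually_filtermap abs_le_iff intro!: always_eventually) (metis minus_le_iff)
  moreover have "filtermap \<phi> sequentially \<noteq> bot" by (simp add: filtermap_bot_iff)
  ultimately obtain l where l: "inf (nhds l) (filtermap \<phi> sequentially) \<noteq> bot"
    unfolding compact_filter by blast
  \<comment> \<open>The indices that are large and at which \<open>\<phi> m\<close> is close to
    \<open>l\<close>; this filter is proper because \<open>l\<close> is a cluster point.\<close>
  define \<FF> where "\<FF> = inf (filtercomap \<phi> (nhds l)) sequentially"
  have "\<FF> \<noteq> bot"
  proof
    assume "\<FF> = bot"
    then obtain P Q where PQ: "eventually P (filtercomap \<phi> (nhds l))" "eventually Q sequentially"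
      "\<And>m. P m \<Longrightarrow> Q m \<Longrightarrow> False"
      using eventually_inf[of "\<lambda>_. False" "filtercomap \<phi> (nhds l)" sequentially] unfolding \<FF>_def by auto
    obtain P' where P': "eventually P' (nhds l)" "\<And>m. P' (\<phi> m) \<Longrightarrow> P m"
      using PQ(1) unfolding eventually_filtercomap by blast
    have "eventually (\<lambda>x. \<not> P' x) (filtermap \<phi> sequentially)"
      unfolding eventually_filtermap using PQ(2) by eventually_elim (use PQ(3) P'(2) in blast)
    then have "eventually (\<lambda>_. False) (inf (nhds l) (filtermap \<phi> sequentially))"
      unfolding eventually_inf using P'(1) by (intro exI[of _ P'] exI[of _ "\<lambda>x. \<not> P' x"]) auto
    then show False using l by (simp add: trivial_limit_def)
  qed
  moreover have lim: "filterlim \<phi> (nhds l) \<FF>"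
    unfolding \<FF>_def by (rule filterlim_mono[OF filterlim_filtercomap order_refl]) simp
  have "((\<lambda>m. \<phi> m i) \<longlongrightarrow> l i) \<FF>" for i
  proof -
    have "continuous_on UNIV (\<lambda>x::'i \<Rightarrow> real. x i)" by (rule continuous_on_product_coordinates)
    then have "((\<lambda>x. x i) \<longlongrightarrow> l i) (at l)" by (simp add: continuous_on_def)
    then have "((\<lambda>x. x i) \<longlongrightarrow> l i) (nhds l)" by (subst (asm) tendsto_at_iff_tendsto_nhds)
    then show ?thesis using lim by (rule filterlim_compose)
  qed
  moreover have "\<FF> \<le> sequentially" unfolding \<FF>_def by simp
  ultimately show ?thesis by blast
qed

context prob_space
begin

text \<open>Test with the set \<open>{g < f}\<close>: there \<open>f - g\<close> is positive, yet
  its integral is at most zero, so the set is null.\<close>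

lemma AE_le_of_integrals:
  fixes f g :: "'a \<Rightarrow> real"
  assumes f: "integrable M f" and g: "integrable M g"
    and le: "\<And>A. A \<in> sets M \<Longrightarrow> expectation (\<lambda>x. indicator A x * f x) \<le> expectation (\<lambda>x. indicator A x * g x)"
  shows "AE x in M. f x \<le> g x"
proof -
  have [measurable]: "f \<in> borel_measurable M" "g \<in> borel_measurable M" using f g by auto
  let ?A = "{x\<in>space M. g x < f x}"
  have A: "?A \<in> sets M" by measurable
  have i: "integrable M (\<lambda>x. indicator ?A x * f x)" "integrable M (\<lambda>x. indicator ?A x * g x)"
    using f g A by (auto intro: integrable_real_mult_indicator simp: mult.commute)
  let ?h = "\<lambda>x. indicator ?A x * f x - indicator ?A x * g x"
  have h: "AE x in M. 0 \<le> ?h x" by (auto simp: indicator_def)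
  have ih: "integrable M ?h" using i by simp
  have "expectation ?h \<le> 0" using i le[OF A] by simp
  then have "expectation ?h = 0" using integral_nonneg_AE[OF h] by linarith
  then have "AE x in M. ?h x = 0" using integral_nonneg_eq_0_iff_AE[OF ih h] by blast
  moreover have "AE x in M. x \<in> space M" by simp
  ultimately show ?thesis by eventually_elim (auto simp: indicator_def split: if_splits)
qed

lemma AE_eq_of_integrals:
  fixes f g :: "'a \<Rightarrow> real"
  assumes f: "integrable M f" and g: "integrable M g"
    and eq: "\<And>A. A \<in> sets M \<Longrightarrow> expectation (\<lambda>x. indicator A x * f x) = expectation (\<lambda>x. indicator A x * g x)"
  shows "AE x in M. f x = g x"
proof -
  have "AE x in M. f x \<le> g x" by (rule AE_le_of_integrals[OF f g]) (simp add: eq)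
  moreover have "AE x in M. g x \<le> f x" by (rule AE_le_of_integrals[OF g f]) (simp add: eq)
  ultimately show ?thesis by eventually_elim simp
qed

text \<open>The limiting set function is finitely additive and dominated by \<open>c * prob\<close>.
  Domination gives continuity at the empty set, hence countable additivity, and Radon-Nikodym
  supplies the density.\<close>

lemma weak_limit_density:
  fixes X :: "nat \<Rightarrow> 'a \<Rightarrow> real"
  assumes F: "\<FF> \<noteq> bot" and X: "\<And>m. X m \<in> borel_measurable M" "\<And>m x. x \<in> space M \<Longrightarrow> \<bar>X m x\<bar> \<le> c"
    and lim: "\<And>A. A \<in> sets M \<Longrightarrow> ((\<lambda>m. expectation (\<lambda>x. indicator A x * X m x)) \<longlongrightarrow> l A) \<FF>"
  shows "\<exists>x\<in>borel_measurable M. (\<forall>\<omega>. \<bar>x \<omega>\<bar> \<le> c) \<and> (\<forall>A\<in>sets M. l A = expectation (\<lambda>\<omega>. indicator A \<omega> * x \<omega>))"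
proof -
  obtain x0 where "x0 \<in> space M" using not_empty by blast
  then have c: "c \<ge> 0" using X(2)[of x0 0] by linarith
  have bX: "X m \<in> bmeas M" for m using X by (intro bmeasI)
  have iX: "integrable M (\<lambda>x. indicator A x * X m x)" if "A \<in> sets M" for A m
    using bX bmeas_indicator[OF that] by (intro bmeas_integrable bmeas_mult)
  have bound: "\<bar>l A\<bar> \<le> c * prob A" if A: "A \<in> sets M" for A
  proof -
    have "\<bar>expectation (\<lambda>x. indicator A x * X m x)\<bar> \<le> c * prob A" for m
    proof -
      have "\<bar>expectation (\<lambda>x. indicator A x * X m x)\<bar> \<le> expectation (\<lambda>x. \<bar>indicator A x * X m x\<bar>)"
        by (rule integral_abs_bound)
      also have "\<dots> \<le> expectation (\<lambda>x. c * indicator A x)"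
        using iX[OF A] X(2) A c
        by (intro integral_mono) (auto simp: indicator_def intro!: bmeas_integrable bmeas_indicator[OF A, unfolded indicator_def] bmeas_mult)
      finally show ?thesis using A by simp
    qed
    then show ?thesis
      by (intro tendsto_upperbound[OF tendsto_rabs[OF lim[OF A]] _ F]) (auto intro: always_eventually)
  qed
  have add: "l (A \<union> B) = l A + l B" if "A \<in> sets M" "B \<in> sets M" "A \<inter> B = {}" for A B
  proof (rule tendsto_unique[OF F lim])
    have "(\<lambda>m. expectation (\<lambda>x. indicator (A \<union> B) x * X m x)) =
       (\<lambda>m. expectation (\<lambda>x. indicator A x * X m x) + expectation (\<lambda>x. indicator B x * X m x))"
      using iX that by (simp add: Bochner_Integration.integral_add[symmetric] indicator_disj_union distrib_right del: Bochner_Integration.integral_add)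
    then show "((\<lambda>m. expectation (\<lambda>x. indicator (A \<union> B) x * X m x)) \<longlongrightarrow> l A + l B) \<FF>"
      using lim[OF that(1)] lim[OF that(2)] by (auto intro: tendsto_add)
  qed (use that in auto)
  \<comment> \<open>Adding \<open>c * prob A\<close> makes the set function nonnegative, so that it
    defines a measure; the shift is undone in the density \<open>g x - c\<close>.\<close>
  define \<mu> where "\<mu> A = ennreal (l A + c * prob A)" for A
  have nn: "0 \<le> l A + c * prob A" "l A + c * prob A \<le> 2 * c * prob A" if "A \<in> sets M" for A
    using bound[OF that] by (auto simp: abs_le_iff)
  have pos: "positive (sets M) \<mu>"
    unfolding positive_def \<mu>_def using bound[of "{}"] by simp
  have adt: "additive (sets M) \<mu>"
    unfolding additive_def \<mu>_def
  proof (intro ballI impI)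
    fix A B assume AB: "A \<in> sets M" "B \<in> sets M" "A \<inter> B = {}"
    then have "l (A \<union> B) + c * prob (A \<union> B) = (l A + c * prob A) + (l B + c * prob B)"
      by (simp add: add finite_measure_Union algebra_simps)
    then show "ennreal (l (A \<union> B) + c * prob (A \<union> B)) = ennreal (l A + c * prob A) + ennreal (l B + c * prob B)"
      using nn(1) AB by (simp add: ennreal_plus)
  qed
  have ca: "countably_additive (sets M) \<mu>"
  proof (rule sets.empty_continuous_imp_countably_additive[OF pos adt])
    fix A :: "nat \<Rightarrow> 'a set" assume A: "range A \<subseteq> sets M" "decseq A" "(\<Inter>i. A i) = {}"
    have "(\<lambda>i. 2 * c * prob (A i)) \<longlonglongrightarrow> 2 * c * prob (\<Inter>i. A i)"
      using A by (intro tendsto_intros finite_Lim_measure_decseq)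
    then have z: "(\<lambda>i. 2 * c * prob (A i)) \<longlonglongrightarrow> 0" using A by simp
    have "(\<lambda>i. l (A i) + c * prob (A i)) \<longlonglongrightarrow> 0"
    proof (rule tendsto_sandwich[OF _ _ tendsto_const z])
      have "A i \<in> sets M" for i using A(1) by blast
      then show "\<forall>\<^sub>F i in sequentially. 0 \<le> l (A i) + c * prob (A i)"
        "\<forall>\<^sub>F i in sequentially. l (A i) + c * prob (A i) \<le> 2 * c * prob (A i)"
        using nn by (simp_all add: always_eventually)
    qed
    then show "(\<lambda>i. \<mu> (A i)) \<longlonglongrightarrow> 0" unfolding \<mu>_def using tendsto_ennrealI by fastforce
  qed (simp add: \<mu>_def)
  define N where "N = measure_of (space M) (sets M) \<mu>"
  have sN: "sets N = sets M" unfolding N_def by (simp add: sets.sigma_sets_eq)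
  have eN: "emeasure N A = \<mu> A" if "A \<in> sets M" for A
    unfolding N_def using that pos ca sets.sigma_algebra_axioms by (intro emeasure_measure_of_sigma)
  have "absolutely_continuous M N"
    unfolding absolutely_continuous_def
  proof
    fix A assume A: "A \<in> null_sets M"
    then have "l A + c * prob A \<le> 0" using nn(2)[of A] by (auto simp: null_sets_def measure_def)
    then show "A \<in> null_sets N" using A sN eN by (auto simp: null_sets_def \<mu>_def ennreal_neg)
  qed
  from Radon_Nikodym[OF this sN] obtain f where f[measurable]: "f \<in> borel_measurable M" and d: "density M f = N" by blast
  have fA: "(\<integral>\<^sup>+x. f x * indicator A x \<partial>M) = ennreal (l A + c * prob A)" if "A \<in> sets M" for A
    using eN[OF that] emeasure_density[OF f that] by (simp add: d \<mu>_def)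
  have "(\<integral>\<^sup>+x. f x \<partial>M) \<noteq> \<infinity>"
    using fA[of "space M"] nn_integral_cong[of M "\<lambda>x. f x * indicator (space M) x" f] by simp
  then have fin: "AE x in M. f x \<noteq> \<infinity>" by (intro nn_integral_PInf_AE) auto
  define g where "g x = enn2real (f x)" for x
  have g[measurable]: "g \<in> borel_measurable M" unfolding g_def by measurable
  have gA: "has_bochner_integral M (\<lambda>x. g x * indicator A x) (l A + c * prob A)" if A: "A \<in> sets M" for A
  proof (rule has_bochner_integral_nn_integral)
    have "(\<integral>\<^sup>+x. ennreal (g x * indicator A x) \<partial>M) = (\<integral>\<^sup>+x. f x * indicator A x \<partial>M)"
      by (rule nn_integral_cong_AE, use fin in eventually_elim) (auto simp: g_def indicator_def top.not_eq_extremum)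
    then show "(\<integral>\<^sup>+x. ennreal (g x * indicator A x) \<partial>M) = ennreal (l A + c * prob A)" using fA[OF A] by simp
  qed (use A nn in \<open>auto simp: g_def\<close>)
  have ig: "integrable M g"
  proof -
    have "integrable M (\<lambda>x. g x * indicator (space M) x)" using gA[of "space M"] by (auto simp: has_bochner_integral_iff)
    then show ?thesis by (rule Bochner_Integration.integrable_cong[THEN iffD1, rotated 2]) auto
  qed
  have Eg: "expectation (\<lambda>x. indicator A x * (g x - c)) = l A" if A: "A \<in> sets M" for A
  proof -
    have "expectation (\<lambda>x. indicator A x * (g x - c)) = expectation (\<lambda>x. g x * indicator A x - c * indicator A x)"
      by (simp add: algebra_simps)
    also have "\<dots> = l A" using gA[OF A] A bmeas_integrable[OF bmeas_indicator[OF A]]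
      by (subst Bochner_Integration.integral_diff) (auto simp: has_bochner_integral_iff)
    finally show ?thesis .
  qed
  have "AE x in M. g x - c \<le> c"
    by (rule AE_le_of_integrals) (use ig Eg bound in \<open>auto simp: abs_le_iff mult.commute\<close>)
  moreover have "AE x in M. - c \<le> g x - c" unfolding g_def by (intro AE_I2) simp
  ultimately have ae: "AE x in M. max (-c) (min c (g x - c)) = g x - c" by eventually_elim auto
  show ?thesis
  proof (intro bexI[of _ "\<lambda>x. max (-c) (min c (g x - c))"] conjI ballI allI)
    fix A assume A: "A \<in> sets M"
    have "expectation (\<lambda>x. indicator A x * max (-c) (min c (g x - c))) = expectation (\<lambda>x. indicator A x * (g x - c))"
      by (rule integral_cong_AE, use A in measurable, use A in measurable, use ae in eventually_elim) simp
    then show "l A = expectation (\<lambda>x. indicator A x * max (-c) (min c (g x - c)))" using Eg[OF A] by simp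
  qed (use c in auto)
qed

text \<open>Weak-star compactness of a ball in L-infinity, for all indices \<open>i\<close> at once:
  the expectations indexed by pairs of an index and an integrable function form one pointwise
  bounded sequence of functions, so a single filter serves all of them.\<close>

lemma weak_limit_exists:
  fixes X :: "nat \<Rightarrow> 'i \<Rightarrow> 'a \<Rightarrow> real"
  assumes G: "\<And>i. subalgebra M (G i)"
    and X: "\<And>m i. X m i \<in> borel_measurable (G i)" "\<And>m i x. x \<in> space M \<Longrightarrow> \<bar>X m i x\<bar> \<le> c"
  shows "\<exists>\<FF> x. \<FF> \<noteq> bot \<and> \<FF> \<le> sequentially \<and> (\<forall>i. x i \<in> borel_measurable (G i)) \<and>
    (\<forall>i. \<forall>\<omega>\<in>space M. \<bar>x i \<omega>\<bar> \<le> c) \<and>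
    (\<forall>i f. integrable M f \<longrightarrow>
      ((\<lambda>m. expectation (\<lambda>\<omega>. f \<omega> * X m i \<omega>)) \<longlongrightarrow> expectation (\<lambda>\<omega>. f \<omega> * x i \<omega>)) \<FF>)"
proof -
  obtain x0 where "x0 \<in> space M" using not_empty by blast
  then have c: "c \<ge> 0" using X(2)[of x0 0 undefined] by linarith
  have XM: "X m i \<in> borel_measurable M" for m i using X(1) by (rule measurable_from_subalg[OF G])
  have bX: "X m i \<in> bmeas M" for m i using XM X(2) by (intro bmeasI)
  have le: "\<bar>expectation (\<lambda>\<omega>. f \<omega> * Z \<omega>)\<bar> \<le> c * expectation (\<lambda>\<omega>. \<bar>f \<omega>\<bar>)"
    if f: "integrable M f" and Z: "Z \<in> borel_measurable M" "\<And>x. x \<in> space M \<Longrightarrow> \<bar>Z x\<bar> \<le> c" for f Z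
  proof -
    have bZ: "Z \<in> bmeas M" using Z by (intro bmeasI)
    have "\<bar>expectation (\<lambda>\<omega>. f \<omega> * Z \<omega>)\<bar> \<le> expectation (\<lambda>\<omega>. \<bar>f \<omega> * Z \<omega>\<bar>)" by (rule integral_abs_bound)
    also have "\<dots> \<le> expectation (\<lambda>\<omega>. c * \<bar>f \<omega>\<bar>)"
    proof (rule integral_mono)
      show "integrable M (\<lambda>\<omega>. \<bar>f \<omega> * Z \<omega>\<bar>)"
        using integrable_bmeas_mult[OF bZ f] by (auto simp: mult.commute)
      show "\<bar>f \<omega> * Z \<omega>\<bar> \<le> c * \<bar>f \<omega>\<bar>" if "\<omega> \<in> space M" for \<omega>
        using mult_right_mono[OF Z(2)[OF that], of "\<bar>f \<omega>\<bar>"] by (simp add: abs_mult mult.commute)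
    qed (use f in auto)
    finally show ?thesis by simp
  qed
  \<comment> \<open>Non-integrable second components are sent to 0, which lets the pairs range over
    a full type.\<close>
  define \<phi> where "\<phi> m q = (if integrable M (snd q) then expectation (\<lambda>\<omega>. snd q \<omega> * X m (fst q) \<omega>) else 0)"
    for m and q :: "'i \<times> ('a \<Rightarrow> real)"
  have "\<bar>\<phi> m q\<bar> \<le> c * expectation (\<lambda>\<omega>. \<bar>snd q \<omega>\<bar>)" for m q
    unfolding \<phi>_def using le[OF _ XM X(2)] c by (auto intro!: mult_nonneg_nonneg)
  from pointwise_cluster_filter[of \<phi>, OF this]
  obtain \<FF> l where F: "\<FF> \<noteq> bot" "\<FF> \<le> sequentially" and l: "\<And>q. ((\<lambda>m. \<phi> m q) \<longlongrightarrow> l q) \<FF>" by blast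
  have l': "((\<lambda>m. expectation (\<lambda>\<omega>. f \<omega> * X m i \<omega>)) \<longlongrightarrow> l (i, f)) \<FF>" if "integrable M f" for i f
    using l[of "(i, f)"] that by (simp add: \<phi>_def)
  have "\<exists>x\<in>borel_measurable (G i). (\<forall>\<omega>\<in>space M. \<bar>x \<omega>\<bar> \<le> c) \<and> (\<forall>f. integrable M f \<longrightarrow>
      ((\<lambda>m. expectation (\<lambda>\<omega>. f \<omega> * X m i \<omega>)) \<longlongrightarrow> expectation (\<lambda>\<omega>. f \<omega> * x \<omega>)) \<FF>)" for i
  proof -
    have "\<exists>x\<in>borel_measurable M. (\<forall>\<omega>. \<bar>x \<omega>\<bar> \<le> c) \<and> (\<forall>A\<in>sets M. l (i, indicator A) = expectation (\<lambda>\<omega>. indicator A \<omega> * x \<omega>))"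
    proof (rule weak_limit_density[OF F(1) XM X(2)])
      fix A assume "A \<in> events"
      then show "((\<lambda>m. expectation (\<lambda>x. indicator A x * X m i x)) \<longlongrightarrow> l (i, indicator A)) \<FF>"
        by (intro l' bmeas_integrable bmeas_indicator)
    qed
    then obtain x where x: "x \<in> borel_measurable M" "\<And>\<omega>. \<bar>x \<omega>\<bar> \<le> c"
      and xA: "\<And>A. A \<in> sets M \<Longrightarrow> l (i, indicator A) = expectation (\<lambda>\<omega>. indicator A \<omega> * x \<omega>)" by blast
    have bx: "x \<in> bmeas M" using x by (intro bmeasI)
    \<comment> \<open>From indicators to all integrable functions: both sides are linear in
      \<open>f\<close>, and both are Lipschitz in the L1 norm with constant \<open>c\<close>, which
      handles the limit case.\<close>
    have lx: "l (i, f) = expectation (\<lambda>\<omega>. f \<omega> * x \<omega>)" if "integrable M f" for f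
      using that
    proof (induction rule: integrable_induct)
      case (base A a)
      have "integrable M (indicator A :: 'a \<Rightarrow> real)" using base by (intro bmeas_integrable bmeas_indicator)
      from tendsto_mult_left[OF l'[OF this, of i], of a]
      have "((\<lambda>m. expectation (\<lambda>\<omega>. (indicator A \<omega> *\<^sub>R a) * X m i \<omega>)) \<longlongrightarrow> a * l (i, indicator A)) \<FF>"
        by (simp add: mult.assoc mult.left_commute)
      moreover have "integrable M (\<lambda>\<omega>. indicator A \<omega> *\<^sub>R a)" using base by (simp add: bmeas_integrable bmeas_indicator)
      ultimately have "l (i, \<lambda>\<omega>. indicator A \<omega> *\<^sub>R a) = a * l (i, indicator A)"
        by (intro tendsto_unique[OF F(1) l'])
      then show ?case using xA[OF base(1)] by (simp add: mult.assoc mult.left_commute)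
    next
      case (add f g)
      have "((\<lambda>m. expectation (\<lambda>\<omega>. (f \<omega> + g \<omega>) * X m i \<omega>)) \<longlongrightarrow> l (i, f) + l (i, g)) \<FF>"
        using tendsto_add[OF l'[OF add(1), of i] l'[OF add(2), of i]] add(1,2) bX integrable_bmeas_mult[OF bX]
        by (simp add: ring_distribs mult.commute[of _ "X _ _ _"])
      then have "l (i, \<lambda>\<omega>. f \<omega> + g \<omega>) = l (i, f) + l (i, g)"
        by (intro tendsto_unique[OF F(1) l']) (use add in auto)
      then show ?case using add integrable_bmeas_mult[OF bx]
        by (simp add: ring_distribs mult.commute[of _ "x _"])
    next
      case (lim f s)
      have s: "integrable M (s k)" "l (i, s k) = expectation (\<lambda>\<omega>. s k \<omega> * x \<omega>)" for k by (fact lim)+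
      have sf: "\<omega> \<in> space M \<Longrightarrow> (\<lambda>k. s k \<omega>) \<longlonglongrightarrow> f \<omega>" "\<omega> \<in> space M \<Longrightarrow> norm (s k \<omega>) \<le> 2 * norm (f \<omega>)" for k \<omega>
        by (fact lim)+
      have f: "integrable M f" by (fact lim)
      have d: "\<bar>l (i, f) - l (i, g)\<bar> \<le> c * expectation (\<lambda>\<omega>. \<bar>f \<omega> - g \<omega>\<bar>)" if g: "integrable M g" for g
      proof -
        have "((\<lambda>m. expectation (\<lambda>\<omega>. (f \<omega> - g \<omega>) * X m i \<omega>)) \<longlongrightarrow> l (i, f) - l (i, g)) \<FF>"
          using tendsto_diff[OF l'[OF f, of i] l'[OF g, of i]] f g integrable_bmeas_mult[OF bX]
          by (simp add: ring_distribs mult.commute[of _ "X _ _ _"])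
        from tendsto_rabs[OF this] show ?thesis
          by (rule tendsto_upperbound[OF _ always_eventually F(1)]) (use le XM X(2) f g in auto)
      qed
      have "(\<lambda>k. expectation (\<lambda>\<omega>. \<bar>f \<omega> - s k \<omega>\<bar>)) \<longlonglongrightarrow> expectation (\<lambda>\<omega>. 0)"
      proof (rule integral_dominated_convergence[where w = "\<lambda>\<omega>. 3 * norm (f \<omega>)"])
        show "AE \<omega> in M. (\<lambda>k. \<bar>f \<omega> - s k \<omega>\<bar>) \<longlonglongrightarrow> 0"
        proof (intro AE_I2)
          fix \<omega> assume "\<omega> \<in> space M"
          from tendsto_rabs[OF tendsto_diff[OF tendsto_const[of "f \<omega>"] sf(1)[OF this]]]
          show "(\<lambda>k. \<bar>f \<omega> - s k \<omega>\<bar>) \<longlonglongrightarrow> 0" by simp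
        qed
        show "AE \<omega> in M. norm \<bar>f \<omega> - s k \<omega>\<bar> \<le> 3 * norm (f \<omega>)" for k
          using sf(2)[of _ k] by (intro AE_I2) fastforce
      qed (use s(1) f in auto)
      then have z: "(\<lambda>k. c * expectation (\<lambda>\<omega>. \<bar>f \<omega> - s k \<omega>\<bar>)) \<longlonglongrightarrow> 0"
        using tendsto_mult_right_zero by fastforce
      have "\<bar>l (i, f) - expectation (\<lambda>\<omega>. f \<omega> * x \<omega>)\<bar> \<le> c * expectation (\<lambda>\<omega>. \<bar>f \<omega> - s k \<omega>\<bar>) + c * expectation (\<lambda>\<omega>. \<bar>f \<omega> - s k \<omega>\<bar>)" for k
      proof -
        have "expectation (\<lambda>\<omega>. (f \<omega> - s k \<omega>) * x \<omega>) = expectation (\<lambda>\<omega>. f \<omega> * x \<omega>) - expectation (\<lambda>\<omega>. s k \<omega> * x \<omega>)"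
          using f s(1) integrable_bmeas_mult[OF bx] by (simp add: ring_distribs mult.commute[of _ "x _"])
        moreover have "\<bar>expectation (\<lambda>\<omega>. (f \<omega> - s k \<omega>) * x \<omega>)\<bar> \<le> c * expectation (\<lambda>\<omega>. \<bar>f \<omega> - s k \<omega>\<bar>)"
          by (rule le) (use f s(1) x in auto)
        ultimately show ?thesis using d[OF s(1)[of k]] s(2)[of k] by (simp add: abs_le_iff)
      qed
      then have "\<bar>l (i, f) - expectation (\<lambda>\<omega>. f \<omega> * x \<omega>)\<bar> \<le> 0 + 0"
        by (intro tendsto_lowerbound[OF tendsto_add[OF z z]]) (auto intro: always_eventually)
      then show ?case by simp
    qed
    \<comment> \<open>\<open>x\<close> is only known to be measurable for \<open>M\<close>.
      Conditioning is self-adjoint: an indicator tested against the \<open>G i\<close>-measurable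
      \<open>X m i\<close> may be replaced by its conditional expectation \<open>a\<close>, and this
      forces \<open>x\<close> to agree almost everywhere with its own conditional expectation
      \<open>y\<close>.\<close>
    obtain y where y: "y \<in> borel_measurable (G i)" "\<And>\<omega>. \<omega> \<in> space M \<Longrightarrow> \<bar>y \<omega>\<bar> \<le> c"
      and yG: "\<And>\<phi>. \<phi> \<in> bmeas (G i) \<Longrightarrow> expectation (\<lambda>\<omega>. \<phi> \<omega> * y \<omega>) = expectation (\<lambda>\<omega>. \<phi> \<omega> * x \<omega>)"
      using bounded_cond_exp[OF G x(1,2), of i] by blast
    have sp: "space (G i) = space M" using G[of i] by (simp add: subalgebra_def)
    have bG: "y \<in> bmeas (G i)" using y by (intro bmeasI) (auto simp: sp)
    have bXG: "X m i \<in> bmeas (G i)" for m using X by (intro bmeasI) (auto simp: sp)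
    have "AE \<omega> in M. x \<omega> = y \<omega>"
    proof (rule AE_eq_of_integrals)
      show "integrable M x" "integrable M y" using bx bG bmeas_subalgebra[OF G] by (auto intro: bmeas_integrable)
      fix A assume A: "A \<in> sets M"
      obtain a where a: "a \<in> borel_measurable (G i)" "\<And>\<omega>. \<omega> \<in> space M \<Longrightarrow> \<bar>a \<omega>\<bar> \<le> 1"
        and aG: "\<And>\<phi>. \<phi> \<in> bmeas (G i) \<Longrightarrow> expectation (\<lambda>\<omega>. \<phi> \<omega> * a \<omega>) = expectation (\<lambda>\<omega>. \<phi> \<omega> * indicator A \<omega>)"
        using bounded_cond_exp[OF G, of "indicator A" 1 i] A by (auto simp: indicator_def)
      have ba: "a \<in> bmeas (G i)" using a by (intro bmeasI) (auto simp: sp)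
      have "(\<lambda>m. expectation (\<lambda>\<omega>. indicator A \<omega> * X m i \<omega>)) = (\<lambda>m. expectation (\<lambda>\<omega>. a \<omega> * X m i \<omega>))"
        using aG[OF bXG] by (simp add: mult.commute)
      then have "l (i, indicator A) = l (i, a)"
        using l'[of "indicator A" i] l'[of a i] bmeas_integrable[OF bmeas_subalgebra[OF G ba]]
          bmeas_integrable[OF bmeas_indicator[OF A]]
        by (intro tendsto_unique[OF F(1)]) auto
      also have "l (i, a) = expectation (\<lambda>\<omega>. a \<omega> * y \<omega>)"
        using lx[OF bmeas_integrable[OF bmeas_subalgebra[OF G ba]]] yG[OF ba] by simp
      also have "\<dots> = expectation (\<lambda>\<omega>. indicator A \<omega> * y \<omega>)" using aG[OF bG] by (simp add: mult.commute)
      finally show "expectation (\<lambda>\<omega>. indicator A \<omega> * x \<omega>) = expectation (\<lambda>\<omega>. indicator A \<omega> * y \<omega>)"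
        using xA[OF A] by simp
    qed
    then have "((\<lambda>m. expectation (\<lambda>\<omega>. f \<omega> * X m i \<omega>)) \<longlongrightarrow> expectation (\<lambda>\<omega>. f \<omega> * y \<omega>)) \<FF>"
      if f: "integrable M f" for f
    proof -
      have "expectation (\<lambda>\<omega>. f \<omega> * x \<omega>) = expectation (\<lambda>\<omega>. f \<omega> * y \<omega>)"
        using f x(1) measurable_from_subalg[OF G y(1)] \<open>AE \<omega> in M. x \<omega> = y \<omega>\<close>
        by (intro integral_cong_AE borel_measurable_times) auto
      then show ?thesis using l'[OF f, of i] lx[OF f] by simp
    qed
    then show ?thesis using y by (intro bexI[of _ y]) auto
  qed
  then obtain x where "\<And>i. x i \<in> borel_measurable (G i) \<and> (\<forall>\<omega>\<in>space M. \<bar>x i \<omega>\<bar> \<le> c) \<and> (\<forall>f. integrable M f \<longrightarrow>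
      ((\<lambda>m. expectation (\<lambda>\<omega>. f \<omega> * X m i \<omega>)) \<longlongrightarrow> expectation (\<lambda>\<omega>. f \<omega> * x i \<omega>)) \<FF>)"
    using choice[of "\<lambda>i x. x \<in> borel_measurable (G i) \<and> (\<forall>\<omega>\<in>space M. \<bar>x \<omega>\<bar> \<le> c) \<and> (\<forall>f. integrable M f \<longrightarrow>
      ((\<lambda>m. expectation (\<lambda>\<omega>. f \<omega> * X m i \<omega>)) \<longlongrightarrow> expectation (\<lambda>\<omega>. f \<omega> * x \<omega>)) \<FF>)"] by blast
  then show ?thesis using F by blast
qed

end

subsection \<open>Quadratic variation and predictable variation\<close>

definition quad_var :: "(nat \<Rightarrow> real) \<Rightarrow> nat \<Rightarrow> real" where
  "quad_var y j = (\<Sum>l<j. (y (Suc l) - y l)\<^sup>2)"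

text \<open>Switch for a stopped integrand: it uses values up to index \<open>l\<close> only and
  multiplies the increment from \<open>l\<close> to \<open>Suc l\<close>, so it is predictable. The
  increment that crosses the threshold is still included.\<close>

definition qv_active :: "real \<Rightarrow> (nat \<Rightarrow> real) \<Rightarrow> nat \<Rightarrow> real" where
  "qv_active c y l = (if \<forall>k\<le>l. \<not> c \<le> quad_var y k then 1 else 0)"

lemma qv_active_bounds: "0 \<le> qv_active c y l" "qv_active c y l \<le> 1" "(qv_active c y l)\<^sup>2 = qv_active c y l"
  by (auto simp: qv_active_def)

lemma quad_var_mono: "i \<le> j \<Longrightarrow> quad_var y i \<le> quad_var y j"
  unfolding quad_var_def by (intro sum_mono2) auto

text \<open>\<open>- 2 * y l * (y (Suc l) - y l)\<close> is the increment of \<open>quad_var y\<close> minus that of \<open>y\<^sup>2\<close>.\<close>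

lemma quad_var_transform:
  assumes y: "\<And>i. i \<le> n \<Longrightarrow> \<bar>y i\<bar> \<le> K"
  shows "- K\<^sup>2 \<le> (\<Sum>l<n. qv_active c y l * (- 2 * y l) * (y (Suc l) - y l))"
    and "c \<le> quad_var y n \<Longrightarrow> c - K\<^sup>2 \<le> (\<Sum>l<n. qv_active c y l * (- 2 * y l) * (y (Suc l) - y l))"
proof -
  let ?x = "\<lambda>k. quad_var y k - (y k)\<^sup>2"
  obtain k where k: "k \<le> n" "?x 0 + (\<Sum>i<n. qv_active c y i * (?x (Suc i) - ?x i)) = ?x k"
    and ck: "(\<exists>k\<le>n. c \<le> quad_var y k) \<longrightarrow> c \<le> quad_var y k"
    using stopped_sum[of n ?x "\<lambda>k. c \<le> quad_var y k"] unfolding qv_active_def[symmetric] by (elim exE conjE) (rule that)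
  have "?x (Suc i) - ?x i = - 2 * y i * (y (Suc i) - y i)" for i
    by (simp add: quad_var_def power2_eq_square algebra_simps)
  then have eq: "(\<Sum>l<n. qv_active c y l * (- 2 * y l) * (y (Suc l) - y l)) = quad_var y k - (y k)\<^sup>2 + (y 0)\<^sup>2"
    using k by (simp add: quad_var_def mult.assoc)
  have "(y k)\<^sup>2 \<le> K\<^sup>2" using y[OF k(1)] by (metis abs_ge_zero order_trans power2_abs power_mono)
  moreover have "0 \<le> quad_var y k" by (auto simp: quad_var_def intro: sum_nonneg)
  moreover have "0 \<le> (y 0)\<^sup>2" by simp
  ultimately show "- K\<^sup>2 \<le> (\<Sum>l<n. qv_active c y l * (- 2 * y l) * (y (Suc l) - y l))" unfolding eq by linarith
  show "c - K\<^sup>2 \<le> (\<Sum>l<n. qv_active c y l * (- 2 * y l) * (y (Suc l) - y l))" if "c \<le> quad_var y n"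
  proof -
    have "c \<le> quad_var y k" using ck that by blast
    then show ?thesis using \<open>(y k)\<^sup>2 \<le> K\<^sup>2\<close> \<open>0 \<le> (y 0)\<^sup>2\<close> unfolding eq by linarith
  qed
qed

text \<open>Below the threshold the sum is less than \<open>c\<close>; the increment that crosses it
  is counted too and contributes at most \<open>(2 * K)\<^sup>2\<close>.\<close>

lemma qv_active_sum_le:
  assumes y: "\<And>i. i \<le> n \<Longrightarrow> \<bar>y i\<bar> \<le> K" and c: "c \<ge> 0"
  shows "(\<Sum>l<n. qv_active c y l * (y (Suc l) - y l)\<^sup>2) \<le> c + 4 * K\<^sup>2"
  using y
proof (induction n)
  case (Suc n)
  have d: "(y (Suc n) - y n)\<^sup>2 \<le> 4 * K\<^sup>2"
  proof -
    have "\<bar>y (Suc n) - y n\<bar> \<le> 2 * K" using Suc.prems[of n] Suc.prems[of "Suc n"] by (auto simp: abs_le_iff)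
    then have "\<bar>y (Suc n) - y n\<bar>\<^sup>2 \<le> (2 * K)\<^sup>2" by (intro power_mono) auto
    then show ?thesis by (simp add: power_mult_distrib)
  qed
  show ?case
  proof (cases "qv_active c y n = 0")
    case True
    then show ?thesis using Suc by simp
  next
    case False
    then have q: "quad_var y n < c" by (auto simp: qv_active_def split: if_splits)
    have "(\<Sum>l<n. qv_active c y l * (y (Suc l) - y l)\<^sup>2) \<le> quad_var y n"
      unfolding quad_var_def using mult_right_mono[OF qv_active_bounds(2)] by (intro sum_mono) force
    moreover have "qv_active c y n * (y (Suc n) - y n)\<^sup>2 \<le> 4 * K\<^sup>2"
      using d qv_active_bounds(2)[of c y n] mult_right_mono[of "qv_active c y n" 1 "(y (Suc n) - y n)\<^sup>2"] by simp
    ultimately show ?thesis using q by simp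
  qed
qed (use c in simp)

context discrete_filtration
begin

lemma qv_active_bmeas:
  assumes Y: "\<And>i. i \<le> n \<Longrightarrow> Y i \<in> borel_measurable (G i)" and l: "l < n"
  shows "(\<lambda>x. qv_active c (\<lambda>i. Y i x) l) \<in> bmeas (G l)"
proof (rule bmeasI[where c = 1])
  have [measurable]: "(\<lambda>x. quad_var (\<lambda>i. Y i x) k) \<in> borel_measurable (G l)" if "k \<le> l" for k
  proof -
    have [measurable]: "Y i \<in> borel_measurable (G l)" if "i \<le> l" for i
      by (rule measurable_mono[OF Y]) (use that l in auto)
    show ?thesis unfolding quad_var_def using that by (intro borel_measurable_sum) auto
  qed
  have "Measurable.pred (G l) (\<lambda>x. \<forall>k\<in>{..l}. \<not> c \<le> quad_var (\<lambda>i. Y i x) k)"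
    by (intro pred_intros_finite) auto
  then have "Measurable.pred (G l) (\<lambda>x. \<forall>k\<le>l. \<not> c \<le> quad_var (\<lambda>i. Y i x) k)"
    by (simp only: Ball_def atMost_iff)
  then show "(\<lambda>x. qv_active c (\<lambda>i. Y i x) l) \<in> borel_measurable (G l)"
    unfolding qv_active_def pred_def by (intro measurable_If borel_measurable_const)
qed (auto simp: qv_active_def)

text \<open>The sign turns the drift of the transformed process into the switched
  \<open>\<bar>a\<bar>\<close>, while the switch bounds the sum of squares by
  \<open>c + 4 * K\<^sup>2\<close> whatever \<open>n\<close> is. Removing the drift does not
  increase second moments, so Kolmogorov's inequality is uniform in the grid.\<close>

lemma active_transform_maximal:
  assumes Y: "\<And>i. i \<le> n \<Longrightarrow> Y i \<in> borel_measurable (G i)" "\<And>i x. i \<le> n \<Longrightarrow> x \<in> space M \<Longrightarrow> \<bar>Y i x\<bar> \<le> K"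
    and a: "\<And>i. i < n \<Longrightarrow> a i \<in> bmeas (G i)"
    "\<And>i \<phi>. i < n \<Longrightarrow> \<phi> \<in> bmeas (G i) \<Longrightarrow>
      expectation (\<lambda>x. \<phi> x * a i x) = expectation (\<lambda>x. \<phi> x * (Y (Suc i) x - Y i x))"
    and md: "mart_diff (\<lambda>i x. Y (Suc i) x - Y i x - a i x) n"
    and c: "c \<ge> 0" and l: "l > 0"
  defines "h \<equiv> \<lambda>i x. qv_active c (\<lambda>i. Y i x) i * sgn (a i x)"
  shows "prob {x\<in>space M. \<exists>k\<le>n. \<bar>\<Sum>i<k. h i x * (Y (Suc i) x - Y i x - a i x)\<bar> \<ge> l} \<le> (c + 4 * K\<^sup>2) / l\<^sup>2"
proof -
  let ?g = "\<lambda>i x. qv_active c (\<lambda>i. Y i x) i"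
  have bY: "Y i \<in> bmeas M" if "i \<le> n" for i
    using Y that measurable_from_subalg[OF sub Y(1)] by (intro bmeasI[where c = K]) auto
  have bg: "?g i \<in> bmeas (G i)" if "i < n" for i using qv_active_bmeas[OF Y(1) that] .
  have bh: "h i \<in> bmeas (G i)" if "i < n" for i
    unfolding h_def by (intro bmeas_mult bg bmeas_sgn a that)
  have [simp]: "integrable M (\<lambda>x. ?g i x * (Y (Suc i) x - Y i x)\<^sup>2)" if "i < n" for i
    using that by (intro bmeas_integrable bmeas_intros bY bmeas_M[OF bg]) auto
  have "(\<Sum>i<n. expectation (\<lambda>x. (h i x * (Y (Suc i) x - Y i x - a i x))\<^sup>2)) \<le>
     (\<Sum>i<n. expectation (\<lambda>x. ?g i x * (Y (Suc i) x - Y i x)\<^sup>2))"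
  proof (rule sum_mono)
    fix i assume "i \<in> {..<n}"
    then have i: "i < n" by simp
    have "expectation (\<lambda>x. (h i x * (Y (Suc i) x - Y i x - a i x))\<^sup>2) \<le> expectation (\<lambda>x. (h i x * (Y (Suc i) x - Y i x))\<^sup>2)"
      using i bY[of i] bY[of "Suc i"] a(2)[OF i] a(1)[OF i] bh[OF i] by (intro doob_square_le bmeas_diff) auto
    also have "\<dots> \<le> expectation (\<lambda>x. ?g i x * (Y (Suc i) x - Y i x)\<^sup>2)"
    proof (rule integral_mono)
      show "integrable M (\<lambda>x. (h i x * (Y (Suc i) x - Y i x))\<^sup>2)"
        using i by (intro bmeas_integrable bmeas_intros bY bmeas_M[OF bh]) auto
      show "(h i x * (Y (Suc i) x - Y i x))\<^sup>2 \<le> ?g i x * (Y (Suc i) x - Y i x)\<^sup>2" for x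
        unfolding h_def by (auto simp: power_mult_distrib qv_active_bounds sgn_real_def)
    qed (use i in simp)
    finally show "expectation (\<lambda>x. (h i x * (Y (Suc i) x - Y i x - a i x))\<^sup>2) \<le> expectation (\<lambda>x. ?g i x * (Y (Suc i) x - Y i x)\<^sup>2)" .
  qed
  also have "\<dots> = expectation (\<lambda>x. \<Sum>i<n. ?g i x * (Y (Suc i) x - Y i x)\<^sup>2)"
    by (subst Bochner_Integration.integral_sum) auto
  also have "\<dots> \<le> c + 4 * K\<^sup>2"
    by (rule integral_le_const) (use qv_active_sum_le[OF Y(2) c] in \<open>auto intro!: AE_I2 Bochner_Integration.integrable_sum\<close>)
  finally show ?thesis
    using mart_diff_maximal[OF mart_diff_mult[OF md bh] l] by (meson divide_right_mono order_trans zero_le_power2)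
qed

text \<open>\<open>r j\<close> indicates that the predictable variation has not exceeded \<open>C\<close> by time \<open>j\<close>; the jump of
  \<open>Y * r\<close> when it drops to \<open>0\<close> is absorbed into \<open>P - Q\<close>.\<close>

lemma truncated_decomposition:
  assumes Y: "\<And>i. i \<le> n \<Longrightarrow> Y i \<in> borel_measurable (G i)" "\<And>i x. i \<le> n \<Longrightarrow> x \<in> space M \<Longrightarrow> \<bar>Y i x\<bar> \<le> K"
    and a: "\<And>i. i < n \<Longrightarrow> a i \<in> borel_measurable (G i)"
    and md: "mart_diff (\<lambda>i x. Y (Suc i) x - Y i x - a i x) n"
    and C: "C \<ge> 0"
  shows "\<exists>r N P Q. (\<forall>j\<le>n. r j \<in> borel_measurable (G j) \<and> N j \<in> borel_measurable (G j) \<and>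
        P j \<in> borel_measurable (G j) \<and> Q j \<in> borel_measurable (G j)) \<and>
      mart_diff (\<lambda>i x. N (Suc i) x - N i x) n \<and>
      (\<forall>x\<in>space M. (\<forall>j\<le>n. Y j x * r j x = N j x + P j x - Q j x \<and> 0 \<le> r j x \<and> r j x \<le> 1 \<and>
          0 \<le> P j x \<and> P j x \<le> C + K \<and> 0 \<le> Q j x \<and> Q j x \<le> C + K \<and> \<bar>N j x\<bar> \<le> 2 * C + 3 * K) \<and>
        (\<forall>i j. i \<le> j \<and> j \<le> n \<longrightarrow> P i x \<le> P j x \<and> Q i x \<le> Q j x \<and> r j x \<le> r i x) \<and>
        ((\<Sum>i<n. \<bar>a i x\<bar>) \<le> C \<longrightarrow> r n x = 1))"
proof -
  define V where "V j x = (\<Sum>i<j. \<bar>a i x\<bar>)" for j x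
  have V_mono: "V i x \<le> V j x" if "i \<le> j" for i j x unfolding V_def using that by (intro sum_mono2) auto
  \<comment> \<open>\<open>V (Suc i)\<close> involves \<open>a 0\<close> to \<open>a i\<close> only
    and is known at time \<open>i\<close>; hence \<open>r (Suc i)\<close> may multiply the
    \<open>i\<close>-th martingale difference.\<close>
  define r where "r j x = (if V j x \<le> C then 1 else 0 :: real)" for j x
  define d where "d i x = Y (Suc i) x - Y i x - a i x" for i x
  define N where "N j x = Y 0 x + (\<Sum>i<j. r (Suc i) x * d i x)" for j x
  \<comment> \<open>The increment of \<open>Y * r\<close> is
    \<open>r (Suc i) * (Y (Suc i) - Y i) - Y i * (r i - r (Suc i))\<close>. The drift and the jump
    term are split into positive and negative parts, collected in \<open>P\<close> and
    \<open>Q\<close>.\<close>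
  define P where "P j x = (\<Sum>i<j. r (Suc i) x * max (a i x) 0 + max (- Y i x) 0 * (r i x - r (Suc i) x))" for j x
  define Q where "Q j x = (\<Sum>i<j. r (Suc i) x * max (- a i x) 0 + max (Y i x) 0 * (r i x - r (Suc i) x))" for j x
  have r01: "0 \<le> r j x" "r j x \<le> 1" for j x by (auto simp: r_def)
  have r_anti: "r j x \<le> r i x" if "i \<le> j" for i j x using V_mono[OF that, of x] by (auto simp: r_def)
  have r0: "r 0 x = 1" for x using C by (simp add: r_def V_def)
  have amj: "a i \<in> borel_measurable (G j)" if "i < n" "i \<le> j" for i j
    using measurable_mono[OF a[OF that(1)] that(2)] .
  have Ymj: "Y i \<in> borel_measurable (G j)" if "i \<le> n" "i \<le> j" for i j
    using measurable_mono[OF Y(1)[OF that(1)] that(2)] .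
  have Vm: "V i \<in> borel_measurable (G j)" if "i \<le> Suc j" "i \<le> n" for i j
    unfolding V_def using that by (intro borel_measurable_sum borel_measurable_abs amj) auto
  have rm: "r i \<in> borel_measurable (G j)" if "i \<le> Suc j" "i \<le> n" for i j
    unfolding r_def using Vm[OF that] by measurable
  have dm: "d i \<in> borel_measurable (G j)" if "i < j" "j \<le> n" for i j
    unfolding d_def using that by (intro borel_measurable_diff amj Ymj) auto
  have Nm: "N j \<in> borel_measurable (G j)" if "j \<le> n" for j
    unfolding N_def using that by (intro borel_measurable_sum borel_measurable_add borel_measurable_times rm dm Ymj) auto
  have Pm: "P j \<in> borel_measurable (G j)" "Q j \<in> borel_measurable (G j)" if "j \<le> n" for j
    unfolding P_def Q_def using that
    by (intro borel_measurable_sum borel_measurable_add borel_measurable_times borel_measurable_diff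
      borel_measurable_max borel_measurable_uminus borel_measurable_const rm amj Ymj; simp)+
  have NPQ: "Y j x * r j x = N j x + P j x - Q j x" if "j \<le> n" for j x
    using that
  proof (induction j)
    case (Suc j)
    have m: "max y 0 - max (- y) 0 = y" for y :: real by auto
    have "P (Suc j) x - Q (Suc j) x = P j x - Q j x + r (Suc j) x * (max (a j x) 0 - max (- a j x) 0)
      - (max (Y j x) 0 - max (- Y j x) 0) * (r j x - r (Suc j) x)"
      by (simp add: P_def Q_def algebra_simps)
    also have "\<dots> = P j x - Q j x + r (Suc j) x * a j x - Y j x * (r j x - r (Suc j) x)" by (simp only: m)
    finally have "N (Suc j) x + P (Suc j) x - Q (Suc j) x = Y j x * r j x + r (Suc j) x * d j x + r (Suc j) x * a j x - Y j x * (r j x - r (Suc j) x)"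
      using Suc by (simp add: N_def)
    then show ?case by (simp add: d_def algebra_simps)
  qed (simp add: N_def P_def Q_def r0)
  \<comment> \<open>No overshoot: the step that carries \<open>V\<close> above \<open>C\<close>
    already has weight \<open>r (Suc i) = 0\<close>.\<close>
  have Va: "(\<Sum>i<j. r (Suc i) x * \<bar>a i x\<bar>) \<le> C" for j x
  proof (induction j)
    case (Suc j)
    show ?case
    proof (cases "V (Suc j) x \<le> C")
      case True
      have "(\<Sum>i<Suc j. r (Suc i) x * \<bar>a i x\<bar>) \<le> V (Suc j) x"
        unfolding V_def using mult_right_mono[OF r01(2)] by (intro sum_mono) force
      then show ?thesis using True by simp
    next
      case False
      then show ?thesis using Suc by (simp add: r_def)
    qed
  qed (use C in simp)
  have YK: "max (- Y i x) 0 \<le> K" "max (Y i x) 0 \<le> K" if "i \<le> n" "x \<in> space M" for i x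
    using Y(2)[OF that] by (auto simp: abs_le_iff)
  have tel: "(\<Sum>i<j. K * (r i x - r (Suc i) x)) \<le> K" if "x \<in> space M" for j x
  proof -
    have "(\<Sum>i<j. K * (r i x - r (Suc i) x)) = K * (r 0 x - r j x)"
      unfolding sum_distrib_left[symmetric] sum_lessThan_telescope'[of "\<lambda>i. r i x"] ..
    also have "\<dots> \<le> K * 1" using YK(1)[of 0 x] that r01[of j x] r0 by (intro mult_left_mono) auto
    finally show ?thesis by simp
  qed
  have PQ_le: "P j x \<le> C + K" "Q j x \<le> C + K" if "j \<le> n" "x \<in> space M" for j x
  proof -
    have "P j x \<le> (\<Sum>i<j. r (Suc i) x * \<bar>a i x\<bar> + K * (r i x - r (Suc i) x))"
      unfolding P_def using that r01 r_anti YK by (intro sum_mono add_mono mult_left_mono mult_right_mono) auto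
    then show "P j x \<le> C + K" using Va[of x j] tel[OF that(2), of j] by (simp add: sum.distrib)
    have "Q j x \<le> (\<Sum>i<j. r (Suc i) x * \<bar>a i x\<bar> + K * (r i x - r (Suc i) x))"
      unfolding Q_def using that r01 r_anti YK by (intro sum_mono add_mono mult_left_mono mult_right_mono) auto
    then show "Q j x \<le> C + K" using Va[of x j] tel[OF that(2), of j] by (simp add: sum.distrib)
  qed
  have term_nn: "0 \<le> r (Suc i) x * max (a i x) 0 + max (- Y i x) 0 * (r i x - r (Suc i) x)"
    "0 \<le> r (Suc i) x * max (- a i x) 0 + max (Y i x) 0 * (r i x - r (Suc i) x)" for i x
    using r01 r_anti by (auto intro!: add_nonneg_nonneg mult_nonneg_nonneg)
  have PQ_mono: "P i x \<le> P j x" "Q i x \<le> Q j x" if "i \<le> j" for i j x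
    unfolding P_def Q_def using that by (intro sum_mono2 term_nn; auto)+
  have PQ0: "0 \<le> P j x" "0 \<le> Q j x" for j x unfolding P_def Q_def by (intro sum_nonneg term_nn)+
  \<comment> \<open>\<open>N = Y * r - P + Q\<close>, with bounds \<open>K\<close>,
    \<open>C + K\<close> and \<open>C + K\<close>.\<close>
  have NK: "\<bar>N j x\<bar> \<le> 2 * C + 3 * K" if "j \<le> n" "x \<in> space M" for j x
  proof -
    have "\<bar>Y j x * r j x\<bar> \<le> K * 1" unfolding abs_mult using Y(2)[OF that] r01[of j x] by (intro mult_mono) auto
    then show ?thesis using NPQ[OF that(1), of x] PQ_le[OF that] PQ0[of j x] Y(2)[OF that] C by (auto simp: abs_le_iff)
  qed
  have "mart_diff (\<lambda>i x. r (Suc i) x * d i x) n"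
    unfolding d_def
    by (rule mart_diff_mult[OF md]) (use rm r01 in \<open>auto intro!: bmeasI[where c = 1] simp: Suc_le_eq\<close>)
  then have N_mart: "mart_diff (\<lambda>i x. N (Suc i) x - N i x) n" by (simp add: N_def)
  have r_n: "r n x = 1" if "(\<Sum>i<n. \<bar>a i x\<bar>) \<le> C" for x using that by (simp add: r_def V_def)
  have r_m: "r j \<in> borel_measurable (G j)" if "j \<le> n" for j using rm[of j j] that by simp
  show ?thesis
    by (intro exI[of _ r] exI[of _ N] exI[of _ P] exI[of _ Q] conjI allI ballI impI)
      ((elim conjE)?, (rule r_m r_n N_mart Nm Pm NPQ r01 PQ_le PQ0 PQ_mono r_anti NK; assumption))+
qed

end

subsection \<open>Filtered probability spaces on a time horizon\<close>

locale horizon = usual_filtered_prob_space M F T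
  for M :: "'a measure" and F :: "real \<Rightarrow> 'a measure" and T :: real +
  assumes T_pos: "T > 0"
begin

abbreviation "FF \<equiv> on_horizon T F"

lemma FF_eq: "t \<in> {0..T} \<Longrightarrow> FF t = F t"
  by (simp add: on_horizon_def)

lemma sub_FF: "subalgebra M (FF t)"
  using T_pos unfolding on_horizon_def by (intro subalgebra_F) auto

lemma space_FF: "space (FF t) = space M"
  using sub_FF by (simp add: subalgebra_def)

lemma sets_FF_mono: "s \<le> t \<Longrightarrow> sets (FF s) \<subseteq> sets (FF t)"
  by (rule sets_F_mono)

lemma FF_measurable_mono: "f \<in> borel_measurable (FF s) \<Longrightarrow> s \<le> t \<Longrightarrow> f \<in> borel_measurable (FF t)"
  using sets_FF_mono[of s t] by (auto simp: measurable_def space_FF)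

lemma FF_measurable_M: "f \<in> borel_measurable (FF s) \<Longrightarrow> f \<in> borel_measurable M"
  by (rule measurable_from_subalg[OF sub_FF])

lemma sets_FF_M: "A \<in> sets (FF s) \<Longrightarrow> A \<in> sets M"
  using sub_FF by (auto simp: subalgebra_def)

lemma null_sets_FF: "A \<in> null_sets M \<Longrightarrow> A \<in> sets (FF t)"
proof -
  assume "A \<in> null_sets M"
  then have "A \<in> sets (FF 0)" using null_sets_F0 T_pos by (auto simp: FF_eq)
  then show ?thesis using sets_FF_mono[of 0 t] by (cases "0 \<le> t") (auto simp: on_horizon_def)
qed

lemma sets_FF_right:
  assumes "t < T" and A: "\<And>u. t < u \<Longrightarrow> u \<le> T \<Longrightarrow> 0 < u \<Longrightarrow> A \<in> sets (FF u)"
  shows "A \<in> sets (FF t)"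
proof -
  \<comment> \<open>Below time 0 the extended family is constantly \<open>F 0\<close>, so
    right-continuity is used at \<open>max 0 t\<close>.\<close>
  let ?t = "max 0 t"
  have t: "?t \<in> {0..<T}" using assms(1) T_pos by auto
  have "A \<in> sets (F u)" if "u \<in> {?t<..T}" for u
    using A[of u] that by (auto simp: FF_eq)
  then have "A \<in> sets (F ?t)" using right_continuous_F[OF t] by auto
  moreover have "FF t = F ?t" using assms(1) T_pos by (simp add: on_horizon_def min_def)
  ultimately show ?thesis by simp
qed

lemma measurable_FF_right:
  fixes f :: "'a \<Rightarrow> real"
  assumes "t < T" and f: "\<And>u. t < u \<Longrightarrow> u \<le> T \<Longrightarrow> 0 < u \<Longrightarrow> f \<in> borel_measurable (FF u)"
  shows "f \<in> borel_measurable (FF t)"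
proof (rule measurableI)
  fix A :: "real set" assume A: "A \<in> sets borel"
  show "f -` A \<inter> space (FF t) \<in> sets (FF t)"
  proof (rule sets_FF_right[OF assms(1)])
    fix u assume "t < u" "u \<le> T" "0 < u"
    from measurable_sets[OF f[OF this] A] show "f -` A \<inter> space (FF t) \<in> sets (FF u)" by (simp add: space_FF)
  qed
qed simp

text \<open>By right-continuity of the filtration strict inequalities suffice: the event at level
  \<open>t\<close> is an intersection of strict events at levels just above \<open>t\<close>. Times
  defined as infima over dyadic times are described directly by strict inequalities.\<close>

lemma stopping_time_uptoI:
  assumes r: "\<And>\<omega>. \<omega> \<in> space M \<Longrightarrow> \<tau> \<omega> \<in> {0..T}"
    and less: "\<And>u. 0 < u \<Longrightarrow> u \<le> T \<Longrightarrow> {\<omega>\<in>space M. \<tau> \<omega> < u} \<in> sets (FF u)"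
  shows "stopping_time_upto M F T \<tau>"
  unfolding stopping_time_upto_def
proof (intro conjI ballI r stopping_timeI)
  fix t
  have "{\<omega>\<in>space M. \<tau> \<omega> \<le> t} \<in> sets (FF t)"
  proof (cases "t < T")
    case True
    show ?thesis
    proof (rule sets_FF_right[OF True])
      fix u assume u: "t < u" "u \<le> T" "0 < u"
      show "{\<omega>\<in>space M. \<tau> \<omega> \<le> t} \<in> sets (FF u)"
      proof (cases "t < 0")
        case True
        then have "{\<omega>\<in>space M. \<tau> \<omega> \<le> t} = {}" using r by fastforce
        then show ?thesis by (simp only: sets.empty_sets)
      next
        case False
        define w where "w k = t + (u - t) / real (Suc k)" for k
        have w: "t < w k" "w k \<le> u" for k
        proof -
          have "(u - t) / real (Suc k) \<le> (u - t) / 1" using u by (intro divide_left_mono) auto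
          then show "t < w k" "w k \<le> u" unfolding w_def using u by auto
        qed
        have lim: "w \<longlonglongrightarrow> t"
        proof -
          have "(\<lambda>k. t + (u - t) * (1 / real (Suc k))) \<longlonglongrightarrow> t + (u - t) * 0"
            by (intro tendsto_intros LIMSEQ_inverse_real_of_nat[unfolded inverse_eq_divide])
          then show ?thesis unfolding w_def by simp
        qed
        have "{\<omega>\<in>space M. \<tau> \<omega> \<le> t} = (\<Inter>k. {\<omega>\<in>space M. \<tau> \<omega> < w k})"
        proof safe
          fix \<omega> k assume "\<tau> \<omega> \<le> t" then show "\<tau> \<omega> < w k" using w(1)[of k] by simp
        next
          fix \<omega> assume \<omega>: "\<omega> \<in> (\<Inter>k. {\<omega>\<in>space M. \<tau> \<omega> < w k})"
          then have "\<tau> \<omega> \<le> w k" for k by (auto intro: less_imp_le)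
          then show "\<tau> \<omega> \<le> t" by (intro LIMSEQ_le_const[OF lim]) auto
        qed auto
        also have "\<dots> \<in> sets (FF u)"
        proof (intro sets.countable_INT)
          have "{\<omega>\<in>space M. \<tau> \<omega> < w k} \<in> sets (FF u)" for k
          proof -
            have "{\<omega>\<in>space M. \<tau> \<omega> < w k} \<in> sets (FF (w k))"
              using w[of k] u False by (intro less) auto
            then show ?thesis using sets_FF_mono[OF w(2)] by blast
          qed
          then show "range (\<lambda>k. {\<omega>\<in>space M. \<tau> \<omega> < w k}) \<subseteq> sets (FF u)" by blast
        qed auto
        finally show ?thesis .
      qed
    qed
  next
    case False
    then have "{\<omega>\<in>space M. \<tau> \<omega> \<le> t} = space (FF t)" using r by (fastforce simp: space_FF)
    then show ?thesis by (simp only: sets.top)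
  qed
  then show "Measurable.pred (FF t) (\<lambda>\<omega>. \<tau> \<omega> \<le> t)" by (simp add: pred_def space_FF)
qed

lemma stopping_time_uptoD:
  assumes "stopping_time_upto M F T \<tau>"
  shows "\<omega> \<in> space M \<Longrightarrow> 0 \<le> \<tau> \<omega>" "\<omega> \<in> space M \<Longrightarrow> \<tau> \<omega> \<le> T"
    "{\<omega>\<in>space M. \<tau> \<omega> \<le> t} \<in> sets (FF t)" "{\<omega>\<in>space M. \<tau> \<omega> < t} \<in> sets (FF t)"
    "\<tau> \<in> borel_measurable M"
proof -
  have st: "stopping_time FF \<tau>" and r: "\<And>\<omega>. \<omega> \<in> space M \<Longrightarrow> \<tau> \<omega> \<in> {0..T}"
    using assms by (auto simp: stopping_time_upto_def)
  show "\<omega> \<in> space M \<Longrightarrow> 0 \<le> \<tau> \<omega>" "\<omega> \<in> space M \<Longrightarrow> \<tau> \<omega> \<le> T" using r[of \<omega>] by auto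
  show "{\<omega>\<in>space M. \<tau> \<omega> \<le> t} \<in> sets (FF t)"
    using stopping_timeD[OF st, of t] by (simp add: pred_def space_FF)
  show "{\<omega>\<in>space M. \<tau> \<omega> < t} \<in> sets (FF t)"
    using stopping_time_less_const[OF st, of t] by (simp add: pred_def space_FF)
  show "\<tau> \<in> borel_measurable M"
    using sub_FF by (intro measurable_stopping_time[OF st]) (auto simp: subalgebra_def space_FF)
qed

subsection \<open>Dyadic grids\<close>

definition grid :: "nat \<Rightarrow> nat \<Rightarrow> real" where
  "grid n i = T * real i / 2 ^ n"

definition grid_points :: "nat \<Rightarrow> real set" where
  "grid_points n = grid n ` {..2 ^ n}"

definition dyadics :: "real set" where
  "dyadics = (\<Union>n. grid_points n)"

lemma grid_0 [simp]: "grid n 0 = 0" and grid_end [simp]: "grid n (2 ^ n) = T"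
  by (auto simp: grid_def)

lemma grid_less: "i < j \<Longrightarrow> grid n i < grid n j"
  using T_pos by (simp add: grid_def divide_strict_right_mono)

lemma grid_le: "i \<le> j \<Longrightarrow> grid n i \<le> grid n j"
  using T_pos by (simp add: grid_def divide_right_mono)

lemma grid_le_iff [simp]: "grid n i \<le> grid n j \<longleftrightarrow> i \<le> j"
  using grid_le grid_less by (meson leD leI)

lemma grid_nonneg: "0 \<le> grid n i"
  using T_pos by (simp add: grid_def)

lemma grid_le_T: "i \<le> 2 ^ n \<Longrightarrow> grid n i \<le> T"
  using grid_le[of i "2 ^ n" n] by simp

lemma grid_in: "i \<le> 2 ^ n \<Longrightarrow> grid n i \<in> {0..T}"
  using grid_nonneg grid_le_T by simp

lemma grid_step: "grid n (Suc i) = grid n i + T / 2 ^ n"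
  by (simp add: grid_def field_simps)

lemma grid_points_mono: "m \<le> n \<Longrightarrow> grid_points m \<subseteq> grid_points n"
proof
  fix t assume mn: "m \<le> n" and "t \<in> grid_points m"
  then obtain i where i: "i \<le> 2 ^ m" "t = grid m i" by (auto simp: grid_points_def)
  have "(2::nat) ^ n = 2 ^ m * 2 ^ (n - m)" using mn by (simp add: power_add[symmetric])
  then have "i * 2 ^ (n - m) \<le> 2 ^ n" using i by simp
  moreover have "(2::real) ^ n = 2 ^ m * 2 ^ (n - m)" using mn by (simp add: power_add[symmetric])
  then have "t = grid n (i * 2 ^ (n - m))" using i by (simp add: grid_def)
  ultimately show "t \<in> grid_points n" by (auto simp: grid_points_def)
qed

lemma grid_points_in: "t \<in> grid_points n \<Longrightarrow> t \<in> {0..T}"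
  using grid_in by (auto simp: grid_points_def)

lemma dyadics_in: "t \<in> dyadics \<Longrightarrow> 0 \<le> t" "t \<in> dyadics \<Longrightarrow> t \<le> T"
  using grid_points_in by (auto simp: dyadics_def)

lemma countable_dyadics: "countable dyadics"
  unfolding dyadics_def grid_points_def by (intro countable_UN countable_image) auto

lemma T_grid_points: "T \<in> grid_points n"
  unfolding grid_points_def by (intro image_eqI[of _ _ "2 ^ n"]) auto

lemma T_dyadics: "T \<in> dyadics"
  using T_grid_points by (auto simp: dyadics_def)

text \<open>Index of the last grid point up to \<open>t\<close>. Clipping to \<open>[0,T]\<close>
  keeps it at most \<open>2 ^ n\<close> for every real \<open>t\<close>, so sequences along a grid
  extend to processes on all of the reals.\<close>

definition grid_index :: "nat \<Rightarrow> real \<Rightarrow> nat" where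
  "grid_index n t = nat \<lfloor>max 0 (min T t) * 2 ^ n / T\<rfloor>"

lemma grid_index:
  shows grid_index_le: "grid_index n t \<le> 2 ^ n" and grid_index_lower: "grid n (grid_index n t) \<le> max 0 (min T t)"
    and grid_index_upper: "max 0 (min T t) < grid n (Suc (grid_index n t))"
    and grid_index_grid: "i \<le> 2 ^ n \<Longrightarrow> grid_index n (grid n i) = i"
    and grid_index_mono: "s \<le> t \<Longrightarrow> grid_index n s \<le> grid_index n t"
proof -
  let ?t = "max 0 (min T t)"
  have t: "0 \<le> ?t" "?t \<le> T" using T_pos by auto
  let ?x = "?t * 2 ^ n / T"
  have x: "0 \<le> ?x" "?x \<le> 2 ^ n" using t T_pos by (auto simp: divide_le_eq)
  have i: "real (grid_index n t) = of_int \<lfloor>?x\<rfloor>" unfolding grid_index_def using x(1) by simp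
  have "real (grid_index n t) \<le> 2 ^ n" using i x(2) of_int_floor_le[of ?x] by linarith
  then show "grid_index n t \<le> 2 ^ n" by (simp flip: of_nat_le_iff)
  have "real (grid_index n t) \<le> ?x" "?x < real (grid_index n t) + 1" using i by linarith+
  then have "T * real (grid_index n t) \<le> ?t * 2 ^ n" "?t * 2 ^ n < T * real (Suc (grid_index n t))"
    using T_pos by (simp_all add: pos_le_divide_eq pos_divide_less_eq mult.commute add.commute)
  then show "grid n (grid_index n t) \<le> ?t" "?t < grid n (Suc (grid_index n t))"
    unfolding grid_def by (simp_all only: pos_divide_le_eq pos_less_divide_eq zero_less_power zero_less_numeral)
  show "grid_index n (grid n i) = i" if "i \<le> 2 ^ n"
  proof -
    have "max 0 (min T (grid n i)) = grid n i" using grid_in[OF that] by simp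
    then show ?thesis using T_pos by (simp add: grid_index_def grid_def)
  qed
  show "grid_index n s \<le> grid_index n t" if "s \<le> t"
    unfolding grid_index_def using T_pos that by (intro nat_mono floor_mono divide_right_mono mult_right_mono) auto
qed

lemma dyadic_between:
  assumes "0 \<le> s" "s < t" "t \<le> T" shows "\<exists>u\<in>dyadics. s < u \<and> u < t"
proof -
  have "(\<lambda>n. T / 2 ^ n) \<longlonglongrightarrow> 0" by (intro LIMSEQ_divide_realpow_zero) auto
  then have "\<forall>\<^sub>F n in sequentially. T / 2 ^ n < t - s" using assms by (intro order_tendstoD) auto
  then obtain n where n: "T / 2 ^ n < t - s" by (auto simp: eventually_sequentially)
  let ?u = "grid n (Suc (grid_index n s))"
  have u: "s < ?u" "?u < t"
    using grid_index_upper[of s n] grid_index_lower[of n s] assms n by (auto simp: grid_step max_def min_def split: if_splits)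
  then have "?u < grid n (2 ^ n)" using assms by simp
  then have "Suc (grid_index n s) \<le> 2 ^ n" by (metis grid_le_iff less_imp_le)
  then have "?u \<in> dyadics" by (auto simp: dyadics_def grid_points_def)
  then show ?thesis using u by blast
qed

lemma FF_discrete_filtration: "discrete_filtration M (\<lambda>i. FF (grid n i))"
  by unfold_locales (use sub_FF sets_FF_mono grid_le in auto)

subsection \<open>Limits of decompositions\<close>

text \<open>The decreasing process \<open>r\<close> is a weak limit of the indicators that the predictable variation is
  still small. Unlike stopping times these survive the passage to the limit, at the price of damping \<open>W\<close>.\<close>

definition damped_decomposition ::
  "real set \<Rightarrow> (real \<Rightarrow> 'a \<Rightarrow> real) \<Rightarrow> real \<Rightarrow> real \<Rightarrow> (real \<Rightarrow> 'a \<Rightarrow> real) \<Rightarrow> (real \<Rightarrow> 'a \<Rightarrow> real) \<Rightarrow>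
    (real \<Rightarrow> 'a \<Rightarrow> real) \<Rightarrow> (real \<Rightarrow> 'a \<Rightarrow> real) \<Rightarrow> bool" where
  "damped_decomposition D W c \<epsilon> r N P Q \<longleftrightarrow>
     (\<forall>t. r t \<in> borel_measurable (FF t) \<and> N t \<in> borel_measurable (FF t) \<and>
        P t \<in> borel_measurable (FF t) \<and> Q t \<in> borel_measurable (FF t)) \<and>
     (\<forall>t. \<forall>\<omega>\<in>space M. 0 \<le> r t \<omega> \<and> r t \<omega> \<le> 1 \<and> \<bar>N t \<omega>\<bar> \<le> c \<and>
        0 \<le> P t \<omega> \<and> P t \<omega> \<le> c \<and> 0 \<le> Q t \<omega> \<and> Q t \<omega> \<le> c) \<and>
     (\<forall>s t. s \<le> t \<longrightarrow> (AE \<omega> in M. P s \<omega> \<le> P t \<omega> \<and> Q s \<omega> \<le> Q t \<omega> \<and> r t \<omega> \<le> r s \<omega>)) \<and>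
     (\<forall>s\<in>D. \<forall>t\<in>D. s \<le> t \<longrightarrow> (\<forall>A\<in>sets (FF s).
        expectation (\<lambda>\<omega>. indicator A \<omega> * N t \<omega>) = expectation (\<lambda>\<omega>. indicator A \<omega> * N s \<omega>))) \<and>
     (\<forall>t\<in>D. AE \<omega> in M. W t \<omega> * r t \<omega> = N t \<omega> + P t \<omega> - Q t \<omega>) \<and>
     1 - \<epsilon> \<le> expectation (r T)"

section \<open>Weak-star convergence of bounded random variables along a filter\<close>

definition weakly_tendsto :: "nat filter \<Rightarrow> (nat \<Rightarrow> 'a \<Rightarrow> real) \<Rightarrow> ('a \<Rightarrow> real) \<Rightarrow> bool" where
  "weakly_tendsto \<FF> X x \<longleftrightarrow> (\<forall>m. X m \<in> bmeas M) \<and> x \<in> bmeas M \<and>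
     (\<forall>f. integrable M f \<longrightarrow>
        ((\<lambda>m. expectation (\<lambda>\<omega>. f \<omega> * X m \<omega>)) \<longlongrightarrow> expectation (\<lambda>\<omega>. f \<omega> * x \<omega>)) \<FF>)"

lemma weakly_tendsto_const: "x \<in> bmeas M \<Longrightarrow> weakly_tendsto \<FF> (\<lambda>_. x) x"
  by (simp add: weakly_tendsto_def)

lemma weakly_tendsto_add:
  assumes "weakly_tendsto \<FF> X x" "weakly_tendsto \<FF> Y y"
  shows "weakly_tendsto \<FF> (\<lambda>m \<omega>. X m \<omega> + Y m \<omega>) (\<lambda>\<omega>. x \<omega> + y \<omega>)"
  unfolding weakly_tendsto_def
proof (intro conjI allI impI bmeas_add)
  fix f :: "'a \<Rightarrow> real" assume f: "integrable M f"
  have b: "X m \<in> bmeas M" "Y m \<in> bmeas M" "x \<in> bmeas M" "y \<in> bmeas M" for m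
    using assms by (auto simp: weakly_tendsto_def)
  have "expectation (\<lambda>\<omega>. f \<omega> * (u \<omega> + v \<omega>)) = expectation (\<lambda>\<omega>. f \<omega> * u \<omega>) + expectation (\<lambda>\<omega>. f \<omega> * v \<omega>)"
    if "u \<in> bmeas M" "v \<in> bmeas M" for u v
    using integrable_bmeas_mult[OF that(1) f] integrable_bmeas_mult[OF that(2) f]
    by (simp add: distrib_left mult.commute[of "f _"])
  then show "((\<lambda>m. expectation (\<lambda>\<omega>. f \<omega> * (X m \<omega> + Y m \<omega>))) \<longlongrightarrow> expectation (\<lambda>\<omega>. f \<omega> * (x \<omega> + y \<omega>))) \<FF>"
    using assms f b by (auto simp: weakly_tendsto_def intro!: tendsto_add)
qed (use assms in \<open>auto simp: weakly_tendsto_def\<close>)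

text \<open>The bounded factor moves into the test function. It is the same for all
  \<open>m\<close>: weak limits do not in general respect products of two varying factors.\<close>

lemma weakly_tendsto_mult:
  assumes "weakly_tendsto \<FF> X x" and w: "w \<in> bmeas M"
  shows "weakly_tendsto \<FF> (\<lambda>m \<omega>. w \<omega> * X m \<omega>) (\<lambda>\<omega>. w \<omega> * x \<omega>)"
  unfolding weakly_tendsto_def
proof (intro conjI allI impI bmeas_mult w)
  fix f :: "'a \<Rightarrow> real" assume f: "integrable M f"
  then have "integrable M (\<lambda>\<omega>. w \<omega> * f \<omega>)" by (rule integrable_bmeas_mult[OF w])
  then have "((\<lambda>m. expectation (\<lambda>\<omega>. (w \<omega> * f \<omega>) * X m \<omega>)) \<longlongrightarrow> expectation (\<lambda>\<omega>. (w \<omega> * f \<omega>) * x \<omega>)) \<FF>"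
    using assms(1) by (simp add: weakly_tendsto_def)
  then show "((\<lambda>m. expectation (\<lambda>\<omega>. f \<omega> * (w \<omega> * X m \<omega>))) \<longlongrightarrow> expectation (\<lambda>\<omega>. f \<omega> * (w \<omega> * x \<omega>))) \<FF>"
    by (simp add: mult_ac)
qed (use assms in \<open>auto simp: weakly_tendsto_def\<close>)

lemma weakly_tendsto_le:
  assumes F: "\<FF> \<noteq> bot" and X: "weakly_tendsto \<FF> X x" and Y: "weakly_tendsto \<FF> Y y"
    and le: "\<forall>\<^sub>F m in \<FF>. AE \<omega> in M. X m \<omega> \<le> Y m \<omega>"
  shows "AE \<omega> in M. x \<omega> \<le> y \<omega>"
proof (rule AE_le_of_integrals)
  have b: "X m \<in> bmeas M" "Y m \<in> bmeas M" "x \<in> bmeas M" "y \<in> bmeas M" for m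
    using X Y by (auto simp: weakly_tendsto_def)
  show "integrable M x" "integrable M y" using b by (auto intro: bmeas_integrable)
  fix A assume A: "A \<in> sets M"
  note bA = bmeas_indicator[OF A]
  show "expectation (\<lambda>\<omega>. indicator A \<omega> * x \<omega>) \<le> expectation (\<lambda>\<omega>. indicator A \<omega> * y \<omega>)"
  proof (rule tendsto_le[OF F])
    show "((\<lambda>m. expectation (\<lambda>\<omega>. indicator A \<omega> * X m \<omega>)) \<longlongrightarrow> expectation (\<lambda>\<omega>. indicator A \<omega> * x \<omega>)) \<FF>"
      "((\<lambda>m. expectation (\<lambda>\<omega>. indicator A \<omega> * Y m \<omega>)) \<longlongrightarrow> expectation (\<lambda>\<omega>. indicator A \<omega> * y \<omega>)) \<FF>"
      using X Y bmeas_integrable[OF bA] by (auto simp: weakly_tendsto_def)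
    show "\<forall>\<^sub>F m in \<FF>. expectation (\<lambda>\<omega>. indicator A \<omega> * X m \<omega>) \<le> expectation (\<lambda>\<omega>. indicator A \<omega> * Y m \<omega>)"
      using le
    proof eventually_elim
      case (elim m)
      show ?case
      proof (rule integral_mono_AE)
        show "integrable M (\<lambda>\<omega>. indicator A \<omega> * X m \<omega>)" "integrable M (\<lambda>\<omega>. indicator A \<omega> * Y m \<omega>)"
          by (intro bmeas_integrable bmeas_mult bA b)+
        show "AE \<omega> in M. indicator A \<omega> * X m \<omega> \<le> indicator A \<omega> * Y m \<omega>"
          using elim by eventually_elim (auto simp: indicator_def)
      qed
    qed
  qed
qed

lemma weakly_tendsto_eq:
  assumes F: "\<FF> \<noteq> bot" and X: "weakly_tendsto \<FF> X x" and Y: "weakly_tendsto \<FF> Y y"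
    and eq: "\<forall>\<^sub>F m in \<FF>. AE \<omega> in M. X m \<omega> = Y m \<omega>"
  shows "AE \<omega> in M. x \<omega> = y \<omega>"
proof -
  have "AE \<omega> in M. x \<omega> \<le> y \<omega>" 
    by (rule weakly_tendsto_le[OF F X Y]) (use eq in eventually_elim, auto elim: eventually_mono)
  moreover have "AE \<omega> in M. y \<omega> \<le> x \<omega>"
    by (rule weakly_tendsto_le[OF F Y X]) (use eq in eventually_elim, auto elim: eventually_mono)
  ultimately show ?thesis by eventually_elim simp
qed

lemma weakly_tendsto_cong_AE:
  assumes "weakly_tendsto \<FF> X x" "y \<in> bmeas M" "AE \<omega> in M. x \<omega> = y \<omega>"
  shows "weakly_tendsto \<FF> X y"
proof -
  have "expectation (\<lambda>\<omega>. f \<omega> * x \<omega>) = expectation (\<lambda>\<omega>. f \<omega> * y \<omega>)" if "integrable M f" for f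
    by (rule integral_cong_AE)
      (use assms that in \<open>auto simp: weakly_tendsto_def intro!: borel_measurable_times dest: bmeas_measurable\<close>)
  then show ?thesis using assms by (simp add: weakly_tendsto_def)
qed

text \<open>Each defining condition is linear in \<open>r\<close>, \<open>N\<close>,
  \<open>P\<close> and \<open>Q\<close> once \<open>W\<close> is fixed, including the product of
  \<open>W t\<close> with \<open>r t\<close>, and so passes to the weak limit. Conditions tied to
  grid points hold eventually at every dyadic time because the grids are nested.\<close>

lemma damped_decomposition_limit:
  assumes W: "\<And>t. t \<in> dyadics \<Longrightarrow> W t \<in> bmeas M" and c: "c \<ge> 0"
    and d: "\<And>m. damped_decomposition (grid_points m) W c \<epsilon> (r m) (N m) (P m) (Q m)"
  shows "\<exists>r N P Q. damped_decomposition dyadics W c \<epsilon> r N P Q"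
proof -
  note d' = d[unfolded damped_decomposition_def]
  \<comment> \<open>One family indexed by a tag and a time, so that the four processes converge
    along the same filter at all times.\<close>
  define X where "X m q = (if fst q = (0::nat) then r m (snd q) else if fst q = 1 then N m (snd q)
    else if fst q = 2 then P m (snd q) else Q m (snd q))" for m q
  have "\<exists>\<FF> x. \<FF> \<noteq> bot \<and> \<FF> \<le> sequentially \<and> (\<forall>i. x i \<in> borel_measurable (FF (snd i))) \<and>
    (\<forall>i. \<forall>\<omega>\<in>space M. \<bar>x i \<omega>\<bar> \<le> max c 1) \<and>
    (\<forall>i f. integrable M f \<longrightarrow>
      ((\<lambda>m. expectation (\<lambda>\<omega>. f \<omega> * X m i \<omega>)) \<longlongrightarrow> expectation (\<lambda>\<omega>. f \<omega> * x i \<omega>)) \<FF>)"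
  proof (rule weak_limit_exists)
    show "X m i \<in> borel_measurable (FF (snd i))" for m i using d'[of m] by (simp add: X_def)
    show "\<bar>X m i \<omega>\<bar> \<le> max c 1" if "\<omega> \<in> space M" for m i \<omega>
    proof -
      have "0 \<le> r m t \<omega> \<and> r m t \<omega> \<le> 1 \<and> \<bar>N m t \<omega>\<bar> \<le> c \<and>
        0 \<le> P m t \<omega> \<and> P m t \<omega> \<le> c \<and> 0 \<le> Q m t \<omega> \<and> Q m t \<omega> \<le> c" for t using d'[of m] that by blast
      from this[of "snd i"] show ?thesis by (auto simp: X_def)
    qed
  qed (rule sub_FF)
  then obtain \<FF> x where F: "\<FF> \<noteq> bot" "\<FF> \<le> sequentially" and x: "\<And>i. x i \<in> borel_measurable (FF (snd i))"
    "\<And>i \<omega>. \<omega> \<in> space M \<Longrightarrow> \<bar>x i \<omega>\<bar> \<le> max c 1"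
    and lim: "\<And>i f. integrable M f \<Longrightarrow>
      ((\<lambda>m. expectation (\<lambda>\<omega>. f \<omega> * X m i \<omega>)) \<longlongrightarrow> expectation (\<lambda>\<omega>. f \<omega> * x i \<omega>)) \<FF>" by blast
  have bx: "x i \<in> bmeas M" for i using FF_measurable_M[OF x(1)] x(2) by (rule bmeasI)
  have bnd: "0 \<le> r m t \<omega>" "r m t \<omega> \<le> 1" "\<bar>N m t \<omega>\<bar> \<le> c" "0 \<le> P m t \<omega>" "P m t \<omega> \<le> c" "0 \<le> Q m t \<omega>" "Q m t \<omega> \<le> c"
    if "\<omega> \<in> space M" for m t \<omega>
    using d'[of m, THEN conjunct2, THEN conjunct1, rule_format, OF that, of t] by simp_all
  have meas: "r m t \<in> borel_measurable M" "N m t \<in> borel_measurable M" "P m t \<in> borel_measurable M" "Q m t \<in> borel_measurable M" for m t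
    using d'[of m, THEN conjunct1, rule_format, of t] by (auto dest: FF_measurable_M)
  have b: "r m t \<in> bmeas M" "N m t \<in> bmeas M" "P m t \<in> bmeas M" "Q m t \<in> bmeas M" for m t
    by (rule bmeasI[OF meas(1), where c = 1], use bnd in simp)
      (rule bmeasI[OF meas(2), where c = c] bmeasI[OF meas(3), where c = c] bmeasI[OF meas(4), where c = c], use bnd in simp)+
  have "weakly_tendsto \<FF> (\<lambda>m. X m i) (x i)" for i
    unfolding weakly_tendsto_def
  proof (intro conjI allI impI lim bx)
    show "X m i \<in> bmeas M" for m using b[of m "snd i"] by (simp add: X_def)
  qed
  from this[of "(0, t)" for t] this[of "(1, t)" for t] this[of "(2, t)" for t] this[of "(3, t)" for t]
  have w: "weakly_tendsto \<FF> (\<lambda>m. r m t) (x (0, t))" "weakly_tendsto \<FF> (\<lambda>m. N m t) (x (1, t))"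
    "weakly_tendsto \<FF> (\<lambda>m. P m t) (x (2, t))" "weakly_tendsto \<FF> (\<lambda>m. Q m t) (x (3, t))" for t
    by (simp_all add: X_def)
  \<comment> \<open>Weak limits respect the bounds almost everywhere; clipping makes them hold
    everywhere and changes the limits only on null sets.\<close>
  define clip where "clip l u y = max l (min u y)" for l u y :: real
  define r' where "r' t \<omega> = clip 0 1 (x (0, t) \<omega>)" for t \<omega>
  define N' where "N' t \<omega> = clip (- c) c (x (1, t) \<omega>)" for t \<omega>
  define P' where "P' t \<omega> = clip 0 c (x (2, t) \<omega>)" for t \<omega>
  define Q' where "Q' t \<omega> = clip 0 c (x (3, t) \<omega>)" for t \<omega>
  have clip_AE: "AE \<omega> in M. y \<omega> = clip l u (y \<omega>)"
    if Y: "weakly_tendsto \<FF> Y y" and l: "\<And>m \<omega>. \<omega> \<in> space M \<Longrightarrow> l \<le> Y m \<omega>" and u: "\<And>m \<omega>. \<omega> \<in> space M \<Longrightarrow> Y m \<omega> \<le> u" for Y y l u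
  proof -
    have "AE \<omega> in M. l \<le> y \<omega>"
      by (rule weakly_tendsto_le[OF F(1) weakly_tendsto_const Y]) (auto simp: l)
    moreover have "AE \<omega> in M. y \<omega> \<le> u"
      by (rule weakly_tendsto_le[OF F(1) Y weakly_tendsto_const]) (auto simp: u)
    ultimately show ?thesis by eventually_elim (auto simp: clip_def)
  qed
  have clip_meas: "(\<lambda>\<omega>. clip l u (y \<omega>)) \<in> borel_measurable G" if "y \<in> borel_measurable G" for l u y and G :: "'a measure"
    unfolding clip_def using that by measurable
  have m': "r' t \<in> borel_measurable (FF t)" "N' t \<in> borel_measurable (FF t)" "P' t \<in> borel_measurable (FF t)" "Q' t \<in> borel_measurable (FF t)" for t
    using x(1)[of "(0, t)"] x(1)[of "(1, t)"] x(1)[of "(2, t)"] x(1)[of "(3, t)"]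
    unfolding r'_def N'_def P'_def Q'_def by (simp_all add: clip_meas)
  have b': "0 \<le> r' t \<omega>" "r' t \<omega> \<le> 1" "\<bar>N' t \<omega>\<bar> \<le> c" "0 \<le> P' t \<omega>" "P' t \<omega> \<le> c" "0 \<le> Q' t \<omega>" "Q' t \<omega> \<le> c" for t \<omega>
    using c by (auto simp: r'_def N'_def P'_def Q'_def clip_def)
  have bm': "r' t \<in> bmeas M" "N' t \<in> bmeas M" "P' t \<in> bmeas M" "Q' t \<in> bmeas M" for t
    by (rule bmeasI[OF FF_measurable_M[OF m'(1)], where c = 1], use b' in simp)
      (rule bmeasI[OF FF_measurable_M[OF m'(2)], where c = c] bmeasI[OF FF_measurable_M[OF m'(3)], where c = c]
        bmeasI[OF FF_measurable_M[OF m'(4)], where c = c], use b' in simp)+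
  have w': "weakly_tendsto \<FF> (\<lambda>m. r m t) (r' t)" for t
    by (rule weakly_tendsto_cong_AE[OF w(1) bm'(1)]) (unfold r'_def, rule clip_AE[OF w(1)], use bnd in auto)
  have wN: "weakly_tendsto \<FF> (\<lambda>m. N m t) (N' t)" for t
    by (rule weakly_tendsto_cong_AE[OF w(2) bm'(2)]) (unfold N'_def, rule clip_AE[OF w(2)], use bnd in \<open>auto simp: abs_le_iff minus_le_iff\<close>)
  have wP: "weakly_tendsto \<FF> (\<lambda>m. P m t) (P' t)" for t
    by (rule weakly_tendsto_cong_AE[OF w(3) bm'(3)]) (unfold P'_def, rule clip_AE[OF w(3)], use bnd in auto)
  have wQ: "weakly_tendsto \<FF> (\<lambda>m. Q m t) (Q' t)" for t
    by (rule weakly_tendsto_cong_AE[OF w(4) bm'(4)]) (unfold Q'_def, rule clip_AE[OF w(4)], use bnd in auto)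
  have ev: "\<forall>\<^sub>F m in \<FF>. t \<in> grid_points m" if "t \<in> dyadics" for t
  proof -
    obtain m0 where "t \<in> grid_points m0" using \<open>t \<in> dyadics\<close> by (auto simp: dyadics_def)
    then have "\<forall>\<^sub>F m in sequentially. t \<in> grid_points m"
      using grid_points_mono by (auto simp: eventually_sequentially intro!: exI[of _ m0])
    then show ?thesis using F(2) by (simp add: filter_leD)
  qed
  have mono: "AE \<omega> in M. P' s \<omega> \<le> P' t \<omega> \<and> Q' s \<omega> \<le> Q' t \<omega> \<and> r' t \<omega> \<le> r' s \<omega>" if "s \<le> t" for s t
  proof -
    have mm: "AE \<omega> in M. P m s \<omega> \<le> P m t \<omega> \<and> Q m s \<omega> \<le> Q m t \<omega> \<and> r m t \<omega> \<le> r m s \<omega>" for m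
      using d'[of m] that by blast
    have "AE \<omega> in M. P' s \<omega> \<le> P' t \<omega>"
      by (rule weakly_tendsto_le[OF F(1) wP wP], rule always_eventually, rule allI) (use mm in simp)
    moreover have "AE \<omega> in M. Q' s \<omega> \<le> Q' t \<omega>"
      by (rule weakly_tendsto_le[OF F(1) wQ wQ], rule always_eventually, rule allI) (use mm in simp)
    moreover have "AE \<omega> in M. r' t \<omega> \<le> r' s \<omega>"
      by (rule weakly_tendsto_le[OF F(1) w' w'], rule always_eventually, rule allI) (use mm in simp)
    ultimately show ?thesis by eventually_elim simp
  qed
  have mart: "expectation (\<lambda>\<omega>. indicator A \<omega> * N' t \<omega>) = expectation (\<lambda>\<omega>. indicator A \<omega> * N' s \<omega>)"
    if s: "s \<in> dyadics" and t: "t \<in> dyadics" and st: "s \<le> t" and A: "A \<in> sets (FF s)" for s t A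
  proof (rule tendsto_unique[OF F(1)])
    have iA: "integrable M (indicator A :: 'a \<Rightarrow> real)" using sets_FF_M[OF A] by (intro bmeas_integrable bmeas_indicator)
    show "((\<lambda>m. expectation (\<lambda>\<omega>. indicator A \<omega> * N m t \<omega>)) \<longlongrightarrow> expectation (\<lambda>\<omega>. indicator A \<omega> * N' t \<omega>)) \<FF>"
      using wN[of t] iA by (simp add: weakly_tendsto_def)
    have l: "((\<lambda>m. expectation (\<lambda>\<omega>. indicator A \<omega> * N m s \<omega>)) \<longlongrightarrow> expectation (\<lambda>\<omega>. indicator A \<omega> * N' s \<omega>)) \<FF>"
      using wN[of s] iA by (simp add: weakly_tendsto_def)
    have "\<forall>\<^sub>F m in \<FF>. expectation (\<lambda>\<omega>. indicator A \<omega> * N m s \<omega>) = expectation (\<lambda>\<omega>. indicator A \<omega> * N m t \<omega>)"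
      using ev[OF s] ev[OF t]
    proof eventually_elim
      case (elim m)
      have "\<forall>s\<in>grid_points m. \<forall>t\<in>grid_points m. s \<le> t \<longrightarrow> (\<forall>A\<in>sets (FF s).
        expectation (\<lambda>\<omega>. indicator A \<omega> * N m t \<omega>) = expectation (\<lambda>\<omega>. indicator A \<omega> * N m s \<omega>))"
        using d'[of m] by blast
      then have "expectation (\<lambda>\<omega>. indicator A \<omega> * N m t \<omega>) = expectation (\<lambda>\<omega>. indicator A \<omega> * N m s \<omega>)"
        using elim st A by blast
      then show ?case by (rule sym)
    qed
    then show "((\<lambda>m. expectation (\<lambda>\<omega>. indicator A \<omega> * N m t \<omega>)) \<longlongrightarrow> expectation (\<lambda>\<omega>. indicator A \<omega> * N' s \<omega>)) \<FF>"
      by (rule Lim_transform_eventually[OF l])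
  qed
  have eq: "AE \<omega> in M. W t \<omega> * r' t \<omega> = N' t \<omega> + P' t \<omega> - Q' t \<omega>" if t: "t \<in> dyadics" for t
  proof -
    have "AE \<omega> in M. W t \<omega> * r' t \<omega> + Q' t \<omega> = N' t \<omega> + P' t \<omega>"
    proof (rule weakly_tendsto_eq[OF F(1)])
      show "weakly_tendsto \<FF> (\<lambda>m \<omega>. W t \<omega> * r m t \<omega> + Q m t \<omega>) (\<lambda>\<omega>. W t \<omega> * r' t \<omega> + Q' t \<omega>)"
        by (intro weakly_tendsto_add weakly_tendsto_mult w' wQ W t)
      show "weakly_tendsto \<FF> (\<lambda>m \<omega>. N m t \<omega> + P m t \<omega>) (\<lambda>\<omega>. N' t \<omega> + P' t \<omega>)"
        by (intro weakly_tendsto_add wN wP)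
      show "\<forall>\<^sub>F m in \<FF>. AE \<omega> in M. W t \<omega> * r m t \<omega> + Q m t \<omega> = N m t \<omega> + P m t \<omega>"
        using ev[OF t]
      proof eventually_elim
        case (elim m)
        then have "AE \<omega> in M. W t \<omega> * r m t \<omega> = N m t \<omega> + P m t \<omega> - Q m t \<omega>" using d'[of m] by blast
        then show ?case by eventually_elim simp
      qed
    qed
    then show ?thesis by eventually_elim simp
  qed
  have "1 - \<epsilon> \<le> expectation (r' T)"
  proof (rule tendsto_lowerbound[OF _ _ F(1)])
    show "((\<lambda>m. expectation (r m T)) \<longlongrightarrow> expectation (r' T)) \<FF>"
      using w'[of T, unfolded weakly_tendsto_def] bmeas_integrable[OF bmeas_const[of 1]] by fastforce
    show "\<forall>\<^sub>F m in \<FF>. 1 - \<epsilon> \<le> expectation (r m T)" using d' by (intro always_eventually) blast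
  qed
  then have "damped_decomposition dyadics W c \<epsilon> r' N' P' Q'"
    unfolding damped_decomposition_def by (intro conjI allI ballI impI m' b' mono mart eq)
  then show ?thesis by blast
qed

end

subsection \<open>Tightness of the predictable variation\<close>

lemma abs_qv_active_le: "\<bar>qv_active c y l\<bar> \<le> 1"
  by (simp add: qv_active_def)

lemma (in discrete_filtration) mart_diff_increment:
  assumes md: "mart_diff (\<lambda>i x. N (Suc i) x - N i x) n" and N: "\<And>i. i \<le> n \<Longrightarrow> N i \<in> bmeas M"
    and \<phi>: "\<phi> \<in> bmeas (G i)" and ij: "i \<le> j" "j \<le> n"
  shows "expectation (\<lambda>x. \<phi> x * N j x) = expectation (\<lambda>x. \<phi> x * N i x)"
  using ij
proof (induction j rule: dec_induct)
  case (step j)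
  have "\<phi> \<in> bmeas (G j)" using \<phi> step by (auto intro: bmeas_mono)
  then have "expectation (\<lambda>x. \<phi> x * (N (Suc j) x - N j x)) = 0" using md step by (auto simp: mart_diff_def)
  moreover have "integrable M (\<lambda>x. \<phi> x * N (Suc j) x)" "integrable M (\<lambda>x. \<phi> x * N j x)"
    using step N bmeas_M[OF \<phi>] by (auto intro!: bmeas_integrable bmeas_mult)
  ultimately show ?case using step by (simp add: right_diff_distrib)
qed simp

context horizon
begin

definition grid_sum :: "(real \<Rightarrow> 'a \<Rightarrow> real) \<Rightarrow> nat \<Rightarrow> (nat \<Rightarrow> 'a \<Rightarrow> real) \<Rightarrow> nat \<Rightarrow> 'a \<Rightarrow> real" where
  "grid_sum Y n h j \<omega> = (\<Sum>l<j. h l \<omega> * (Y (grid n (Suc l)) \<omega> - Y (grid n l) \<omega>))"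

text \<open>Condition (1) of the theorem for integrands \<open>h m / c m\<close> that are constant along dyadic grids.\<close>

definition grid_no_gain :: "(real \<Rightarrow> 'a \<Rightarrow> real) \<Rightarrow> bool" where
  "grid_no_gain Y \<longleftrightarrow> (\<forall>\<nu> h c.
     (\<forall>m. \<forall>l<2 ^ \<nu> m. h m l \<in> borel_measurable (FF (grid (\<nu> m) l)) \<and> (\<forall>\<omega>\<in>space M. \<bar>h m l \<omega>\<bar> \<le> 1)) \<and>
     (\<forall>m. 0 < c m) \<and> filterlim c at_top sequentially \<and>
     (\<forall>\<delta>>0. (\<lambda>m. prob {\<omega>\<in>space M. \<exists>j\<le>2 ^ \<nu> m. grid_sum Y (\<nu> m) (h m) j \<omega> \<le> - \<delta> * c m}) \<longlonglongrightarrow> 0)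
     \<longrightarrow> (\<forall>\<delta>>0. (\<lambda>m. prob {\<omega>\<in>space M. \<delta> * c m \<le> grid_sum Y (\<nu> m) (h m) (2 ^ \<nu> m) \<omega>}) \<longlonglongrightarrow> 0))"

lemma grid_no_gainD:
  assumes "grid_no_gain Y"
    and "\<And>m l. l < 2 ^ \<nu> m \<Longrightarrow> h m l \<in> borel_measurable (FF (grid (\<nu> m) l))"
    and "\<And>m l \<omega>. l < 2 ^ \<nu> m \<Longrightarrow> \<omega> \<in> space M \<Longrightarrow> \<bar>h m l \<omega>\<bar> \<le> 1"
    and "\<And>m. 0 < c m" "filterlim c at_top sequentially"
    and "\<And>\<delta>. \<delta> > 0 \<Longrightarrow> (\<lambda>m. prob {\<omega>\<in>space M. \<exists>j\<le>2 ^ \<nu> m. grid_sum Y (\<nu> m) (h m) j \<omega> \<le> - \<delta> * c m}) \<longlonglongrightarrow> 0"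
    and "\<delta> > 0"
  shows "(\<lambda>m. prob {\<omega>\<in>space M. \<delta> * c m \<le> grid_sum Y (\<nu> m) (h m) (2 ^ \<nu> m) \<omega>}) \<longlonglongrightarrow> 0"
  using assms(1)[unfolded grid_no_gain_def, rule_format, of \<nu> h c] assms(2-7) by blast

context
  fixes Y :: "real \<Rightarrow> 'a \<Rightarrow> real" and K :: real
  assumes Y_meas: "\<And>t. t \<in> {0..T} \<Longrightarrow> Y t \<in> borel_measurable (FF t)"
    and Y_bound: "\<And>t \<omega>. t \<in> {0..T} \<Longrightarrow> \<omega> \<in> space M \<Longrightarrow> \<bar>Y t \<omega>\<bar> \<le> K"
    and K: "K > 0" and gain: "grid_no_gain Y"
begin

text \<open>Otherwise there are grids on which the quadratic variation reaches \<open>Suc m\<close>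
  with probability above \<open>\<epsilon>\<close>. The integrand \<open>- Y / K\<close>, switched
  off at that level, never loses more than \<open>K / 2\<close>, yet gains a multiple of
  \<open>m\<close> on those events once \<open>m\<close> is large, which contradicts
  \<open>gain\<close> at scale \<open>Suc m\<close>.\<close>

lemma quad_var_tight:
  assumes \<epsilon>: "\<epsilon> > 0"
  shows "\<exists>c>0. \<forall>n. prob {\<omega>\<in>space M. c \<le> quad_var (\<lambda>i. Y (grid n i) \<omega>) (2 ^ n)} \<le> \<epsilon>"
proof (rule ccontr)
  let ?A = "\<lambda>c n. {\<omega>\<in>space M. c \<le> quad_var (\<lambda>i. Y (grid n i) \<omega>) (2 ^ n)}"
  assume "\<not> ?thesis"
  then have "\<exists>n. \<epsilon> < prob (?A (real (Suc m)) n)" for m using of_nat_0_less_iff[of "Suc m"] not_less by blast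
  then obtain \<nu> where \<nu>: "\<And>m. \<epsilon> < prob (?A (real (Suc m)) (\<nu> m))"
    using choice[of "\<lambda>m n. \<epsilon> < prob (?A (real (Suc m)) n)"] by blast
  \<comment> \<open>\<open>- 2 * Y\<close> divided by \<open>2 * K\<close>, which brings the
    integrand into \<open>[-1, 1]\<close>.\<close>
  define h where "h m l \<omega> = qv_active (real (Suc m)) (\<lambda>i. Y (grid (\<nu> m) i) \<omega>) l * (- Y (grid (\<nu> m) l) \<omega> / K)" for m l \<omega>
  have gs: "grid_sum Y (\<nu> m) (h m) j \<omega> = (\<Sum>l<j. qv_active (real (Suc m)) (\<lambda>i. Y (grid (\<nu> m) i) \<omega>) l * (- 2 * Y (grid (\<nu> m) l) \<omega>) *
      (Y (grid (\<nu> m) (Suc l)) \<omega> - Y (grid (\<nu> m) l) \<omega>)) / (2 * K)" for m j \<omega>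
    unfolding grid_sum_def h_def sum_divide_distrib using K by (intro sum.cong) (auto simp: field_simps)
  have Yg: "\<bar>Y (grid (\<nu> m) i) \<omega>\<bar> \<le> K" if "i \<le> 2 ^ \<nu> m" "\<omega> \<in> space M" for m i \<omega>
    using Y_bound[OF grid_in] that by blast
  have low: "- K / 2 \<le> grid_sum Y (\<nu> m) (h m) j \<omega>" if "j \<le> 2 ^ \<nu> m" "\<omega> \<in> space M" for m j \<omega>
  proof -
    have "- K\<^sup>2 / (2 * K) \<le> grid_sum Y (\<nu> m) (h m) j \<omega>"
      unfolding gs using K Yg that by (intro divide_right_mono quad_var_transform(1)) auto
    then show ?thesis using K by (simp add: power2_eq_square)
  qed
  \<comment> \<open>The gain is at least \<open>(Suc m - K\<^sup>2) / (2 * K)\<close>. The slope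
    \<open>1 / (4 * K)\<close> is half of \<open>1 / (2 * K)\<close> and is attained as soon as
    \<open>2 * K\<^sup>2 < Suc m\<close>.\<close>
  have "(\<lambda>m. prob {\<omega>\<in>space M. 1 / (4 * K) * real (Suc m) \<le> grid_sum Y (\<nu> m) (h m) (2 ^ \<nu> m) \<omega>}) \<longlonglongrightarrow> 0"
  proof (rule grid_no_gainD[OF gain])
    fix m l assume l: "l < (2::nat) ^ \<nu> m"
    interpret G: discrete_filtration M "\<lambda>i. FF (grid (\<nu> m) i)" by (rule FF_discrete_filtration)
    show "h m l \<in> borel_measurable (FF (grid (\<nu> m) l))"
      unfolding h_def using l Y_meas[OF grid_in]
      by (intro borel_measurable_times borel_measurable_divide borel_measurable_uminus
        bmeas_measurable[OF G.qv_active_bmeas[where n = "2 ^ \<nu> m"]]) auto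
    fix \<omega> assume "\<omega> \<in> space M"
    then have "\<bar>- Y (grid (\<nu> m) l) \<omega> / K\<bar> \<le> 1" using Yg[of l m \<omega>] l K by simp
    then have "\<bar>h m l \<omega>\<bar> \<le> 1 * 1"
      unfolding h_def abs_mult by (intro mult_mono abs_qv_active_le) auto
    then show "\<bar>h m l \<omega>\<bar> \<le> 1" by simp
  next
    fix \<delta> :: real assume \<delta>: "\<delta> > 0"
    \<comment> \<open>Losses are bounded pathwise by a constant, so for large \<open>m\<close> the
      loss events are empty.\<close>
    have "filterlim (\<lambda>m. \<delta> * real (Suc m)) at_top sequentially"
      by (rule filterlim_tendsto_pos_mult_at_top[OF tendsto_const \<delta>])
        (rule filterlim_compose[OF filterlim_real_sequentially filterlim_Suc])
    then have "\<forall>\<^sub>F m in sequentially. K / 2 < \<delta> * real (Suc m)" unfolding filterlim_at_top_dense by blast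
    then have "\<forall>\<^sub>F m in sequentially. prob {\<omega>\<in>space M. \<exists>j\<le>2 ^ \<nu> m. grid_sum Y (\<nu> m) (h m) j \<omega> \<le> - \<delta> * real (Suc m)} = 0"
    proof eventually_elim
      case (elim m)
      then have "{\<omega>\<in>space M. \<exists>j\<le>2 ^ \<nu> m. grid_sum Y (\<nu> m) (h m) j \<omega> \<le> - \<delta> * real (Suc m)} = {}"
        using low[of _ m] by fastforce
      then show ?case by (simp only: measure_empty)
    qed
    then show "(\<lambda>m. prob {\<omega>\<in>space M. \<exists>j\<le>2 ^ \<nu> m. grid_sum Y (\<nu> m) (h m) j \<omega> \<le> - \<delta> * real (Suc m)}) \<longlonglongrightarrow> 0"
      by (rule tendsto_eventually)
  next
    show "filterlim (\<lambda>m. real (Suc m)) at_top sequentially"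
      by (rule filterlim_compose[OF filterlim_real_sequentially filterlim_Suc])
  qed (use K in auto)
  then have "\<forall>\<^sub>F m in sequentially. prob {\<omega>\<in>space M. 1 / (4 * K) * real (Suc m) \<le> grid_sum Y (\<nu> m) (h m) (2 ^ \<nu> m) \<omega>} < \<epsilon>"
    using \<epsilon> by (intro order_tendstoD)
  moreover have "\<forall>\<^sub>F m in sequentially. 2 * K\<^sup>2 < real (Suc m)"
    using filterlim_compose[OF filterlim_real_sequentially filterlim_Suc] by (simp add: filterlim_at_top_dense)
  ultimately have "\<forall>\<^sub>F m in sequentially. False"
  proof eventually_elim
    case (elim m)
    have "prob (?A (real (Suc m)) (\<nu> m)) \<le> prob {\<omega>\<in>space M. 1 / (4 * K) * real (Suc m) \<le> grid_sum Y (\<nu> m) (h m) (2 ^ \<nu> m) \<omega>}"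
    proof (rule finite_measure_mono)
      show "?A (real (Suc m)) (\<nu> m) \<subseteq> {\<omega>\<in>space M. 1 / (4 * K) * real (Suc m) \<le> grid_sum Y (\<nu> m) (h m) (2 ^ \<nu> m) \<omega>}"
      proof safe
        fix \<omega> assume \<omega>: "\<omega> \<in> space M" "real (Suc m) \<le> quad_var (\<lambda>i. Y (grid (\<nu> m) i) \<omega>) (2 ^ \<nu> m)"
        have "(real (Suc m) - K\<^sup>2) / (2 * K) \<le> grid_sum Y (\<nu> m) (h m) (2 ^ \<nu> m) \<omega>"
          unfolding gs using K Yg \<omega> by (intro divide_right_mono quad_var_transform(2)) auto
        moreover have "1 / (4 * K) * real (Suc m) \<le> (real (Suc m) - K\<^sup>2) / (2 * K)"
        proof -
          have "1 / (4 * K) * real (Suc m) = real (Suc m) / 2 / (2 * K)" by simp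
          also have "\<dots> \<le> (real (Suc m) - K\<^sup>2) / (2 * K)"
            using elim(2) K by (intro divide_right_mono) auto
          finally show ?thesis .
        qed
        ultimately show "1 / (4 * K) * real (Suc m) \<le> grid_sum Y (\<nu> m) (h m) (2 ^ \<nu> m) \<omega>" by linarith
      qed
      have "h m l \<in> borel_measurable M" if "l < 2 ^ \<nu> m" for l
      proof -
        interpret G: discrete_filtration M "\<lambda>i. FF (grid (\<nu> m) i)" by (rule FF_discrete_filtration)
        have "h m l \<in> borel_measurable (FF (grid (\<nu> m) l))"
          unfolding h_def using that Y_meas[OF grid_in]
          by (intro borel_measurable_times borel_measurable_divide borel_measurable_uminus
            bmeas_measurable[OF G.qv_active_bmeas[where n = "2 ^ \<nu> m"]]) auto
        then show ?thesis by (rule FF_measurable_M)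
      qed
      then have "grid_sum Y (\<nu> m) (h m) (2 ^ \<nu> m) \<in> borel_measurable M"
        unfolding grid_sum_def using FF_measurable_M[OF Y_meas[OF grid_in]]
        by (intro borel_measurable_sum borel_measurable_times borel_measurable_diff) auto
      then show "{\<omega>\<in>space M. 1 / (4 * K) * real (Suc m) \<le> grid_sum Y (\<nu> m) (h m) (2 ^ \<nu> m) \<omega>} \<in> events"
        by measurable
    qed
    then show ?case using \<nu>[of m] elim(1) by simp
  qed
  then show False by simp
qed

text \<open>With the switched sign of the drift as integrand, the gain is the switched predictable
  variation, which is nonnegative and increasing, plus a martingale sum \<open>D\<close>. Only
  \<open>D\<close> can produce losses, and its maximum is bounded in probability uniformly in the
  grid, hence negligible at scale \<open>Suc m\<close>.\<close>

lemma predictable_variation_tight: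
  assumes a: "\<And>n i. i < 2 ^ n \<Longrightarrow> a n i \<in> borel_measurable (FF (grid n i))"
    "\<And>n i x. i < 2 ^ n \<Longrightarrow> x \<in> space M \<Longrightarrow> \<bar>a n i x\<bar> \<le> 2 * K"
    "\<And>n i \<phi>. i < 2 ^ n \<Longrightarrow> \<phi> \<in> bmeas (FF (grid n i)) \<Longrightarrow>
      expectation (\<lambda>x. \<phi> x * a n i x) = expectation (\<lambda>x. \<phi> x * (Y (grid n (Suc i)) x - Y (grid n i) x))"
    and md: "\<And>n. discrete_filtration.mart_diff M (\<lambda>i. FF (grid n i))
       (\<lambda>i x. Y (grid n (Suc i)) x - Y (grid n i) x - a n i x) (2 ^ n)"
    and \<epsilon>: "\<epsilon> > 0"
  shows "\<exists>C>0. \<forall>n. prob {\<omega>\<in>space M. C \<le> (\<Sum>i<2 ^ n. \<bar>a n i \<omega>\<bar>)} \<le> \<epsilon>"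
proof (rule ccontr)
  let ?V = "\<lambda>n \<omega>. \<Sum>i<2 ^ n. \<bar>a n i \<omega>\<bar>"
  assume "\<not> ?thesis"
  then have "\<exists>n. \<epsilon> < prob {\<omega>\<in>space M. real (Suc m) \<le> ?V n \<omega>}" for m
    using of_nat_0_less_iff[of "Suc m"] not_less by blast
  then obtain \<nu> where \<nu>: "\<And>m. \<epsilon> < prob {\<omega>\<in>space M. real (Suc m) \<le> ?V (\<nu> m) \<omega>}"
    using choice[of "\<lambda>m n. \<epsilon> < prob {\<omega>\<in>space M. real (Suc m) \<le> ?V n \<omega>}"] by blast
  \<comment> \<open>Where the quadratic variation stays below this \<open>c\<close>, the switch
    never turns off and the gain contains the entire predictable variation.\<close>
  obtain c where c: "c > 0" and qv: "\<And>n. prob {\<omega>\<in>space M. c \<le> quad_var (\<lambda>i. Y (grid n i) \<omega>) (2 ^ n)} \<le> \<epsilon> / 2"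
    using quad_var_tight[of "\<epsilon> / 2"] \<epsilon> by auto
  define h where "h m l \<omega> = qv_active c (\<lambda>i. Y (grid (\<nu> m) i) \<omega>) l * sgn (a (\<nu> m) l \<omega>)" for m l \<omega>
  define D where "D m j \<omega> = (\<Sum>l<j. h m l \<omega> * (Y (grid (\<nu> m) (Suc l)) \<omega> - Y (grid (\<nu> m) l) \<omega> - a (\<nu> m) l \<omega>))" for m j \<omega>
  have hm: "h m l \<in> borel_measurable (FF (grid (\<nu> m) l))" if "l < 2 ^ \<nu> m" for m l
  proof -
    interpret G: discrete_filtration M "\<lambda>i. FF (grid (\<nu> m) i)" by (rule FF_discrete_filtration)
    have [measurable]: "a (\<nu> m) l \<in> borel_measurable (FF (grid (\<nu> m) l))" using a(1)[OF that] .
    show ?thesis unfolding h_def using that Y_meas[OF grid_in]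
      by (intro borel_measurable_times bmeas_measurable[OF G.qv_active_bmeas[where n = "2 ^ \<nu> m"]]) auto
  qed
  have hM: "h m l \<in> borel_measurable M" "a (\<nu> m) l \<in> borel_measurable M" if "l < 2 ^ \<nu> m" for m l
    using hm[OF that] a(1)[OF that] by (auto intro: FF_measurable_M)
  have YM: "Y (grid n l) \<in> borel_measurable M" if "l \<le> 2 ^ n" for n l
    using FF_measurable_M[OF Y_meas[OF grid_in[OF that]]] .
  have h1: "\<bar>h m l \<omega>\<bar> \<le> 1" for m l \<omega>
  proof -
    have "\<bar>h m l \<omega>\<bar> \<le> 1 * 1"
      unfolding h_def abs_mult by (intro mult_mono abs_qv_active_le) (simp_all add: abs_sgn_eq)
    then show ?thesis by simp
  qed
  have DM: "D m j \<in> borel_measurable M" if "j \<le> 2 ^ \<nu> m" for m j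
    unfolding D_def using that by (intro borel_measurable_sum borel_measurable_times borel_measurable_diff hM YM) auto
  have gsM: "grid_sum Y (\<nu> m) (h m) j \<in> borel_measurable M" if "j \<le> 2 ^ \<nu> m" for m j
    unfolding grid_sum_def using that by (intro borel_measurable_sum borel_measurable_times borel_measurable_diff hM YM) auto
  have gs: "grid_sum Y (\<nu> m) (h m) j \<omega> = (\<Sum>l<j. qv_active c (\<lambda>i. Y (grid (\<nu> m) i) \<omega>) l * \<bar>a (\<nu> m) l \<omega>\<bar>) + D m j \<omega>" for m j \<omega>
    unfolding grid_sum_def D_def sum.distrib[symmetric]
    by (intro sum.cong) (auto simp: h_def algebra_simps abs_sgn)
  have Dmax: "prob {\<omega>\<in>space M. \<exists>j\<le>2 ^ \<nu> m. l \<le> \<bar>D m j \<omega>\<bar>} \<le> (c + 4 * K\<^sup>2) / l\<^sup>2" if "l > 0" for m l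
  proof -
    interpret G: discrete_filtration M "\<lambda>i. FF (grid (\<nu> m) i)" by (rule FF_discrete_filtration)
    show ?thesis unfolding D_def h_def
    proof (rule G.active_transform_maximal)
      show "a (\<nu> m) i \<in> bmeas (FF (grid (\<nu> m) i))" if "i < 2 ^ \<nu> m" for i
        using a that by (intro bmeasI[where c = "2 * K"]) (auto simp: space_FF)
    qed (use Y_meas[OF grid_in] Y_bound[OF grid_in] a(3) md c that in auto)
  qed
  have sq: "(\<lambda>m. (c + 4 * K\<^sup>2) / (\<delta> * real (Suc m))\<^sup>2) \<longlonglongrightarrow> 0" if "\<delta> > 0" for \<delta>
  proof (rule real_tendsto_divide_at_top[OF tendsto_const])
    have "filterlim (\<lambda>m. \<delta> * real (Suc m)) at_top sequentially"
      by (rule filterlim_tendsto_pos_mult_at_top[OF tendsto_const that])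
        (rule filterlim_compose[OF filterlim_real_sequentially filterlim_Suc])
    then show "filterlim (\<lambda>m. (\<delta> * real (Suc m))\<^sup>2) at_top sequentially"
      by (rule filterlim_pow_at_top[rotated]) simp
  qed
  have Dlim: "(\<lambda>m. prob {\<omega>\<in>space M. \<exists>j\<le>2 ^ \<nu> m. \<delta> * real (Suc m) \<le> \<bar>D m j \<omega>\<bar>}) \<longlonglongrightarrow> 0" if "\<delta> > 0" for \<delta>
  proof (rule tendsto_sandwich[OF _ _ tendsto_const sq[OF that]])
    have "0 < \<delta> * real (Suc m)" for m using that by simp
    from Dmax[OF this] show "\<forall>\<^sub>F m in sequentially. prob {\<omega>\<in>space M. \<exists>j\<le>2 ^ \<nu> m. \<delta> * real (Suc m) \<le> \<bar>D m j \<omega>\<bar>}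
      \<le> (c + 4 * K\<^sup>2) / (\<delta> * real (Suc m))\<^sup>2" by (intro always_eventually allI)
  qed (simp add: measure_nonneg)
  have DmaxM: "{\<omega>\<in>space M. \<exists>j\<le>2 ^ \<nu> m. l \<le> \<bar>D m j \<omega>\<bar>} \<in> events" for m l
  proof -
    have "{\<omega>\<in>space M. \<exists>j\<in>{..2 ^ \<nu> m}. l \<le> \<bar>D m j \<omega>\<bar>} \<in> events"
      using DM by (intro sets.sets_Collect_finite_Ex) auto
    then show ?thesis by (simp only: Bex_def atMost_iff)
  qed
  have "(\<lambda>m. prob {\<omega>\<in>space M. 1 / 2 * real (Suc m) \<le> grid_sum Y (\<nu> m) (h m) (2 ^ \<nu> m) \<omega>}) \<longlonglongrightarrow> 0"
  proof (rule grid_no_gainD[OF gain])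
    fix \<delta> :: real assume \<delta>: "\<delta> > 0"
    show "(\<lambda>m. prob {\<omega>\<in>space M. \<exists>j\<le>2 ^ \<nu> m. grid_sum Y (\<nu> m) (h m) j \<omega> \<le> - \<delta> * real (Suc m)}) \<longlonglongrightarrow> 0"
    proof (rule tendsto_sandwich[OF _ _ tendsto_const Dlim[OF \<delta>]])
      have "prob {\<omega>\<in>space M. \<exists>j\<le>2 ^ \<nu> m. grid_sum Y (\<nu> m) (h m) j \<omega> \<le> - \<delta> * real (Suc m)}
        \<le> prob {\<omega>\<in>space M. \<exists>j\<le>2 ^ \<nu> m. \<delta> * real (Suc m) \<le> \<bar>D m j \<omega>\<bar>}" for m
      proof (rule finite_measure_mono[OF _ DmaxM], safe)
        fix \<omega> j assume j: "j \<le> (2::nat) ^ \<nu> m" "grid_sum Y (\<nu> m) (h m) j \<omega> \<le> - \<delta> * real (Suc m)"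
        have "0 \<le> (\<Sum>l<j. qv_active c (\<lambda>i. Y (grid (\<nu> m) i) \<omega>) l * \<bar>a (\<nu> m) l \<omega>\<bar>)"
          by (intro sum_nonneg mult_nonneg_nonneg qv_active_bounds) auto
        then have "\<delta> * real (Suc m) \<le> \<bar>D m j \<omega>\<bar>" using j gs[of m j \<omega>] by linarith
        then show "\<exists>j\<le>2 ^ \<nu> m. \<delta> * real (Suc m) \<le> \<bar>D m j \<omega>\<bar>" using j by blast
      qed
      then show "\<forall>\<^sub>F m in sequentially. prob {\<omega>\<in>space M. \<exists>j\<le>2 ^ \<nu> m. grid_sum Y (\<nu> m) (h m) j \<omega> \<le> - \<delta> * real (Suc m)}
        \<le> prob {\<omega>\<in>space M. \<exists>j\<le>2 ^ \<nu> m. \<delta> * real (Suc m) \<le> \<bar>D m j \<omega>\<bar>}" by simp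
    qed simp
  next
    show "filterlim (\<lambda>m. real (Suc m)) at_top sequentially"
      by (rule filterlim_compose[OF filterlim_real_sequentially filterlim_Suc])
  qed (use hm h1 in auto)
  from tendsto_add[OF this Dlim[of "1 / 2"]]
  have "(\<lambda>m. prob {\<omega>\<in>space M. 1 / 2 * real (Suc m) \<le> grid_sum Y (\<nu> m) (h m) (2 ^ \<nu> m) \<omega>} +
     prob {\<omega>\<in>space M. \<exists>j\<le>2 ^ \<nu> m. 1 / 2 * real (Suc m) \<le> \<bar>D m j \<omega>\<bar>}) \<longlonglongrightarrow> 0" by simp
  then have "\<forall>\<^sub>F m in sequentially. prob {\<omega>\<in>space M. 1 / 2 * real (Suc m) \<le> grid_sum Y (\<nu> m) (h m) (2 ^ \<nu> m) \<omega>} +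
     prob {\<omega>\<in>space M. \<exists>j\<le>2 ^ \<nu> m. 1 / 2 * real (Suc m) \<le> \<bar>D m j \<omega>\<bar>} < \<epsilon> / 2"
    using \<epsilon> by (intro order_tendstoD) auto
  then have "\<forall>\<^sub>F m in sequentially. False"
  proof eventually_elim
    case (elim m)
    let ?A = "{\<omega>\<in>space M. 1 / 2 * real (Suc m) \<le> grid_sum Y (\<nu> m) (h m) (2 ^ \<nu> m) \<omega>}"
    let ?B = "{\<omega>\<in>space M. \<exists>j\<le>2 ^ \<nu> m. 1 / 2 * real (Suc m) \<le> \<bar>D m j \<omega>\<bar>}"
    let ?Q = "{\<omega>\<in>space M. c \<le> quad_var (\<lambda>i. Y (grid (\<nu> m) i) \<omega>) (2 ^ \<nu> m)}"
    have A: "?A \<in> events" using gsM[of "2 ^ \<nu> m" m] by auto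
    have "(\<lambda>\<omega>. quad_var (\<lambda>i. Y (grid (\<nu> m) i) \<omega>) (2 ^ \<nu> m)) \<in> borel_measurable M"
      unfolding quad_var_def using YM by (intro borel_measurable_sum borel_measurable_power borel_measurable_diff) auto
    then have Q: "?Q \<in> events" by auto
    \<comment> \<open>If the predictable variation reaches \<open>Suc m\<close>, then the quadratic
      variation reached \<open>c\<close>, or the gain reached half of \<open>Suc m\<close>, or
      \<open>D\<close> compensated the other half. The first has probability at most
      \<open>\<epsilon> / 2\<close>, the other two together less than
      \<open>\<epsilon> / 2\<close>.\<close>
    have "prob {\<omega>\<in>space M. real (Suc m) \<le> ?V (\<nu> m) \<omega>} \<le> prob (?Q \<union> (?A \<union> ?B))"
    proof (rule finite_measure_mono)
      show "{\<omega>\<in>space M. real (Suc m) \<le> ?V (\<nu> m) \<omega>} \<subseteq> ?Q \<union> (?A \<union> ?B)"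
      proof
        fix \<omega> assume \<omega>: "\<omega> \<in> {\<omega>\<in>space M. real (Suc m) \<le> ?V (\<nu> m) \<omega>}"
        show "\<omega> \<in> ?Q \<union> (?A \<union> ?B)"
        proof (rule ccontr)
          assume n: "\<omega> \<notin> ?Q \<union> (?A \<union> ?B)"
          then have q: "quad_var (\<lambda>i. Y (grid (\<nu> m) i) \<omega>) (2 ^ \<nu> m) < c" using \<omega> by auto
          have "qv_active c (\<lambda>i. Y (grid (\<nu> m) i) \<omega>) l = 1" if "l < 2 ^ \<nu> m" for l
          proof -
            have "quad_var (\<lambda>i. Y (grid (\<nu> m) i) \<omega>) k < c" if "k \<le> l" for k
              using quad_var_mono[of k "2 ^ \<nu> m"] that \<open>l < 2 ^ \<nu> m\<close> q by (intro le_less_trans[OF _ q]) auto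
            then show ?thesis by (auto simp: qv_active_def not_le)
          qed
          then have "grid_sum Y (\<nu> m) (h m) (2 ^ \<nu> m) \<omega> = ?V (\<nu> m) \<omega> + D m (2 ^ \<nu> m) \<omega>" unfolding gs by simp
          moreover have "\<bar>D m (2 ^ \<nu> m) \<omega>\<bar> < 1 / 2 * real (Suc m)"
          proof -
            have "\<not> (\<exists>j\<le>2 ^ \<nu> m. 1 / 2 * real (Suc m) \<le> \<bar>D m j \<omega>\<bar>)" using n \<omega> by blast
            then show ?thesis by (meson not_le order_refl)
          qed
          moreover have "grid_sum Y (\<nu> m) (h m) (2 ^ \<nu> m) \<omega> < 1 / 2 * real (Suc m)" using n \<omega> by (auto simp: not_le)
          moreover have "real (Suc m) \<le> ?V (\<nu> m) \<omega>" using \<omega> by blast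
          moreover have False if "g = v + d" "\<bar>d\<bar> < 1 / 2 * x" "g < 1 / 2 * x" "x \<le> v" for g v d x :: real
            using that by linarith
          ultimately show False by blast
        qed
      qed
      show "?Q \<union> (?A \<union> ?B) \<in> events" by (intro sets.Un A DmaxM Q)
    qed
    also have "\<dots> \<le> prob ?Q + prob (?A \<union> ?B)" by (intro measure_Un_le Q sets.Un A DmaxM)
    also have "prob (?A \<union> ?B) \<le> prob ?A + prob ?B" by (intro measure_Un_le A DmaxM)
    finally have "prob {\<omega>\<in>space M. real (Suc m) \<le> ?V (\<nu> m) \<omega>} \<le> prob ?Q + (prob ?A + prob ?B)" by simp
    then show ?case using elim qv[of "\<nu> m"] \<nu>[of m] by linarith
  qed
  then show False by simp
qed

end

end

subsection \<open>Decomposition along the dyadic times\<close>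

context horizon
begin

lemma FF_clip: "FF (max 0 (min T t)) = FF t"
  using T_pos by (simp add: on_horizon_def)

lemma grid_dyadics: "i \<le> 2 ^ n \<Longrightarrow> grid n i \<in> dyadics"
  unfolding dyadics_def grid_points_def by blast

text \<open>A sequence along the grid becomes a process by holding the value of the last grid point.
  This point is not later than the time clipped to \<open>[0,T]\<close>, so adaptedness survives;
  \<open>grid_index\<close> is monotone, so order relations survive.\<close>

lemma damped_decompositionI_grid:
  assumes meas: "\<And>j. j \<le> 2 ^ m \<Longrightarrow> r j \<in> borel_measurable (FF (grid m j))"
      "\<And>j. j \<le> 2 ^ m \<Longrightarrow> N j \<in> borel_measurable (FF (grid m j))"
      "\<And>j. j \<le> 2 ^ m \<Longrightarrow> P j \<in> borel_measurable (FF (grid m j))"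
      "\<And>j. j \<le> 2 ^ m \<Longrightarrow> Q j \<in> borel_measurable (FF (grid m j))"
    and bnd: "\<And>j \<omega>. j \<le> 2 ^ m \<Longrightarrow> \<omega> \<in> space M \<Longrightarrow> 0 \<le> r j \<omega> \<and> r j \<omega> \<le> 1 \<and> \<bar>N j \<omega>\<bar> \<le> c \<and>
      0 \<le> P j \<omega> \<and> P j \<omega> \<le> c \<and> 0 \<le> Q j \<omega> \<and> Q j \<omega> \<le> c"
    and mono: "\<And>i j. i \<le> j \<Longrightarrow> j \<le> 2 ^ m \<Longrightarrow> AE \<omega> in M. P i \<omega> \<le> P j \<omega> \<and> Q i \<omega> \<le> Q j \<omega> \<and> r j \<omega> \<le> r i \<omega>"
    and mart: "discrete_filtration.mart_diff M (\<lambda>i. FF (grid m i)) (\<lambda>i x. N (Suc i) x - N i x) (2 ^ m)"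
    and eq: "\<And>j. j \<le> 2 ^ m \<Longrightarrow> AE \<omega> in M. W (grid m j) \<omega> * r j \<omega> = N j \<omega> + P j \<omega> - Q j \<omega>"
    and e: "1 - \<epsilon> \<le> expectation (r (2 ^ m))"
  shows "damped_decomposition (grid_points m) W c \<epsilon> (\<lambda>t. r (grid_index m t)) (\<lambda>t. N (grid_index m t))
    (\<lambda>t. P (grid_index m t)) (\<lambda>t. Q (grid_index m t))"
proof -
  interpret G: discrete_filtration M "\<lambda>i. FF (grid m i)" by (rule FF_discrete_filtration)
  have lift: "X (grid_index m t) \<in> borel_measurable (FF t)"
    if "X (grid_index m t) \<in> borel_measurable (FF (grid m (grid_index m t)))" for X :: "nat \<Rightarrow> 'a \<Rightarrow> real" and t
    using FF_measurable_mono[OF that grid_index_lower] by (simp add: FF_clip)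
  have bN: "N j \<in> bmeas M" if "j \<le> 2 ^ m" for j
    using FF_measurable_M[OF meas(2)[OF that]] bnd[OF that] by (intro bmeasI[where c = c]) auto
  have gT: "grid_index m T = 2 ^ m" using grid_index_grid[of "2 ^ m" m] by simp
  show ?thesis
    unfolding damped_decomposition_def
  proof (intro conjI allI ballI impI)
    fix t
    show "r (grid_index m t) \<in> borel_measurable (FF t)" "N (grid_index m t) \<in> borel_measurable (FF t)"
      "P (grid_index m t) \<in> borel_measurable (FF t)" "Q (grid_index m t) \<in> borel_measurable (FF t)"
      by (rule lift, rule meas, rule grid_index_le)+
  next
    fix t \<omega> assume "\<omega> \<in> space M"
    note b = bnd[OF grid_index_le[of m t] this]
    show "0 \<le> r (grid_index m t) \<omega>" "r (grid_index m t) \<omega> \<le> 1" "\<bar>N (grid_index m t) \<omega>\<bar> \<le> c"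
      "0 \<le> P (grid_index m t) \<omega>" "P (grid_index m t) \<omega> \<le> c" "0 \<le> Q (grid_index m t) \<omega>" "Q (grid_index m t) \<omega> \<le> c"
      using b by simp_all
  next
    fix s t :: real assume "s \<le> t"
    show "AE \<omega> in M. P (grid_index m s) \<omega> \<le> P (grid_index m t) \<omega> \<and> Q (grid_index m s) \<omega> \<le> Q (grid_index m t) \<omega> \<and>
        r (grid_index m t) \<omega> \<le> r (grid_index m s) \<omega>"
      by (intro mono grid_index_mono grid_index_le \<open>s \<le> t\<close>)
  next
    fix s t A assume s: "s \<in> grid_points m" and t: "t \<in> grid_points m" and st: "s \<le> t" and A: "A \<in> sets (FF s)"
    obtain i where i: "i \<le> 2 ^ m" "s = grid m i" using s by (auto simp: grid_points_def)
    obtain j where j: "j \<le> 2 ^ m" "t = grid m j" using t by (auto simp: grid_points_def)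
    have "i \<le> j" using st i j by simp
    then show "expectation (\<lambda>\<omega>. indicator A \<omega> * N (grid_index m t) \<omega>) = expectation (\<lambda>\<omega>. indicator A \<omega> * N (grid_index m s) \<omega>)"
      using G.mart_diff_increment[OF mart bN bmeas_indicator[of A], of i j] A i j by (simp add: grid_index_grid)
  next
    fix t assume t: "t \<in> grid_points m"
    obtain j where j: "j \<le> 2 ^ m" "t = grid m j" using t by (auto simp: grid_points_def)
    then show "AE \<omega> in M. W t \<omega> * r (grid_index m t) \<omega> = N (grid_index m t) \<omega> + P (grid_index m t) \<omega> - Q (grid_index m t) \<omega>"
      using eq[OF j(1)] by (simp add: grid_index_grid)
  next
    show "1 - \<epsilon> \<le> expectation (r (grid_index m T))" using e gT by simp
  qed
qed

text \<open>The bound \<open>C\<close> on the predictable variation comes from tightness and is the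
  same for every grid, so the truncated decompositions share the constant
  \<open>2 * C + 3 * K\<close> and admit a weak limit.\<close>

lemma damped_decomposition_exists:
  fixes Y :: "real \<Rightarrow> 'a \<Rightarrow> real"
  assumes Y_meas: "\<And>t. t \<in> {0..T} \<Longrightarrow> Y t \<in> borel_measurable (FF t)"
    and Y_bound: "\<And>t \<omega>. t \<in> {0..T} \<Longrightarrow> \<omega> \<in> space M \<Longrightarrow> \<bar>Y t \<omega>\<bar> \<le> K"
    and K: "K > 0" and gain: "grid_no_gain Y" and \<epsilon>: "\<epsilon> > 0"
  shows "\<exists>c\<ge>0. \<exists>r N P Q. damped_decomposition dyadics Y c \<epsilon> r N P Q"
proof -
  have "\<forall>n. \<exists>a. (\<forall>i<2 ^ n. a i \<in> borel_measurable (FF (grid n i)) \<and> (\<forall>x\<in>space M. \<bar>a i x\<bar> \<le> 2 * K) \<and>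
    (\<forall>\<phi>\<in>bmeas (FF (grid n i)). expectation (\<lambda>x. \<phi> x * a i x) = expectation (\<lambda>x. \<phi> x * (Y (grid n (Suc i)) x - Y (grid n i) x)))) \<and>
    discrete_filtration.mart_diff M (\<lambda>i. FF (grid n i)) (\<lambda>i x. Y (grid n (Suc i)) x - Y (grid n i) x - a i x) (2 ^ n)"
  proof
    fix n
    interpret G: discrete_filtration M "\<lambda>i. FF (grid n i)" by (rule FF_discrete_filtration)
    show "\<exists>a. (\<forall>i<2 ^ n. a i \<in> borel_measurable (FF (grid n i)) \<and> (\<forall>x\<in>space M. \<bar>a i x\<bar> \<le> 2 * K) \<and>
      (\<forall>\<phi>\<in>bmeas (FF (grid n i)). expectation (\<lambda>x. \<phi> x * a i x) = expectation (\<lambda>x. \<phi> x * (Y (grid n (Suc i)) x - Y (grid n i) x)))) \<and>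
      G.mart_diff (\<lambda>i x. Y (grid n (Suc i)) x - Y (grid n i) x - a i x) (2 ^ n)"
      by (rule G.doob_decomposition) (use Y_meas[OF grid_in] Y_bound[OF grid_in] in auto)
  qed
  then obtain a where a: "\<And>n. (\<forall>i<2 ^ n. a n i \<in> borel_measurable (FF (grid n i)) \<and> (\<forall>x\<in>space M. \<bar>a n i x\<bar> \<le> 2 * K) \<and>
    (\<forall>\<phi>\<in>bmeas (FF (grid n i)). expectation (\<lambda>x. \<phi> x * a n i x) = expectation (\<lambda>x. \<phi> x * (Y (grid n (Suc i)) x - Y (grid n i) x)))) \<and>
    discrete_filtration.mart_diff M (\<lambda>i. FF (grid n i)) (\<lambda>i x. Y (grid n (Suc i)) x - Y (grid n i) x - a n i x) (2 ^ n)"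
    unfolding choice_iff by blast
  have am: "a n i \<in> borel_measurable (FF (grid n i))" if "i < 2 ^ n" for n i using a[of n] that by blast
  have "\<exists>C>0. \<forall>n. prob {\<omega>\<in>space M. C \<le> (\<Sum>i<2 ^ n. \<bar>a n i \<omega>\<bar>)} \<le> \<epsilon>"
    by (rule predictable_variation_tight[OF Y_meas Y_bound K gain]) (use a \<epsilon> in blast)+
  then obtain C where C: "C > 0" and tight: "\<And>n. prob {\<omega>\<in>space M. C \<le> (\<Sum>i<2 ^ n. \<bar>a n i \<omega>\<bar>)} \<le> \<epsilon>" by blast
  let ?c = "2 * C + 3 * K"
  have "\<exists>r N P Q. damped_decomposition (grid_points m) Y ?c \<epsilon> r N P Q" for m
  proof -
    interpret G: discrete_filtration M "\<lambda>i. FF (grid m i)" by (rule FF_discrete_filtration)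
    let ?D = "\<lambda>r N P Q. (\<forall>j\<le>2 ^ m. r j \<in> borel_measurable (FF (grid m j)) \<and> N j \<in> borel_measurable (FF (grid m j)) \<and>
        P j \<in> borel_measurable (FF (grid m j)) \<and> Q j \<in> borel_measurable (FF (grid m j))) \<and>
      G.mart_diff (\<lambda>i x. N (Suc i) x - N i x) (2 ^ m) \<and>
      (\<forall>x\<in>space M. (\<forall>j\<le>2 ^ m. Y (grid m j) x * r j x = N j x + P j x - Q j x \<and> 0 \<le> r j x \<and> r j x \<le> 1 \<and>
          0 \<le> P j x \<and> P j x \<le> C + K \<and> 0 \<le> Q j x \<and> Q j x \<le> C + K \<and> \<bar>N j x\<bar> \<le> 2 * C + 3 * K) \<and>
        (\<forall>i j. i \<le> j \<and> j \<le> 2 ^ m \<longrightarrow> P i x \<le> P j x \<and> Q i x \<le> Q j x \<and> r j x \<le> r i x) \<and>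
        ((\<Sum>i<2 ^ m. \<bar>a m i x\<bar>) \<le> C \<longrightarrow> r (2 ^ m) x = 1))"
    have "\<exists>r N P Q. ?D r N P Q"
      by (rule G.truncated_decomposition) (use Y_meas[OF grid_in] Y_bound[OF grid_in] a[of m] C in auto)
    then obtain r N P Q where D: "?D r N P Q" by (elim exE) (rule that)
    note m = D[THEN conjunct1, rule_format] and md = D[THEN conjunct2, THEN conjunct1]
    note D2 = D[THEN conjunct2, THEN conjunct2, THEN bspec]
    have b: "Y (grid m j) x * r j x = N j x + P j x - Q j x \<and> 0 \<le> r j x \<and> r j x \<le> 1 \<and>
          0 \<le> P j x \<and> P j x \<le> C + K \<and> 0 \<le> Q j x \<and> Q j x \<le> C + K \<and> \<bar>N j x\<bar> \<le> 2 * C + 3 * K"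
      if "x \<in> space M" "j \<le> 2 ^ m" for x j using D2[OF that(1), THEN conjunct1, rule_format, OF that(2)] .
    have mono: "P i x \<le> P j x \<and> Q i x \<le> Q j x \<and> r j x \<le> r i x" if "x \<in> space M" "i \<le> j" "j \<le> 2 ^ m" for x i j
      using D2[OF that(1), THEN conjunct2, THEN conjunct1, rule_format, of i j] that(2,3) by blast
    have r1: "r (2 ^ m) x = 1" if "x \<in> space M" "(\<Sum>i<2 ^ m. \<bar>a m i x\<bar>) \<le> C" for x
      using D2[OF that(1), THEN conjunct2, THEN conjunct2] that(2) by blast
    have "damped_decomposition (grid_points m) Y ?c \<epsilon> (\<lambda>t. r (grid_index m t)) (\<lambda>t. N (grid_index m t))
      (\<lambda>t. P (grid_index m t)) (\<lambda>t. Q (grid_index m t))"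
    proof (rule damped_decompositionI_grid[OF _ _ _ _ _ _ md])
      show "0 \<le> r j \<omega> \<and> r j \<omega> \<le> 1 \<and> \<bar>N j \<omega>\<bar> \<le> ?c \<and> 0 \<le> P j \<omega> \<and> P j \<omega> \<le> ?c \<and> 0 \<le> Q j \<omega> \<and> Q j \<omega> \<le> ?c"
        if "j \<le> 2 ^ m" "\<omega> \<in> space M" for j \<omega> using b[OF that(2,1)] C K by auto
      show "AE \<omega> in M. P i \<omega> \<le> P j \<omega> \<and> Q i \<omega> \<le> Q j \<omega> \<and> r j \<omega> \<le> r i \<omega>" if "i \<le> j" "j \<le> 2 ^ m" for i j
        using mono that by (intro AE_I2) blast
      show "AE \<omega> in M. Y (grid m j) \<omega> * r j \<omega> = N j \<omega> + P j \<omega> - Q j \<omega>" if "j \<le> 2 ^ m" for j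
        using b that by (intro AE_I2) blast
      let ?A = "{\<omega>\<in>space M. C \<le> (\<Sum>i<2 ^ m. \<bar>a m i \<omega>\<bar>)}"
      have "(\<lambda>\<omega>. \<Sum>i<2 ^ m. \<bar>a m i \<omega>\<bar>) \<in> borel_measurable M"
        using FF_measurable_M[OF am] by (intro borel_measurable_sum borel_measurable_abs) auto
      then have A: "?A \<in> events" by auto
      have "r (2 ^ m) \<in> borel_measurable M" using m[of "2 ^ m"] FF_measurable_M by blast
      then have ir: "integrable M (r (2 ^ m))" using b[of _ "2 ^ m"] by (intro bmeas_integrable bmeasI[where c = 1]) auto
      \<comment> \<open>\<open>r\<close> equals 1 at the end unless the predictable variation
        reached \<open>C\<close>, an event of probability at most \<open>\<epsilon>\<close>.\<close>
      have "1 - \<epsilon> \<le> expectation (\<lambda>\<omega>. 1 - indicator ?A \<omega>)"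
        using tight[of m] A bmeas_integrable[OF bmeas_indicator[OF A]] by (simp add: prob_space)
      also have "\<dots> \<le> expectation (r (2 ^ m))"
      proof (rule integral_mono[OF _ ir])
        fix \<omega> assume w: "\<omega> \<in> space M"
        show "1 - indicator ?A \<omega> \<le> r (2 ^ m) \<omega>"
          using r1[OF w] b[OF w, of "2 ^ m"] w by (cases "\<omega> \<in> ?A") (auto simp: not_le)
      qed (use bmeas_integrable[OF bmeas_indicator[OF A]] in auto)
      finally show "1 - \<epsilon> \<le> expectation (r (2 ^ m))" .
    qed (use m in blast)+
    then show ?thesis by blast
  qed
  then have "\<forall>m. \<exists>r N P Q. damped_decomposition (grid_points m) Y ?c \<epsilon> r N P Q" by blast
  then obtain r N P Q where "\<And>m. damped_decomposition (grid_points m) Y ?c \<epsilon> (r m) (N m) (P m) (Q m)"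
    unfolding choice_iff by blast
  moreover have "Y t \<in> bmeas M" if "t \<in> dyadics" for t
    using dyadics_in[OF that] FF_measurable_M[OF Y_meas] Y_bound by (intro bmeasI[where c = K]) auto
  ultimately have "\<exists>r N P Q. damped_decomposition dyadics Y ?c \<epsilon> r N P Q"
    using C K by (intro damped_decomposition_limit) auto
  then show ?thesis using C K by (intro exI[of _ ?c]) auto
qed

text \<open>Multiplying by \<open>1 / max r (1 / 2)\<close> turns the damping \<open>r\<close> into \<open>min 1 (2 * r)\<close>, which equals
  \<open>1\<close> wherever \<open>r \<ge> 1 / 2\<close>. The factor is increasing, so discrete integration by parts yields a
  decomposition on every grid, with bounds independent of the grid.\<close>

lemma damped_decomposition_undamp:
  fixes Y :: "real \<Rightarrow> 'a \<Rightarrow> real"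
  assumes d: "damped_decomposition dyadics Y c \<epsilon> r N P Q" and c: "c \<ge> 0"
    and Y: "\<And>t. t \<in> dyadics \<Longrightarrow> Y t \<in> bmeas M"
  shows "\<exists>r' N' P' Q'. damped_decomposition dyadics (\<lambda>t \<omega>. Y t \<omega> * min 1 (2 * r t \<omega>)) (6 * c) 0 r' N' P' Q'"
proof -
  note d' = d[unfolded damped_decomposition_def]
  have meas: "r t \<in> borel_measurable (FF t)" "N t \<in> borel_measurable (FF t)" "P t \<in> borel_measurable (FF t)" "Q t \<in> borel_measurable (FF t)" for t
    using d'[THEN conjunct1, rule_format, of t] by simp_all
  have bnd: "0 \<le> r t \<omega>" "r t \<omega> \<le> 1" "\<bar>N t \<omega>\<bar> \<le> c" "0 \<le> P t \<omega>" "P t \<omega> \<le> c" "0 \<le> Q t \<omega>" "Q t \<omega> \<le> c"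
    if "\<omega> \<in> space M" for t \<omega>
    using d'[THEN conjunct2, THEN conjunct1, rule_format, OF that, of t] by simp_all
  have mono: "AE \<omega> in M. P s \<omega> \<le> P t \<omega> \<and> Q s \<omega> \<le> Q t \<omega> \<and> r t \<omega> \<le> r s \<omega>" if "s \<le> t" for s t
    using d'[THEN conjunct2, THEN conjunct2, THEN conjunct1, rule_format, OF that] .
  have mart: "expectation (\<lambda>\<omega>. indicator A \<omega> * N t \<omega>) = expectation (\<lambda>\<omega>. indicator A \<omega> * N s \<omega>)"
    if "s \<in> dyadics" "t \<in> dyadics" "s \<le> t" "A \<in> sets (FF s)" for s t A
    using d'[THEN conjunct2, THEN conjunct2, THEN conjunct2, THEN conjunct1, rule_format, OF that] .
  have eq: "AE \<omega> in M. Y t \<omega> * r t \<omega> = N t \<omega> + P t \<omega> - Q t \<omega>" if "t \<in> dyadics" for t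
    using d'[THEN conjunct2, THEN conjunct2, THEN conjunct2, THEN conjunct2, THEN conjunct1, rule_format, OF that] .
  let ?W = "\<lambda>t \<omega>. Y t \<omega> * min 1 (2 * r t \<omega>)"
  have "\<exists>r' N' P' Q'. damped_decomposition (grid_points m) ?W (6 * c) 0 r' N' P' Q'" for m
  proof -
    interpret G: discrete_filtration M "\<lambda>i. FF (grid m i)" by (rule FF_discrete_filtration)
    define u where "u j \<omega> = 1 / max (r (grid m j) \<omega>) (1 / 2)" for j \<omega>
    \<comment> \<open>Running maximum of \<open>u\<close>. It equals \<open>u\<close> almost
      everywhere because \<open>r\<close> decreases almost everywhere, but it increases at every
      sample point.\<close>
    define v where "v j \<omega> = rec_nat (u 0 \<omega>) (\<lambda>j y. max y (u (Suc j) \<omega>)) j" for j \<omega>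
    have v0: "v 0 \<omega> = u 0 \<omega>" and vS: "v (Suc j) \<omega> = max (v j \<omega>) (u (Suc j) \<omega>)" for j \<omega>
      by (simp_all add: v_def)
    have u12: "1 \<le> u j \<omega>" "u j \<omega> \<le> 2" if "\<omega> \<in> space M" for j \<omega>
      using bnd(1,2)[OF that, of "grid m j"] by (auto simp: u_def field_simps max_def)
    have v12: "1 \<le> v j \<omega> \<and> v j \<omega> \<le> 2" if "\<omega> \<in> space M" for j \<omega>
      using u12[OF that] by (induction j) (auto simp: v0 vS max_def)
    have v_mono: "v i \<omega> \<le> v j \<omega>" if "i \<le> j" for i j \<omega>
      using that by (induction j rule: dec_induct) (auto simp: vS)
    have um: "u j \<in> borel_measurable (FF (grid m j))" for j
      unfolding u_def using meas(1) by (intro borel_measurable_divide borel_measurable_max) auto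
    have vm: "v j \<in> borel_measurable (FF (grid m j))" for j
    proof (induction j)
      case 0 then show ?case using um[of 0] by (simp add: v0[abs_def])
    next
      case (Suc j)
      then have "v j \<in> borel_measurable (FF (grid m (Suc j)))" by (rule G.measurable_mono) simp
      then show ?case using um[of "Suc j"] by (simp add: vS[abs_def])
    qed
    have uv: "AE \<omega> in M. v j \<omega> = u j \<omega>" for j
    proof (induction j)
      case (Suc j)
      have "AE \<omega> in M. r (grid m (Suc j)) \<omega> \<le> r (grid m j) \<omega>" using mono[OF grid_le, of j "Suc j" m] by simp
      then show ?case using Suc
      proof eventually_elim
        case (elim \<omega>)
        have "u j \<omega> \<le> u (Suc j) \<omega>" unfolding u_def using elim by (intro divide_left_mono) (auto simp: max_def)
        then show ?case using elim by (simp add: vS)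
      qed
    qed (simp add: v0)
    \<comment> \<open>Summation by parts: the increments of \<open>(N + c) * v\<close> are
      \<open>v l\<close> times those of \<open>N\<close>, plus those of \<open>S\<close>. The shift
      by \<open>c\<close> makes \<open>N + c\<close> nonnegative, so that \<open>S\<close>
      increases; it is compensated in \<open>Q'\<close>.\<close>
    define S where "S j \<omega> = (\<Sum>l<j. (N (grid m (Suc l)) \<omega> + c) * (v (Suc l) \<omega> - v l \<omega>))" for j \<omega>
    define L where "L j \<omega> = (N (grid m j) \<omega> + c) * v j \<omega> - S j \<omega>" for j \<omega>
    define P' where "P' j \<omega> = P (grid m j) \<omega> * v j \<omega> + S j \<omega>" for j \<omega>
    define Q' where "Q' j \<omega> = (Q (grid m j) \<omega> + c) * v j \<omega>" for j \<omega>
    have Nc: "0 \<le> N t \<omega> + c" "N t \<omega> + c \<le> 2 * c" if "\<omega> \<in> space M" for t \<omega>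
      using bnd(3)[OF that, of t] by (auto simp: abs_le_iff)
    have S_mono: "S i \<omega> \<le> S j \<omega>" if "i \<le> j" "\<omega> \<in> space M" for i j \<omega>
      unfolding S_def using Nc(1)[OF that(2)] v_mono that(1) by (intro sum_mono2) (auto intro!: mult_nonneg_nonneg)
    have S0: "0 \<le> S j \<omega>" if "\<omega> \<in> space M" for j \<omega> using S_mono[of 0 j \<omega>] that by (simp add: S_def)
    have S_le: "S j \<omega> \<le> 2 * c" if "\<omega> \<in> space M" for j \<omega>
    proof -
      have "S j \<omega> \<le> (\<Sum>l<j. 2 * c * (v (Suc l) \<omega> - v l \<omega>))"
        unfolding S_def using Nc[OF that] v_mono by (intro sum_mono mult_right_mono) auto
      also have "\<dots> = 2 * c * (v j \<omega> - v 0 \<omega>)"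
        by (simp add: sum_distrib_left[symmetric] sum_lessThan_telescope[of "\<lambda>l. v l \<omega>"])
      also have "\<dots> \<le> 2 * c * 1" using v12[OF that, of j] v12[OF that, of 0] c by (intro mult_left_mono) auto
      finally show ?thesis by simp
    qed
    have Sm: "S j \<in> borel_measurable (FF (grid m j))" for j
      unfolding S_def
    proof (intro borel_measurable_sum borel_measurable_times borel_measurable_add borel_measurable_diff borel_measurable_const)
      fix l assume "l \<in> {..<j}"
      then have l: "Suc l \<le> j" "l \<le> j" by auto
      show "N (grid m (Suc l)) \<in> borel_measurable (FF (grid m j))" using FF_measurable_mono[OF meas(2) grid_le[OF l(1)]] .
      show "v (Suc l) \<in> borel_measurable (FF (grid m j))" "v l \<in> borel_measurable (FF (grid m j))"
        using l by (auto intro: G.measurable_mono[OF vm])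
    qed
    \<comment> \<open>The factor \<open>min 1 (2 * r)\<close> has moved into \<open>?W\<close>, so
      the damping process becomes constant 1 with defect 0. The products with \<open>v\<close> are
      at most \<open>4 * c\<close> and \<open>S\<close> is at most \<open>2 * c\<close>;
      \<open>6 * c\<close> bounds all their combinations.\<close>
    have "damped_decomposition (grid_points m) ?W (6 * c) 0 (\<lambda>t. (\<lambda>j \<omega>. 1) (grid_index m t)) (\<lambda>t. L (grid_index m t))
      (\<lambda>t. P' (grid_index m t)) (\<lambda>t. Q' (grid_index m t))"
    proof (rule damped_decompositionI_grid)
      fix j assume "j \<le> (2::nat) ^ m"
      show "(\<lambda>\<omega>. 1) \<in> borel_measurable (FF (grid m j))" by simp
      show "L j \<in> borel_measurable (FF (grid m j))" "P' j \<in> borel_measurable (FF (grid m j))" "Q' j \<in> borel_measurable (FF (grid m j))"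
        unfolding L_def P'_def Q'_def using meas vm Sm
        by (intro borel_measurable_add borel_measurable_diff borel_measurable_times borel_measurable_const; blast)+
    next
      fix j \<omega> assume w: "\<omega> \<in> space M"
      have a: "0 \<le> x * v j \<omega>" "x * v j \<omega> \<le> y * 2" if "0 \<le> x" "x \<le> y" for x y
        using v12[OF w, of j] that by (auto intro!: mult_mono mult_nonneg_nonneg intro: order_trans)
      have 1: "0 \<le> (N (grid m j) \<omega> + c) * v j \<omega>" "(N (grid m j) \<omega> + c) * v j \<omega> \<le> 2 * c * 2" using a[OF Nc[OF w]] by auto
      have 2: "0 \<le> P (grid m j) \<omega> * v j \<omega>" "P (grid m j) \<omega> * v j \<omega> \<le> c * 2" using a[OF bnd(4,5)[OF w]] by auto
      have 3: "0 \<le> (Q (grid m j) \<omega> + c) * v j \<omega>" "(Q (grid m j) \<omega> + c) * v j \<omega> \<le> 2 * c * 2"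
        using a[of "Q (grid m j) \<omega> + c" "2 * c"] bnd(6,7)[OF w, of "grid m j"] c by auto
      show "(0::real) \<le> 1 \<and> (1::real) \<le> 1 \<and> \<bar>L j \<omega>\<bar> \<le> 6 * c \<and> 0 \<le> P' j \<omega> \<and> P' j \<omega> \<le> 6 * c \<and> 0 \<le> Q' j \<omega> \<and> Q' j \<omega> \<le> 6 * c"
        using 1 2 3 S0[OF w, of j] S_le[OF w, of j] c unfolding L_def P'_def Q'_def by (auto simp: abs_le_iff)
    next
      fix i j assume ij: "i \<le> j" "j \<le> (2::nat) ^ m"
      have "AE \<omega> in M. P (grid m i) \<omega> \<le> P (grid m j) \<omega> \<and> Q (grid m i) \<omega> \<le> Q (grid m j) \<omega> \<and> r (grid m j) \<omega> \<le> r (grid m i) \<omega>"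
        by (rule mono[OF grid_le[OF ij(1)]])
      moreover have "AE \<omega> in M. \<omega> \<in> space M" by simp
      ultimately show "AE \<omega> in M. P' i \<omega> \<le> P' j \<omega> \<and> Q' i \<omega> \<le> Q' j \<omega> \<and> (1::real) \<le> 1"
      proof eventually_elim
        case (elim \<omega>)
        then have w: "\<omega> \<in> space M" by simp
        have v: "0 \<le> v i \<omega>" "v i \<omega> \<le> v j \<omega>" using v12[OF w, of i] v_mono[OF ij(1)] by auto
        have "P (grid m i) \<omega> * v i \<omega> \<le> P (grid m j) \<omega> * v j \<omega>"
          using elim v bnd[OF w] by (intro mult_mono) auto
        moreover have "(Q (grid m i) \<omega> + c) * v i \<omega> \<le> (Q (grid m j) \<omega> + c) * v j \<omega>"
          using elim v bnd[OF w] c by (intro mult_mono add_nonneg_nonneg) auto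
        ultimately show ?case using S_mono[OF ij(1) w] unfolding P'_def Q'_def by auto
      qed
    next
      have Nm: "G.mart_diff (\<lambda>i x. N (grid m (Suc i)) x - N (grid m i) x) (2 ^ m)"
        unfolding G.mart_diff_def
      proof (intro allI impI conjI ballI)
        fix i assume i: "i < (2::nat) ^ m"
        have bN: "N (grid m j) \<in> bmeas (FF (grid m k))" if "j \<le> k" for j k
          using FF_measurable_mono[OF meas(2) grid_le[OF that]] bnd(3) by (intro bmeasI[where c = c]) (auto simp: space_FF)
        show "(\<lambda>x. N (grid m (Suc i)) x - N (grid m i) x) \<in> bmeas (FF (grid m (Suc i)))"
          by (intro bmeas_diff bN) auto
        fix \<phi> assume \<phi>: "\<phi> \<in> bmeas (FF (grid m i))"
        note I = bmeas_integrable[OF bmeas_subalgebra[OF sub_FF bN[OF order_refl]]]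
        have D: "grid m i \<in> dyadics" "grid m (Suc i) \<in> dyadics" 
          using i by (auto intro!: grid_dyadics)
        have "expectation (\<lambda>x. \<phi> x * N (grid m (Suc i)) x) = expectation (\<lambda>x. \<phi> x * N (grid m i) x)"
          by (rule expectation_bmeas_eqI[OF sub_FF I I _ \<phi>]) (use mart[OF D] grid_le[of i "Suc i" m] in auto)
        moreover have "integrable M (\<lambda>x. \<phi> x * N (grid m j) x)" for j
          using integrable_bmeas_mult[OF bmeas_subalgebra[OF sub_FF \<phi>] I] .
        ultimately show "expectation (\<lambda>x. \<phi> x * (N (grid m (Suc i)) x - N (grid m i) x)) = 0"
          by (simp add: right_diff_distrib)
      qed
      have "G.mart_diff (\<lambda>i x. v i x * (N (grid m (Suc i)) x - N (grid m i) x)) (2 ^ m)"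
        by (rule G.mart_diff_mult[OF Nm]) (use vm v12 in \<open>auto intro!: bmeasI[where c = 2] simp: space_FF abs_le_iff\<close>, smt (verit))
      moreover have "v i x * (N (grid m (Suc i)) x - N (grid m i) x) = L (Suc i) x - L i x" for i x
        by (simp add: L_def S_def algebra_simps)
      ultimately show "G.mart_diff (\<lambda>i x. L (Suc i) x - L i x) (2 ^ m)" by simp
    next
      fix j assume j: "j \<le> (2::nat) ^ m"
      then have D: "grid m j \<in> dyadics" by (rule grid_dyadics)
      show "AE \<omega> in M. ?W (grid m j) \<omega> * 1 = L j \<omega> + P' j \<omega> - Q' j \<omega>"
        using eq[OF D] uv[of j] AE_space
      proof eventually_elim
        case (elim \<omega>)
        have "L j \<omega> + P' j \<omega> - Q' j \<omega> = (N (grid m j) \<omega> + P (grid m j) \<omega> - Q (grid m j) \<omega>) * u j \<omega>"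
          using elim by (simp add: L_def P'_def Q'_def algebra_simps)
        also have "\<dots> = Y (grid m j) \<omega> * (r (grid m j) \<omega> * u j \<omega>)" using elim by (simp add: mult.assoc)
        \<comment> \<open>\<open>u\<close> is \<open>1 / r\<close> where
          \<open>r \<ge> 1 / 2\<close> and 2 elsewhere.\<close>
        also have "r (grid m j) \<omega> * u j \<omega> = min 1 (2 * r (grid m j) \<omega>)"
          using bnd(1)[of \<omega> "grid m j"] elim by (auto simp: u_def max_def min_def)
        finally show ?case by simp
      qed
    qed (simp add: prob_space)
    then show ?thesis by blast
  qed
  then have "\<forall>m. \<exists>r' N' P' Q'. damped_decomposition (grid_points m) ?W (6 * c) 0 r' N' P' Q'" by blast
  then obtain r' N' P' Q' where dm: "\<And>m. damped_decomposition (grid_points m) ?W (6 * c) 0 (r' m) (N' m) (P' m) (Q' m)"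
    unfolding choice_iff by blast
  \<comment> \<open>Summation by parts was applied on each grid separately, so a second passage to
    the limit produces one decomposition along all dyadic times.\<close>
  show ?thesis
  proof (rule damped_decomposition_limit[OF _ _ dm])
    fix t assume "t \<in> dyadics"
    have "(\<lambda>\<omega>. min 1 (2 * r t \<omega>)) \<in> bmeas M"
      using FF_measurable_M[OF meas(1)[of t]] bnd(1,2) by (intro bmeasI[where c = 1]) auto
    then show "(\<lambda>\<omega>. Y t \<omega> * min 1 (2 * r t \<omega>)) \<in> bmeas M" using Y[OF \<open>t \<in> dyadics\<close>] by (intro bmeas_mult)
  qed (use c in simp)
qed

end

subsection \<open>Cadlag paths\<close>

lemma cadlag_pathI:
  assumes "\<And>t. 0 \<le> t \<Longrightarrow> t < T \<Longrightarrow> (x \<longlongrightarrow> x t) (at_right t)"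
    and "\<And>t. 0 < t \<Longrightarrow> t \<le> T \<Longrightarrow> \<exists>l. (x \<longlongrightarrow> l) (at_left t)"
  shows "cadlag_path T x"
  using assms by (auto simp: cadlag_path_def continuous_within)

lemma cadlag_path_right: "cadlag_path T x \<Longrightarrow> 0 \<le> t \<Longrightarrow> t < T \<Longrightarrow> (x \<longlongrightarrow> x t) (at_right t)"
  by (auto simp: cadlag_path_def continuous_within)

lemma cadlag_path_left: "cadlag_path T x \<Longrightarrow> 0 < t \<Longrightarrow> t \<le> T \<Longrightarrow> \<exists>l. (x \<longlongrightarrow> l) (at_left t)"
  by (auto simp: cadlag_path_def)

lemma cadlag_path_const: "cadlag_path T (\<lambda>_. c)"
  by (rule cadlag_pathI) auto

lemma cadlag_path_compose:
  assumes x: "cadlag_path T x" and f: "continuous_on UNIV f" shows "cadlag_path T (\<lambda>t. f (x t))"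
proof (rule cadlag_pathI)
  have c: "isCont f z" for z using f by (simp add: continuous_on_eq_continuous_at)
  show "((\<lambda>t. f (x t)) \<longlongrightarrow> f (x t)) (at_right t)" if "0 \<le> t" "t < T" for t
    by (rule isCont_tendsto_compose[OF c cadlag_path_right[OF x that]])
  show "\<exists>l. ((\<lambda>t. f (x t)) \<longlongrightarrow> l) (at_left t)" if "0 < t" "t \<le> T" for t
    using cadlag_path_left[OF x that] isCont_tendsto_compose[OF c] by blast
qed

lemma cadlag_path_add:
  assumes "cadlag_path T x" "cadlag_path T y" shows "cadlag_path T (\<lambda>t. x t + y t)"
proof (rule cadlag_pathI)
  show "((\<lambda>t. x t + y t) \<longlongrightarrow> x t + y t) (at_right t)" if "0 \<le> t" "t < T" for t
    using cadlag_path_right[OF assms(1) that] cadlag_path_right[OF assms(2) that] by (rule tendsto_add)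
  show "\<exists>l. ((\<lambda>t. x t + y t) \<longlongrightarrow> l) (at_left t)" if "0 < t" "t \<le> T" for t
    using cadlag_path_left[OF assms(1) that] cadlag_path_left[OF assms(2) that] tendsto_add by blast
qed

lemma cadlag_path_mult:
  assumes "cadlag_path T x" "cadlag_path T y" shows "cadlag_path T (\<lambda>t. x t * y t)"
proof (rule cadlag_pathI)
  show "((\<lambda>t. x t * y t) \<longlongrightarrow> x t * y t) (at_right t)" if "0 \<le> t" "t < T" for t
    using cadlag_path_right[OF assms(1) that] cadlag_path_right[OF assms(2) that] by (rule tendsto_mult)
  show "\<exists>l. ((\<lambda>t. x t * y t) \<longlongrightarrow> l) (at_left t)" if "0 < t" "t \<le> T" for t
    using cadlag_path_left[OF assms(1) that] cadlag_path_left[OF assms(2) that] tendsto_mult by blast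
qed

lemma cadlag_path_minus: "cadlag_path T x \<Longrightarrow> cadlag_path T (\<lambda>t. - x t)"
  by (rule cadlag_path_compose[where f = uminus]) (auto intro: continuous_intros)

lemma cadlag_path_diff: "cadlag_path T x \<Longrightarrow> cadlag_path T y \<Longrightarrow> cadlag_path T (\<lambda>t. x t - y t)"
  using cadlag_path_add[of T x "\<lambda>t. - y t"] by (simp add: cadlag_path_minus)

lemma cadlag_path_sum: "(\<And>i. i \<in> I \<Longrightarrow> cadlag_path T (x i)) \<Longrightarrow> cadlag_path T (\<lambda>t. \<Sum>i\<in>I. x i t)"
  by (induction I rule: infinite_finite_induct) (auto intro: cadlag_path_const cadlag_path_add)

lemma mono_left_limit:
  fixes g :: "real \<Rightarrow> real"
  assumes g: "\<And>s t. 0 \<le> s \<Longrightarrow> s \<le> t \<Longrightarrow> t \<le> T \<Longrightarrow> g s \<le> g t" and t: "0 < t" "t \<le> T"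
  shows "\<exists>l. (g \<longlongrightarrow> l) (at_left t)"
proof -
  let ?l = "SUP s\<in>{0..<t}. g s"
  have bdd: "bdd_above (g ` {0..<t})" by (rule bdd_aboveI2[of _ _ "g t"]) (use g t in auto)
  have "(g \<longlongrightarrow> ?l) (at_left t)"
  proof (rule order_tendstoI)
    fix a assume "a < ?l"
    then obtain s where s: "0 \<le> s" "s < t" "a < g s" using less_cSUP_iff[OF _ bdd] t by auto
    have "\<forall>\<^sub>F u in at_left t. s < u" by (rule eventually_at_leftI[OF _ s(2)]) auto
    moreover have "\<forall>\<^sub>F u in at_left t. u < t" by (rule eventually_at_leftI[OF _ s(2)]) auto
    ultimately show "\<forall>\<^sub>F u in at_left t. a < g u"
    proof eventually_elim
      case (elim u) then show ?case using g[of s u] s t by auto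
    qed
  next
    fix a assume a: "?l < a"
    have "\<forall>\<^sub>F u in at_left t. 0 < u \<and> u < t" by (rule eventually_at_leftI[OF _ t(1)]) auto
    then show "\<forall>\<^sub>F u in at_left t. g u < a"
    proof eventually_elim
      case (elim u) then show ?case using cSUP_upper[OF _ bdd, of u] a by auto
    qed
  qed
  then show ?thesis by blast
qed

context horizon
begin

text \<open>Only meant for paths that are increasing along the dyadic times: there the infimum is the right limit.\<close>

definition right_limit :: "(real \<Rightarrow> real) \<Rightarrow> real \<Rightarrow> real" where
  "right_limit p t = (if t < T then INF s\<in>{s\<in>dyadics. t < s}. p s else p T)"

context
  fixes p :: "real \<Rightarrow> real" and c :: real
  assumes mono: "\<And>s t. s \<in> dyadics \<Longrightarrow> t \<in> dyadics \<Longrightarrow> s \<le> t \<Longrightarrow> p s \<le> p t"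
    and bnd: "\<And>t. t \<in> dyadics \<Longrightarrow> 0 \<le> p t \<and> p t \<le> c"
begin

lemma right_limit_bdd: "bdd_below (p ` {s\<in>dyadics. t < s})"
  by (rule bdd_belowI2[of _ 0]) (use bnd in auto)

lemma right_limit_le: "s \<in> dyadics \<Longrightarrow> t < s \<Longrightarrow> right_limit p t \<le> p s"
  using cINF_lower[OF right_limit_bdd, of s t] dyadics_in(2)[of s] by (auto simp: right_limit_def)

lemma right_limit_lessD:
  assumes "t < T" "right_limit p t < a" obtains s where "s \<in> dyadics" "t < s" "p s < a"
proof -
  have "{s\<in>dyadics. t < s} \<noteq> {}" using T_dyadics assms(1) by blast
  then show thesis using cINF_less_iff[OF _ right_limit_bdd, of t a] assms that by (auto simp: right_limit_def)
qed

lemma right_limit_mono: "0 \<le> s \<Longrightarrow> s \<le> t \<Longrightarrow> t \<le> T \<Longrightarrow> right_limit p s \<le> right_limit p t"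
proof (cases "t < T")
  case True
  assume st: "0 \<le> s" "s \<le> t" "t \<le> T"
  show ?thesis
  proof (rule ccontr)
    assume "\<not> ?thesis"
    then obtain u where "u \<in> dyadics" "t < u" "p u < right_limit p s" using right_limit_lessD[OF True] by (metis not_le)
    then show False using right_limit_le[of u s] st by auto
  qed
next
  case False
  assume st: "0 \<le> s" "s \<le> t" "t \<le> T"
  then show ?thesis using False right_limit_le[OF T_dyadics, of s] by (auto simp: right_limit_def)
qed

lemma right_limit_tendsto:
  assumes t: "t < T" and s: "\<And>k. s k \<in> dyadics" "\<And>k. t < s k" "s \<longlonglongrightarrow> t"
  shows "(\<lambda>k. p (s k)) \<longlonglongrightarrow> right_limit p t"
proof (rule order_tendstoI)
  fix a assume "a < right_limit p t"
  then show "\<forall>\<^sub>F k in sequentially. a < p (s k)"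
    using right_limit_le[OF s(1) s(2)] by (intro always_eventually allI) (rule less_le_trans)
next
  fix a assume "right_limit p t < a"
  then obtain u where u: "u \<in> dyadics" "t < u" "p u < a" using right_limit_lessD[OF t] by metis
  have "\<forall>\<^sub>F k in sequentially. s k < u" using s(3) u(2) by (rule order_tendstoD)
  then show "\<forall>\<^sub>F k in sequentially. p (s k) < a"
  proof eventually_elim
    case (elim k) then show ?case using mono[OF s(1) u(1), of k] u by auto
  qed
qed

lemma right_limit_cadlag: "cadlag_path T (right_limit p)"
proof (rule cadlag_pathI)
  fix t assume t: "0 \<le> t" "t < T"
  show "(right_limit p \<longlongrightarrow> right_limit p t) (at_right t)"
  proof (rule order_tendstoI)
    fix a assume a: "a < right_limit p t"
    have "\<forall>\<^sub>F u in at_right t. t < u \<and> u < T" by (rule eventually_at_rightI[OF _ t(2)]) auto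
    then show "\<forall>\<^sub>F u in at_right t. a < right_limit p u"
    proof eventually_elim
      case (elim u) then show ?case using right_limit_mono[of t u] t a by auto
    qed
  next
    fix a assume "right_limit p t < a"
    then obtain s where s: "s \<in> dyadics" "t < s" "p s < a" using right_limit_lessD[OF t(2)] by metis
    have "\<forall>\<^sub>F u in at_right t. u < s" by (rule eventually_at_rightI[OF _ s(2)]) auto
    then show "\<forall>\<^sub>F u in at_right t. right_limit p u < a"
    proof eventually_elim
      case (elim u) then show ?case using right_limit_le[OF s(1), of u] s by auto
    qed
  qed
qed (rule mono_left_limit[OF right_limit_mono])

lemma right_limit_bounds:
  assumes "0 \<le> t" "t \<le> T" shows "0 \<le> right_limit p t" "right_limit p t \<le> c"
proof -
  show "right_limit p t \<le> c"
    using right_limit_le[OF T_dyadics, of t] bnd[OF T_dyadics] assms by (cases "t < T") (auto simp: right_limit_def)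
  show "0 \<le> right_limit p t"
  proof (cases "t < T")
    case True
    show ?thesis
    proof (rule ccontr)
      assume "\<not> ?thesis"
      then obtain u where "u \<in> dyadics" "p u < 0" using right_limit_lessD[OF True] by (metis not_le)
      then show False using bnd[of u] by auto
    qed
  next
    case False then show ?thesis using bnd[OF T_dyadics] by (simp add: right_limit_def)
  qed
qed

end

lemma dyadic_sequence:
  assumes "0 \<le> t" "t < u" "u \<le> T"
  shows "\<exists>s. (\<forall>k. s k \<in> dyadics \<and> t < s k \<and> s k < u) \<and> s \<longlonglongrightarrow> t"
proof -
  define v where "v k = t + (u - t) * inverse (real (Suc k))" for k
  have v: "t < v k" "v k \<le> u" for k
  proof -
    have "(u - t) * inverse (real (Suc k)) \<le> (u - t) * 1" using assms by (intro mult_left_mono) (auto simp: inverse_le_1_iff)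
    from add_left_mono[OF this, of t] show "v k \<le> u" unfolding v_def by simp
    show "t < v k" unfolding v_def using assms by simp
  qed
  have "\<exists>s\<in>dyadics. t < s \<and> s < v k" for k using dyadic_between[of t "v k"] assms v[of k] by auto
  then have "\<forall>k. \<exists>s. s \<in> dyadics \<and> t < s \<and> s < v k" by blast
  then obtain s where s: "\<And>k. s k \<in> dyadics" "\<And>k. t < s k" "\<And>k. s k < v k" unfolding choice_iff by blast
  have "v \<longlonglongrightarrow> t + (u - t) * 0" unfolding v_def by (intro tendsto_intros LIMSEQ_inverse_real_of_nat)
  then have "v \<longlonglongrightarrow> t" by simp
  then have "s \<longlonglongrightarrow> t"
    by (intro tendsto_sandwich[OF _ _ tendsto_const \<open>v \<longlonglongrightarrow> t\<close>]) (use s in \<open>auto intro!: always_eventually less_imp_le\<close>)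
  moreover have "s k < u" for k using s(3)[of k] v(2)[of k] by simp
  ultimately show ?thesis using s by blast
qed

subsection \<open>Regularisation\<close>

text \<open>Off a null set the identities hold at all dyadic times simultaneously, and
  \<open>P\<close>, \<open>Q\<close> and \<open>1 - r\<close> increase along these times. Their
  right limits are cadlag, and the martingale is read off from the identity, so its regularity comes
  from that of \<open>Y\<close> and of monotone paths.\<close>

lemma regular_decomposition:
  fixes Y :: "real \<Rightarrow> 'a \<Rightarrow> real"
  assumes Y_meas: "\<And>t. t \<in> {0..T} \<Longrightarrow> Y t \<in> borel_measurable (FF t)"
    and Y_bound: "\<And>t \<omega>. t \<in> {0..T} \<Longrightarrow> \<omega> \<in> space M \<Longrightarrow> \<bar>Y t \<omega>\<bar> \<le> K"
    and Y_cadlag: "\<And>\<omega>. \<omega> \<in> space M \<Longrightarrow> cadlag_path T (\<lambda>t. Y t \<omega>)"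
    and K: "K > 0" and gain: "grid_no_gain Y" and \<epsilon>: "\<epsilon> > 0"
  shows "\<exists>\<alpha> N B c. stopping_time_upto M F T \<alpha> \<and> prob {\<omega>\<in>space M. \<alpha> \<omega> < T} \<le> \<epsilon> \<and>
    (\<forall>t\<in>{0..T}. N t \<in> borel_measurable (FF t)) \<and> (\<forall>\<omega>\<in>space M. cadlag_path T (\<lambda>t. N t \<omega>)) \<and>
    (\<forall>t\<in>{0..T}. \<forall>\<omega>\<in>space M. \<bar>N t \<omega>\<bar> \<le> c) \<and>
    (\<forall>t\<in>{0..T}. \<forall>A\<in>sets (FF t). expectation (\<lambda>\<omega>. indicator A \<omega> * N t \<omega>) = expectation (\<lambda>\<omega>. indicator A \<omega> * N T \<omega>)) \<and>
    (AE \<omega> in M. (\<exists>g. \<forall>s t. 0 \<le> s \<and> s \<le> t \<and> t \<le> T \<longrightarrow> \<bar>B t \<omega> - B s \<omega>\<bar> \<le> g t - (g s :: real)) \<and>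
      (\<forall>t\<in>{0..T}. t < \<alpha> \<omega> \<longrightarrow> Y t \<omega> = N t \<omega> + B t \<omega>))"
proof -
  have bY: "Y t \<in> bmeas M" if "t \<in> dyadics" for t
    using dyadics_in[OF that] FF_measurable_M[OF Y_meas] Y_bound by (intro bmeasI[where c = K]) auto
  \<comment> \<open>Half of \<open>\<epsilon>\<close>, because Markov's inequality at level
    \<open>1 / 2\<close> doubles it.\<close>
  have "\<exists>c\<ge>0. \<exists>r N P Q. damped_decomposition dyadics Y c (\<epsilon> / 2) r N P Q"
    by (rule damped_decomposition_exists[OF Y_meas Y_bound K gain]) (use \<epsilon> in auto)
  then obtain c r N0 P0 Q0 where c: "c \<ge> 0" and d0: "damped_decomposition dyadics Y c (\<epsilon> / 2) r N0 P0 Q0" by blast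
  obtain r' N' P Q where d: "damped_decomposition dyadics (\<lambda>t \<omega>. Y t \<omega> * min 1 (2 * r t \<omega>)) (6 * c) 0 r' N' P Q"
    using damped_decomposition_undamp[OF d0 c bY] by blast
  note d0' = d0[unfolded damped_decomposition_def] and d' = d[unfolded damped_decomposition_def]
  have r_meas: "r t \<in> borel_measurable (FF t)" for t using d0'[THEN conjunct1, rule_format, of t] by simp
  have meas: "r' t \<in> borel_measurable (FF t)" "N' t \<in> borel_measurable (FF t)" for t
    using d'[THEN conjunct1, rule_format, of t] by simp_all
  have r01: "0 \<le> r t \<omega>" "r t \<omega> \<le> 1" if "\<omega> \<in> space M" for t \<omega>
    using d0'[THEN conjunct2, THEN conjunct1, rule_format, OF that, of t] by simp_all
  have bnd: "0 \<le> r' t \<omega>" "r' t \<omega> \<le> 1" "\<bar>N' t \<omega>\<bar> \<le> 6 * c" "0 \<le> P t \<omega>" "P t \<omega> \<le> 6 * c" "0 \<le> Q t \<omega>" "Q t \<omega> \<le> 6 * c"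
    if "\<omega> \<in> space M" for t \<omega>
    using d'[THEN conjunct2, THEN conjunct1, rule_format, OF that, of t] by simp_all
  have rT: "1 - \<epsilon> / 2 \<le> expectation (r T)" "1 \<le> expectation (r' T)"
    using d0'[THEN conjunct2, THEN conjunct2, THEN conjunct2, THEN conjunct2, THEN conjunct2]
      d'[THEN conjunct2, THEN conjunct2, THEN conjunct2, THEN conjunct2, THEN conjunct2] by simp_all
  have mart: "expectation (\<lambda>\<omega>. indicator A \<omega> * N' t \<omega>) = expectation (\<lambda>\<omega>. indicator A \<omega> * N' s \<omega>)"
    if "s \<in> dyadics" "t \<in> dyadics" "s \<le> t" "A \<in> sets (FF s)" for s t A
    using d'[THEN conjunct2, THEN conjunct2, THEN conjunct2, THEN conjunct1, rule_format, OF that] .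
  let ?good = "\<lambda>\<omega>. (\<forall>s\<in>dyadics. \<forall>t\<in>dyadics. s \<le> t \<longrightarrow> P s \<omega> \<le> P t \<omega> \<and> Q s \<omega> \<le> Q t \<omega> \<and> r t \<omega> \<le> r s \<omega>) \<and>
    (\<forall>t\<in>dyadics. Y t \<omega> * min 1 (2 * r t \<omega>) = N' t \<omega> + P t \<omega> - Q t \<omega>)"
  have "AE \<omega> in M. ?good \<omega>"
  proof -
    have 1: "AE \<omega> in M. \<forall>s\<in>dyadics. \<forall>t\<in>dyadics. s \<le> t \<longrightarrow> P s \<omega> \<le> P t \<omega> \<and> Q s \<omega> \<le> Q t \<omega> \<and> r t \<omega> \<le> r s \<omega>"
    proof (intro AE_ball_countable[THEN iffD2] ballI countable_dyadics)
      fix s t assume "s \<in> dyadics" "t \<in> dyadics"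
      show "AE \<omega> in M. s \<le> t \<longrightarrow> P s \<omega> \<le> P t \<omega> \<and> Q s \<omega> \<le> Q t \<omega> \<and> r t \<omega> \<le> r s \<omega>"
      proof (cases "s \<le> t")
        case True
        show ?thesis
          using d'[THEN conjunct2, THEN conjunct2, THEN conjunct1, rule_format, OF True]
            d0'[THEN conjunct2, THEN conjunct2, THEN conjunct1, rule_format, OF True]
          by eventually_elim simp
      qed simp
    qed
    have 2: "AE \<omega> in M. \<forall>t\<in>dyadics. Y t \<omega> * min 1 (2 * r t \<omega>) = N' t \<omega> + P t \<omega> - Q t \<omega>"
    proof (intro AE_ball_countable[THEN iffD2] ballI countable_dyadics)
      fix t assume t: "t \<in> dyadics"
      \<comment> \<open>\<open>r'\<close> is at most 1 and has expectation at least 1 at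
        \<open>T\<close>, hence is 1 almost everywhere there and, being decreasing, at every earlier
        time.\<close>
      have ir: "integrable M (r' T)"
        using FF_measurable_M[OF meas(1)] bnd(1,2) by (intro bmeas_integrable bmeasI[where c = 1]) auto
      have z: "AE \<omega> in M. 0 \<le> 1 - r' T \<omega>" using bnd(2) by (intro AE_I2) simp
      have "expectation (\<lambda>\<omega>. 1 - r' T \<omega>) = 1 - expectation (r' T)" using ir by (simp add: prob_space)
      then have "expectation (\<lambda>\<omega>. 1 - r' T \<omega>) = 0" using integral_nonneg_AE[OF z] rT(2) by linarith
      then have "AE \<omega> in M. 1 - r' T \<omega> = 0" using integral_nonneg_eq_0_iff_AE[OF _ z] ir by simp
      moreover have "AE \<omega> in M. r' T \<omega> \<le> r' t \<omega>"
        using d'[THEN conjunct2, THEN conjunct2, THEN conjunct1, rule_format, OF dyadics_in(2)[OF t]] by eventually_elim simp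
      moreover have "AE \<omega> in M. Y t \<omega> * min 1 (2 * r t \<omega>) * r' t \<omega> = N' t \<omega> + P t \<omega> - Q t \<omega>"
        using d'[THEN conjunct2, THEN conjunct2, THEN conjunct2, THEN conjunct2, THEN conjunct1, rule_format, OF t] .
      moreover have "AE \<omega> in M. r' t \<omega> \<le> 1" using bnd(2) by (intro AE_I2)
      ultimately show "AE \<omega> in M. Y t \<omega> * min 1 (2 * r t \<omega>) = N' t \<omega> + P t \<omega> - Q t \<omega>"
      proof eventually_elim
        case (elim \<omega>)
        then have "r' t \<omega> = 1" by simp
        then show ?case using elim by simp
      qed
    qed
    show ?thesis using 1 2 by eventually_elim (rule conjI)
  qed
  then obtain Z where Z: "{\<omega>\<in>space M. \<not> ?good \<omega>} \<subseteq> Z" "Z \<in> null_sets M"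
    unfolding eventually_ae_filter by blast
  have good: "?good \<omega>" if "\<omega> \<in> space M" "\<omega> \<notin> Z" for \<omega> using Z(1) that by blast
  have P_mono: "P s \<omega> \<le> P t \<omega>" and Q_mono: "Q s \<omega> \<le> Q t \<omega>" and r_mono: "1 - r s \<omega> \<le> 1 - r t \<omega>"
    if "\<omega> \<in> space M" "\<omega> \<notin> Z" "s \<in> dyadics" "t \<in> dyadics" "s \<le> t" for s t \<omega>
    using good[OF that(1,2)] that(3-5) by auto
  have eq: "N' t \<omega> = Y t \<omega> * min 1 (2 * r t \<omega>) - P t \<omega> + Q t \<omega>" if "\<omega> \<in> space M" "\<omega> \<notin> Z" "t \<in> dyadics" for t \<omega>
    using good[OF that(1,2)] that(3) by simp
  have Pb: "0 \<le> P t \<omega> \<and> P t \<omega> \<le> 6 * c" and Qb: "0 \<le> Q t \<omega> \<and> Q t \<omega> \<le> 6 * c" and rb: "0 \<le> 1 - r t \<omega> \<and> 1 - r t \<omega> \<le> 1"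
    if "\<omega> \<in> space M" for t \<omega>
    using bnd[OF that, of t] r01[OF that, of t] by auto
  \<comment> \<open>\<open>right_limit\<close> is meant for increasing paths, so it is applied to
    \<open>1 - r\<close>; \<open>w\<close> is then the right limit of
    \<open>min 1 (2 * r)\<close>.\<close>
  define R where "R t \<omega> = right_limit (\<lambda>s. 1 - r s \<omega>) t" for t \<omega>
  define w where "w t \<omega> = min 1 (2 * (1 - R t \<omega>))" for t \<omega>
  define P' where "P' t \<omega> = right_limit (\<lambda>s. P s \<omega>) t" for t \<omega>
  define Q' where "Q' t \<omega> = right_limit (\<lambda>s. Q s \<omega>) t" for t \<omega>
  \<comment> \<open>Zero on the null set \<open>Z\<close>, so that every path is cadlag;
    \<open>Z\<close> belongs to every member of the filtration, which keeps \<open>N\<close>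
    adapted.\<close>
  define N where "N t \<omega> = (if \<omega> \<in> Z then 0 else Y t \<omega> * w t \<omega> - P' t \<omega> + Q' t \<omega>)" for t \<omega>
  define B where "B t \<omega> = P' t \<omega> - Q' t \<omega>" for t \<omega>
  define Nk where "Nk t \<omega> = (if \<omega> \<in> Z then 0 else N' t \<omega>)" for t \<omega>
  have Z_sets: "Z \<in> sets (FF t)" for t using Z(2) by (rule null_sets_FF)
  have Nk_meas: "Nk t \<in> borel_measurable (FF t)" for t
    unfolding Nk_def using sets.Int_space_eq2[OF Z_sets] Z_sets meas(2) by (intro measurable_If_set) auto
  have Nk_bound: "\<bar>Nk t \<omega>\<bar> \<le> 6 * c" if "\<omega> \<in> space M" for t \<omega> unfolding Nk_def using bnd(3)[OF that] c by simp
  have NT: "N T \<omega> = Nk T \<omega>" if "\<omega> \<in> space M" for \<omega>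
    using eq[OF that _ T_dyadics] r01[OF that, of T]
    by (auto simp: N_def Nk_def w_def R_def P'_def Q'_def right_limit_def)
  \<comment> \<open>\<open>N\<close> is the right limit of \<open>Nk\<close> along dyadic times.
    Measurability then follows from right-continuity of the filtration, the martingale property from
    dominated convergence.\<close>
  have N_lim: "(\<lambda>k. Nk (s k) \<omega>) \<longlonglongrightarrow> N t \<omega>"
    if t: "0 \<le> t" "t < T" and s: "\<And>k. s k \<in> dyadics" "\<And>k. t < s k" "s \<longlonglongrightarrow> t" and \<omega>: "\<omega> \<in> space M" for t s \<omega>
  proof (cases "\<omega> \<in> Z")
    case False
    note g = \<omega> False
    have "filterlim s (at_right t) sequentially"
      using s by (auto simp: filterlim_at intro!: always_eventually)
    then have "(\<lambda>k. Y (s k) \<omega>) \<longlonglongrightarrow> Y t \<omega>"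
      by (rule filterlim_compose[OF cadlag_path_right[OF Y_cadlag[OF \<omega>] t]])
    moreover have "(\<lambda>k. P (s k) \<omega>) \<longlonglongrightarrow> P' t \<omega>" unfolding P'_def
      by (rule right_limit_tendsto[OF P_mono[OF g] Pb[OF \<omega>] t(2) s])
    moreover have "(\<lambda>k. Q (s k) \<omega>) \<longlonglongrightarrow> Q' t \<omega>" unfolding Q'_def
      by (rule right_limit_tendsto[OF Q_mono[OF g] Qb[OF \<omega>] t(2) s])
    moreover have "(\<lambda>k. 1 - r (s k) \<omega>) \<longlonglongrightarrow> R t \<omega>" unfolding R_def
      by (rule right_limit_tendsto[OF r_mono[OF g] rb[OF \<omega>] t(2) s])
    then have "(\<lambda>k. min 1 (2 * (1 - (1 - r (s k) \<omega>)))) \<longlonglongrightarrow> w t \<omega>"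
      unfolding w_def by (intro tendsto_intros)
    ultimately have "(\<lambda>k. Y (s k) \<omega> * min 1 (2 * (1 - (1 - r (s k) \<omega>))) - P (s k) \<omega> + Q (s k) \<omega>) \<longlonglongrightarrow>
        Y t \<omega> * w t \<omega> - P' t \<omega> + Q' t \<omega>"
      by (intro tendsto_intros)
    then show ?thesis using False eq[OF g s(1)] by (simp add: Nk_def N_def)
  qed (simp add: Nk_def N_def)
  have N_meas: "N t \<in> borel_measurable (FF t)" if t: "t \<in> {0..T}" for t
  proof (cases "t < T")
    case True
    show ?thesis
    proof (rule measurable_FF_right[OF True])
      fix u assume u: "t < u" "u \<le> T"
      obtain s where s: "\<And>k. s k \<in> dyadics" "\<And>k. t < s k" "\<And>k. s k < u" "s \<longlonglongrightarrow> t"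
        using dyadic_sequence[of t u] t u by auto
      show "N t \<in> borel_measurable (FF u)"
      proof (rule borel_measurable_LIMSEQ_real)
        show "(\<lambda>k. Nk (s k) \<omega>) \<longlonglongrightarrow> N t \<omega>" if "\<omega> \<in> space (FF u)" for \<omega>
          using N_lim[OF _ True s(1,2,4)] t that by (simp add: space_FF)
        show "Nk (s k) \<in> borel_measurable (FF u)" for k
          using FF_measurable_mono[OF Nk_meas less_imp_le[OF s(3)]] .
      qed
    qed
  next
    case False
    then have "t = T" using t by simp
    then show ?thesis using Nk_meas[of T] NT by (subst measurable_cong[of _ _ "Nk T"]) (auto simp: space_FF)
  qed
  have N_bound: "\<bar>N t \<omega>\<bar> \<le> 6 * c" if t: "t \<in> {0..T}" and \<omega>: "\<omega> \<in> space M" for t \<omega>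
  proof (cases "t < T")
    case True
    obtain s where s: "\<And>k. s k \<in> dyadics" "\<And>k. t < s k" "s \<longlonglongrightarrow> t"
      using dyadic_sequence[of t T] t True by auto
    show ?thesis
      by (rule LIMSEQ_le_const2[OF tendsto_rabs[OF N_lim[OF _ True s \<omega>]]]) (use t Nk_bound[OF \<omega>] in auto)
  next
    case False then show ?thesis using t NT[OF \<omega>] Nk_bound[OF \<omega>, of T] by simp
  qed
  have N_mart: "expectation (\<lambda>\<omega>. indicator A \<omega> * N t \<omega>) = expectation (\<lambda>\<omega>. indicator A \<omega> * N T \<omega>)"
    if t: "t \<in> {0..T}" and A: "A \<in> sets (FF t)" for t A
  proof (cases "t < T")
    case True
    obtain s where s: "\<And>k. s k \<in> dyadics" "\<And>k. t < s k" "s \<longlonglongrightarrow> t"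
      using dyadic_sequence[of t T] t True by auto
    have AM: "A \<in> sets M" using sets_FF_M[OF A] .
    have ae: "expectation (\<lambda>\<omega>. indicator A \<omega> * Nk u \<omega>) = expectation (\<lambda>\<omega>. indicator A \<omega> * N' u \<omega>)" for u
    proof (rule integral_cong_AE)
      show "AE \<omega> in M. indicator A \<omega> * Nk u \<omega> = indicator A \<omega> * N' u \<omega>"
        using AE_not_in[OF Z(2)] by eventually_elim (simp add: Nk_def)
    qed (use AM FF_measurable_M[OF Nk_meas] FF_measurable_M[OF meas(2)] in auto)
    have "(\<lambda>k. expectation (\<lambda>\<omega>. indicator A \<omega> * Nk (s k) \<omega>)) \<longlonglongrightarrow> expectation (\<lambda>\<omega>. indicator A \<omega> * N t \<omega>)"
    proof (rule integral_dominated_convergence[where w = "\<lambda>_. 6 * c"])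
      show "AE \<omega> in M. (\<lambda>k. indicator A \<omega> * Nk (s k) \<omega>) \<longlonglongrightarrow> indicator A \<omega> * N t \<omega>"
        using N_lim[OF _ True s] t by (intro AE_I2 tendsto_mult tendsto_const) auto
      show "AE \<omega> in M. norm (indicator A \<omega> * Nk (s k) \<omega>) \<le> 6 * c" for k
        using Nk_bound c by (intro AE_I2) (auto simp: indicator_def)
      show "(\<lambda>\<omega>. indicator A \<omega> * N t \<omega>) \<in> borel_measurable M"
        using AM FF_measurable_M[OF N_meas[OF t]] by (intro borel_measurable_times borel_measurable_indicator)
      show "(\<lambda>\<omega>. indicator A \<omega> * Nk (s k) \<omega>) \<in> borel_measurable M" for k
        using AM FF_measurable_M[OF Nk_meas] by (intro borel_measurable_times borel_measurable_indicator)
    qed simp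
    moreover have "expectation (\<lambda>\<omega>. indicator A \<omega> * Nk (s k) \<omega>) = expectation (\<lambda>\<omega>. indicator A \<omega> * Nk T \<omega>)" for k
      unfolding ae using mart[OF s(1)[of k] T_dyadics dyadics_in(2)[OF s(1)], of A] sets_FF_mono[of t "s k"] s(2)[of k] A by auto
    moreover have "expectation (\<lambda>\<omega>. indicator A \<omega> * Nk T \<omega>) = expectation (\<lambda>\<omega>. indicator A \<omega> * N T \<omega>)"
      by (rule Bochner_Integration.integral_cong) (auto simp: NT)
    ultimately show ?thesis using LIMSEQ_unique[OF _ tendsto_const] by fastforce
  next
    case False then show ?thesis using t by simp
  qed
  have N_cadlag: "cadlag_path T (\<lambda>t. N t \<omega>)" if \<omega>: "\<omega> \<in> space M" for \<omega>
  proof (cases "\<omega> \<in> Z")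
    case True then show ?thesis by (simp add: N_def cadlag_path_const)
  next
    case False
    note g = \<omega> False
    have "cadlag_path T (\<lambda>t. P' t \<omega>)" unfolding P'_def by (rule right_limit_cadlag[OF P_mono[OF g] Pb[OF \<omega>]])
    moreover have "cadlag_path T (\<lambda>t. Q' t \<omega>)" unfolding Q'_def by (rule right_limit_cadlag[OF Q_mono[OF g] Qb[OF \<omega>]])
    moreover have "cadlag_path T (\<lambda>t. R t \<omega>)" unfolding R_def by (rule right_limit_cadlag[OF r_mono[OF g] rb[OF \<omega>]])
    then have "cadlag_path T (\<lambda>t. w t \<omega>)" unfolding w_def
      by (rule cadlag_path_compose[where f = "\<lambda>y. min 1 (2 * (1 - y))"]) (intro continuous_intros)
    ultimately have "cadlag_path T (\<lambda>t. Y t \<omega> * w t \<omega> - P' t \<omega> + Q' t \<omega>)"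
      by (intro cadlag_path_add cadlag_path_diff cadlag_path_mult Y_cadlag \<omega>)
    then show ?thesis using False by (simp add: N_def)
  qed
  \<comment> \<open>From the first drop of \<open>r\<close> below \<open>1 / 2\<close> on,
    \<open>w\<close> may differ from 1. Inserting \<open>T\<close> gives the value \<open>T\<close>
    if there is no drop.\<close>
  define \<alpha> where "\<alpha> \<omega> = Inf (insert T {t\<in>dyadics. r t \<omega> < 1 / 2})" for \<omega>
  have \<alpha>_bdd: "bdd_below (insert T {t\<in>dyadics. r t \<omega> < 1 / 2})" for \<omega>
    by (rule bdd_belowI[of _ 0]) (use dyadics_in T_pos in auto)
  have \<alpha>_in: "\<alpha> \<omega> \<in> {0..T}" for \<omega>
    unfolding \<alpha>_def using cInf_lower[OF _ \<alpha>_bdd[of \<omega>], of T] dyadics_in T_pos by (auto intro!: cInf_greatest)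
  have \<alpha>_less: "\<alpha> \<omega> < u \<longleftrightarrow> (\<exists>s\<in>dyadics. s < u \<and> r s \<omega> < 1 / 2)" if "u \<le> T" for u \<omega>
    unfolding \<alpha>_def cInf_less_iff[OF insert_not_empty \<alpha>_bdd] using that by auto
  have st: "stopping_time_upto M F T \<alpha>"
  proof (rule stopping_time_uptoI)
    fix u assume u: "0 < u" "u \<le> T"
    have "{\<omega>\<in>space M. \<alpha> \<omega> < u} = (\<Union>s\<in>{s\<in>dyadics. s < u}. {\<omega>\<in>space (FF u). r s \<omega> < 1 / 2})"
      using \<alpha>_less[OF u(2)] by (auto simp: space_FF)
    also have "\<dots> \<in> sets (FF u)"
    proof (intro sets.countable_UN')
      show "countable {s\<in>dyadics. s < u}" using countable_dyadics by (rule countable_subset[rotated]) auto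
      have "{\<omega>\<in>space (FF u). r s \<omega> < 1 / 2} \<in> sets (FF u)" if "s < u" for s
      proof -
        have [measurable]: "r s \<in> borel_measurable (FF u)" using FF_measurable_mono[OF r_meas, of s u] that by simp
        show ?thesis by measurable
      qed
      then show "(\<lambda>s. {\<omega>\<in>space (FF u). r s \<omega> < 1 / 2}) ` {s\<in>dyadics. s < u} \<subseteq> sets (FF u)" by blast
    qed
    finally show "{\<omega>\<in>space M. \<alpha> \<omega> < u} \<in> sets (FF u)" .
  qed (rule \<alpha>_in)
  have "prob {\<omega>\<in>space M. \<alpha> \<omega> < T} \<le> \<epsilon>"
  proof -
    have rM: "r T \<in> bmeas M" using FF_measurable_M[OF r_meas] r01 by (intro bmeasI[where c = 1]) auto
    have i: "integrable M (\<lambda>\<omega>. 1 - r T \<omega>)" using bmeas_integrable[OF rM] by simp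
    have [measurable]: "r T \<in> borel_measurable M" using rM by (rule bmeas_measurable)
    have "prob {\<omega>\<in>space M. \<alpha> \<omega> < T} \<le> prob {\<omega>\<in>space M. 1 / 2 \<le> 1 - r T \<omega>}"
    proof (rule finite_measure_mono_AE)
      show "AE \<omega> in M. \<omega> \<in> {\<omega>\<in>space M. \<alpha> \<omega> < T} \<longrightarrow> \<omega> \<in> {\<omega>\<in>space M. 1 / 2 \<le> 1 - r T \<omega>}"
        using AE_not_in[OF Z(2)] AE_space
      proof eventually_elim
        case (elim \<omega>)
        have "1 / 2 \<le> 1 - r T \<omega>" if a: "\<alpha> \<omega> < T"
        proof -
          obtain s where s: "s \<in> dyadics" "r s \<omega> < 1 / 2" using \<alpha>_less[of T \<omega>] a by blast
          then show ?thesis using r_mono[OF elim(2,1) s(1) T_dyadics dyadics_in(2)[OF s(1)]] by simp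
        qed
        then show ?case using elim by simp
      qed
      show "{\<omega>\<in>space M. 1 / 2 \<le> 1 - r T \<omega>} \<in> events" by measurable
    qed
    also have "\<dots> \<le> expectation (\<lambda>\<omega>. 1 - r T \<omega>) / (1 / 2)"
      by (rule integral_Markov_inequality_measure[where A = "{}"]) (use i r01 in \<open>auto intro!: AE_I2\<close>)
    also have "expectation (\<lambda>\<omega>. 1 - r T \<omega>) = 1 - expectation (r T)" using bmeas_integrable[OF rM] by (simp add: prob_space)
    finally show ?thesis using rT(1) by simp
  qed
  moreover have "AE \<omega> in M. (\<exists>g. \<forall>s t. 0 \<le> s \<and> s \<le> t \<and> t \<le> T \<longrightarrow> \<bar>B t \<omega> - B s \<omega>\<bar> \<le> g t - g s) \<and>
      (\<forall>t\<in>{0..T}. t < \<alpha> \<omega> \<longrightarrow> Y t \<omega> = N t \<omega> + B t \<omega>)"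
    using AE_not_in[OF Z(2)] AE_space
  proof eventually_elim
    case (elim \<omega>)
    note g = elim(2,1)
    have "\<bar>B t \<omega> - B s \<omega>\<bar> \<le> (P' t \<omega> + Q' t \<omega>) - (P' s \<omega> + Q' s \<omega>)" if "0 \<le> s" "s \<le> t" "t \<le> T" for s t
      using right_limit_mono[where p = "\<lambda>s. P s \<omega>", OF P_mono[OF g] Pb[OF elim(2)] that]
        right_limit_mono[where p = "\<lambda>s. Q s \<omega>", OF Q_mono[OF g] Qb[OF elim(2)] that]
      unfolding B_def P'_def Q'_def by simp
    then have 1: "\<exists>g. \<forall>s t. 0 \<le> s \<and> s \<le> t \<and> t \<le> T \<longrightarrow> \<bar>B t \<omega> - B s \<omega>\<bar> \<le> g t - g s"
      by (intro exI[of _ "\<lambda>t. P' t \<omega> + Q' t \<omega>"]) blast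
    have "Y t \<omega> = N t \<omega> + B t \<omega>" if t: "t \<in> {0..T}" "t < \<alpha> \<omega>" for t
    proof -
      obtain s where s: "s \<in> dyadics" "t < s" "s < \<alpha> \<omega>" using dyadic_between[of t "\<alpha> \<omega>"] t \<alpha>_in[of \<omega>] by auto
      have sT: "s \<le> T" using dyadics_in(2)[OF s(1)] .
      \<comment> \<open>A second dyadic time after \<open>s\<close> turns the strict description of
        \<open>\<alpha>\<close> into \<open>r s \<ge> 1 / 2\<close>.\<close>
      obtain u where u: "u \<in> dyadics" "s < u" "u < \<alpha> \<omega>" using dyadic_between[of s "\<alpha> \<omega>"] s t \<alpha>_in[of \<omega>] by auto
      have "\<not> r s \<omega> < 1 / 2" using \<alpha>_less[of u \<omega>] u s dyadics_in(2)[OF u(1)] by auto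
      then have "R t \<omega> \<le> 1 / 2"
        using right_limit_le[where p = "\<lambda>s. 1 - r s \<omega>", OF r_mono[OF g] rb[OF elim(2)] s(1,2)] by (simp add: R_def)
      then have "w t \<omega> = 1" by (simp add: w_def)
      then show ?thesis using elim(1) by (simp add: N_def B_def)
    qed
    then show ?case using 1 by blast
  qed
  ultimately show ?thesis
    using st N_meas N_cadlag N_bound N_mart
    by (intro exI[of _ \<alpha>] exI[of _ N] exI[of _ B] exI[of _ "6 * c"]) blast
qed

end

subsection \<open>Stopped processes\<close>

lemma cadlag_path_stopped:
  assumes x: "cadlag_path T x" and a: "0 \<le> a" shows "cadlag_path T (\<lambda>t. x (min a t))"
proof (rule cadlag_pathI)
  fix t assume t: "0 \<le> t" "t < T"
  show "((\<lambda>t. x (min a t)) \<longlongrightarrow> x (min a t)) (at_right t)"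
  proof (cases "t < a")
    case True
    have "\<forall>\<^sub>F u in at_right t. x u = x (min a u)"
      by (rule eventually_at_rightI[OF _ True]) (auto simp: min_def)
    from Lim_transform_eventually[OF cadlag_path_right[OF x t] this] show ?thesis using True by (simp add: min_def)
  next
    case False
    have "\<forall>\<^sub>F u in at_right t. x (min a t) = x (min a u)"
      by (rule eventually_at_rightI[OF _ t(2)]) (use False in \<open>auto simp: min_def\<close>)
    from Lim_transform_eventually[OF tendsto_const this] show ?thesis .
  qed
next
  fix t assume t: "0 < t" "t \<le> T"
  show "\<exists>l. ((\<lambda>t. x (min a t)) \<longlongrightarrow> l) (at_left t)"
  proof (cases "t \<le> a")
    case True
    obtain l where l: "(x \<longlongrightarrow> l) (at_left t)" using cadlag_path_left[OF x t] by blast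
    have "\<forall>\<^sub>F u in at_left t. x u = x (min a u)"
      by (rule eventually_at_leftI[OF _ t(1)]) (use True in \<open>auto simp: min_def\<close>)
    from Lim_transform_eventually[OF l this] show ?thesis by blast
  next
    case False
    then have "a < t" by simp
    then have "\<forall>\<^sub>F u in at_left t. x a = x (min a u)"
      by (rule eventually_at_leftI[rotated]) (auto simp: min_def)
    from Lim_transform_eventually[OF tendsto_const this] show ?thesis by blast
  qed
qed

lemma cadlag_path_started:
  assumes x: "cadlag_path T x" and a: "0 \<le> a" "a \<le> T" shows "cadlag_path T (\<lambda>t. x (max a t))"
proof (rule cadlag_pathI)
  fix t assume t: "0 \<le> t" "t < T"
  show "((\<lambda>t. x (max a t)) \<longlongrightarrow> x (max a t)) (at_right t)"
  proof (cases "a \<le> t")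
    case True
    have "\<forall>\<^sub>F u in at_right t. x u = x (max a u)"
      by (rule eventually_at_rightI[OF _ t(2)]) (use True in \<open>auto simp: max_def\<close>)
    from Lim_transform_eventually[OF cadlag_path_right[OF x t] this] show ?thesis using True by (simp add: max_def)
  next
    case False
    then have "t < a" by simp
    then have "\<forall>\<^sub>F u in at_right t. x (max a t) = x (max a u)"
      by (rule eventually_at_rightI[rotated]) (use False in \<open>auto simp: max_def\<close>)
    from Lim_transform_eventually[OF tendsto_const this] show ?thesis .
  qed
next
  fix t assume t: "0 < t" "t \<le> T"
  show "\<exists>l. ((\<lambda>t. x (max a t)) \<longlongrightarrow> l) (at_left t)"
  proof (cases "t \<le> a")
    case True
    have "\<forall>\<^sub>F u in at_left t. x a = x (max a u)"
      by (rule eventually_at_leftI[OF _ t(1)]) (use True in \<open>auto simp: max_def\<close>)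
    from Lim_transform_eventually[OF tendsto_const this] show ?thesis by blast
  next
    case False
    then have at: "a < t" by simp
    obtain l where l: "(x \<longlongrightarrow> l) (at_left t)" using cadlag_path_left[OF x t] by blast
    have "\<forall>\<^sub>F u in at_left t. x u = x (max a u)"
      by (rule eventually_at_leftI[OF _ at]) (auto simp: max_def)
    from Lim_transform_eventually[OF l this] show ?thesis by blast
  qed
qed

context horizon
begin

text \<open>The grid point strictly after \<open>s\<close>, capped at \<open>T\<close>: approaching
  from the right is what makes right-continuous paths converge, and the cap fixes
  \<open>T\<close>.\<close>

definition next_grid :: "nat \<Rightarrow> real \<Rightarrow> real" where
  "next_grid n s = min T (grid n (Suc (grid_index n s)))"

lemma next_grid_in: "0 \<le> next_grid n s" "next_grid n s \<le> T"
  using grid_nonneg T_pos by (auto simp: next_grid_def less_imp_le)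

lemma next_grid_T: "next_grid n T = T"
  using grid_index_upper[of T n] T_pos by (simp add: next_grid_def)

lemma next_grid_greater: "0 \<le> s \<Longrightarrow> s < T \<Longrightarrow> s < next_grid n s"
  using grid_index_upper[of s n] by (simp add: next_grid_def)

lemma next_grid_tendsto: "0 \<le> s \<Longrightarrow> s < T \<Longrightarrow> (\<lambda>n. next_grid n s) \<longlonglongrightarrow> s"
proof -
  assume s: "0 \<le> s" "s < T"
  have "(\<lambda>n. s + T / 2 ^ n) \<longlonglongrightarrow> s + 0" by (intro tendsto_intros LIMSEQ_divide_realpow_zero) auto
  then have l: "(\<lambda>n. s + T / 2 ^ n) \<longlonglongrightarrow> s" by simp
  have "next_grid n s \<le> s + T / 2 ^ n" for n
    using grid_index_lower[of n s] s by (simp add: next_grid_def grid_step min_def)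
  then show ?thesis
    by (intro tendsto_sandwich[OF _ _ tendsto_const l]) (use next_grid_greater[OF s] in \<open>auto intro: always_eventually less_imp_le\<close>)
qed

text \<open>The intervals whose left end lies after \<open>s\<close> telescope. For a stopping time
  \<open>s\<close> the condition \<open>s < grid n i\<close> is decided at the left end, so stopping
  becomes a transform with predictable 0/1 weights.\<close>

lemma grid_sum_after:
  assumes s: "0 \<le> s" "s \<le> T"
  shows "(\<Sum>i<2 ^ n. of_bool (s < grid n i) * (x (grid n (Suc i)) - x (grid n i))) = x T - (x (next_grid n s) :: real)"
proof (cases "s < T")
  case True
  let ?k = "Suc (grid_index n s)"
  have k: "grid n (grid_index n s) \<le> s" "s < grid n ?k" using grid_index_lower[of n s] grid_index_upper[of s n] s by auto
  then have "grid n (grid_index n s) < grid n (2 ^ n)" using True by simp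
  then have kn: "?k \<le> 2 ^ n" by (metis Suc_leI grid_le_iff not_le)
  have "s < grid n i \<longleftrightarrow> ?k \<le> i" for i
  proof
    assume "s < grid n i"
    then have "\<not> grid n i \<le> grid n (grid_index n s)" using k by linarith
    then show "?k \<le> i" by simp
  next
    assume "?k \<le> i" then show "s < grid n i" using grid_le[of ?k i n] k(2) by linarith
  qed
  then have "(\<Sum>i<2 ^ n. of_bool (s < grid n i) * (x (grid n (Suc i)) - x (grid n i))) = (\<Sum>i<2 ^ n. if ?k \<le> i then x (grid n (Suc i)) - x (grid n i) else 0)"
    by (intro sum.cong) auto
  also have "\<dots> = (\<Sum>i\<in>{..<2 ^ n} \<inter> {i. ?k \<le> i}. x (grid n (Suc i)) - x (grid n i))"
    by (subst sum.inter_restrict) auto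
  also have "{..<2 ^ n} \<inter> {i. ?k \<le> i} = {?k..<2 ^ n}" by auto
  also have "(\<Sum>i\<in>{?k..<2 ^ n}. x (grid n (Suc i)) - x (grid n i)) = x (grid n (2 ^ n)) - x (grid n ?k)"
    by (rule sum_Suc_diff'[OF kn])
  also have "grid n ?k = next_grid n s" using grid_le_T[OF kn] by (simp add: next_grid_def)
  finally show ?thesis by simp
next
  case False
  then have "s = T" using s by simp
  moreover have "\<not> T < grid n i" if "i < 2 ^ n" for i using grid_le_T[of i n] that by simp
  ultimately show ?thesis by (simp add: next_grid_T)
qed

lemma cadlag_next_grid:
  assumes x: "cadlag_path T x" and s: "0 \<le> s" "s \<le> T"
  shows "(\<lambda>n. x (next_grid n s)) \<longlonglongrightarrow> x s"
proof (cases "s < T")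
  case True
  have "filterlim (\<lambda>n. next_grid n s) (at_right s) sequentially"
    using next_grid_greater[OF s(1) True] next_grid_tendsto[OF s(1) True]
    by (auto simp: filterlim_at less_imp_neq[symmetric] intro!: always_eventually)
  then show ?thesis by (rule filterlim_compose[OF cadlag_path_right[OF x s(1) True]])
next
  case False
  then have "s = T" using s by simp
  then show ?thesis by (simp add: next_grid_T)
qed

text \<open>\<open>N t\<close> minus the stopped value is a limit of sums over grid intervals after
  \<open>\<tau>\<close>, with times cut at \<open>t\<close>. A summand with left end before
  \<open>t\<close> is known at \<open>t\<close>; all others vanish.\<close>

lemma stopped_measurable:
  assumes N: "\<And>t. t \<in> {0..T} \<Longrightarrow> N t \<in> borel_measurable (FF t)" "\<And>\<omega>. \<omega> \<in> space M \<Longrightarrow> cadlag_path T (\<lambda>t. N t \<omega>)"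
    and \<tau>: "stopping_time_upto M F T \<tau>" and t: "t \<in> {0..T}"
  shows "(\<lambda>\<omega>. N (min (\<tau> \<omega>) t) \<omega>) \<in> borel_measurable (FF t)"
proof -
  let ?D = "\<lambda>n i \<omega>. of_bool (\<tau> \<omega> < grid n i) * (N (min t (grid n (Suc i))) \<omega> - N (min t (grid n i)) \<omega>)"
  have "(\<lambda>\<omega>. N t \<omega> - N (min (\<tau> \<omega>) t) \<omega>) \<in> borel_measurable (FF t)"
  proof (rule borel_measurable_LIMSEQ_real)
    fix n
    show "(\<lambda>\<omega>. \<Sum>i<2 ^ n. ?D n i \<omega>) \<in> borel_measurable (FF t)"
    proof (rule borel_measurable_sum)
      fix i assume i: "i \<in> {..<(2::nat) ^ n}"
      show "?D n i \<in> borel_measurable (FF t)"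
      proof (cases "grid n i < t")
        case True
        have "{\<omega>\<in>space M. \<tau> \<omega> < grid n i} \<in> sets (FF t)"
          using stopping_time_uptoD(4)[OF \<tau>, of "grid n i"] sets_FF_mono[of "grid n i" t] True by auto
        then have "(\<lambda>\<omega>. of_bool (\<tau> \<omega> < grid n i) :: real) \<in> borel_measurable (FF t)"
          unfolding of_bool_def by (intro measurable_If) (auto simp: space_FF)
        moreover have "N (min t u) \<in> borel_measurable (FF t)" if "0 \<le> u" for u
          using t that by (intro FF_measurable_mono[OF N(1)]) auto
        ultimately show ?thesis using grid_nonneg by (intro borel_measurable_times borel_measurable_diff) auto
      next
        case False
        then have "min t (grid n i) = t" "min t (grid n (Suc i)) = t" using grid_less[of i "Suc i" n] by auto
        then show ?thesis by simp
      qed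
    qed
  next
    fix \<omega> assume "\<omega> \<in> space (FF t)"
    then have w: "\<omega> \<in> space M" by (simp add: space_FF)
    have s: "0 \<le> \<tau> \<omega>" "\<tau> \<omega> \<le> T" using stopping_time_uptoD[OF \<tau>] w by auto
    have c: "cadlag_path T (\<lambda>u. N (min t u) \<omega>)" using cadlag_path_stopped[OF N(2)[OF w]] t by simp
    have "(\<lambda>n. N (min t T) \<omega> - N (min t (next_grid n (\<tau> \<omega>))) \<omega>) \<longlonglongrightarrow> N (min t T) \<omega> - N (min t (\<tau> \<omega>)) \<omega>"
      by (intro tendsto_diff tendsto_const cadlag_next_grid[OF c s])
    then show "(\<lambda>n. \<Sum>i<2 ^ n. ?D n i \<omega>) \<longlonglongrightarrow> N t \<omega> - N (min (\<tau> \<omega>) t) \<omega>"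
      unfolding grid_sum_after[OF s, of _ "\<lambda>u. N (min t u) \<omega>"] using t by (simp add: min.commute)
  qed
  from borel_measurable_diff[OF N(1)[OF t] this] show ?thesis by simp
qed

text \<open>Optional stopping through the grid: the increments after \<open>\<tau>\<close>,
  restricted to \<open>[s,t]\<close>, have expectation zero on \<open>A\<close>, and their sum tends
  to the increment of \<open>N\<close> over \<open>[s,t]\<close> minus the stopped
  increment.\<close>

lemma stopped_martingale:
  assumes N: "\<And>t. t \<in> {0..T} \<Longrightarrow> N t \<in> borel_measurable (FF t)" "\<And>\<omega>. \<omega> \<in> space M \<Longrightarrow> cadlag_path T (\<lambda>t. N t \<omega>)"
    "\<And>t \<omega>. t \<in> {0..T} \<Longrightarrow> \<omega> \<in> space M \<Longrightarrow> \<bar>N t \<omega>\<bar> \<le> c"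
    and mart: "\<And>t A. t \<in> {0..T} \<Longrightarrow> A \<in> sets (FF t) \<Longrightarrow>
      expectation (\<lambda>\<omega>. indicator A \<omega> * N t \<omega>) = expectation (\<lambda>\<omega>. indicator A \<omega> * N T \<omega>)"
    and \<tau>: "stopping_time_upto M F T \<tau>" and st: "0 \<le> s" "s \<le> t" "t \<le> T" and A: "A \<in> sets (FF s)"
  shows "expectation (\<lambda>\<omega>. indicator A \<omega> * N (min (\<tau> \<omega>) t) \<omega>) = expectation (\<lambda>\<omega>. indicator A \<omega> * N (min (\<tau> \<omega>) s) \<omega>)"
proof -
  have AM: "A \<in> sets M" using sets_FF_M[OF A] .
  have bA: "indicator A \<in> bmeas M" using bmeas_indicator[OF AM] .
  have bN: "N u \<in> bmeas M" if "0 \<le> u" "u \<le> T" for u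
    using FF_measurable_M[OF N(1)] N(3) that by (intro bmeasI[where c = c]) auto
  have bS: "(\<lambda>\<omega>. N (min (\<tau> \<omega>) u) \<omega>) \<in> bmeas M" if u: "0 \<le> u" "u \<le> T" for u
  proof (rule bmeasI[where c = c])
    show "(\<lambda>\<omega>. N (min (\<tau> \<omega>) u) \<omega>) \<in> borel_measurable M"
      using FF_measurable_M[OF stopped_measurable[OF N(1,2) \<tau>, of u]] u by auto
    show "\<bar>N (min (\<tau> \<omega>) u) \<omega>\<bar> \<le> c" if "\<omega> \<in> space M" for \<omega>
      using N(3)[OF _ that, of "min (\<tau> \<omega>) u"] stopping_time_uptoD(1,2)[OF \<tau> that] u by auto
  qed
  \<comment> \<open>Clamping times to \<open>[s,t]\<close> removes the increments outside; those
    that remain start no earlier than \<open>s\<close>, when \<open>A\<close> is already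
    known.\<close>
  define k where "k u = max s (min t u)" for u
  have k: "0 \<le> k u" "k u \<le> T" "s \<le> k u" for u using st by (auto simp: k_def)
  let ?D = "\<lambda>n i \<omega>. of_bool (\<tau> \<omega> < grid n i) * (N (k (grid n (Suc i))) \<omega> - N (k (grid n i)) \<omega>)"
  have bD: "(\<lambda>\<omega>. of_bool (\<tau> \<omega> < u)) \<in> bmeas M" for u
  proof -
    have "{\<omega>\<in>space M. \<tau> \<omega> < u} \<in> sets M" using sets_FF_M[OF stopping_time_uptoD(4)[OF \<tau>]] .
    then have "(\<lambda>\<omega>. of_bool (\<tau> \<omega> < u) :: real) \<in> borel_measurable M" unfolding of_bool_def by (intro measurable_If) auto
    then show ?thesis by (rule bmeasI[where c = 1]) simp
  qed
  have z: "expectation (\<lambda>\<omega>. indicator A \<omega> * ?D n i \<omega>) = 0" for n i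
  proof (cases "k (grid n (Suc i)) = k (grid n i)")
    case False
    let ?u = "k (grid n i)" and ?v = "k (grid n (Suc i))"
    \<comment> \<open>A nonzero clamped increment has its clamped left end at or after
      \<open>grid n i\<close>, so the event that \<open>\<tau>\<close> lies before
      \<open>grid n i\<close> is known there.\<close>
    have gu: "grid n i \<le> ?u" and uv: "?u \<le> ?v" using False grid_less[of i "Suc i" n] by (auto simp: k_def max_def min_def split: if_splits)
    let ?B = "A \<inter> {\<omega>\<in>space M. \<tau> \<omega> < grid n i}"
    have B: "?B \<in> sets (FF ?u)"
      using A sets_FF_mono[OF k(3)] stopping_time_uptoD(4)[OF \<tau>, of "grid n i"] sets_FF_mono[OF gu] by (intro sets.Int) auto
    have B': "?B \<in> sets (FF ?v)" using B sets_FF_mono[OF uv] by auto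
    have "expectation (\<lambda>\<omega>. indicator A \<omega> * ?D n i \<omega>) = expectation (\<lambda>\<omega>. indicator ?B \<omega> * N ?v \<omega> - indicator ?B \<omega> * N ?u \<omega>)"
      by (rule Bochner_Integration.integral_cong) (auto simp: indicator_def)
    also have "\<dots> = expectation (\<lambda>\<omega>. indicator ?B \<omega> * N ?v \<omega>) - expectation (\<lambda>\<omega>. indicator ?B \<omega> * N ?u \<omega>)"
      using bmeas_indicator[OF sets_FF_M[OF B]] bN[OF k(1,2)]
      by (intro Bochner_Integration.integral_diff bmeas_integrable bmeas_mult)
    also have "\<dots> = 0" using mart[OF _ B] mart[OF _ B'] k by simp
    finally show ?thesis .
  qed simp
  have "(\<lambda>n. expectation (\<lambda>\<omega>. indicator A \<omega> * (\<Sum>i<2 ^ n. ?D n i \<omega>))) \<longlonglongrightarrow>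
    expectation (\<lambda>\<omega>. indicator A \<omega> * (N t \<omega> - N (k (\<tau> \<omega>)) \<omega>))"
  proof (rule integral_dominated_convergence[where w = "\<lambda>_. 2 * c"])
    have kN: "(\<lambda>\<omega>. N (k (\<tau> \<omega>)) \<omega>) \<in> borel_measurable M"
    proof -
      \<comment> \<open>The value at the clamped time is
        \<open>N s + N (min \<tau> t) - N (min \<tau> s)\<close>, whatever the position of
        \<open>\<tau>\<close> relative to \<open>s\<close> and \<open>t\<close>.\<close>
      have "(\<lambda>\<omega>. N s \<omega> + (N (min (\<tau> \<omega>) t) \<omega> - N (min (\<tau> \<omega>) s) \<omega>)) \<in> borel_measurable M"
        using bN[of s] bS[of t] bS[of s] st by (intro borel_measurable_add borel_measurable_diff bmeas_measurable) auto
      also have "(\<lambda>\<omega>. N s \<omega> + (N (min (\<tau> \<omega>) t) \<omega> - N (min (\<tau> \<omega>) s) \<omega>)) = (\<lambda>\<omega>. N (k (\<tau> \<omega>)) \<omega>)"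
        using st by (auto simp: k_def fun_eq_iff min_def max_def)
      finally show ?thesis .
    qed
    show "(\<lambda>\<omega>. indicator A \<omega> * (N t \<omega> - N (k (\<tau> \<omega>)) \<omega>)) \<in> borel_measurable M"
      using kN bN[of t] st bA by (intro borel_measurable_times borel_measurable_diff) (auto dest: bmeas_measurable)
    show "(\<lambda>\<omega>. indicator A \<omega> * (\<Sum>i<2 ^ n. ?D n i \<omega>)) \<in> borel_measurable M" for n
      by (intro bmeas_measurable bmeas_intros bA[unfolded indicator_def] bA bD bN k)
    have sum: "(\<Sum>i<2 ^ n. ?D n i \<omega>) = N t \<omega> - N (k (next_grid n (\<tau> \<omega>))) \<omega>" if "\<omega> \<in> space M" for n \<omega>
      using grid_sum_after[OF stopping_time_uptoD(1,2)[OF \<tau> that], of n "\<lambda>u. N (k u) \<omega>"] st by (simp add: k_def min_def max_def)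
    show "AE \<omega> in M. (\<lambda>n. indicator A \<omega> * (\<Sum>i<2 ^ n. ?D n i \<omega>)) \<longlonglongrightarrow> indicator A \<omega> * (N t \<omega> - N (k (\<tau> \<omega>)) \<omega>)"
    proof (rule AE_I2)
      fix \<omega> assume w: "\<omega> \<in> space M"
      have c: "cadlag_path T (\<lambda>u. N (k u) \<omega>)"
        unfolding k_def using cadlag_path_stopped[OF cadlag_path_started[OF N(2)[OF w], of s], of t] st
        by (simp add: min_def max_def if_distrib cong: if_cong)
      show "(\<lambda>n. indicator A \<omega> * (\<Sum>i<2 ^ n. ?D n i \<omega>)) \<longlonglongrightarrow> indicator A \<omega> * (N t \<omega> - N (k (\<tau> \<omega>)) \<omega>)"
        unfolding sum[OF w] by (intro tendsto_mult tendsto_diff tendsto_const cadlag_next_grid[OF c] stopping_time_uptoD(1,2)[OF \<tau> w])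
    qed
    show "AE \<omega> in M. norm (indicator A \<omega> * (\<Sum>i<2 ^ n. ?D n i \<omega>)) \<le> 2 * c" for n
    proof (rule AE_I2)
      fix \<omega> assume w: "\<omega> \<in> space M"
      have "\<bar>N t \<omega>\<bar> \<le> c" "\<bar>N (k (next_grid n (\<tau> \<omega>))) \<omega>\<bar> \<le> c" using N(3)[OF _ w] k st by auto
      then show "norm (indicator A \<omega> * (\<Sum>i<2 ^ n. ?D n i \<omega>)) \<le> 2 * c"
        unfolding sum[OF w] by (auto simp: indicator_def)
    qed
  qed simp
  moreover have "expectation (\<lambda>\<omega>. indicator A \<omega> * (\<Sum>i<2 ^ n. ?D n i \<omega>)) = 0" for n
  proof -
    have "expectation (\<lambda>\<omega>. indicator A \<omega> * (\<Sum>i<2 ^ n. ?D n i \<omega>)) = (\<Sum>i<2 ^ n. expectation (\<lambda>\<omega>. indicator A \<omega> * ?D n i \<omega>))"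
      unfolding sum_distrib_left
      by (rule Bochner_Integration.integral_sum) (intro bmeas_integrable bmeas_intros bA bD bN k)
    then show ?thesis using z by simp
  qed
  ultimately have 0: "expectation (\<lambda>\<omega>. indicator A \<omega> * (N t \<omega> - N (k (\<tau> \<omega>)) \<omega>)) = 0"
    using LIMSEQ_unique[OF _ tendsto_const[of 0]] by simp
  have I: "integrable M (\<lambda>\<omega>. indicator A \<omega> * N t \<omega>)" "integrable M (\<lambda>\<omega>. indicator A \<omega> * N s \<omega>)"
    "integrable M (\<lambda>\<omega>. indicator A \<omega> * N (min (\<tau> \<omega>) t) \<omega>)" "integrable M (\<lambda>\<omega>. indicator A \<omega> * N (min (\<tau> \<omega>) s) \<omega>)"
    using st by (auto intro!: bmeas_integrable bmeas_mult bA bN bS)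
  have "indicator A \<omega> * (N t \<omega> - N (k (\<tau> \<omega>)) \<omega>) =
    (indicator A \<omega> * N t \<omega> - indicator A \<omega> * N s \<omega>) - (indicator A \<omega> * N (min (\<tau> \<omega>) t) \<omega> - indicator A \<omega> * N (min (\<tau> \<omega>) s) \<omega>)" for \<omega>
    using st by (cases "\<omega> \<in> A") (auto simp: k_def min_def max_def)
  with 0 have "(expectation (\<lambda>\<omega>. indicator A \<omega> * N t \<omega>) - expectation (\<lambda>\<omega>. indicator A \<omega> * N s \<omega>)) -
      (expectation (\<lambda>\<omega>. indicator A \<omega> * N (min (\<tau> \<omega>) t) \<omega>) - expectation (\<lambda>\<omega>. indicator A \<omega> * N (min (\<tau> \<omega>) s) \<omega>)) = 0"
    using I by simp
  moreover have "expectation (\<lambda>\<omega>. indicator A \<omega> * N t \<omega>) = expectation (\<lambda>\<omega>. indicator A \<omega> * N s \<omega>)"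
    using mart[of s A] mart[of t A] A sets_FF_mono[OF st(2)] st by auto
  ultimately show ?thesis by linarith
qed

end

subsection \<open>Bounded variation\<close>

text \<open>Bounded variation through a dominating increasing \<open>g\<close>, for instance the
  variation function; intervals can be joined without handling partitions.\<close>

definition bv_on :: "real \<Rightarrow> real \<Rightarrow> (real \<Rightarrow> real) \<Rightarrow> bool" where
  "bv_on a b x \<longleftrightarrow> (\<exists>g. \<forall>s t. a \<le> s \<and> s \<le> t \<and> t \<le> b \<longrightarrow> \<bar>x t - x s\<bar> \<le> g t - (g s :: real))"

lemma bv_on_finite_variation_path:
  assumes "bv_on 0 T x" shows "finite_variation_path T x"
proof -
  obtain g where g: "\<And>s t. 0 \<le> s \<Longrightarrow> s \<le> t \<Longrightarrow> t \<le> T \<Longrightarrow> \<bar>x t - x s\<bar> \<le> g t - g s"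
    using assms unfolding bv_on_def by blast
  have mono: "g s \<le> g t" if "0 \<le> s" "s \<le> t" "t \<le> T" for s t using g[OF that] by linarith
  have "(\<Sum>i<n. \<bar>x (p (Suc i)) - x (p i)\<bar>) \<le> g T - g 0" if p: "p ` {..n} \<subseteq> {0..T}" "mono_on {..n} p" for n p
  proof -
    have pin: "p i \<in> {0..T}" if "i \<le> n" for i using p(1) that by blast
    have "(\<Sum>i<n. \<bar>x (p (Suc i)) - x (p i)\<bar>) \<le> (\<Sum>i<n. g (p (Suc i)) - g (p i))"
    proof (rule sum_mono)
      fix i assume "i \<in> {..<n}"
      then show "\<bar>x (p (Suc i)) - x (p i)\<bar> \<le> g (p (Suc i)) - g (p i)"
        using pin[of i] pin[of "Suc i"] mono_onD[OF p(2), of i "Suc i"] by (intro g) auto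
    qed
    also have "\<dots> = g (p n) - g (p 0)" by (rule sum_lessThan_telescope[of "\<lambda>i. g (p i)"])
    also have "\<dots> \<le> g T - g 0" using pin[of 0] pin[of n] mono[of "p n" T] mono[of 0 "p 0"] by auto
    finally show ?thesis .
  qed
  then show ?thesis unfolding finite_variation_path_def by blast
qed

text \<open>The relation to \<open>y\<close> is required only before \<open>b\<close>, since local
  decompositions hold strictly before a stopping time; the jump of \<open>x\<close> at
  \<open>b\<close> is a finite amount, charged to the dominating function at
  \<open>b\<close>.\<close>

lemma bv_on_extend:
  assumes x: "bv_on 0 a x" and y: "bv_on a b y" and ab: "0 \<le> a" "a < b"
    and eq: "\<And>t. a \<le> t \<Longrightarrow> t < b \<Longrightarrow> x t = y t + C"
  shows "bv_on 0 b x"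
proof -
  obtain g where g: "\<And>s t. 0 \<le> s \<Longrightarrow> s \<le> t \<Longrightarrow> t \<le> a \<Longrightarrow> \<bar>x t - x s\<bar> \<le> g t - g s"
    using x unfolding bv_on_def by blast
  obtain h where h: "\<And>s t. a \<le> s \<Longrightarrow> s \<le> t \<Longrightarrow> t \<le> b \<Longrightarrow> \<bar>y t - y s\<bar> \<le> h t - h s"
    using y unfolding bv_on_def by blast
  \<comment> \<open>For \<open>s < b\<close> the triangle inequality through \<open>a\<close>
    requires \<open>h' b \<ge> \<bar>x b - x a\<bar> + 2 * h s - h a\<close>, and
    \<open>h s \<le> h b\<close>.\<close>
  define h' where "h' t = (if t < b then h t else 2 * h b - h a + \<bar>x b - x a\<bar>)" for t
  have h': "\<bar>x t - x s\<bar> \<le> h' t - h' s" if st: "a \<le> s" "s \<le> t" "t \<le> b" for s t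
  proof (cases "t < b")
    case True
    then show ?thesis using h[OF st] eq[of t] eq[of s] st by (simp add: h'_def)
  next
    case False
    then have t: "t = b" using st by simp
    show ?thesis
    proof (cases "s < b")
      case True
      have "\<bar>x s - x a\<bar> \<le> h s - h a" using h[of a s] eq[of s] eq[of a] st ab True by simp
      moreover have "h s \<le> h b" using h[of s b] st True by auto
      moreover have "h' t - h' s = 2 * h b - h a + \<bar>x b - x a\<bar> - h s" using True t by (simp add: h'_def)
      ultimately show ?thesis unfolding t by (auto simp: abs_if split: if_splits)
    next
      case False
      then have "s = t" using t st by simp
      then show ?thesis by simp
    qed
  qed
  define k where "k t = (if t \<le> a then g t else g a + h' t - h' a)" for t
  have "\<bar>x t - x s\<bar> \<le> k t - k s" if st: "0 \<le> s" "s \<le> t" "t \<le> b" for s t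
  proof -
    consider "t \<le> a" | "s \<le> a" "a < t" | "a < s" by linarith
    then show ?thesis
    proof cases
      case 1 then show ?thesis using g[of s t] st by (simp add: k_def)
    next
      case 2 
      have "\<bar>x t - x s\<bar> \<le> \<bar>x t - x a\<bar> + \<bar>x a - x s\<bar>" by simp
      then show ?thesis using g[of s a] h'[of a t] st 2 by (simp add: k_def)
    next
      case 3 then show ?thesis using h'[of s t] st by (simp add: k_def)
    qed
  qed
  then show ?thesis unfolding bv_on_def by blast
qed

subsection \<open>Gluing local decompositions\<close>

context horizon
begin

text \<open>Almost every path meets only finitely many pieces. The martingale part uses the
  increments of \<open>N k\<close> on the \<open>k\<close>-th stretch between successive stopping
  times; stopped at \<open>\<tau> k\<close> it is almost everywhere a sum of \<open>k\<close>
  bounded martingales, so these times localise it.\<close>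

lemma semimartingale_glue:
  assumes S: "adapted_upto F T S" "cadlag_process M T S"
    and \<rho>: "\<And>k. stopping_time_upto M F T (\<rho> k)" "(\<lambda>k. prob {\<omega>\<in>space M. \<rho> k \<omega> < T}) \<longlonglongrightarrow> 0"
    and N_meas: "\<And>k t. t \<in> {0..T} \<Longrightarrow> N k t \<in> borel_measurable (FF t)"
    and N_cadlag: "\<And>k \<omega>. \<omega> \<in> space M \<Longrightarrow> cadlag_path T (\<lambda>t. N k t \<omega>)"
    and N_bound: "\<And>k t \<omega>. t \<in> {0..T} \<Longrightarrow> \<omega> \<in> space M \<Longrightarrow> \<bar>N k t \<omega>\<bar> \<le> c k"
    and N_mart: "\<And>k t A. t \<in> {0..T} \<Longrightarrow> A \<in> sets (FF t) \<Longrightarrow>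
      expectation (\<lambda>\<omega>. indicator A \<omega> * N k t \<omega>) = expectation (\<lambda>\<omega>. indicator A \<omega> * N k T \<omega>)"
    and dec: "\<And>k. AE \<omega> in M. bv_on 0 T (\<lambda>t. B k t \<omega>) \<and> (\<forall>t\<in>{0..T}. t < \<rho> k \<omega> \<longrightarrow> S t \<omega> = N k t \<omega> + B k t \<omega>)"
  shows "semimartingale M F T S"
proof -
  \<comment> \<open>The \<open>\<rho> k\<close> need not be ordered; their running maximum starts at
    0 and increases.\<close>
  define \<tau> where "\<tau> k \<omega> = rec_nat 0 (\<lambda>j y. max y (\<rho> j \<omega>)) k" for k \<omega>
  have \<tau>0: "\<tau> 0 \<omega> = 0" and \<tau>S: "\<tau> (Suc k) \<omega> = max (\<tau> k \<omega>) (\<rho> k \<omega>)" for k \<omega> by (simp_all add: \<tau>_def)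
  have \<tau>_st: "stopping_time_upto M F T (\<tau> k)" for k
  proof (induction k)
    case 0 then show ?case using T_pos by (simp add: stopping_time_upto_def \<tau>0[abs_def] stopping_time_const)
  next
    case (Suc k)
    then show ?case using \<rho>(1)[of k] by (auto simp: stopping_time_upto_def \<tau>S[abs_def] intro: stopping_time_max)
  qed
  have \<tau>_in: "0 \<le> \<tau> k \<omega>" "\<tau> k \<omega> \<le> T" if "\<omega> \<in> space M" for k \<omega> using stopping_time_uptoD(1,2)[OF \<tau>_st that] .
  have \<tau>_mono: "\<tau> i \<omega> \<le> \<tau> j \<omega>" if "i \<le> j" for i j \<omega>
    using that by (induction j rule: dec_induct) (auto simp: \<tau>S)
  have \<tau>_T: "AE \<omega> in M. \<exists>k. \<tau> k \<omega> = T"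
  proof -
    \<comment> \<open>A path for which no \<open>\<tau> k\<close> equals \<open>T\<close> lies in
      every event \<open>\<rho> k < T\<close>, and the probabilities of these tend to 0.\<close>
    let ?E = "\<Inter>k. {\<omega>\<in>space M. \<rho> k \<omega> < T}"
    have m: "{\<omega>\<in>space M. \<rho> k \<omega> < T} \<in> events" for k using sets_FF_M[OF stopping_time_uptoD(4)[OF \<rho>(1)]] .
    then have E: "?E \<in> events" by (intro sets.countable_INT) auto
    have "prob ?E \<le> prob {\<omega>\<in>space M. \<rho> k \<omega> < T}" for k using m by (intro finite_measure_mono) auto
    then have "prob ?E \<le> 0" by (intro LIMSEQ_le_const[OF \<rho>(2)]) auto
    then have "?E \<in> null_sets M" using E by (auto simp: null_sets_def emeasure_eq_measure measure_le_0_iff)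
    from AE_not_in[OF this] AE_space show ?thesis
    proof eventually_elim
      case (elim \<omega>)
      then have w: "\<omega> \<in> space M" "\<omega> \<notin> ?E" by blast+
      then obtain k where "T \<le> \<rho> k \<omega>" by (auto simp: not_less)
      then have "\<tau> (Suc k) \<omega> = T" using \<tau>_in(2)[OF w(1), of "Suc k"] by (simp add: \<tau>S)
      then show "\<exists>k. \<tau> k \<omega> = T" by blast
    qed
  qed
  then obtain Z0 where Z0: "{\<omega>\<in>space M. \<not> (\<exists>k. \<tau> k \<omega> = T)} \<subseteq> Z0" "Z0 \<in> null_sets M"
    unfolding eventually_ae_filter by blast
  define Z where "Z j t \<omega> = N j (min (\<tau> (Suc j) \<omega>) t) \<omega> - N j (min (\<tau> j \<omega>) t) \<omega>" for j t \<omega>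
  \<comment> \<open>All terms from the first \<open>k\<close> with
    \<open>\<tau> k \<omega> = T\<close> on vanish, so this finite sum is the full series. Such a
    \<open>k\<close> exists off the null set \<open>Z0\<close>; on \<open>Z0\<close> the value 0
    keeps paths cadlag.\<close>
  define X where "X t \<omega> = (if \<omega> \<in> Z0 then 0 else \<Sum>j<(LEAST k. \<tau> k \<omega> = T). Z j t \<omega>)" for t \<omega>
  have \<tau>T_up: "\<tau> j \<omega> = T" if "\<tau> i \<omega> = T" "i \<le> j" "\<omega> \<in> space M" for i j \<omega>
    using \<tau>_mono[OF that(2), of \<omega>] \<tau>_in(2)[OF that(3), of j] that(1) by simp
  have X_eq: "\<exists>n0. \<forall>n\<ge>n0. \<forall>t. X t \<omega> = (\<Sum>j<n. Z j t \<omega>)" if w: "\<omega> \<in> space M" "\<omega> \<notin> Z0" for \<omega>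
  proof -
    let ?k = "LEAST k. \<tau> k \<omega> = T"
    have "\<exists>k. \<tau> k \<omega> = T" using Z0(1) w by blast
    then have k: "\<tau> ?k \<omega> = T" by (rule LeastI_ex[of "\<lambda>k. \<tau> k \<omega> = T"])
    have "X t \<omega> = (\<Sum>j<n. Z j t \<omega>)" if "?k \<le> n" for n t
    proof -
      have "Z j t \<omega> = 0" if "?k \<le> j" for j
        using \<tau>T_up[OF k that w(1)] \<tau>T_up[OF k le_SucI[OF that] w(1)] by (simp add: Z_def)
      then have "(\<Sum>j<n. Z j t \<omega>) = (\<Sum>j<?k. Z j t \<omega>)"
        using that by (intro sum.mono_neutral_right) auto
      then show ?thesis using w by (simp add: X_def)
    qed
    then show ?thesis by blast
  qed
  have X_stop: "X (min (\<tau> k \<omega>) t) \<omega> = (\<Sum>j<k. Z j t \<omega>)" if w: "\<omega> \<in> space M" "\<omega> \<notin> Z0" for k t \<omega>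
  proof -
    obtain n0 where n0: "\<And>n t. n \<ge> n0 \<Longrightarrow> X t \<omega> = (\<Sum>j<n. Z j t \<omega>)" using X_eq[OF w] by blast
    let ?n = "max n0 k"
    have "X (min (\<tau> k \<omega>) t) \<omega> = (\<Sum>j<?n. Z j (min (\<tau> k \<omega>) t) \<omega>)" by (rule n0) simp
    also have "\<dots> = (\<Sum>j<k. Z j (min (\<tau> k \<omega>) t) \<omega>)"
    proof (rule sum.mono_neutral_right)
      show "\<forall>j\<in>{..<?n} - {..<k}. Z j (min (\<tau> k \<omega>) t) \<omega> = 0"
      proof
        fix j assume "j \<in> {..<?n} - {..<k}"
        then have "\<tau> k \<omega> \<le> \<tau> j \<omega>" "\<tau> k \<omega> \<le> \<tau> (Suc j) \<omega>" by (auto intro!: \<tau>_mono)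
        then show "Z j (min (\<tau> k \<omega>) t) \<omega> = 0" by (simp add: Z_def min.absorb2 min.coboundedI1)
      qed
    qed auto
    also have "\<dots> = (\<Sum>j<k. Z j t \<omega>)"
    proof (rule sum.cong)
      fix j assume "j \<in> {..<k}"
      then have "\<tau> j \<omega> \<le> \<tau> k \<omega>" "\<tau> (Suc j) \<omega> \<le> \<tau> k \<omega>" by (auto intro!: \<tau>_mono)
      then show "Z j (min (\<tau> k \<omega>) t) \<omega> = Z j t \<omega>" by (simp add: Z_def min.assoc[symmetric] min.absorb1)
    qed simp
    finally show ?thesis .
  qed
  have Z_meas: "Z j t \<in> borel_measurable (FF t)" if "t \<in> {0..T}" for j t
    unfolding Z_def using stopped_measurable[OF N_meas N_cadlag \<tau>_st that] by (intro borel_measurable_diff) auto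
  have Z_bound: "\<bar>Z j t \<omega>\<bar> \<le> 2 * c j" if "t \<in> {0..T}" "\<omega> \<in> space M" for j t \<omega>
  proof -
    have "\<bar>N j (min (\<tau> i \<omega>) t) \<omega>\<bar> \<le> c j" for i using N_bound[of "min (\<tau> i \<omega>) t" \<omega> j] \<tau>_in[OF that(2), of i] that by auto
    from this[of j] this[of "Suc j"] show ?thesis unfolding Z_def by (auto simp: abs_le_iff)
  qed
  have bZ: "Z j t \<in> bmeas M" if "t \<in> {0..T}" for j t
    using FF_measurable_M[OF Z_meas[OF that]] Z_bound[OF that] by (rule bmeasI)
  have Z_cadlag: "cadlag_path T (\<lambda>t. Z j t \<omega>)" if "\<omega> \<in> space M" for j \<omega>
    unfolding Z_def by (intro cadlag_path_diff cadlag_path_stopped[OF N_cadlag[OF that]] \<tau>_in[OF that])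
  have Z_mart: "expectation (\<lambda>\<omega>. indicator A \<omega> * Z j t \<omega>) = expectation (\<lambda>\<omega>. indicator A \<omega> * Z j s \<omega>)"
    if st: "0 \<le> s" "s \<le> t" "t \<le> T" and A: "A \<in> sets (FF s)" for s t A j
  proof -
    have b: "(\<lambda>\<omega>. indicator A \<omega> * N j (min (\<tau> i \<omega>) u) \<omega>) \<in> bmeas M" if u: "u \<in> {0..T}" for i u
    proof (intro bmeas_mult bmeas_indicator sets_FF_M[OF A] bmeasI)
      show "(\<lambda>\<omega>. N j (min (\<tau> i \<omega>) u) \<omega>) \<in> borel_measurable M"
        using FF_measurable_M[OF stopped_measurable[OF N_meas N_cadlag \<tau>_st u]] .
      show "\<bar>N j (min (\<tau> i \<omega>) u) \<omega>\<bar> \<le> c j" if "\<omega> \<in> space M" for \<omega>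
        using N_bound[of "min (\<tau> i \<omega>) u" \<omega> j] \<tau>_in[OF that, of i] that u by auto
    qed
    note I = bmeas_integrable[OF b]
    have E: "expectation (\<lambda>\<omega>. indicator A \<omega> * Z j u \<omega>) =
       expectation (\<lambda>\<omega>. indicator A \<omega> * N j (min (\<tau> (Suc j) \<omega>) u) \<omega>) - expectation (\<lambda>\<omega>. indicator A \<omega> * N j (min (\<tau> j \<omega>) u) \<omega>)"
      if "u \<in> {0..T}" for u
      unfolding Z_def right_diff_distrib using I[OF that] by (intro Bochner_Integration.integral_diff)
    have "expectation (\<lambda>\<omega>. indicator A \<omega> * N j (min (\<tau> i \<omega>) t) \<omega>) = expectation (\<lambda>\<omega>. indicator A \<omega> * N j (min (\<tau> i \<omega>) s) \<omega>)" for i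
      by (rule stopped_martingale[OF N_meas N_cadlag N_bound N_mart \<tau>_st st A])
    then show ?thesis using st by (simp add: E)
  qed
  have X_stop_meas: "(\<lambda>\<omega>. X (min (\<tau> k \<omega>) t) \<omega>) \<in> borel_measurable (FF t)" if t: "t \<in> {0..T}" for k t
  proof -
    have X0: "X u \<omega> = 0" if "\<omega> \<in> Z0" for u \<omega> using that by (simp add: X_def)
    have "(\<lambda>\<omega>. if \<omega> \<in> Z0 then 0 else \<Sum>j<k. Z j t \<omega>) \<in> borel_measurable (FF t)"
      using null_sets_FF[OF Z0(2)] Z_meas[OF t] sets.Int_space_eq2[OF null_sets_FF[OF Z0(2)]]
      by (intro measurable_If_set borel_measurable_sum) auto
    then show ?thesis
      using X_stop X0 by (subst measurable_cong[where g = "\<lambda>\<omega>. if \<omega> \<in> Z0 then 0 else \<Sum>j<k. Z j t \<omega>"]) (auto simp: space_FF)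
  qed
  have X_meas: "X t \<in> borel_measurable (FF t)" if t: "t \<in> {0..T}" for t
  proof (rule borel_measurable_LIMSEQ_real)
    show "(\<lambda>\<omega>. X (min (\<tau> k \<omega>) t) \<omega>) \<in> borel_measurable (FF t)" for k by (rule X_stop_meas[OF t])
    fix \<omega> assume "\<omega> \<in> space (FF t)"
    then have w: "\<omega> \<in> space M" by (simp add: space_FF)
    show "(\<lambda>k. X (min (\<tau> k \<omega>) t) \<omega>) \<longlonglongrightarrow> X t \<omega>"
    proof (cases "\<omega> \<in> Z0")
      case True then show ?thesis by (simp add: X_def)
    next
      case False
      then obtain k0 where k0: "\<tau> k0 \<omega> = T" using Z0(1) w by blast
      have "X (min (\<tau> k \<omega>) t) \<omega> = X t \<omega>" if "k0 \<le> k" for k using \<tau>T_up[OF k0 that w] t by (simp add: min_absorb2)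
      then show ?thesis by (intro tendsto_eventually) (auto simp: eventually_sequentially)
    qed
  qed
  have X_cadlag: "cadlag_path T (\<lambda>t. X t \<omega>)" if w: "\<omega> \<in> space M" for \<omega>
    unfolding X_def by (cases "\<omega> \<in> Z0") (auto intro!: cadlag_path_const cadlag_path_sum Z_cadlag[OF w])
  have mart: "martingale_upto M F T (\<lambda>t \<omega>. X (min (\<tau> k \<omega>) t) \<omega>)" for k
  proof -
    have ae: "AE \<omega> in M. X (min (\<tau> k \<omega>) t) \<omega> = (\<Sum>j<k. Z j t \<omega>)" for t
      using AE_not_in[OF Z0(2)] AE_space by eventually_elim (rule X_stop)
    have bS: "(\<lambda>\<omega>. \<Sum>j<k. Z j t \<omega>) \<in> bmeas M" if "t \<in> {0..T}" for t by (intro bmeas_sum bZ that)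
    have i: "integrable M (\<lambda>\<omega>. X (min (\<tau> k \<omega>) t) \<omega>)" if t: "t \<in> {0..T}" for t
      using integrable_cong_AE[THEN iffD2, OF _ _ ae bmeas_integrable[OF bS[OF t]]]
        FF_measurable_M[OF X_stop_meas[OF t]] bmeas_measurable[OF bS[OF t]] by blast
    have "AE \<omega> in M. real_cond_exp M (F s) (\<lambda>\<omega>. X (min (\<tau> k \<omega>) t) \<omega>) \<omega> = X (min (\<tau> k \<omega>) s) \<omega>"
      if s: "s \<in> {0..T}" and t: "t \<in> {s..T}" for s t
    proof -
      have t': "t \<in> {0..T}" using s t by auto
      have Fs: "FF s = F s" using FF_eq[OF s] .
      interpret finite_measure_subalgebra M "F s" using sub_FF[of s] Fs by unfold_locales simp
      show ?thesis
      proof (rule real_cond_exp_charact)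
        fix A assume A: "A \<in> sets (F s)"
        then have AM: "A \<in> sets M" using sets_FF_M[of A s] Fs by simp
        have e: "(\<integral>\<omega>\<in>A. X (min (\<tau> k \<omega>) u) \<omega> \<partial>M) = (\<Sum>j<k. expectation (\<lambda>\<omega>. indicator A \<omega> * Z j u \<omega>))" if u: "u \<in> {0..T}" for u
        proof -
          have "(\<integral>\<omega>\<in>A. X (min (\<tau> k \<omega>) u) \<omega> \<partial>M) = expectation (\<lambda>\<omega>. \<Sum>j<k. indicator A \<omega> * Z j u \<omega>)"
            unfolding set_lebesgue_integral_def
          proof (rule integral_cong_AE)
            show "AE \<omega> in M. indicator A \<omega> *\<^sub>R X (min (\<tau> k \<omega>) u) \<omega> = (\<Sum>j<k. indicator A \<omega> * Z j u \<omega>)"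
              using ae[of u] by eventually_elim (simp add: sum_distrib_left)
            show "(\<lambda>\<omega>. \<Sum>j<k. indicator A \<omega> * Z j u \<omega>) \<in> borel_measurable M"
              by (intro bmeas_measurable bmeas_sum bmeas_mult bmeas_indicator AM bZ u)
            show "(\<lambda>\<omega>. indicator A \<omega> *\<^sub>R X (min (\<tau> k \<omega>) u) \<omega>) \<in> borel_measurable M"
              using AM FF_measurable_M[OF X_stop_meas[OF u]] by simp
          qed
          also have "\<dots> = (\<Sum>j<k. expectation (\<lambda>\<omega>. indicator A \<omega> * Z j u \<omega>))"
            by (intro Bochner_Integration.integral_sum bmeas_integrable bmeas_mult bmeas_indicator AM bZ u)
          finally show ?thesis .
        qed
        show "(\<integral>\<omega>\<in>A. X (min (\<tau> k \<omega>) t) \<omega> \<partial>M) = (\<integral>\<omega>\<in>A. X (min (\<tau> k \<omega>) s) \<omega> \<partial>M)"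
          unfolding e[OF t'] e[OF s] using Z_mart[of s t A] s t A Fs by (intro sum.cong) auto
      qed (use i[OF t'] i[OF s] X_stop_meas[OF s] Fs in auto)
    qed
    then show ?thesis
      unfolding martingale_upto_def adapted_upto_def using X_stop_meas i FF_eq by (auto simp del: atLeastAtMost_iff)
  qed
  have "local_martingale_upto M F T X"
    unfolding local_martingale_upto_def
  proof (intro conjI exI[of _ \<tau>] allI ballI)
    show "adapted_upto F T X" unfolding adapted_upto_def using X_meas FF_eq by metis
    show "cadlag_process M T X" unfolding cadlag_process_def using X_cadlag by blast
    show "AE \<omega> in M. \<forall>\<^sub>F k in sequentially. \<tau> k \<omega> = T"
      using \<tau>_T AE_space
    proof eventually_elim
      case (elim \<omega>) then show ?case using \<tau>T_up unfolding eventually_sequentially by blast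
    qed
  qed (use \<tau>_st \<tau>_mono mart in auto)
  moreover have "finite_variation_process M F T (\<lambda>t \<omega>. S t \<omega> - X t \<omega>)"
    unfolding finite_variation_process_def
  proof (intro conjI)
    show "adapted_upto F T (\<lambda>t \<omega>. S t \<omega> - X t \<omega>)"
      using S(1) X_meas unfolding adapted_upto_def by (auto simp: FF_eq[symmetric] simp del: atLeastAtMost_iff)
    show "cadlag_process M T (\<lambda>t \<omega>. S t \<omega> - X t \<omega>)"
      using S(2) X_cadlag unfolding cadlag_process_def by (auto intro: cadlag_path_diff)
    have "AE \<omega> in M. \<forall>k. bv_on 0 T (\<lambda>t. B k t \<omega>) \<and> (\<forall>t\<in>{0..T}. t < \<rho> k \<omega> \<longrightarrow> S t \<omega> = N k t \<omega> + B k t \<omega>)"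
      using dec by (intro AE_all_countable[THEN iffD2] allI)
    then show "AE \<omega> in M. finite_variation_path T (\<lambda>t. S t \<omega> - X t \<omega>)"
      using AE_not_in[OF Z0(2)] AE_space
    proof eventually_elim
      case (elim \<omega>)
      note w = elim(3,2)
      have "bv_on 0 (\<tau> k \<omega>) (\<lambda>t. S t \<omega> - X t \<omega>)" for k
      proof (induction k)
        case 0
        show ?case unfolding bv_on_def \<tau>0 
        proof (intro exI[of _ "\<lambda>_. 0"] allI impI)
          fix s t :: real assume "0 \<le> s \<and> s \<le> t \<and> t \<le> 0"
          then have "s = t" by linarith
          then show "\<bar>S t \<omega> - X t \<omega> - (S s \<omega> - X s \<omega>)\<bar> \<le> 0 - 0" by simp
        qed
      next
        case (Suc k)
        show ?case
        proof (cases "\<tau> k \<omega> < \<rho> k \<omega>")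
          case True
          then have \<tau>S': "\<tau> (Suc k) \<omega> = \<rho> k \<omega>" by (simp add: \<tau>S)
          have "bv_on (\<tau> k \<omega>) (\<rho> k \<omega>) (\<lambda>t. B k t \<omega>)"
          proof -
            have "bv_on 0 T (\<lambda>t. B k t \<omega>)" using elim(1) by blast
            then obtain g where g: "\<And>s t. 0 \<le> s \<and> s \<le> t \<and> t \<le> T \<Longrightarrow> \<bar>B k t \<omega> - B k s \<omega>\<bar> \<le> g t - g s" unfolding bv_on_def by blast
            show ?thesis unfolding bv_on_def
            proof (intro exI[of _ g] allI impI g)
              fix s t assume "\<tau> k \<omega> \<le> s \<and> s \<le> t \<and> t \<le> \<rho> k \<omega>"
              then show "0 \<le> s \<and> s \<le> t \<and> t \<le> T" using \<tau>_in[OF w(1), of k] \<tau>_in[OF w(1), of "Suc k"] \<tau>S' by auto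
            qed
          qed
          \<comment> \<open>On the stretch from \<open>\<tau> k\<close> to \<open>\<rho> k\<close>,
            \<open>X\<close> and \<open>N k\<close> differ by a constant, so \<open>S - X\<close>
            varies like \<open>B k\<close>.\<close>
          moreover have "S t \<omega> - X t \<omega> = B k t \<omega> + (N k (\<tau> k \<omega>) \<omega> - X (\<tau> k \<omega>) \<omega>)" if t: "\<tau> k \<omega> \<le> t" "t < \<rho> k \<omega>" for t
          proof -
            have "t \<in> {0..T}" using t \<tau>_in[OF w(1), of k] \<tau>_in(2)[OF w(1), of "Suc k"] \<tau>S' by auto
            then have "S t \<omega> = N k t \<omega> + B k t \<omega>" using elim(1) t by blast
            moreover have "X t \<omega> = (\<Sum>j<Suc k. Z j t \<omega>)" using X_stop[OF w, of "Suc k" t] t \<tau>S' by (simp add: min_def)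
            moreover have "(\<Sum>j<k. Z j t \<omega>) = X (\<tau> k \<omega>) \<omega>" using X_stop[OF w, of k t] t by (simp add: min_def)
            moreover have "Z k t \<omega> = N k t \<omega> - N k (\<tau> k \<omega>) \<omega>" using t \<tau>S' by (simp add: Z_def min_def)
            ultimately show ?thesis by simp
          qed
          ultimately show ?thesis unfolding \<tau>S'
            by (intro bv_on_extend[OF Suc]) (use True \<tau>_in[OF w(1), of k] in auto)
        next
          case False
          then show ?thesis using Suc by (simp add: \<tau>S max_def)
        qed
      qed
      moreover obtain k where "\<tau> k \<omega> = T" using Z0(1) w by blast
      ultimately show ?case by (metis bv_on_finite_variation_path)
    qed
  qed
  ultimately show ?thesis unfolding semimartingale_def by (intro exI[of _ X] exI[of _ "\<lambda>t \<omega>. S t \<omega> - X t \<omega>"]) auto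
qed

end

subsection \<open>Integrands along dyadic grids\<close>

text \<open>A single finite random variable is eventually overtaken by \<open>c m\<close> at every
  sample point, and dominated convergence applies. This removes error terms that do not depend on
  \<open>m\<close>.\<close>

lemma (in prob_space) prob_greater_tendsto_0:
  fixes f :: "'a \<Rightarrow> real"
  assumes f: "f \<in> borel_measurable M" and c: "filterlim c at_top sequentially"
  shows "(\<lambda>m. prob {\<omega>\<in>space M. c m < f \<omega>}) \<longlonglongrightarrow> 0"
proof -
  have A: "{\<omega>\<in>space M. c m < f \<omega>} \<in> events" for m using f by measurable
  have "(\<lambda>m. expectation (indicator {\<omega>\<in>space M. c m < f \<omega>} :: 'a \<Rightarrow> real)) \<longlonglongrightarrow> expectation (\<lambda>_. 0 :: real)"
  proof (rule integral_dominated_convergence[where w = "\<lambda>_. 1"])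
    show "AE \<omega> in M. (\<lambda>m. indicator {\<omega>\<in>space M. c m < f \<omega>} \<omega> :: real) \<longlonglongrightarrow> 0"
    proof (rule AE_I2)
      fix \<omega>
      have "\<forall>\<^sub>F m in sequentially. f \<omega> < c m" using c unfolding filterlim_at_top_dense by blast
      then have "\<forall>\<^sub>F m in sequentially. (indicator {\<omega>\<in>space M. c m < f \<omega>} \<omega> :: real) = 0"
        by eventually_elim (simp add: indicator_def)
      then show "(\<lambda>m. indicator {\<omega>\<in>space M. c m < f \<omega>} \<omega> :: real) \<longlonglongrightarrow> 0" by (rule tendsto_eventually)
    qed
  qed (use A in \<open>auto simp: indicator_def\<close>)
  then show ?thesis using A by simp
qed

text \<open>At most one of the consecutive intervals contains \<open>t\<close>. The induction
  carries along that the sum is 0 while \<open>t\<close> lies beyond the last end point.\<close>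

lemma disjoint_intervals_sum_bound:
  fixes s :: "nat \<Rightarrow> real" and a :: "nat \<Rightarrow> real"
  assumes s: "\<And>j. j < n \<Longrightarrow> s j \<le> s (Suc j)" and a: "\<And>j. j < n \<Longrightarrow> \<bar>a j\<bar> \<le> b" and b: "b \<ge> 0"
  shows "\<bar>\<Sum>j<n. a j * indicator {s j <.. s (Suc j)} t\<bar> \<le> b"
proof -
  have "\<bar>\<Sum>j<k. a j * indicator {s j <.. s (Suc j)} t\<bar> \<le> b \<and> (s k < t \<longrightarrow> (\<Sum>j<k. a j * indicator {s j <.. s (Suc j)} t) = 0)"
    if "k \<le> n" for k
    using that
  proof (induction k)
    case (Suc k)
    then have IH: "\<bar>\<Sum>j<k. a j * indicator {s j <.. s (Suc j)} t\<bar> \<le> b"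
      "s k < t \<Longrightarrow> (\<Sum>j<k. a j * indicator {s j <.. s (Suc j)} t) = 0" by auto
    show ?case
    proof (cases "s k < t")
      case True
      then show ?thesis using IH(2) a[of k] b Suc.prems by (auto simp: indicator_def)
    next
      case False
      then show ?thesis using False IH(1) s[of k] Suc.prems by (auto simp: indicator_def)
    qed
  qed (use b in simp)
  then show ?thesis by blast
qed

text \<open>The stopped path keeps the value \<open>x s\<close> from \<open>s\<close> on, the killed
  path drops to 0. Their increments differ only on the interval that contains \<open>s\<close>, by
  \<open>x s\<close>.\<close>

lemma stopped_killed_increment:
  fixes x :: "real \<Rightarrow> real" and s t g g' :: real
  defines "y \<equiv> \<lambda>u. if u < s then x u else 0"
  assumes "g \<le> g'"
  shows "of_bool (g < s) * (x (min (min g' s) t) - x (min (min g s) t)) =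
    y (min t g') - y (min t g) + x s * (of_bool (s \<le> min t g') - of_bool (s \<le> min t g))"
proof (cases "g < s")
  case True
  have 1: "min (min g s) t = min t g" "min t g < s" using True by auto
  show ?thesis
  proof (cases "min t g' < s")
    case True
    then have "min (min g' s) t = min t g'" by auto
    moreover have n: "(s \<le> min t g') = False" "(s \<le> min t g) = False" using True 1(2) by (auto simp only: not_le)
    ultimately show ?thesis unfolding n using True 1 \<open>g < s\<close> by (simp add: y_def)
  next
    case False
    then have "min (min g' s) t = s" by auto
    moreover have n: "(s \<le> min t g') = True" "(s \<le> min t g) = False" using False 1(2) by (auto simp only: not_le not_less)
    ultimately show ?thesis unfolding n using False 1 \<open>g < s\<close> by (simp add: y_def)
  qed
next
  case False
  show ?thesis
  proof (cases "t < s")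
    case True
    then have "min t g' = t" "min t g = t" using False assms(2) by auto
    then show ?thesis using False by simp
  next
    case f: False
    then have "s \<le> min t g'" "s \<le> min t g" using False assms(2) by auto
    then show ?thesis using False by (simp add: y_def not_less[symmetric])
  qed
qed

section \<open>Killed processes and their grid integrands\<close>

definition killed :: "(real \<Rightarrow> 'a \<Rightarrow> real) \<Rightarrow> ('a \<Rightarrow> real) \<Rightarrow> real \<Rightarrow> 'a \<Rightarrow> real" where
  "killed S \<sigma> t \<omega> = (if t < \<sigma> \<omega> then S t \<omega> else 0)"

context horizon
begin

text \<open>The grid is stopped at \<open>\<sigma>\<close>; an additional last step with coefficient
  0 reaches \<open>T\<close>. Where the \<open>of_bool\<close> factor vanishes the stopped interval
  is empty, so the factor leaves the integral unchanged, but it makes the coefficient measurable at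
  the stopped left end.\<close>

definition grid_rep :: "nat \<Rightarrow> (nat \<Rightarrow> 'a \<Rightarrow> real) \<Rightarrow> real \<Rightarrow> ('a \<Rightarrow> real) \<Rightarrow> 'a simple_rep" where
  "grid_rep n h c \<sigma> = \<lparr>steps = Suc (2 ^ n),
     times = (\<lambda>j \<omega>. if j \<le> 2 ^ n then min (grid n j) (\<sigma> \<omega>) else T),
     coeff = (\<lambda>j \<omega>. if j \<le> 2 ^ n then h (j - 1) \<omega> * of_bool (grid n (j - 1) < \<sigma> \<omega>) / c else 0)\<rparr>"

context
  fixes S :: "real \<Rightarrow> 'a \<Rightarrow> real" and \<sigma> :: "'a \<Rightarrow> real" and K :: real
  assumes S_meas: "\<And>t. t \<in> {0..T} \<Longrightarrow> S t \<in> borel_measurable (FF t)"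
    and S_cadlag: "\<And>\<omega>. \<omega> \<in> space M \<Longrightarrow> cadlag_path T (\<lambda>t. S t \<omega>)"
    and \<sigma>: "stopping_time_upto M F T \<sigma>"
    and S_bound: "\<And>t \<omega>. t \<in> {0..T} \<Longrightarrow> \<omega> \<in> space M \<Longrightarrow> t < \<sigma> \<omega> \<Longrightarrow> \<bar>S t \<omega>\<bar> \<le> K"
    and K: "K > 0"
begin

abbreviation "Sk \<equiv> killed S \<sigma>"

lemma killed_bound: "t \<in> {0..T} \<Longrightarrow> \<omega> \<in> space M \<Longrightarrow> \<bar>Sk t \<omega>\<bar> \<le> K"
  using S_bound K by (auto simp: killed_def)

lemma killed_meas: "t \<in> {0..T} \<Longrightarrow> Sk t \<in> borel_measurable (FF t)"
proof -
  assume t: "t \<in> {0..T}"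
  have "{\<omega>\<in>space (FF t). t < \<sigma> \<omega>} = space (FF t) - {\<omega>\<in>space M. \<sigma> \<omega> \<le> t}" by (auto simp: space_FF)
  then have "{\<omega>\<in>space (FF t). t < \<sigma> \<omega>} \<in> sets (FF t)" using stopping_time_uptoD(3)[OF \<sigma>, of t] by (simp add: sets.Diff)
  then show ?thesis unfolding killed_def[abs_def] using S_meas[OF t] by (intro measurable_If) auto
qed

lemma S_stopped_meas: "u \<in> {0..T} \<Longrightarrow> (\<lambda>\<omega>. S (min u (\<sigma> \<omega>)) \<omega>) \<in> borel_measurable M"
  using FF_measurable_M[OF stopped_measurable[OF S_meas S_cadlag \<sigma>]] by (simp add: min.commute)

lemma S_\<sigma>_meas: "(\<lambda>\<omega>. S (\<sigma> \<omega>) \<omega>) \<in> borel_measurable M"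
proof -
  have "(\<lambda>\<omega>. S (min T (\<sigma> \<omega>)) \<omega>) \<in> borel_measurable M" using T_pos by (intro S_stopped_meas) auto
  then show ?thesis
    by (subst measurable_cong[where g = "\<lambda>\<omega>. S (min T (\<sigma> \<omega>)) \<omega>"]) (use stopping_time_uptoD(2)[OF \<sigma>] in \<open>auto simp: min_absorb2\<close>)
qed

context
  fixes n :: nat and h :: "nat \<Rightarrow> 'a \<Rightarrow> real" and c :: real
  assumes h: "\<And>l. l < 2 ^ n \<Longrightarrow> h l \<in> borel_measurable (FF (grid n l))"
    "\<And>l \<omega>. l < 2 ^ n \<Longrightarrow> \<omega> \<in> space M \<Longrightarrow> \<bar>h l \<omega>\<bar> \<le> 1" and c: "c > 0"
begin

lemma grid_coeff_bound: "1 \<le> j \<Longrightarrow> \<omega> \<in> space M \<Longrightarrow> \<bar>coeff (grid_rep n h c \<sigma>) j \<omega>\<bar> \<le> 1 / c"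
proof (cases "j \<le> 2 ^ n")
  case True
  assume j: "1 \<le> j" "\<omega> \<in> space M"
  then have "\<bar>h (j - 1) \<omega>\<bar> \<le> 1" using h(2)[of "j - 1" \<omega>] True by simp
  then have "\<bar>h (j - 1) \<omega> * of_bool (grid n (j - 1) < \<sigma> \<omega>)\<bar> \<le> 1" by (simp add: of_bool_def)
  then show ?thesis using True c by (simp add: grid_rep_def divide_right_mono)
qed (use c in \<open>simp add: grid_rep_def\<close>)

lemma grid_coeff_meas: "1 \<le> j \<Longrightarrow> j \<le> 2 ^ n \<Longrightarrow> coeff (grid_rep n h c \<sigma>) j \<in> borel_measurable (FF (grid n (j - 1)))"
proof -
  assume j: "1 \<le> j" "j \<le> 2 ^ n"
  let ?g = "grid n (j - 1)"
  have "{\<omega>\<in>space (FF ?g). ?g < \<sigma> \<omega>} = space (FF ?g) - {\<omega>\<in>space M. \<sigma> \<omega> \<le> ?g}" by (auto simp: space_FF)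
  then have "{\<omega>\<in>space (FF ?g). ?g < \<sigma> \<omega>} \<in> sets (FF ?g)" using stopping_time_uptoD(3)[OF \<sigma>, of ?g] by (simp add: sets.Diff)
  then have "(\<lambda>\<omega>. of_bool (?g < \<sigma> \<omega>) :: real) \<in> borel_measurable (FF ?g)" unfolding of_bool_def by (intro measurable_If) auto
  then show ?thesis using h(1)[of "j - 1"] j by (simp add: grid_rep_def)
qed

lemma grid_times_mono: "\<omega> \<in> space M \<Longrightarrow> times (grid_rep n h c \<sigma>) j \<omega> \<le> times (grid_rep n h c \<sigma>) (Suc j) \<omega>"
  using grid_less[of j "Suc j" n] stopping_time_uptoD(2)[OF \<sigma>, of \<omega>] by (auto simp: grid_rep_def min_def)

lemma grid_times_stopping: "stopping_time_upto M F T (times (grid_rep n h c \<sigma>) j)"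
proof (cases "j \<le> 2 ^ n")
  case True
  have "stopping_time FF \<sigma>" using \<sigma> by (simp add: stopping_time_upto_def)
  then have "stopping_time FF (\<lambda>\<omega>. min (grid n j) (\<sigma> \<omega>))" by (intro stopping_time_min stopping_time_const)
  moreover have "\<forall>\<omega>\<in>space M. min (grid n j) (\<sigma> \<omega>) \<in> {0..T}"
    using grid_in[OF True] stopping_time_uptoD(1,2)[OF \<sigma>] by auto
  ultimately show ?thesis using True by (simp add: stopping_time_upto_def grid_rep_def)
next
  case False
  then show ?thesis using T_pos by (simp add: stopping_time_upto_def grid_rep_def stopping_time_const)
qed

lemma grid_rep_simple: "simple_integrand M F T (grid_rep n h c \<sigma>)"
  unfolding simple_integrand_def
proof (intro conjI ballI allI impI)
  fix j show "stopping_time_upto M F T (times (grid_rep n h c \<sigma>) j)" by (rule grid_times_stopping)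
next
  fix \<omega> assume w: "\<omega> \<in> space M"
  show "times (grid_rep n h c \<sigma>) 0 \<omega> = 0" using stopping_time_uptoD(1)[OF \<sigma> w] by (simp add: grid_rep_def)
  show "times (grid_rep n h c \<sigma>) (steps (grid_rep n h c \<sigma>)) \<omega> = T" by (simp add: grid_rep_def)
  fix j assume "j \<in> {1..steps (grid_rep n h c \<sigma>)}"
  then show "times (grid_rep n h c \<sigma>) (j - 1) \<omega> \<le> times (grid_rep n h c \<sigma>) j \<omega>"
    using grid_times_mono[OF w, of "j - 1"] by simp
next
  fix j assume j: "j \<in> {1..steps (grid_rep n h c \<sigma>)}"
  let ?f = "coeff (grid_rep n h c \<sigma>) j" and ?t = "times (grid_rep n h c \<sigma>) (j - 1)"
  have st: "stopping_time FF ?t" using grid_times_stopping by (simp add: stopping_time_upto_def)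
  have sp: "space (pre_sigma ?t) = space M" by (rule space_pre_sigma)
  show f: "?f \<in> borel_measurable (stopped_sigma M F T ?t)"
    unfolding stopped_sigma_def
  proof (cases "j \<le> 2 ^ n")
    case False
    then show "?f \<in> borel_measurable (pre_sigma ?t)" by (simp add: grid_rep_def)
  next
    case True
    let ?g = "grid n (j - 1)"
    have t: "?t \<omega> = min ?g (\<sigma> \<omega>)" for \<omega> using True by (simp add: grid_rep_def)
    show "?f \<in> borel_measurable (pre_sigma ?t)"
    proof (rule measurableI)
      fix B :: "real set" assume B: "B \<in> sets borel"
      show "?f -` B \<inter> space (pre_sigma ?t) \<in> sets (pre_sigma ?t)"
      proof (rule sets_pre_sigmaI[OF st])
        fix u
        show "{\<omega> \<in> ?f -` B \<inter> space (pre_sigma ?t). ?t \<omega> \<le> u} \<in> sets (FF u)"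
        \<comment> \<open>If \<open>u\<close> precedes the grid point, the stopped time is at most
          \<open>u\<close> only where \<open>\<sigma>\<close> is, and there the coefficient is
          0.\<close>
        proof (cases "?g \<le> u")
          case True
          have "?f -` B \<inter> space (FF ?g) \<in> sets (FF ?g)"
            using grid_coeff_meas[of j] j \<open>j \<le> 2 ^ n\<close> B by (intro measurable_sets) auto
          moreover have "{\<omega> \<in> ?f -` B \<inter> space (pre_sigma ?t). ?t \<omega> \<le> u} = ?f -` B \<inter> space (FF ?g)"
            using True by (auto simp: t sp space_FF simp del: One_nat_def)
          ultimately show ?thesis using sets_FF_mono[OF True] by auto
        next
          case False
          have "?f \<omega> = 0" if "\<sigma> \<omega> \<le> u" for \<omega> using that False \<open>j \<le> 2 ^ n\<close> by (simp add: grid_rep_def)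
          then have "{\<omega> \<in> ?f -` B \<inter> space (pre_sigma ?t). ?t \<omega> \<le> u} = (if 0 \<in> B then {\<omega>\<in>space M. \<sigma> \<omega> \<le> u} else {})"
            using False by (auto simp: t sp min_le_iff_disj simp del: One_nat_def)
          then show ?thesis using stopping_time_uptoD(3)[OF \<sigma>, of u] by simp
        qed
      qed
    qed simp
  qed
  have "?f \<in> borel_measurable M"
    using FF_measurable_M[OF grid_coeff_meas[of j]] j by (cases "j \<le> 2 ^ n") (auto simp: grid_rep_def)
  then have "Linf_norm M ?f \<le> ereal (1 / c)"
    unfolding Linf_norm_def using grid_coeff_bound[of j] j by (intro esssup_I AE_I2) auto
  then show "Linf_norm M ?f < \<infinity>" by (rule le_less_trans) simp
qed

lemma grid_rep_sup_norm: "0 \<le> sup_norm M T (integrand_process (grid_rep n h c \<sigma>))"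
  "sup_norm M T (integrand_process (grid_rep n h c \<sigma>)) \<le> ereal (1 / c)"
proof -
  let ?H = "grid_rep n h c \<sigma>"
  have eq: "integrand_process ?H t \<omega> = (\<Sum>j<Suc (2 ^ n). coeff ?H (Suc j) \<omega> * indicator {times ?H j \<omega> <.. times ?H (Suc j) \<omega>} t)" for t \<omega>
  proof -
    have "steps ?H = Suc (2 ^ n)" by (simp add: grid_rep_def)
    then show ?thesis unfolding integrand_process_def One_nat_def by (simp only: sum.atLeast1_atMost_eq diff_Suc_Suc diff_zero)
  qed
  have b: "\<bar>integrand_process ?H t \<omega>\<bar> \<le> 1 / c" if "\<omega> \<in> space M" for t \<omega>
    unfolding eq using grid_times_mono[OF that] grid_coeff_bound[OF _ that] c by (intro disjoint_intervals_sum_bound) auto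
  have m: "integrand_process ?H t \<in> borel_measurable M" for t
  proof -
    have [measurable]: "times ?H j \<in> borel_measurable M" for j using stopping_time_uptoD(5)[OF grid_times_stopping] .
    have [measurable]: "coeff ?H (Suc j) \<in> borel_measurable M" for j
      using FF_measurable_M[OF grid_coeff_meas[of "Suc j"]] by (cases "Suc j \<le> 2 ^ n") (auto simp: grid_rep_def)
    have "(\<lambda>\<omega>. indicator {times ?H j \<omega> <.. times ?H (Suc j) \<omega>} t :: real) \<in> borel_measurable M" for j
      unfolding indicator_def greaterThanAtMost_iff of_bool_def by measurable
    then show ?thesis unfolding eq[abs_def] by (intro borel_measurable_sum borel_measurable_times) auto
  qed
  have Lb: "Linf_norm M (integrand_process ?H t) \<le> ereal (1 / c)" for t
    unfolding Linf_norm_def using b m by (intro esssup_I AE_I2) auto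
  then show "sup_norm M T (integrand_process ?H) \<le> ereal (1 / c)" unfolding sup_norm_def by (intro SUP_least)
  \<comment> \<open>The lower bound, needed to squeeze the norms to 0, compares with the constant 0,
    whose essential supremum is 0 on a space of positive measure.\<close>
  have "0 = esssup M (\<lambda>_. 0 :: ereal)" using esssup_const[of M 0] emeasure_space_1 by simp
  also have "\<dots> \<le> Linf_norm M (integrand_process ?H 0)" unfolding Linf_norm_def by (intro esssup_mono) auto
  also have "\<dots> \<le> sup_norm M T (integrand_process ?H)" unfolding sup_norm_def using T_pos by (intro SUP_upper) auto
  finally show "0 \<le> sup_norm M T (integrand_process ?H)" .
qed

text \<open>By \<open>stopped_killed_increment\<close> the integral and the grid sum differ by
  \<open>S (\<sigma> \<omega>) \<omega>\<close> times a coefficient on the one interval that may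
  contain \<open>\<sigma>\<close>: the weights \<open>?d\<close> are nonnegative and telescope to at
  most 1.\<close>

lemma grid_rep_integral:
  assumes w: "\<omega> \<in> space M"
  shows "\<bar>stoch_integral (grid_rep n h c \<sigma>) S t \<omega> -
    (\<Sum>i<2 ^ n. h i \<omega> * (Sk (min t (grid n (Suc i))) \<omega> - Sk (min t (grid n i)) \<omega>)) / c\<bar> \<le> \<bar>S (\<sigma> \<omega>) \<omega>\<bar> / c"
proof -
  let ?H = "grid_rep n h c \<sigma>" and ?d = "\<lambda>i. of_bool (\<sigma> \<omega> \<le> min t (grid n (Suc i))) - of_bool (\<sigma> \<omega> \<le> min t (grid n i)) :: real"
  have st: "steps ?H = Suc (2 ^ n)" by (simp add: grid_rep_def)
  have "stoch_integral ?H S t \<omega> = (\<Sum>j<Suc (2 ^ n). coeff ?H (Suc j) \<omega> *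
      (S (min (times ?H (Suc j) \<omega>) t) \<omega> - S (min (times ?H j \<omega>) t) \<omega>))"
    unfolding stoch_integral_def One_nat_def st by (simp only: sum.atLeast1_atMost_eq diff_Suc_Suc diff_zero)
  also have "\<dots> = (\<Sum>i<2 ^ n. coeff ?H (Suc i) \<omega> * (S (min (times ?H (Suc i) \<omega>) t) \<omega> - S (min (times ?H i \<omega>) t) \<omega>))"
    by (simp add: grid_rep_def)
  also have "\<dots> = (\<Sum>i<2 ^ n. h i \<omega> / c * (of_bool (grid n i < \<sigma> \<omega>) *
      (S (min (min (grid n (Suc i)) (\<sigma> \<omega>)) t) \<omega> - S (min (min (grid n i) (\<sigma> \<omega>)) t) \<omega>)))"
    by (intro sum.cong) (auto simp: grid_rep_def Suc_le_eq)
  also have "\<dots> = (\<Sum>i<2 ^ n. h i \<omega> / c * (Sk (min t (grid n (Suc i))) \<omega> - Sk (min t (grid n i)) \<omega> + S (\<sigma> \<omega>) \<omega> * ?d i))"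
    unfolding killed_def by (intro sum.cong refl arg_cong2[where f = "(*)"] stopped_killed_increment[where x = "\<lambda>t. S t \<omega>"] grid_le) simp
  also have "\<dots> = (\<Sum>i<2 ^ n. h i \<omega> * (Sk (min t (grid n (Suc i))) \<omega> - Sk (min t (grid n i)) \<omega>)) / c
      + S (\<sigma> \<omega>) \<omega> / c * (\<Sum>i<2 ^ n. h i \<omega> * ?d i)"
    unfolding sum_divide_distrib sum_distrib_left sum.distrib[symmetric]
  proof (intro sum.cong refl)
    show "h i \<omega> / c * (a + s * d) = h i \<omega> * a / c + s / c * (h i \<omega> * d)" for i a s d using c by (simp add: field_simps)
  qed
  finally have e: "stoch_integral ?H S t \<omega> - (\<Sum>i<2 ^ n. h i \<omega> * (Sk (min t (grid n (Suc i))) \<omega> - Sk (min t (grid n i)) \<omega>)) / c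
      = S (\<sigma> \<omega>) \<omega> / c * (\<Sum>i<2 ^ n. h i \<omega> * ?d i)" by simp
  have d0: "0 \<le> ?d i" for i using grid_less[of i "Suc i" n] by auto
  have "\<bar>\<Sum>i<2 ^ n. h i \<omega> * ?d i\<bar> \<le> (\<Sum>i<2 ^ n. 1 * ?d i)"
    using h(2)[OF _ w] d0 by (intro order_trans[OF sum_abs] sum_mono) (simp add: abs_mult mult_right_mono)
  also have "\<dots> = of_bool (\<sigma> \<omega> \<le> min t (grid n (2 ^ n))) - of_bool (\<sigma> \<omega> \<le> min t (grid n 0))"
    unfolding mult_1 by (rule sum_lessThan_telescope)
  also have "\<dots> \<le> 1" by simp
  finally have "\<bar>S (\<sigma> \<omega>) \<omega> / c\<bar> * \<bar>\<Sum>i<2 ^ n. h i \<omega> * ?d i\<bar> \<le> \<bar>S (\<sigma> \<omega>) \<omega> / c\<bar> * 1" by (intro mult_left_mono) auto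
  then show ?thesis unfolding e abs_mult using c by simp
qed

text \<open>Between two grid points only a part of one increment is open, and its contribution is at
  most \<open>2 * K\<close> in absolute value. So losses at arbitrary times are controlled by those
  at grid times.\<close>

lemma grid_partial_sum:
  assumes w: "\<omega> \<in> space M" and t: "t \<in> {0..T}"
  shows "\<exists>k\<le>2 ^ n. grid_sum Sk n h k \<omega> - 2 * K \<le> (\<Sum>i<2 ^ n. h i \<omega> * (Sk (min t (grid n (Suc i))) \<omega> - Sk (min t (grid n i)) \<omega>))"
proof -
  let ?k = "grid_index n t" and ?f = "\<lambda>i. h i \<omega> * (Sk (min t (grid n (Suc i))) \<omega> - Sk (min t (grid n i)) \<omega>)"
  have k: "grid n ?k \<le> t" "t < grid n (Suc ?k)" "?k \<le> 2 ^ n"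
    using grid_index_lower[of n t] grid_index_upper[of t n] grid_index_le t by auto
  have below: "(\<Sum>i<?k. ?f i) = grid_sum Sk n h ?k \<omega>"
    unfolding grid_sum_def
  proof (intro sum.cong refl)
    fix i assume "i \<in> {..<?k}"
    then have "grid n (Suc i) \<le> grid n ?k" "grid n i \<le> grid n ?k" by (auto intro!: grid_le)
    then have "grid n (Suc i) \<le> t" "grid n i \<le> t" using k(1) by linarith+
    then show "?f i = h i \<omega> * (Sk (grid n (Suc i)) \<omega> - Sk (grid n i) \<omega>)" by (simp add: min_absorb2)
  qed
  show ?thesis
  proof (cases "?k < 2 ^ n")
    case True
    have "(\<Sum>i<2 ^ n. ?f i) = (\<Sum>i<Suc ?k. ?f i)"
    proof (rule sum.mono_neutral_right)
      show "\<forall>i\<in>{..<2 ^ n} - {..<Suc ?k}. ?f i = 0"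
      proof
        fix i assume "i \<in> {..<2 ^ n} - {..<Suc ?k}"
        then have "grid n (Suc ?k) \<le> grid n i" by (intro grid_le) auto
        then have "t \<le> grid n i" "t \<le> grid n (Suc i)" using k(2) grid_less[of i "Suc i" n] by linarith+
        then show "?f i = 0" by (simp add: min_absorb1)
      qed
    qed (use True in auto)
    moreover have "\<bar>?f ?k\<bar> \<le> 1 * (2 * K)"
      unfolding abs_mult
    proof (rule mult_mono)
      have "\<bar>Sk (min t u) \<omega>\<bar> \<le> K" if "0 \<le> u" for u using killed_bound[OF _ w, of "min t u"] t that by auto
      from this[OF grid_nonneg, of n "Suc ?k"] this[OF grid_nonneg, of n ?k]
      show "\<bar>Sk (min t (grid n (Suc ?k))) \<omega> - Sk (min t (grid n ?k)) \<omega>\<bar> \<le> 2 * K" by (auto simp: abs_le_iff)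
    qed (use h(2)[OF True w] in auto)
    ultimately have "grid_sum Sk n h ?k \<omega> - 2 * K \<le> (\<Sum>i<2 ^ n. ?f i)" using below by (simp add: abs_le_iff)
    then show ?thesis using k(3) by blast
  next
    case False
    then have "?k = 2 ^ n" using k by simp
    then show ?thesis using below K by (intro exI[of _ "2 ^ n"]) auto
  qed
qed

end

section \<open>Condition (1) for the killed process\<close>

text \<open>The integrands have sup norm at most \<open>1 / c m\<close>. Two errors separate the
  integral from the grid sums, the open increment and the jump at \<open>\<sigma>\<close>; both have
  finite bounds independent of \<open>m\<close>, so they vanish after division by
  \<open>c m\<close>.\<close>

lemma grid_no_gain_killed:
  assumes cond: "\<forall>H :: nat \<Rightarrow> 'a simple_rep.
            (\<forall>n. simple_integrand M F T (H n)) \<and>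
            (\<lambda>n. sup_norm M T (integrand_process (H n))) \<longlonglongrightarrow> 0 \<and>
            tendsto_in_prob M (\<lambda>n \<omega>. SUP t\<in>{0..T}. neg_part (stoch_integral (H n) S t \<omega>)) (\<lambda>_. 0)
            \<longrightarrow> tendsto_in_prob M (\<lambda>n \<omega>. pos_part (stoch_integral (H n) S T \<omega>)) (\<lambda>_. 0)"
  shows "grid_no_gain Sk"
  unfolding grid_no_gain_def
proof (intro allI impI)
  fix \<nu> :: "nat \<Rightarrow> nat" and h :: "nat \<Rightarrow> nat \<Rightarrow> 'a \<Rightarrow> real" and c :: "nat \<Rightarrow> real" and \<delta> :: real
  assume a: "(\<forall>m. \<forall>l<2 ^ \<nu> m. h m l \<in> borel_measurable (FF (grid (\<nu> m) l)) \<and> (\<forall>\<omega>\<in>space M. \<bar>h m l \<omega>\<bar> \<le> 1)) \<and>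
     (\<forall>m. 0 < c m) \<and> filterlim c at_top sequentially \<and>
     (\<forall>\<delta>>0. (\<lambda>m. prob {\<omega>\<in>space M. \<exists>j\<le>2 ^ \<nu> m. grid_sum Sk (\<nu> m) (h m) j \<omega> \<le> - \<delta> * c m}) \<longlonglongrightarrow> 0)"
    and \<delta>: "\<delta> > 0"
  have h: "\<And>l. l < 2 ^ \<nu> m \<Longrightarrow> h m l \<in> borel_measurable (FF (grid (\<nu> m) l))"
    "\<And>l \<omega>. l < 2 ^ \<nu> m \<Longrightarrow> \<omega> \<in> space M \<Longrightarrow> \<bar>h m l \<omega>\<bar> \<le> 1" for m using a by blast+
  have c: "0 < c m" for m using a by blast
  have c_top: "filterlim c at_top sequentially" using a by blast
  have low: "(\<lambda>m. prob {\<omega>\<in>space M. \<exists>j\<le>2 ^ \<nu> m. grid_sum Sk (\<nu> m) (h m) j \<omega> \<le> - \<delta> * c m}) \<longlonglongrightarrow> 0" if "\<delta> > 0" for \<delta>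
    using a that by blast
  have ctop: "filterlim (\<lambda>m. \<epsilon> * c m) at_top sequentially" if "\<epsilon> > 0" for \<epsilon>
    by (rule filterlim_tendsto_pos_mult_at_top[OF tendsto_const that c_top])
  define H where "H m = grid_rep (\<nu> m) (h m) (c m) \<sigma>" for m
  let ?G = "\<lambda>m t \<omega>. \<Sum>i<2 ^ \<nu> m. h m i \<omega> * (Sk (min t (grid (\<nu> m) (Suc i))) \<omega> - Sk (min t (grid (\<nu> m) i)) \<omega>)"
  have int: "\<bar>stoch_integral (H m) S t \<omega> - ?G m t \<omega> / c m\<bar> \<le> \<bar>S (\<sigma> \<omega>) \<omega>\<bar> / c m" if "\<omega> \<in> space M" for m t \<omega>
    unfolding H_def by (rule grid_rep_integral[OF h c that])
  have gsM: "grid_sum Sk (\<nu> m) (h m) j \<in> borel_measurable M" if "j \<le> 2 ^ \<nu> m" for m j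
    unfolding grid_sum_def using that FF_measurable_M[OF h(1)] FF_measurable_M[OF killed_meas[OF grid_in]]
    by (intro borel_measurable_sum borel_measurable_times borel_measurable_diff) auto
  have S\<sigma>[measurable]: "(\<lambda>\<omega>. S (\<sigma> \<omega>) \<omega>) \<in> borel_measurable M" by (rule S_\<sigma>_meas)
  have "tendsto_in_prob M (\<lambda>m \<omega>. pos_part (stoch_integral (H m) S T \<omega>)) (\<lambda>_. 0)"
  proof (rule cond[rule_format], intro conjI allI)
    show "simple_integrand M F T (H m)" for m unfolding H_def by (rule grid_rep_simple[OF h c])
    have "(\<lambda>m. 1 / c m) \<longlonglongrightarrow> 0" by (rule real_tendsto_divide_at_top[OF tendsto_const c_top])
    then have l: "(\<lambda>m. ereal (1 / c m)) \<longlonglongrightarrow> 0" by (simp add: zero_ereal_def)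
    show "(\<lambda>m. sup_norm M T (integrand_process (H m))) \<longlonglongrightarrow> 0"
      by (rule tendsto_sandwich[OF _ _ tendsto_const l])
        (simp_all add: H_def grid_rep_sup_norm[OF h c])
    show "tendsto_in_prob M (\<lambda>m \<omega>. SUP t\<in>{0..T}. neg_part (stoch_integral (H m) S t \<omega>)) (\<lambda>_. 0)"
      unfolding tendsto_in_prob_def
    proof (intro allI impI)
      fix \<epsilon> :: real assume \<epsilon>: "\<epsilon> > 0"
      \<comment> \<open>Half of \<open>\<epsilon>\<close> is left for the grid sums, half for the
        errors.\<close>
      let ?A = "\<lambda>m. {\<omega>\<in>space M. \<exists>j\<le>2 ^ \<nu> m. grid_sum Sk (\<nu> m) (h m) j \<omega> \<le> - (\<epsilon> / 2) * c m}"
      let ?B = "\<lambda>m. {\<omega>\<in>space M. \<epsilon> / 2 * c m < 2 * K + \<bar>S (\<sigma> \<omega>) \<omega>\<bar>}"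
      have A: "?A m \<in> events" for m
      proof -
        have "{\<omega>\<in>space M. \<exists>j\<in>{..2 ^ \<nu> m}. grid_sum Sk (\<nu> m) (h m) j \<omega> \<le> - (\<epsilon> / 2) * c m} \<in> events"
          using gsM by (intro sets.sets_Collect_finite_Ex) auto
        then show ?thesis by (simp only: Bex_def atMost_iff)
      qed
      have B: "?B m \<in> events" for m by measurable
      have "(\<lambda>m. prob (?A m) + prob (?B m)) \<longlonglongrightarrow> 0 + 0"
        using \<epsilon> by (intro tendsto_add low prob_greater_tendsto_0 ctop) (simp_all, measurable)
      then have lim: "(\<lambda>m. prob (?A m) + prob (?B m)) \<longlonglongrightarrow> 0" by simp
      have "prob {\<omega>\<in>space M. \<epsilon> < \<bar>(SUP t\<in>{0..T}. neg_part (stoch_integral (H m) S t \<omega>)) - 0\<bar>} \<le> prob (?A m) + prob (?B m)" for m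
      proof -
        have "{\<omega>\<in>space M. \<epsilon> < \<bar>(SUP t\<in>{0..T}. neg_part (stoch_integral (H m) S t \<omega>)) - 0\<bar>} \<subseteq> ?A m \<union> ?B m"
        proof (rule subsetI, rule ccontr)
          fix \<omega> assume w': "\<omega> \<in> {\<omega>\<in>space M. \<epsilon> < \<bar>(SUP t\<in>{0..T}. neg_part (stoch_integral (H m) S t \<omega>)) - 0\<bar>}"
            and n: "\<omega> \<notin> ?A m \<union> ?B m"
          then have w: "\<omega> \<in> space M" by blast
          have nb: "neg_part (stoch_integral (H m) S t \<omega>) \<le> \<epsilon>" if t: "t \<in> {0..T}" for t
          proof -
            obtain k where k: "k \<le> 2 ^ \<nu> m" "grid_sum Sk (\<nu> m) (h m) k \<omega> - 2 * K \<le> ?G m t \<omega>"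
              using grid_partial_sum[OF h c w t] by blast
            have "\<not> (\<exists>j\<le>2 ^ \<nu> m. grid_sum Sk (\<nu> m) (h m) j \<omega> \<le> - (\<epsilon> / 2) * c m)" using n w by blast
            then have "- (\<epsilon> / 2) * c m < grid_sum Sk (\<nu> m) (h m) k \<omega>" using k(1) not_le by blast
            moreover have "2 * K + \<bar>S (\<sigma> \<omega>) \<omega>\<bar> \<le> \<epsilon> / 2 * c m" using n w by (auto simp: not_less)
            ultimately have "- \<epsilon> * c m \<le> ?G m t \<omega> - \<bar>S (\<sigma> \<omega>) \<omega>\<bar>" using k(2) by simp
            then have "- \<epsilon> \<le> (?G m t \<omega> - \<bar>S (\<sigma> \<omega>) \<omega>\<bar>) / c m" using c[of m] by (simp add: pos_le_divide_eq)
            also have "\<dots> \<le> stoch_integral (H m) S t \<omega>" using int[OF w, of m t] by (simp add: diff_divide_distrib abs_le_iff)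
            finally show ?thesis using \<epsilon> by (simp add: neg_part_def)
          qed
          have "(SUP t\<in>{0..T}. neg_part (stoch_integral (H m) S t \<omega>)) \<le> \<epsilon>"
            using T_pos nb by (intro cSUP_least) auto
          moreover have "0 \<le> neg_part (stoch_integral (H m) S 0 \<omega>)" by (simp add: neg_part_def)
          then have "0 \<le> (SUP t\<in>{0..T}. neg_part (stoch_integral (H m) S t \<omega>))"
            using T_pos nb by (intro cSUP_upper2[of _ _ 0]) (auto intro!: bdd_aboveI2[where M = \<epsilon>])
          ultimately show False using w' by simp
        qed
        then have "prob {\<omega>\<in>space M. \<epsilon> < \<bar>(SUP t\<in>{0..T}. neg_part (stoch_integral (H m) S t \<omega>)) - 0\<bar>} \<le> prob (?A m \<union> ?B m)"
          by (rule finite_measure_mono) (intro sets.Un A B)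
        also have "\<dots> \<le> prob (?A m) + prob (?B m)" by (intro measure_Un_le A B)
        finally show ?thesis .
      qed
      then show "(\<lambda>m. prob {\<omega>\<in>space M. \<epsilon> < \<bar>(SUP t\<in>{0..T}. neg_part (stoch_integral (H m) S t \<omega>)) - 0\<bar>}) \<longlonglongrightarrow> 0"
        by (intro tendsto_sandwich[OF _ _ tendsto_const lim] always_eventually allI measure_nonneg)
    qed
  qed
  then have p: "(\<lambda>m. prob {\<omega>\<in>space M. \<epsilon> < \<bar>pos_part (stoch_integral (H m) S T \<omega>) - 0\<bar>}) \<longlonglongrightarrow> 0" if "\<epsilon> > 0" for \<epsilon>
    using that by (simp add: tendsto_in_prob_def)
  \<comment> \<open>Thirds leave room for a strict inequality: a gain of \<open>\<delta>\<close>
    less a jump of at most \<open>\<delta> / 3\<close> still exceeds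
    \<open>\<delta> / 3\<close>.\<close>
  let ?A = "\<lambda>m. {\<omega>\<in>space M. \<delta> / 3 < \<bar>pos_part (stoch_integral (H m) S T \<omega>) - 0\<bar>}"
  let ?B = "\<lambda>m. {\<omega>\<in>space M. \<delta> / 3 * c m < \<bar>S (\<sigma> \<omega>) \<omega>\<bar>}"
  have A: "?A m \<in> events" for m
  proof -
    let ?R = "grid_rep (\<nu> m) (h m) (c m) \<sigma>"
    have "(\<lambda>\<omega>. coeff ?R j \<omega> * (S (min (times ?R j \<omega>) T) \<omega> - S (min (times ?R (j - 1) \<omega>) T) \<omega>)) \<in> borel_measurable M"
      if j: "j \<in> {1..Suc (2 ^ \<nu> m)}" for j
    proof (cases "j \<le> 2 ^ \<nu> m")
      case True
      have t: "(\<lambda>\<omega>. S (min (times ?R i \<omega>) T) \<omega>) \<in> borel_measurable M" if "i \<le> 2 ^ \<nu> m" for i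
        using S_stopped_meas[OF grid_in[OF that]] grid_in[OF that] that by (simp add: grid_rep_def min.absorb1 min.coboundedI1)
      show ?thesis
        using FF_measurable_M[OF grid_coeff_meas[OF h c]] True j by (intro borel_measurable_times borel_measurable_diff t) auto
    next
      case False
      then show ?thesis by (simp add: grid_rep_def)
    qed
    then have "(\<lambda>\<omega>. stoch_integral (H m) S T \<omega>) \<in> borel_measurable M"
      unfolding stoch_integral_def H_def by (intro borel_measurable_sum) (auto simp: grid_rep_def)
    then show ?thesis unfolding pos_part_def by measurable
  qed
  have B: "?B m \<in> events" for m by measurable
  have "(\<lambda>m. prob (?A m) + prob (?B m)) \<longlonglongrightarrow> 0 + 0"
    using \<delta> by (intro tendsto_add p prob_greater_tendsto_0 ctop) (simp_all, measurable)
  then have lim: "(\<lambda>m. prob (?A m) + prob (?B m)) \<longlonglongrightarrow> 0" by simp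
  have "prob {\<omega>\<in>space M. \<delta> * c m \<le> grid_sum Sk (\<nu> m) (h m) (2 ^ \<nu> m) \<omega>} \<le> prob (?A m) + prob (?B m)" for m
  proof -
    have "{\<omega>\<in>space M. \<delta> * c m \<le> grid_sum Sk (\<nu> m) (h m) (2 ^ \<nu> m) \<omega>} \<subseteq> ?A m \<union> ?B m"
    proof (rule subsetI, rule ccontr)
      fix \<omega> assume w: "\<omega> \<in> {\<omega>\<in>space M. \<delta> * c m \<le> grid_sum Sk (\<nu> m) (h m) (2 ^ \<nu> m) \<omega>}" and n: "\<omega> \<notin> ?A m \<union> ?B m"
      have "?G m T \<omega> = grid_sum Sk (\<nu> m) (h m) (2 ^ \<nu> m) \<omega>"
        unfolding grid_sum_def
      proof (intro sum.cong refl)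
        fix i assume "i \<in> {..<(2::nat) ^ \<nu> m}"
        then have "grid (\<nu> m) (Suc i) \<le> T" "grid (\<nu> m) i \<le> T" by (auto intro!: grid_le_T)
        then show "h m i \<omega> * (Sk (min T (grid (\<nu> m) (Suc i))) \<omega> - Sk (min T (grid (\<nu> m) i)) \<omega>) =
          h m i \<omega> * (Sk (grid (\<nu> m) (Suc i)) \<omega> - Sk (grid (\<nu> m) i) \<omega>)" by (simp add: min_absorb2)
      qed
      then have 1: "\<delta> * c m \<le> ?G m T \<omega>" using w by simp
      have 2: "\<bar>S (\<sigma> \<omega>) \<omega>\<bar> \<le> \<delta> / 3 * c m" using n w by (auto simp: not_less)
      have "\<delta> * 2 / 3 * c m \<le> ?G m T \<omega> - \<bar>S (\<sigma> \<omega>) \<omega>\<bar>" using 1 2 by (simp add: field_simps)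
      then have "\<delta> * 2 / 3 \<le> (?G m T \<omega> - \<bar>S (\<sigma> \<omega>) \<omega>\<bar>) / c m" using c[of m] by (simp add: pos_le_divide_eq)
      also have "\<dots> \<le> stoch_integral (H m) S T \<omega>" using int[of \<omega> m T] w by (simp add: diff_divide_distrib abs_le_iff)
      finally have "\<delta> / 3 < pos_part (stoch_integral (H m) S T \<omega>)" using \<delta> by (simp add: pos_part_def)
      then show False using n w by auto
    qed
    then have "prob {\<omega>\<in>space M. \<delta> * c m \<le> grid_sum Sk (\<nu> m) (h m) (2 ^ \<nu> m) \<omega>} \<le> prob (?A m \<union> ?B m)"
      by (rule finite_measure_mono) (intro sets.Un A B)
    also have "\<dots> \<le> prob (?A m) + prob (?B m)" by (intro measure_Un_le A B)
    finally show ?thesis .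
  qed
  then show "(\<lambda>m. prob {\<omega>\<in>space M. \<delta> * c m \<le> grid_sum Sk (\<nu> m) (h m) (2 ^ \<nu> m) \<omega>}) \<longlonglongrightarrow> 0"
    by (intro tendsto_sandwich[OF _ _ tendsto_const lim] always_eventually allI measure_nonneg)
qed

end

end

text \<open>Compactness by bisection: near each time the path is bounded on the right by
  right-continuity and on the left by the left limit, and the time itself adds one value.\<close>

lemma cadlag_path_bounded:
  assumes x: "cadlag_path T x" and T: "T > 0"
  shows "\<exists>C. \<forall>t\<in>{0..T}. \<bar>x t\<bar> \<le> C"
proof -
  have "\<exists>C. \<forall>t\<in>{0..T} \<inter> {0..T}. \<bar>x t\<bar> \<le> C"
  proof (rule Bolzano[where P = "\<lambda>a b. \<exists>C. \<forall>t\<in>{a..b} \<inter> {0..T}. \<bar>x t\<bar> \<le> C" and a = 0 and b = T])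
    fix a b c assume "\<exists>C. \<forall>t\<in>{a..b} \<inter> {0..T}. \<bar>x t\<bar> \<le> C" "\<exists>C. \<forall>t\<in>{b..c} \<inter> {0..T}. \<bar>x t\<bar> \<le> C"
    then obtain C D where CD: "\<forall>t\<in>{a..b} \<inter> {0..T}. \<bar>x t\<bar> \<le> C" "\<forall>t\<in>{b..c} \<inter> {0..T}. \<bar>x t\<bar> \<le> D" by blast
    have "\<bar>x t\<bar> \<le> max C D" if "t \<in> {a..c} \<inter> {0..T}" for t
      using CD that by (cases "t \<le> b") (auto simp: le_max_iff_disj)
    then show "\<exists>C. \<forall>t\<in>{a..c} \<inter> {0..T}. \<bar>x t\<bar> \<le> C" by blast
  next
    fix u assume u: "0 \<le> u" "u \<le> T"
    have "\<exists>d>u. \<exists>C. \<forall>t. u < t \<and> t < d \<and> t \<le> T \<longrightarrow> \<bar>x t\<bar> \<le> C"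
    proof (cases "u < T")
      case True
      have "\<forall>\<^sub>F t in at_right u. \<bar>x t\<bar> < \<bar>x u\<bar> + 1"
        by (rule order_tendstoD(2)[OF tendsto_rabs[OF cadlag_path_right[OF x u(1) True]]]) simp
      then obtain d where "d > u" "\<And>t. u < t \<Longrightarrow> t < d \<Longrightarrow> \<bar>x t\<bar> < \<bar>x u\<bar> + 1"
        unfolding eventually_at_right_field by blast
      then show ?thesis by (intro exI[of _ d] conjI exI[of _ "\<bar>x u\<bar> + 1"]) (auto intro: less_imp_le)
    next
      case False then show ?thesis using u by (intro exI[of _ "u + 1"]) auto
    qed
    then obtain d C where d: "d > u" "\<And>t. u < t \<Longrightarrow> t < d \<Longrightarrow> t \<le> T \<Longrightarrow> \<bar>x t\<bar> \<le> C" by blast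
    have "\<exists>e<u. \<exists>C. \<forall>t. e < t \<and> t < u \<and> 0 \<le> t \<longrightarrow> \<bar>x t\<bar> \<le> C"
    proof (cases "0 < u")
      case True
      obtain l where l: "(x \<longlongrightarrow> l) (at_left u)" using cadlag_path_left[OF x True u(2)] by blast
      have "\<forall>\<^sub>F t in at_left u. \<bar>x t\<bar> < \<bar>l\<bar> + 1" by (rule order_tendstoD(2)[OF tendsto_rabs[OF l]]) simp
      then obtain e where "e < u" "\<And>t. e < t \<Longrightarrow> t < u \<Longrightarrow> \<bar>x t\<bar> < \<bar>l\<bar> + 1"
        unfolding eventually_at_left_field by blast
      then show ?thesis by (intro exI[of _ e] conjI exI[of _ "\<bar>l\<bar> + 1"]) (auto intro: less_imp_le)
    next
      case False then show ?thesis using u by (intro exI[of _ "u - 1"]) auto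
    qed
    then obtain e D where e: "e < u" "\<And>t. e < t \<Longrightarrow> t < u \<Longrightarrow> 0 \<le> t \<Longrightarrow> \<bar>x t\<bar> \<le> D" by blast
    show "\<exists>\<delta>>0. \<forall>a b. a \<le> u \<and> u \<le> b \<and> b - a < \<delta> \<longrightarrow> (\<exists>C. \<forall>t\<in>{a..b} \<inter> {0..T}. \<bar>x t\<bar> \<le> C)"
    proof (rule exI[of _ "min (d - u) (u - e)"], intro conjI allI impI)
      fix a b assume ab: "a \<le> u \<and> u \<le> b \<and> b - a < min (d - u) (u - e)"
      have "\<bar>x t\<bar> \<le> max (max C D) \<bar>x u\<bar>" if t: "t \<in> {a..b} \<inter> {0..T}" for t
      proof -
        consider "t < u" | "t = u" | "u < t" by linarith
        then show ?thesis
        proof cases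
          case 1 then have "\<bar>x t\<bar> \<le> D" using e(2)[of t] ab t by auto
          then show ?thesis by simp
        next
          case 2 then show ?thesis by simp
        next
          case 3 then have "\<bar>x t\<bar> \<le> C" using d(2)[of t] ab t by auto
          then show ?thesis by simp
        qed
      qed
      then show "\<exists>C. \<forall>t\<in>{a..b} \<inter> {0..T}. \<bar>x t\<bar> \<le> C" by blast
    qed (use d e in simp)
  qed (use T in auto)
  then show ?thesis by auto
qed

lemma cadlag_path_killed:
  assumes x: "cadlag_path T x" shows "cadlag_path T (\<lambda>t. if t < s then x t else 0)"
proof (rule cadlag_pathI)
  let ?y = "\<lambda>t. if t < s then x t else 0"
  fix t assume t: "0 \<le> t" "t < T"
  show "(?y \<longlongrightarrow> ?y t) (at_right t)"
  proof (cases "t < s")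
    case True
    have "\<forall>\<^sub>F u in at_right t. x u = ?y u" by (rule eventually_at_rightI[OF _ True]) auto
    from Lim_transform_eventually[OF cadlag_path_right[OF x t] this] show ?thesis using True by simp
  next
    case False
    have "\<forall>\<^sub>F u in at_right t. 0 = ?y u" by (rule eventually_at_rightI[OF _ t(2)]) (use False in auto)
    from Lim_transform_eventually[OF tendsto_const this] show ?thesis using False by simp
  qed
next
  let ?y = "\<lambda>t. if t < s then x t else 0"
  fix t assume t: "0 < t" "t \<le> T"
  show "\<exists>l. (?y \<longlongrightarrow> l) (at_left t)"
  proof (cases "t \<le> s")
    case True
    obtain l where l: "(x \<longlongrightarrow> l) (at_left t)" using cadlag_path_left[OF x t] by blast
    have "\<forall>\<^sub>F u in at_left t. x u = ?y u" by (rule eventually_at_leftI[OF _ t(1)]) (use True in auto)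
    from Lim_transform_eventually[OF l this] show ?thesis by blast
  next
    case False
    then have "s < t" by simp
    then have "\<forall>\<^sub>F u in at_left t. 0 = ?y u" by (rule eventually_at_leftI[rotated]) auto
    from Lim_transform_eventually[OF tendsto_const this] show ?thesis by blast
  qed
qed

lemma (in prob_space) prob_decseq_tendsto_0:
  assumes E: "\<And>k. E k \<in> events" "decseq E" and ae: "AE \<omega> in M. \<exists>k::nat. \<omega> \<notin> E k"
  shows "(\<lambda>k. prob (E k)) \<longlonglongrightarrow> 0"
proof -
  have "(\<lambda>k. prob (E k)) \<longlonglongrightarrow> prob (\<Inter>k. E k)" using E by (intro finite_Lim_measure_decseq) auto
  moreover have "(\<Inter>k. E k) \<in> null_sets M"
  proof (rule AE_iff_null_sets[THEN iffD2])
    show "(\<Inter>k. E k) \<in> events" using E by (intro sets.countable_INT) auto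
    show "AE \<omega> in M. \<omega> \<notin> (\<Inter>k. E k)" using ae by eventually_elim blast
  qed
  then have "prob (\<Inter>k. E k) = 0" by (simp add: null_sets_def measure_def)
  ultimately show ?thesis by simp
qed

subsection \<open>Absence of gains implies the semimartingale property\<close>

context horizon
begin

text \<open>The infimum runs over countably many times, which makes its strict sublevel sets
  countable unions; right-continuity extends the bound from dyadic times to all times before
  \<open>\<sigma> k\<close>. Each path is bounded and so stays below the level for large
  \<open>k\<close>.\<close>

lemma exceedance_time:
  assumes S_meas: "\<And>t. t \<in> {0..T} \<Longrightarrow> S t \<in> borel_measurable (FF t)"
    and S_cadlag: "\<And>\<omega>. \<omega> \<in> space M \<Longrightarrow> cadlag_path T (\<lambda>t. S t \<omega>)"
  shows "\<exists>\<sigma>. (\<forall>k::nat. stopping_time_upto M F T (\<sigma> k)) \<and>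
    (\<forall>k. \<forall>t\<in>{0..T}. \<forall>\<omega>\<in>space M. t < \<sigma> k \<omega> \<longrightarrow> \<bar>S t \<omega>\<bar> \<le> real (Suc k)) \<and>
    (\<lambda>k. prob {\<omega>\<in>space M. \<sigma> k \<omega> < T}) \<longlonglongrightarrow> 0"
proof -
  define \<sigma> where "\<sigma> k \<omega> = Inf (insert T {s\<in>dyadics. real (Suc k) < \<bar>S s \<omega>\<bar>})" for k \<omega>
  have bdd: "bdd_below (insert T {s\<in>dyadics. real (Suc k) < \<bar>S s \<omega>\<bar>})" for k \<omega>
    by (rule bdd_belowI[of _ 0]) (use dyadics_in T_pos in auto)
  have \<sigma>_in: "\<sigma> k \<omega> \<in> {0..T}" for k \<omega>
    unfolding \<sigma>_def using cInf_lower[OF _ bdd[of k \<omega>], of T] dyadics_in T_pos by (auto intro!: cInf_greatest)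
  have \<sigma>_less: "\<sigma> k \<omega> < u \<longleftrightarrow> (\<exists>s\<in>dyadics. s < u \<and> real (Suc k) < \<bar>S s \<omega>\<bar>)" if "u \<le> T" for u k \<omega>
    unfolding \<sigma>_def cInf_less_iff[OF insert_not_empty bdd] using that by auto
  have st: "stopping_time_upto M F T (\<sigma> k)" for k
  proof (rule stopping_time_uptoI)
    fix u assume u: "0 < u" "u \<le> T"
    have "{\<omega>\<in>space M. \<sigma> k \<omega> < u} = (\<Union>s\<in>{s\<in>dyadics. s < u}. {\<omega>\<in>space (FF u). real (Suc k) < \<bar>S s \<omega>\<bar>})"
      using \<sigma>_less[OF u(2)] by (auto simp: space_FF)
    also have "\<dots> \<in> sets (FF u)"
    proof (intro sets.countable_UN')
      show "countable {s\<in>dyadics. s < u}" using countable_dyadics by (rule countable_subset[rotated]) auto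
      have "{\<omega>\<in>space (FF u). real (Suc k) < \<bar>S s \<omega>\<bar>} \<in> sets (FF u)" if "s \<in> dyadics" "s < u" for s
      proof -
        have [measurable]: "S s \<in> borel_measurable (FF u)"
          using FF_measurable_mono[OF S_meas, of s u] dyadics_in[OF that(1)] that by auto
        show ?thesis by measurable
      qed
      then show "(\<lambda>s. {\<omega>\<in>space (FF u). real (Suc k) < \<bar>S s \<omega>\<bar>}) ` {s\<in>dyadics. s < u} \<subseteq> sets (FF u)" by blast
    qed
    finally show "{\<omega>\<in>space M. \<sigma> k \<omega> < u} \<in> sets (FF u)" .
  qed (rule \<sigma>_in)
  have S_le: "\<bar>S t \<omega>\<bar> \<le> real (Suc k)" if t: "t \<in> {0..T}" and w: "\<omega> \<in> space M" and less: "t < \<sigma> k \<omega>" for k t \<omega>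
  proof -
    have t': "0 \<le> t" "t < T" using t less \<sigma>_in[of k \<omega>] by auto
    obtain s where s: "\<And>j. s j \<in> dyadics" "\<And>j. t < s j" "\<And>j. s j < \<sigma> k \<omega>" "s \<longlonglongrightarrow> t"
      using dyadic_sequence[of t "\<sigma> k \<omega>"] t' less \<sigma>_in[of k \<omega>] by auto
    have "filterlim s (at_right t) sequentially"
      using s by (auto simp: filterlim_at less_imp_neq[symmetric] intro!: always_eventually)
    from filterlim_compose[OF cadlag_path_right[OF S_cadlag[OF w] t'] this]
    have l: "(\<lambda>j. \<bar>S (s j) \<omega>\<bar>) \<longlonglongrightarrow> \<bar>S t \<omega>\<bar>" by (rule tendsto_rabs)
    have "\<bar>S (s j) \<omega>\<bar> \<le> real (Suc k)" for j
    proof (rule ccontr)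
      assume "\<not> ?thesis"
      then have "\<sigma> k \<omega> \<le> s j" unfolding \<sigma>_def using s(1)[of j] by (intro cInf_lower bdd) auto
      then show False using s(3)[of j] by simp
    qed
    then show ?thesis by (intro LIMSEQ_le_const2[OF l]) blast
  qed
  have "(\<lambda>k. prob {\<omega>\<in>space M. \<sigma> k \<omega> < T}) \<longlonglongrightarrow> 0"
  proof (rule prob_decseq_tendsto_0)
    show "{\<omega>\<in>space M. \<sigma> k \<omega> < T} \<in> events" for k using sets_FF_M[OF stopping_time_uptoD(4)[OF st]] .
    show "decseq (\<lambda>k. {\<omega>\<in>space M. \<sigma> k \<omega> < T})"
      unfolding \<sigma>_less[OF order_refl]
    proof (rule decseq_SucI, rule subsetI)
      fix k \<omega> assume "\<omega> \<in> {\<omega>\<in>space M. \<exists>s\<in>dyadics. s < T \<and> real (Suc (Suc k)) < \<bar>S s \<omega>\<bar>}"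
      then obtain s where s: "\<omega> \<in> space M" "s \<in> dyadics" "s < T" "real (Suc (Suc k)) < \<bar>S s \<omega>\<bar>" by blast
      have "real (Suc k) < \<bar>S s \<omega>\<bar>" using s(4) by linarith
      then show "\<omega> \<in> {\<omega>\<in>space M. \<exists>s\<in>dyadics. s < T \<and> real (Suc k) < \<bar>S s \<omega>\<bar>}" using s(1-3) by blast
    qed
    show "AE \<omega> in M. \<exists>k. \<omega> \<notin> {\<omega>\<in>space M. \<sigma> k \<omega> < T}"
    proof (rule AE_I2)
      fix \<omega> assume "\<omega> \<in> space M"
      then obtain C where C: "\<forall>t\<in>{0..T}. \<bar>S t \<omega>\<bar> \<le> C" using cadlag_path_bounded[OF S_cadlag T_pos] by blast
      obtain k :: nat where "C < real k" using reals_Archimedean2 by blast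
      have "\<not> \<sigma> k \<omega> < T" unfolding \<sigma>_less[OF order_refl]
      proof
        assume "\<exists>s\<in>dyadics. s < T \<and> real (Suc k) < \<bar>S s \<omega>\<bar>"
        then obtain s where s: "s \<in> dyadics" "real (Suc k) < \<bar>S s \<omega>\<bar>" by blast
        then have "\<bar>S s \<omega>\<bar> \<le> C" using C dyadics_in[OF s(1)] by auto
        then show False using s(2) \<open>C < real k\<close> by simp
      qed
      then show "\<exists>k. \<omega> \<notin> {\<omega>\<in>space M. \<sigma> k \<omega> < T}" by blast
    qed
  qed
  then show ?thesis using st S_le by (intro exI[of _ \<sigma>]) blast
qed

text \<open>Level \<open>Suc k\<close> and tolerance \<open>1 / Suc k\<close> are tied to one index,
  so that the minimum of the exceedance time and \<open>\<alpha> k\<close> reaches \<open>T\<close>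
  with probability tending to 1, as gluing demands. Before it the killed process is \<open>S\<close>
  itself.\<close>

lemma no_gain_imp_semimartingale:
  assumes ad: "adapted_upto F T S" and cad: "cadlag_process M T S"
    and cond: "\<forall>H :: nat \<Rightarrow> 'a simple_rep.
            (\<forall>n. simple_integrand M F T (H n)) \<and>
            (\<lambda>n. sup_norm M T (integrand_process (H n))) \<longlonglongrightarrow> 0 \<and>
            tendsto_in_prob M (\<lambda>n \<omega>. SUP t\<in>{0..T}. neg_part (stoch_integral (H n) S t \<omega>)) (\<lambda>_. 0)
            \<longrightarrow> tendsto_in_prob M (\<lambda>n \<omega>. pos_part (stoch_integral (H n) S T \<omega>)) (\<lambda>_. 0)"
  shows "semimartingale M F T S"
proof -
  have S_meas: "S t \<in> borel_measurable (FF t)" if "t \<in> {0..T}" for t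
    using ad that FF_eq[OF that] by (simp add: adapted_upto_def)
  have S_cadlag: "cadlag_path T (\<lambda>t. S t \<omega>)" if "\<omega> \<in> space M" for \<omega>
    using cad that by (simp add: cadlag_process_def)
  have "\<exists>\<sigma>. (\<forall>k::nat. stopping_time_upto M F T (\<sigma> k)) \<and>
    (\<forall>k. \<forall>t\<in>{0..T}. \<forall>\<omega>\<in>space M. t < \<sigma> k \<omega> \<longrightarrow> \<bar>S t \<omega>\<bar> \<le> real (Suc k)) \<and>
    (\<lambda>k. prob {\<omega>\<in>space M. \<sigma> k \<omega> < T}) \<longlonglongrightarrow> 0" by (rule exceedance_time[OF S_meas S_cadlag])
  then obtain \<sigma> where \<sigma>: "\<And>k::nat. stopping_time_upto M F T (\<sigma> k)"
    and S_le: "\<And>k t \<omega>. t \<in> {0..T} \<Longrightarrow> \<omega> \<in> space M \<Longrightarrow> t < \<sigma> k \<omega> \<Longrightarrow> \<bar>S t \<omega>\<bar> \<le> real (Suc k)"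
    and \<sigma>_lim: "(\<lambda>k. prob {\<omega>\<in>space M. \<sigma> k \<omega> < T}) \<longlonglongrightarrow> 0" by blast
  define \<Phi> where "\<Phi> k \<alpha> N B c \<longleftrightarrow> stopping_time_upto M F T \<alpha> \<and> prob {\<omega>\<in>space M. \<alpha> \<omega> < T} \<le> 1 / real (Suc k) \<and>
    (\<forall>t\<in>{0..T}. N t \<in> borel_measurable (FF t)) \<and> (\<forall>\<omega>\<in>space M. cadlag_path T (\<lambda>t. N t \<omega>)) \<and>
    (\<forall>t\<in>{0..T}. \<forall>\<omega>\<in>space M. \<bar>N t \<omega>\<bar> \<le> c) \<and>
    (\<forall>t\<in>{0..T}. \<forall>A\<in>sets (FF t). expectation (\<lambda>\<omega>. indicator A \<omega> * N t \<omega>) = expectation (\<lambda>\<omega>. indicator A \<omega> * N T \<omega>)) \<and>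
    (AE \<omega> in M. (\<exists>g. \<forall>s t. 0 \<le> s \<and> s \<le> t \<and> t \<le> T \<longrightarrow> \<bar>B t \<omega> - B s \<omega>\<bar> \<le> g t - (g s :: real)) \<and>
      (\<forall>t\<in>{0..T}. t < \<alpha> \<omega> \<longrightarrow> killed S (\<sigma> k) t \<omega> = N t \<omega> + B t \<omega>))" for k :: nat and \<alpha> N B c
  have "\<exists>\<alpha> N B c. \<Phi> k \<alpha> N B c" for k
    unfolding \<Phi>_def
  proof (rule regular_decomposition)
    note hyps = S_meas S_cadlag \<sigma>[of k] S_le[of _ _ k]
    show "killed S (\<sigma> k) t \<in> borel_measurable (FF t)" if "t \<in> {0..T}" for t
      by (rule killed_meas[OF hyps _ that]) auto
    show "\<bar>killed S (\<sigma> k) t \<omega>\<bar> \<le> real (Suc k)" if "t \<in> {0..T}" "\<omega> \<in> space M" for t \<omega>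
      by (rule killed_bound[OF hyps _ that]) auto
    show "grid_no_gain (killed S (\<sigma> k))"
      by (rule grid_no_gain_killed[OF hyps _ cond]) auto
    show "cadlag_path T (\<lambda>t. killed S (\<sigma> k) t \<omega>)" if "\<omega> \<in> space M" for \<omega>
      unfolding killed_def by (rule cadlag_path_killed[OF S_cadlag[OF that]])
  qed auto
  then have "\<forall>k. \<exists>\<alpha> N B c. \<Phi> k \<alpha> N B c" by blast
  then obtain \<alpha> N B c where "\<And>k. \<Phi> k (\<alpha> k) (N k) (B k) (c k)" unfolding choice_iff by blast
  note \<Phi> = this[unfolded \<Phi>_def]
  have \<alpha>: "stopping_time_upto M F T (\<alpha> k)" "prob {\<omega>\<in>space M. \<alpha> k \<omega> < T} \<le> 1 / real (Suc k)" for k using \<Phi>[of k] by blast+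
  show ?thesis
  proof (rule semimartingale_glue[OF ad cad, where \<rho> = "\<lambda>k \<omega>. min (\<sigma> k \<omega>) (\<alpha> k \<omega>)" and N = N and B = B and c = c])
    show "stopping_time_upto M F T (\<lambda>\<omega>. min (\<sigma> k \<omega>) (\<alpha> k \<omega>))" for k
      using \<sigma>[of k] \<alpha>(1)[of k] by (auto simp: stopping_time_upto_def intro: stopping_time_min)
    have "(\<lambda>k. 1 / real (Suc k)) \<longlonglongrightarrow> 0" using LIMSEQ_inverse_real_of_nat by (simp add: inverse_eq_divide)
    from tendsto_add[OF \<sigma>_lim this]
    have l: "(\<lambda>k. prob {\<omega>\<in>space M. \<sigma> k \<omega> < T} + 1 / real (Suc k)) \<longlonglongrightarrow> 0" by simp
    have "prob {\<omega>\<in>space M. min (\<sigma> k \<omega>) (\<alpha> k \<omega>) < T} \<le> prob {\<omega>\<in>space M. \<sigma> k \<omega> < T} + 1 / real (Suc k)" for k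
    proof -
      have e: "{\<omega>\<in>space M. \<sigma> k \<omega> < T} \<in> events" "{\<omega>\<in>space M. \<alpha> k \<omega> < T} \<in> events"
        using sets_FF_M[OF stopping_time_uptoD(4)] \<sigma> \<alpha>(1) by blast+
      have "{\<omega>\<in>space M. min (\<sigma> k \<omega>) (\<alpha> k \<omega>) < T} = {\<omega>\<in>space M. \<sigma> k \<omega> < T} \<union> {\<omega>\<in>space M. \<alpha> k \<omega> < T}" by auto
      then show ?thesis using measure_Un_le[OF e] \<alpha>(2)[of k] by simp
    qed
    then show "(\<lambda>k. prob {\<omega>\<in>space M. min (\<sigma> k \<omega>) (\<alpha> k \<omega>) < T}) \<longlonglongrightarrow> 0"
      by (intro tendsto_sandwich[OF _ _ tendsto_const l] always_eventually allI measure_nonneg)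
    show "AE \<omega> in M. bv_on 0 T (\<lambda>t. B k t \<omega>) \<and> (\<forall>t\<in>{0..T}. t < min (\<sigma> k \<omega>) (\<alpha> k \<omega>) \<longrightarrow> S t \<omega> = N k t \<omega> + B k t \<omega>)" for k
    proof -
      have "AE \<omega> in M. (\<exists>g. \<forall>s t. 0 \<le> s \<and> s \<le> t \<and> t \<le> T \<longrightarrow> \<bar>B k t \<omega> - B k s \<omega>\<bar> \<le> g t - (g s :: real)) \<and>
        (\<forall>t\<in>{0..T}. t < \<alpha> k \<omega> \<longrightarrow> killed S (\<sigma> k) t \<omega> = N k t \<omega> + B k t \<omega>)" using \<Phi>[of k] by (elim conjE)
      then show ?thesis
      proof eventually_elim
        case (elim \<omega>)
        have "killed S (\<sigma> k) t \<omega> = S t \<omega>" if "t < \<sigma> k \<omega>" for t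
          using that by (simp add: killed_def)
        then show ?case using elim by (auto simp: bv_on_def)
      qed
    qed
  qed (use \<Phi> in blast)+
qed

end

subsection \<open>Semimartingales satisfy the condition\<close>

text \<open>Where \<open>\<bar>X\<bar> > \<epsilon>\<close>, also
  \<open>\<bar>X' n\<bar> > \<delta>\<close> for all large \<open>n\<close>, so the event on which
  this fails shrinks to probability 0. The gap between \<open>\<delta>\<close> and
  \<open>\<epsilon>\<close> absorbs the error of pointwise convergence.\<close>

lemma (in prob_space) prob_limit_le:
  fixes X :: "'a \<Rightarrow> real"
  assumes X: "\<And>n. X' n \<in> borel_measurable M" "\<And>\<omega>. \<omega> \<in> space M \<Longrightarrow> (\<lambda>n. X' n \<omega>) \<longlonglongrightarrow> X \<omega>"
    and le: "\<And>n. prob {\<omega>\<in>space M. \<delta> \<le> \<bar>X' n \<omega>\<bar>} \<le> \<eta>" and \<epsilon>: "\<delta> < \<epsilon>"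
  shows "prob {\<omega>\<in>space M. \<epsilon> < \<bar>X \<omega>\<bar>} \<le> \<eta>"
proof -
  have [measurable]: "X \<in> borel_measurable M" by (rule borel_measurable_LIMSEQ_real[OF X(2,1)])
  note X(1)[measurable]
  let ?E = "\<lambda>n. {\<omega>\<in>space M. \<epsilon> < \<bar>X \<omega>\<bar> \<and> \<bar>X' n \<omega>\<bar> < \<delta>}"
  have E: "?E n \<in> events" for n by measurable
  have "(\<lambda>n. expectation (indicator (?E n) :: 'a \<Rightarrow> real)) \<longlonglongrightarrow> expectation (\<lambda>_. 0 :: real)"
  proof (rule integral_dominated_convergence[where w = "\<lambda>_. 1"])
    show "AE \<omega> in M. (\<lambda>n. indicator (?E n) \<omega> :: real) \<longlonglongrightarrow> 0"
    proof (rule AE_I2)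
      fix \<omega> assume w: "\<omega> \<in> space M"
      show "(\<lambda>n. indicator (?E n) \<omega> :: real) \<longlonglongrightarrow> 0"
      proof (cases "\<epsilon> < \<bar>X \<omega>\<bar>")
        case True
        have "\<forall>\<^sub>F n in sequentially. \<delta> < \<bar>X' n \<omega>\<bar>"
          by (rule order_tendstoD(1)[OF tendsto_rabs[OF X(2)[OF w]]]) (use True \<epsilon> in simp)
        then have "\<forall>\<^sub>F n in sequentially. (indicator (?E n) \<omega> :: real) = 0"
          by eventually_elim (simp add: indicator_def)
        then show ?thesis by (rule tendsto_eventually)
      qed simp
    qed
    show "(indicator (?E n) :: 'a \<Rightarrow> real) \<in> borel_measurable M" for n using E by simp
  qed (auto simp: indicator_def)
  then have "(\<lambda>n. prob (?E n)) \<longlonglongrightarrow> 0" using E by simp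
  then have l: "(\<lambda>n. prob (?E n) + \<eta>) \<longlonglongrightarrow> 0 + \<eta>" by (intro tendsto_add tendsto_const)
  have "prob {\<omega>\<in>space M. \<epsilon> < \<bar>X \<omega>\<bar>} \<le> prob (?E n) + \<eta>" for n
  proof -
    have D: "{\<omega>\<in>space M. \<delta> \<le> \<bar>X' n \<omega>\<bar>} \<in> events" by measurable
    have "prob {\<omega>\<in>space M. \<epsilon> < \<bar>X \<omega>\<bar>} \<le> prob (?E n \<union> {\<omega>\<in>space M. \<delta> \<le> \<bar>X' n \<omega>\<bar>})"
      by (rule finite_measure_mono) (auto intro: E D)
    also have "\<dots> \<le> prob (?E n) + prob {\<omega>\<in>space M. \<delta> \<le> \<bar>X' n \<omega>\<bar>}" by (intro measure_Un_le E D)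
    finally show ?thesis using le[of n] by simp
  qed
  then show ?thesis using LIMSEQ_le_const[OF l] by simp
qed

context horizon
begin

text \<open>A coefficient is only known at the random time where its interval starts. It is cut off
  to the event that this time is at most \<open>t\<close>, on which it becomes measurable at
  \<open>t\<close>; the interval contains \<open>t\<close> only there.\<close>

lemma integrand_process_measurable:
  assumes H: "simple_integrand M F T H" and t: "t \<in> {0..T}"
  shows "integrand_process H t \<in> borel_measurable (FF t)"
  unfolding integrand_process_def
proof (rule borel_measurable_sum)
  fix j assume j: "j \<in> {1..steps H}"
  let ?f = "coeff H j" and ?a = "times H (j - 1)" and ?b = "times H j"
  have a: "stopping_time_upto M F T ?a" and b: "stopping_time_upto M F T ?b"
    using H j by (auto simp: simple_integrand_def)
  have f: "?f \<in> borel_measurable (pre_sigma ?a)" using H j by (auto simp: simple_integrand_def stopped_sigma_def)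
  have sa: "stopping_time FF ?a" using a by (simp add: stopping_time_upto_def)
  have le: "{\<omega>\<in>space (FF t). ?a \<omega> \<le> t} \<in> sets (FF t)" using stopping_time_uptoD(3)[OF a] by (simp add: space_FF)
  have g: "(\<lambda>\<omega>. if ?a \<omega> \<le> t then ?f \<omega> else 0) \<in> borel_measurable (FF t)"
  proof (rule measurableI)
    fix B :: "real set" assume B: "B \<in> sets borel"
    have 1: "{\<omega> \<in> ?f -` B \<inter> space M. ?a \<omega> \<le> t} \<in> sets (FF t)"
      using sets_pre_sigmaD[OF sa measurable_sets[OF f B], of t] by (simp add: space_pre_sigma)
    have "(\<lambda>\<omega>. if ?a \<omega> \<le> t then ?f \<omega> else 0) -` B \<inter> space (FF t) =
      {\<omega> \<in> ?f -` B \<inter> space M. ?a \<omega> \<le> t} \<union> (if 0 \<in> B then space (FF t) - {\<omega>\<in>space (FF t). ?a \<omega> \<le> t} else {})"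
      by (auto simp: space_FF split: if_splits)
    then show "(\<lambda>\<omega>. if ?a \<omega> \<le> t then ?f \<omega> else 0) -` B \<inter> space (FF t) \<in> sets (FF t)"
      using 1 le by (simp add: sets.Un sets.Diff)
  qed simp
  have "{\<omega>\<in>space (FF t). ?a \<omega> < t} \<in> sets (FF t)" "{\<omega>\<in>space (FF t). ?b \<omega> < t} \<in> sets (FF t)"
    using stopping_time_uptoD(4)[OF a] stopping_time_uptoD(4)[OF b] by (simp_all add: space_FF)
  then have "(\<lambda>\<omega>. of_bool (?a \<omega> < t) :: real) \<in> borel_measurable (FF t)" "(\<lambda>\<omega>. of_bool (?b \<omega> < t) :: real) \<in> borel_measurable (FF t)"
    unfolding of_bool_def by (auto intro!: measurable_If)
  then have "(\<lambda>\<omega>. of_bool (?a \<omega> < t) * (1 - of_bool (?b \<omega> < t)) * (if ?a \<omega> \<le> t then ?f \<omega> else 0)) \<in> borel_measurable (FF t)"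
    by (intro borel_measurable_times borel_measurable_diff borel_measurable_const g)
  also have "(\<lambda>\<omega>. of_bool (?a \<omega> < t) * (1 - of_bool (?b \<omega> < t)) * (if ?a \<omega> \<le> t then ?f \<omega> else 0)) =
    (\<lambda>\<omega>. ?f \<omega> * indicator {?a \<omega> <.. ?b \<omega>} t)"
    by (auto simp: fun_eq_iff indicator_def)
  finally show "(\<lambda>\<omega>. ?f \<omega> * indicator {?a \<omega> <.. ?b \<omega>} t) \<in> borel_measurable (FF t)" .
qed

text \<open>The integrand is left-continuous and the integrator right-continuous, so the integral is the
  limit of Riemann sums evaluated at the left end points.\<close>

lemma stoch_integral_grid_limit:
  assumes H: "simple_integrand M F T H" and w: "\<omega> \<in> space M" and S: "cadlag_path T (\<lambda>t. S t \<omega>)"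
  shows "(\<lambda>n. \<Sum>i<2 ^ n. integrand_process H (grid n i) \<omega> * (S (grid n (Suc i)) \<omega> - S (grid n i) \<omega>))
    \<longlonglongrightarrow> stoch_integral H S T \<omega>"
proof -
  let ?\<tau> = "\<lambda>j. times H j \<omega>"
  let ?J = "\<lambda>n s. \<Sum>i<2 ^ n. of_bool (s < grid n i) * (S (grid n (Suc i)) \<omega> - S (grid n i) \<omega>)"
  have \<tau>: "0 \<le> ?\<tau> j" "?\<tau> j \<le> T" if "j \<le> steps H" for j
    using H that w by (auto simp: simple_integrand_def stopping_time_upto_def)
  have mono: "?\<tau> (j - 1) \<le> ?\<tau> j" if "j \<in> {1..steps H}" for j
    using H that w by (auto simp: simple_integrand_def)
  have J: "?J n s = S T \<omega> - S (next_grid n s) \<omega>" if "0 \<le> s" "s \<le> T" for n s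
    by (rule grid_sum_after[OF that, where x = "\<lambda>t. S t \<omega>"])
  have Jlim: "(\<lambda>n. ?J n s) \<longlonglongrightarrow> S T \<omega> - S s \<omega>" if "0 \<le> s" "s \<le> T" for s
    unfolding J[OF that] by (intro tendsto_diff tendsto_const cadlag_next_grid[OF S that])
  have eq: "(\<Sum>i<2 ^ n. integrand_process H (grid n i) \<omega> * (S (grid n (Suc i)) \<omega> - S (grid n i) \<omega>)) =
     (\<Sum>j=1..steps H. coeff H j \<omega> * (?J n (?\<tau> (j - 1)) - ?J n (?\<tau> j)))" for n
  proof -
    have "(\<Sum>i<2 ^ n. integrand_process H (grid n i) \<omega> * (S (grid n (Suc i)) \<omega> - S (grid n i) \<omega>)) =
      (\<Sum>j=1..steps H. \<Sum>i<2 ^ n. coeff H j \<omega> * indicator {?\<tau> (j - 1) <.. ?\<tau> j} (grid n i) * (S (grid n (Suc i)) \<omega> - S (grid n i) \<omega>))"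
      unfolding integrand_process_def sum_distrib_right by (rule sum.swap)
    also have "\<dots> = (\<Sum>j=1..steps H. coeff H j \<omega> * (?J n (?\<tau> (j - 1)) - ?J n (?\<tau> j)))"
      unfolding sum_subtractf[symmetric] sum_distrib_left
    proof (intro sum.cong refl)
      fix j i assume "j \<in> {1..steps H}"
      \<comment> \<open>An interval is a difference of two half-lines, so each step of the integrand
        becomes a difference of two sums \<open>?J\<close>, whose limits are known.\<close>
      then have "indicator {?\<tau> (j - 1) <.. ?\<tau> j} (grid n i) = (of_bool (?\<tau> (j - 1) < grid n i) - of_bool (?\<tau> j < grid n i) :: real)"
        using mono[of j] by (auto simp: indicator_def)
      then show "coeff H j \<omega> * indicator {?\<tau> (j - 1) <.. ?\<tau> j} (grid n i) * (S (grid n (Suc i)) \<omega> - S (grid n i) \<omega>) =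
        coeff H j \<omega> * (of_bool (?\<tau> (j - 1) < grid n i) * (S (grid n (Suc i)) \<omega> - S (grid n i) \<omega>) -
          of_bool (?\<tau> j < grid n i) * (S (grid n (Suc i)) \<omega> - S (grid n i) \<omega>))"
        by (simp only: left_diff_distrib mult.assoc)
    qed
    finally show ?thesis .
  qed
  have "(\<lambda>n. \<Sum>j=1..steps H. coeff H j \<omega> * (?J n (?\<tau> (j - 1)) - ?J n (?\<tau> j))) \<longlonglongrightarrow>
    (\<Sum>j=1..steps H. coeff H j \<omega> * ((S T \<omega> - S (?\<tau> (j - 1)) \<omega>) - (S T \<omega> - S (?\<tau> j) \<omega>)))"
    by (intro tendsto_sum tendsto_mult tendsto_diff tendsto_const Jlim \<tau>) auto
  also have "(\<Sum>j=1..steps H. coeff H j \<omega> * ((S T \<omega> - S (?\<tau> (j - 1)) \<omega>) - (S T \<omega> - S (?\<tau> j) \<omega>))) = stoch_integral H S T \<omega>"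
    unfolding stoch_integral_def
  proof (intro sum.cong refl)
    fix j assume j: "j \<in> {1..steps H}"
    then have "min (?\<tau> j) T = ?\<tau> j" "min (?\<tau> (j - 1)) T = ?\<tau> (j - 1)" using \<tau>(2)[of j] \<tau>(2)[of "j - 1"] by (auto simp: min_absorb1)
    then show "coeff H j \<omega> * ((S T \<omega> - S (?\<tau> (j - 1)) \<omega>) - (S T \<omega> - S (?\<tau> j) \<omega>)) =
      coeff H j \<omega> * (S (min (?\<tau> j) T) \<omega> - S (min (?\<tau> (j - 1)) T) \<omega>)" by simp
  qed
  finally show ?thesis unfolding eq .
qed

section \<open>Bounds in probability for sums along grids\<close>

text \<open>The order of choice matters: \<open>l\<close> makes the maximal term small and depends
  only on \<open>\<eta>\<close> and the expectation of \<open>\<xi>\<close>; the bound on the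
  integrand is then taken small relative to \<open>l\<close>. Neither depends on the grid.\<close>

lemma martingale_transform_small:
  assumes \<xi>: "integrable M \<xi>" "\<And>\<omega>. \<omega> \<in> space M \<Longrightarrow> 0 \<le> \<xi> \<omega>" and \<eta>: "\<eta> > 0" and \<epsilon>: "\<epsilon> > 0"
  shows "\<exists>K0>0. \<forall>K. 0 \<le> K \<and> K \<le> K0 \<longrightarrow> (\<forall>n h.
    (\<forall>i<2 ^ n. h i \<in> borel_measurable (FF (grid n i)) \<and> (\<forall>\<omega>\<in>space M. \<bar>h i \<omega>\<bar> \<le> K)) \<longrightarrow>
    prob {\<omega>\<in>space M. \<epsilon> \<le> \<bar>\<Sum>i<2 ^ n. h i \<omega> * (real_cond_exp M (FF (grid n (Suc i))) \<xi> \<omega> - real_cond_exp M (FF (grid n i)) \<xi> \<omega>)\<bar>} \<le> \<eta>)"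
proof -
  have e0: "0 \<le> expectation \<xi>" using \<xi>(2) by (intro integral_nonneg_AE AE_I2)
  \<comment> \<open>Adding 1 keeps \<open>l\<close> positive when the expectation is 0.\<close>
  define l where "l = 2 * (expectation \<xi> + 1) / \<eta>"
  have l: "l > 0" using e0 \<eta> by (simp add: l_def)
  have le: "expectation \<xi> / l \<le> \<eta> / 2"
  proof -
    have "expectation \<xi> \<le> \<eta> / 2 * l" using e0 \<eta> by (simp add: l_def)
    then show ?thesis using l by (simp add: pos_divide_le_eq)
  qed
  let ?c = "\<epsilon> / 2"
  let ?b = "\<lambda>K. 3 * K\<^sup>2 * l\<^sup>2 / ?c\<^sup>2 + K * l / ?c"
  have "(?b \<longlongrightarrow> 3 * 0\<^sup>2 * l\<^sup>2 / ?c\<^sup>2 + 0 * l / ?c) (at_right 0)" using \<epsilon> by (intro tendsto_intros) auto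
  then have "\<forall>\<^sub>F K in at_right 0. ?b K < \<eta> / 2" by (rule order_tendstoD(2)) (use \<eta> in simp)
  then obtain d where d: "d > 0" "\<And>K. 0 < K \<Longrightarrow> K < d \<Longrightarrow> ?b K < \<eta> / 2" unfolding eventually_at_right_field by blast
  have bK: "?b K \<le> \<eta> / 2" if "0 \<le> K" "K \<le> d / 2" for K
    using d(2)[of K] d(1) that \<eta> by (cases "K = 0") auto
  have "prob {\<omega>\<in>space M. \<epsilon> \<le> \<bar>\<Sum>i<2 ^ n. h i \<omega> * (real_cond_exp M (FF (grid n (Suc i))) \<xi> \<omega> - real_cond_exp M (FF (grid n i)) \<xi> \<omega>)\<bar>} \<le> \<eta>"
    if K: "0 \<le> K" "K \<le> d / 2" and h: "\<And>i. i < 2 ^ n \<Longrightarrow> h i \<in> borel_measurable (FF (grid n i))"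
      "\<And>i \<omega>. i < 2 ^ n \<Longrightarrow> \<omega> \<in> space M \<Longrightarrow> \<bar>h i \<omega>\<bar> \<le> K" for K n h
  proof -
    interpret G: discrete_filtration M "\<lambda>i. FF (grid n i)" by (rule FF_discrete_filtration)
    let ?X = "\<lambda>i. real_cond_exp M (FF (grid n i)) \<xi>"
    have sfs: "sigma_finite_subalgebra M (FF t)" for t
    proof -
      interpret finite_measure_subalgebra M "FF t" by unfold_locales (rule sub_FF)
      show ?thesis by unfold_locales
    qed
    have "prob {\<omega>\<in>space M. 2 * ?c \<le> \<bar>\<Sum>i<2 ^ n. h i \<omega> * (?X (Suc i) \<omega> - ?X i \<omega>)\<bar>} \<le>
      expectation (?X 0) / l + 3 * K\<^sup>2 * l\<^sup>2 / ?c\<^sup>2 + K * l / ?c"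
    proof (rule G.nonneg_mart_transform)
      show "?X i \<in> borel_measurable (FF (grid n i))" for i by (rule borel_measurable_cond_exp)
      show iX: "integrable M (?X i)" for i by (rule sigma_finite_subalgebra.real_cond_exp_int(1)[OF sfs \<xi>(1)])
      show "AE \<omega> in M. 0 \<le> ?X i \<omega>" for i
        by (rule sigma_finite_subalgebra.real_cond_exp_pos[OF sfs]) (use \<xi> in auto)
      show "expectation (\<lambda>\<omega>. \<phi> \<omega> * (?X (Suc i) \<omega> - ?X i \<omega>)) = 0" if \<phi>: "\<phi> \<in> bmeas (FF (grid n i))" for i \<phi>
      proof -
        have \<phi>': "\<phi> \<in> borel_measurable (FF (grid n j))" if "j \<in> {i, Suc i}" for j
          by (rule FF_measurable_mono[OF bmeas_measurable[OF \<phi>] grid_le]) (use that in auto)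
        have bM: "\<phi> \<in> bmeas M" using bmeas_subalgebra[OF sub_FF \<phi>] .
        have e: "expectation (\<lambda>\<omega>. \<phi> \<omega> * ?X j \<omega>) = expectation (\<lambda>\<omega>. \<phi> \<omega> * \<xi> \<omega>)" if "j \<in> {i, Suc i}" for j
          by (rule sigma_finite_subalgebra.real_cond_exp_intg(2)[OF sfs integrable_bmeas_mult[OF bM \<xi>(1)] \<phi>'[OF that]]) (use \<xi> in auto)
        have "integrable M (\<lambda>\<omega>. \<phi> \<omega> * ?X j \<omega>)" for j by (rule integrable_bmeas_mult[OF bM iX])
        then show ?thesis using e[of i] e[of "Suc i"] by (simp add: right_diff_distrib)
      qed
      show "h i \<in> borel_measurable (FF (grid n i))" if "i < 2 ^ n" for i using h(1)[OF that] .
      show "\<bar>h i \<omega>\<bar> \<le> K" if "i < 2 ^ n" "\<omega> \<in> space M" for i \<omega> using h(2)[OF that] .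
      show "0 < l" "0 < ?c" "0 \<le> K" using l \<epsilon> K by simp_all
    qed
    also have "expectation (?X 0) = expectation \<xi>" by (rule sigma_finite_subalgebra.real_cond_exp_int(2)[OF sfs \<xi>(1)])
    finally have "prob {\<omega>\<in>space M. 2 * ?c \<le> \<bar>\<Sum>i<2 ^ n. h i \<omega> * (?X (Suc i) \<omega> - ?X i \<omega>)\<bar>} \<le> \<eta>"
      using le bK[OF K] by linarith
    then show ?thesis by simp
  qed
  then show ?thesis using d(1) by (intro exI[of _ "d / 2"]) auto
qed

text \<open>The total variation of a path bounds its sums along all grids at once, so one
  exceptional event serves for every \<open>n\<close>.\<close>

lemma variation_sums_bounded:
  assumes A: "finite_variation_process M F T A" and \<eta>: "\<eta> > 0"
  shows "\<exists>C>0. \<forall>n. prob {\<omega>\<in>space M. C \<le> (\<Sum>i<2 ^ n. \<bar>A (grid n (Suc i)) \<omega> - A (grid n i) \<omega>\<bar>)} \<le> \<eta>"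
proof -
  let ?V = "\<lambda>n \<omega>. \<Sum>i<2 ^ n. \<bar>A (grid n (Suc i)) \<omega> - A (grid n i) \<omega>\<bar>"
  have A_meas: "A t \<in> borel_measurable M" if "t \<in> {0..T}" for t
    using A that FF_measurable_M[of "A t" t] FF_eq[OF that] by (auto simp: finite_variation_process_def adapted_upto_def)
  have [measurable]: "?V n \<in> borel_measurable M" for n
    using A_meas[OF grid_in] by (intro borel_measurable_sum borel_measurable_abs borel_measurable_diff) auto
  let ?E = "\<lambda>k. {\<omega>\<in>space M. \<exists>n. real (Suc k) \<le> ?V n \<omega>}"
  have E: "?E k \<in> events" for k by measurable
  have "(\<lambda>k. prob (?E k)) \<longlonglongrightarrow> 0"
  proof (rule prob_decseq_tendsto_0[OF E])
    show "decseq ?E"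
    proof (rule decseq_SucI, rule subsetI)
      fix k \<omega> assume "\<omega> \<in> ?E (Suc k)"
      then obtain n where n: "\<omega> \<in> space M" "real (Suc (Suc k)) \<le> ?V n \<omega>" by blast
      have "real (Suc k) \<le> ?V n \<omega>" using n(2) by linarith
      then show "\<omega> \<in> ?E k" using n(1) by blast
    qed
    have "AE \<omega> in M. finite_variation_path T (\<lambda>t. A t \<omega>)" using A by (simp add: finite_variation_process_def)
    then show "AE \<omega> in M. \<exists>k. \<omega> \<notin> ?E k"
    proof eventually_elim
      case (elim \<omega>)
      then obtain C where C: "\<And>n p. p ` {..n} \<subseteq> {0..T} \<Longrightarrow> mono_on {..n} p \<Longrightarrow> (\<Sum>i<n. \<bar>A (p (Suc i)) \<omega> - A (p i) \<omega>\<bar>) \<le> C"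
        unfolding finite_variation_path_def by blast
      have V: "?V n \<omega> \<le> C" for n
      proof (rule C)
        show "grid n ` {..2 ^ n} \<subseteq> {0..T}" using grid_in by blast
        show "mono_on {..2 ^ n} (grid n)" by (intro mono_onI grid_le)
      qed
      obtain k :: nat where k: "C < real k" using reals_Archimedean2 by blast
      have "\<not> real (Suc k) \<le> ?V n \<omega>" for n using V[of n] k by simp
      then show ?case by blast
    qed
  qed
  then have "\<forall>\<^sub>F k in sequentially. prob (?E k) < \<eta>" using \<eta> by (rule order_tendstoD)
  then obtain k where k: "prob (?E k) < \<eta>" by (auto simp: eventually_sequentially)
  have "prob {\<omega>\<in>space M. real (Suc k) \<le> ?V n \<omega>} \<le> \<eta>" for n
  proof -
    have "prob {\<omega>\<in>space M. real (Suc k) \<le> ?V n \<omega>} \<le> prob (?E k)" by (rule finite_measure_mono[OF _ E]) blast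
    then show ?thesis using k by simp
  qed
  then show ?thesis by (intro exI[of _ "real (Suc k)"]) auto
qed

text \<open>Four exceptional events, each of probability at most \<open>\<eta> / 4\<close>:
  localisation stops early, the variation of \<open>A\<close> is large, or one of the two
  nonnegative martingale transforms is large. Off them, three contributions of at most
  \<open>\<epsilon> / 4\<close> remain.\<close>

lemma semimartingale_grid_sums_small:
  assumes S: "semimartingale M F T S" and \<eta>: "\<eta> > 0" and \<epsilon>: "\<epsilon> > 0"
  shows "\<exists>K>0. \<forall>n h. (\<forall>i<2 ^ n. h i \<in> borel_measurable (FF (grid n i)) \<and> (\<forall>\<omega>\<in>space M. \<bar>h i \<omega>\<bar> \<le> K)) \<longrightarrow>
    prob {\<omega>\<in>space M. \<epsilon> \<le> \<bar>\<Sum>i<2 ^ n. h i \<omega> * (S (grid n (Suc i)) \<omega> - S (grid n i) \<omega>)\<bar>} \<le> \<eta>"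
proof -
  obtain X A where X: "local_martingale_upto M F T X" and A: "finite_variation_process M F T A"
    and SXA: "\<And>t \<omega>. t \<in> {0..T} \<Longrightarrow> \<omega> \<in> space M \<Longrightarrow> S t \<omega> = X t \<omega> + A t \<omega>"
    using S unfolding semimartingale_def by blast
  obtain \<sigma> :: "nat \<Rightarrow> 'a \<Rightarrow> real" where \<sigma>: "\<And>k. stopping_time_upto M F T (\<sigma> k)" "\<And>k \<omega>. \<omega> \<in> space M \<Longrightarrow> \<sigma> k \<omega> \<le> \<sigma> (Suc k) \<omega>"
    "AE \<omega> in M. \<forall>\<^sub>F k in sequentially. \<sigma> k \<omega> = T"
    "\<And>k. martingale_upto M F T (\<lambda>t \<omega>. X (min (\<sigma> k \<omega>) t) \<omega>)"
    using X unfolding local_martingale_upto_def by blast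
  have \<sigma>e: "{\<omega>\<in>space M. \<sigma> k \<omega> < T} \<in> events" for k using sets_FF_M[OF stopping_time_uptoD(4)[OF \<sigma>(1)]] .
  have "(\<lambda>k. prob {\<omega>\<in>space M. \<sigma> k \<omega> < T}) \<longlonglongrightarrow> 0"
  proof (rule prob_decseq_tendsto_0[OF \<sigma>e])
    show "decseq (\<lambda>k. {\<omega>\<in>space M. \<sigma> k \<omega> < T})" using \<sigma>(2) by (intro decseq_SucI) (auto intro: le_less_trans)
    show "AE \<omega> in M. \<exists>k. \<omega> \<notin> {\<omega>\<in>space M. \<sigma> k \<omega> < T}"
      using \<sigma>(3) by eventually_elim (force simp: eventually_sequentially)
  qed
  then have "\<forall>\<^sub>F k in sequentially. prob {\<omega>\<in>space M. \<sigma> k \<omega> < T} < \<eta> / 4" using \<eta> by (intro order_tendstoD) auto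
  then obtain k where k: "prob {\<omega>\<in>space M. \<sigma> k \<omega> < T} < \<eta> / 4" by (auto simp: eventually_sequentially)
  define Z where "Z t \<omega> = X (min (\<sigma> k \<omega>) t) \<omega>" for t \<omega>
  have Z: "martingale_upto M F T Z" using \<sigma>(4)[of k] by (simp add: Z_def[abs_def])
  have T_in: "T \<in> {0..T}" using T_pos by simp
  define \<xi> where "\<xi> = Z T"
  have \<xi>: "integrable M \<xi>" using Z T_in by (auto simp: \<xi>_def martingale_upto_def)
  define p where "p \<omega> = max 0 (\<xi> \<omega>)" for \<omega>
  define q where "q \<omega> = max 0 (- \<xi> \<omega>)" for \<omega>
  have p: "integrable M p" "0 \<le> p \<omega>" and q: "integrable M q" "0 \<le> q \<omega>" for \<omega>
    using \<xi> by (auto simp: p_def[abs_def] q_def[abs_def])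
  have sfs: "sigma_finite_subalgebra M (FF t)" for t
  proof -
    interpret finite_measure_subalgebra M "FF t" by unfold_locales (rule sub_FF)
    show ?thesis by unfold_locales
  qed
  let ?E = "\<lambda>t. real_cond_exp M (FF t)"
  \<comment> \<open>After localisation the martingale is closed by its terminal value, so it is the
    difference of the nonnegative martingales generated by \<open>p\<close> and
    \<open>q\<close>.\<close>
  have Zt: "AE \<omega> in M. Z t \<omega> = ?E t p \<omega> - ?E t q \<omega>" if t: "t \<in> {0..T}" for t
  proof -
    have "AE \<omega> in M. ?E t (\<lambda>\<omega>. p \<omega> - q \<omega>) \<omega> = ?E t p \<omega> - ?E t q \<omega>"
      by (rule sigma_finite_subalgebra.real_cond_exp_diff[OF sfs p(1) q(1)])
    moreover have "(\<lambda>\<omega>. p \<omega> - q \<omega>) = \<xi>" by (auto simp: p_def q_def)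
    moreover have "AE \<omega> in M. real_cond_exp M (F t) \<xi> \<omega> = Z t \<omega>"
      using Z t T_in by (auto simp: martingale_upto_def \<xi>_def)
    ultimately show ?thesis using FF_eq[OF t] by auto
  qed
  obtain C where C: "C > 0" "\<And>n. prob {\<omega>\<in>space M. C \<le> (\<Sum>i<2 ^ n. \<bar>A (grid n (Suc i)) \<omega> - A (grid n i) \<omega>\<bar>)} \<le> \<eta> / 4"
    using variation_sums_bounded[OF A, of "\<eta> / 4"] \<eta> by auto
  obtain K1 where K1: "K1 > 0" "\<And>K n h. 0 \<le> K \<Longrightarrow> K \<le> K1 \<Longrightarrow>
     (\<forall>i<2 ^ n. h i \<in> borel_measurable (FF (grid n i)) \<and> (\<forall>\<omega>\<in>space M. \<bar>h i \<omega>\<bar> \<le> K)) \<Longrightarrow>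
    prob {\<omega>\<in>space M. \<epsilon> / 4 \<le> \<bar>\<Sum>i<2 ^ n. h i \<omega> * (?E (grid n (Suc i)) p \<omega> - ?E (grid n i) p \<omega>)\<bar>} \<le> \<eta> / 4"
    using martingale_transform_small[OF p(1), of "\<eta> / 4" "\<epsilon> / 4"] p(2) \<eta> \<epsilon> by auto
  obtain K2 where K2: "K2 > 0" "\<And>K n h. 0 \<le> K \<Longrightarrow> K \<le> K2 \<Longrightarrow>
     (\<forall>i<2 ^ n. h i \<in> borel_measurable (FF (grid n i)) \<and> (\<forall>\<omega>\<in>space M. \<bar>h i \<omega>\<bar> \<le> K)) \<Longrightarrow>
    prob {\<omega>\<in>space M. \<epsilon> / 4 \<le> \<bar>\<Sum>i<2 ^ n. h i \<omega> * (?E (grid n (Suc i)) q \<omega> - ?E (grid n i) q \<omega>)\<bar>} \<le> \<eta> / 4"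
    using martingale_transform_small[OF q(1), of "\<eta> / 4" "\<epsilon> / 4"] q(2) \<eta> \<epsilon> by auto
  \<comment> \<open>The last term caps the variation part: the bound \<open>K\<close> on the
    integrand times \<open>C\<close> is at most \<open>\<epsilon> / 4\<close>.\<close>
  define K where "K = min (min K1 K2) (\<epsilon> / (4 * C))"
  have K: "K > 0" "K \<le> K1" "K \<le> K2" "K * C \<le> \<epsilon> / 4"
  proof -
    show "K > 0" "K \<le> K1" "K \<le> K2" using K1 K2 C \<epsilon> by (auto simp: K_def)
    have "K * C \<le> \<epsilon> / (4 * C) * C" using C by (intro mult_right_mono) (auto simp: K_def)
    then show "K * C \<le> \<epsilon> / 4" using C by simp
  qed
  have "prob {\<omega>\<in>space M. \<epsilon> \<le> \<bar>\<Sum>i<2 ^ n. h i \<omega> * (S (grid n (Suc i)) \<omega> - S (grid n i) \<omega>)\<bar>} \<le> \<eta>"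
    if h: "\<forall>i<2 ^ n. h i \<in> borel_measurable (FF (grid n i)) \<and> (\<forall>\<omega>\<in>space M. \<bar>h i \<omega>\<bar> \<le> K)" for n h
  proof -
    let ?I = "\<lambda>Y \<omega>. \<Sum>i<2 ^ n. h i \<omega> * (Y (grid n (Suc i)) \<omega> - Y (grid n i) \<omega>)"
    let ?V = "\<lambda>\<omega>. \<Sum>i<2 ^ n. \<bar>A (grid n (Suc i)) \<omega> - A (grid n i) \<omega>\<bar>"
    let ?A1 = "{\<omega>\<in>space M. \<sigma> k \<omega> < T}" and ?A2 = "{\<omega>\<in>space M. C \<le> ?V \<omega>}"
      and ?A3 = "{\<omega>\<in>space M. \<epsilon> / 4 \<le> \<bar>?I (\<lambda>t. ?E t p) \<omega>\<bar>}" and ?A4 = "{\<omega>\<in>space M. \<epsilon> / 4 \<le> \<bar>?I (\<lambda>t. ?E t q) \<omega>\<bar>}"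
    have hM: "h i \<in> borel_measurable M" if "i < 2 ^ n" for i using h that FF_measurable_M by blast
    have A_meas: "A t \<in> borel_measurable M" if "t \<in> {0..T}" for t
      using A that FF_measurable_M[of "A t" t] FF_eq[OF that] by (auto simp: finite_variation_process_def adapted_upto_def)
    have IM: "?I (\<lambda>t. ?E t f) \<in> borel_measurable M" for f
      using hM FF_measurable_M[OF borel_measurable_cond_exp] by (intro borel_measurable_sum borel_measurable_times borel_measurable_diff) auto
    have VM: "?V \<in> borel_measurable M"
      using A_meas[OF grid_in] by (intro borel_measurable_sum borel_measurable_abs borel_measurable_diff) auto
    have m: "?A1 \<in> events" "?A2 \<in> events" "?A3 \<in> events" "?A4 \<in> events"
      using \<sigma>e[of k] VM IM[of p] IM[of q] by auto
    have "AE \<omega> in M. \<forall>i\<in>{..2 ^ n}. Z (grid n i) \<omega> = ?E (grid n i) p \<omega> - ?E (grid n i) q \<omega>"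
      using Zt[OF grid_in] by (intro AE_finite_allI) auto
    then have "AE \<omega> in M. \<omega> \<in> {\<omega>\<in>space M. \<epsilon> \<le> \<bar>?I S \<omega>\<bar>} \<longrightarrow> \<omega> \<in> (?A1 \<union> ?A2) \<union> (?A3 \<union> ?A4)"
    proof eventually_elim
      case (elim \<omega>)
      show ?case
      proof (intro impI, rule ccontr)
        assume a: "\<omega> \<in> {\<omega>\<in>space M. \<epsilon> \<le> \<bar>?I S \<omega>\<bar>}" "\<omega> \<notin> (?A1 \<union> ?A2) \<union> (?A3 \<union> ?A4)"
        then have w: "\<omega> \<in> space M" by blast
        have "\<sigma> k \<omega> = T" using a w stopping_time_uptoD(2)[OF \<sigma>(1) w, of k] by auto
        then have ZX: "Z t \<omega> = X t \<omega>" if "t \<in> {0..T}" for t using that by (simp add: Z_def min_absorb2)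
        have S_eq: "S (grid n i) \<omega> = ?E (grid n i) p \<omega> - ?E (grid n i) q \<omega> + A (grid n i) \<omega>" if "i \<le> 2 ^ n" for i
          using SXA[OF grid_in[OF that] w] ZX[OF grid_in[OF that]] elim that by simp
        have "?I S \<omega> = (\<Sum>i<2 ^ n. h i \<omega> * (?E (grid n (Suc i)) p \<omega> - ?E (grid n i) p \<omega>) -
            h i \<omega> * (?E (grid n (Suc i)) q \<omega> - ?E (grid n i) q \<omega>) + h i \<omega> * (A (grid n (Suc i)) \<omega> - A (grid n i) \<omega>))"
          by (intro sum.cong refl) (simp add: S_eq Suc_le_eq algebra_simps)
        then have e: "?I S \<omega> = ?I (\<lambda>t. ?E t p) \<omega> - ?I (\<lambda>t. ?E t q) \<omega> + ?I A \<omega>"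
          by (simp only: sum.distrib sum_subtractf)
        have "\<bar>?I A \<omega>\<bar> \<le> (\<Sum>i<2 ^ n. K * \<bar>A (grid n (Suc i)) \<omega> - A (grid n i) \<omega>\<bar>)"
          using h w by (intro order_trans[OF sum_abs] sum_mono) (auto simp: abs_mult intro!: mult_right_mono)
        also have "\<dots> = K * ?V \<omega>" by (simp only: sum_distrib_left)
        also have "\<dots> \<le> K * C" using a w K(1) by (intro mult_left_mono) auto
        finally have 1: "\<bar>?I A \<omega>\<bar> \<le> \<epsilon> / 4" using K(4) by simp
        have 2: "\<bar>?I (\<lambda>t. ?E t p) \<omega>\<bar> < \<epsilon> / 4" and 3: "\<bar>?I (\<lambda>t. ?E t q) \<omega>\<bar> < \<epsilon> / 4" using a(2) w by (auto simp: not_le)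
        have "\<bar>x - y + z\<bar> < e" if "\<bar>x\<bar> < e / 4" "\<bar>y\<bar> < e / 4" "\<bar>z\<bar> \<le> e / 4" for x y z e :: real using that by linarith
        from this[OF 2 3 1] have "\<bar>?I S \<omega>\<bar> < \<epsilon>" unfolding e .
        then show False using a(1) by simp
      qed
    qed
    then have "prob {\<omega>\<in>space M. \<epsilon> \<le> \<bar>?I S \<omega>\<bar>} \<le> prob ((?A1 \<union> ?A2) \<union> (?A3 \<union> ?A4))"
      by (rule finite_measure_mono_AE) (intro sets.Un m)
    also have "\<dots> \<le> prob (?A1 \<union> ?A2) + prob (?A3 \<union> ?A4)" by (intro measure_Un_le sets.Un m)
    also have "\<dots> \<le> (prob ?A1 + prob ?A2) + (prob ?A3 + prob ?A4)" by (intro add_mono measure_Un_le m)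
    also have "\<dots> \<le> (\<eta> / 4 + \<eta> / 4) + (\<eta> / 4 + \<eta> / 4)"
      using k C(2)[of n] K1(2)[OF _ K(2) h] K2(2)[OF _ K(3) h] K(1) by (intro add_mono) auto
    finally show ?thesis by simp
  qed
  then show ?thesis using K(1) by blast
qed

text \<open>The bound \<open>K\<close> for grid sums works for every grid, so the estimate passes
  from the Riemann sums to the integral itself as soon as the sup norm is below
  \<open>K\<close>.\<close>

lemma semimartingale_imp_no_gain:
  assumes S: "semimartingale M F T S" and cad: "cadlag_process M T S" and ad: "adapted_upto F T S"
    and H: "\<And>n. simple_integrand M F T (H n)" and norm: "(\<lambda>n. sup_norm M T (integrand_process (H n))) \<longlonglongrightarrow> 0"
  shows "tendsto_in_prob M (\<lambda>n \<omega>. pos_part (stoch_integral (H n) S T \<omega>)) (\<lambda>_. 0)"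
  unfolding tendsto_in_prob_def
proof (intro allI impI)
  fix \<epsilon> :: real assume \<epsilon>: "\<epsilon> > 0"
  have S_meas: "S t \<in> borel_measurable M" if "t \<in> {0..T}" for t
    using ad that FF_measurable_M[of "S t" t] FF_eq[OF that] by (auto simp: adapted_upto_def)
  have S_cadlag: "cadlag_path T (\<lambda>t. S t \<omega>)" if "\<omega> \<in> space M" for \<omega>
    using cad that by (simp add: cadlag_process_def)
  let ?p = "\<lambda>m. prob {\<omega>\<in>space M. \<epsilon> < \<bar>pos_part (stoch_integral (H m) S T \<omega>) - 0\<bar>}"
  have main: "\<forall>\<^sub>F m in sequentially. ?p m \<le> \<eta>" if \<eta>: "\<eta> > 0" for \<eta>
  proof -
    obtain K where K: "K > 0" and small: "\<And>n h. (\<forall>i<2 ^ n. h i \<in> borel_measurable (FF (grid n i)) \<and> (\<forall>\<omega>\<in>space M. \<bar>h i \<omega>\<bar> \<le> K)) \<Longrightarrow>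
      prob {\<omega>\<in>space M. \<epsilon> / 2 \<le> \<bar>\<Sum>i<2 ^ n. h i \<omega> * (S (grid n (Suc i)) \<omega> - S (grid n i) \<omega>)\<bar>} \<le> \<eta>"
      using semimartingale_grid_sums_small[OF S \<eta>, of "\<epsilon> / 2"] \<epsilon> by auto
    have "\<forall>\<^sub>F m in sequentially. sup_norm M T (integrand_process (H m)) < ereal K"
      using norm by (rule order_tendstoD) (use K in simp)
    then show ?thesis
    proof eventually_elim
      case (elim m)
      let ?h = "\<lambda>t. integrand_process (H m) t"
      let ?I = "\<lambda>n \<omega>. \<Sum>i<2 ^ n. ?h (grid n i) \<omega> * (S (grid n (Suc i)) \<omega> - S (grid n i) \<omega>)"
      \<comment> \<open>The sup norm bounds each value only almost everywhere; clipping at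
        \<open>K\<close> changes the finitely many grid values on null sets.\<close>
      define h where "h n i \<omega> = max (- K) (min K (?h (grid n i) \<omega>))" for n i \<omega>
      have hm: "?h (grid n i) \<in> borel_measurable (FF (grid n i))" if "i \<le> 2 ^ n" for n i
        using integrand_process_measurable[OF H grid_in[OF that]] .
      have IM: "?I n \<in> borel_measurable M" for n
      proof (intro borel_measurable_sum borel_measurable_times borel_measurable_diff)
        fix i assume "i \<in> {..<(2::nat) ^ n}"
        then have i: "i \<le> 2 ^ n" "Suc i \<le> 2 ^ n" by auto
        show "?h (grid n i) \<in> borel_measurable M" by (rule FF_measurable_M, rule hm, rule i(1))
        show "S (grid n (Suc i)) \<in> borel_measurable M" "S (grid n i) \<in> borel_measurable M"
          by (rule S_meas, rule grid_in, rule i)+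
      qed
      have AE_h: "AE \<omega> in M. h n i \<omega> = ?h (grid n i) \<omega>" if i: "i \<le> 2 ^ n" for n i
      proof -
        have "Linf_norm M (?h (grid n i)) \<le> sup_norm M T ?h"
          unfolding sup_norm_def by (rule SUP_upper[OF grid_in[OF i]])
        then have "Linf_norm M (?h (grid n i)) < ereal K" using elim by (rule le_less_trans)
        moreover have "AE \<omega> in M. ereal \<bar>?h (grid n i) \<omega>\<bar> \<le> Linf_norm M (?h (grid n i))"
          unfolding Linf_norm_def by (rule esssup_AE)
        ultimately show ?thesis
        proof -
          assume a: "AE \<omega> in M. ereal \<bar>?h (grid n i) \<omega>\<bar> \<le> Linf_norm M (?h (grid n i))" and b: "Linf_norm M (?h (grid n i)) < ereal K"
          show ?thesis using a
          proof eventually_elim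
            case (elim \<omega>)
            have "ereal \<bar>?h (grid n i) \<omega>\<bar> < ereal K" using elim b by (rule le_less_trans)
            then show ?case by (auto simp: h_def abs_less_iff)
          qed
        qed
      qed
      have "prob {\<omega>\<in>space M. \<epsilon> < \<bar>stoch_integral (H m) S T \<omega>\<bar>} \<le> \<eta>"
      proof (rule prob_limit_le)
        show "?I n \<in> borel_measurable M" for n by (rule IM)
        show "(\<lambda>n. ?I n \<omega>) \<longlonglongrightarrow> stoch_integral (H m) S T \<omega>" if "\<omega> \<in> space M" for \<omega>
          by (rule stoch_integral_grid_limit, rule H, rule that, rule S_cadlag, rule that)
        show "prob {\<omega>\<in>space M. \<epsilon> / 2 \<le> \<bar>?I n \<omega>\<bar>} \<le> \<eta>" for n
        proof -
          let ?I' = "\<lambda>\<omega>. \<Sum>i<2 ^ n. h n i \<omega> * (S (grid n (Suc i)) \<omega> - S (grid n i) \<omega>)"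
          have h'm: "h n i \<in> borel_measurable (FF (grid n i))" if "i \<le> 2 ^ n" for i
            unfolding h_def using hm[OF that] by measurable
          have "?I' \<in> borel_measurable M"
            using FF_measurable_M[OF h'm] S_meas[OF grid_in] by (intro borel_measurable_sum borel_measurable_times borel_measurable_diff) auto
          then have e: "{\<omega>\<in>space M. \<epsilon> / 2 \<le> \<bar>?I' \<omega>\<bar>} \<in> events" by measurable
          have "AE \<omega> in M. \<forall>i\<in>{..<2 ^ n}. h n i \<omega> = ?h (grid n i) \<omega>" by (intro AE_finite_allI AE_h) auto
          then have "AE \<omega> in M. \<omega> \<in> {\<omega>\<in>space M. \<epsilon> / 2 \<le> \<bar>?I n \<omega>\<bar>} \<longrightarrow> \<omega> \<in> {\<omega>\<in>space M. \<epsilon> / 2 \<le> \<bar>?I' \<omega>\<bar>}"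
            by eventually_elim simp
          then have "prob {\<omega>\<in>space M. \<epsilon> / 2 \<le> \<bar>?I n \<omega>\<bar>} \<le> prob {\<omega>\<in>space M. \<epsilon> / 2 \<le> \<bar>?I' \<omega>\<bar>}"
            by (rule finite_measure_mono_AE[OF _ e])
          also have "\<dots> \<le> \<eta>" 
          proof (rule small, intro allI impI conjI ballI)
            fix i assume "i < (2::nat) ^ n"
            then show "h n i \<in> borel_measurable (FF (grid n i))" using h'm by simp
            show "\<bar>h n i \<omega>\<bar> \<le> K" for \<omega> using K by (auto simp: h_def)
          qed
          finally show ?thesis .
        qed
        show "\<epsilon> / 2 < \<epsilon>" using \<epsilon> by simp
      qed
      moreover have "?p m \<le> prob {\<omega>\<in>space M. \<epsilon> < \<bar>stoch_integral (H m) S T \<omega>\<bar>}"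
      proof (rule finite_measure_mono)
        have "(\<lambda>\<omega>. stoch_integral (H m) S T \<omega>) \<in> borel_measurable M"
        proof (rule borel_measurable_LIMSEQ_real)
          show "(\<lambda>n. ?I n \<omega>) \<longlonglongrightarrow> stoch_integral (H m) S T \<omega>" if "\<omega> \<in> space M" for \<omega>
            by (rule stoch_integral_grid_limit, rule H, rule that, rule S_cadlag, rule that)
          show "?I n \<in> borel_measurable M" for n by (rule IM)
        qed
        then show "{\<omega>\<in>space M. \<epsilon> < \<bar>stoch_integral (H m) S T \<omega>\<bar>} \<in> events" by measurable
      qed (use \<epsilon> in \<open>auto simp: pos_part_def max_def split: if_splits\<close>)
      ultimately show ?case by linarith
    qed
  qed
  show "?p \<longlonglongrightarrow> 0"
  proof (rule order_tendstoI)
    fix a :: real assume "a < 0"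
    then show "\<forall>\<^sub>F m in sequentially. a < ?p m" by (intro always_eventually allI less_le_trans[OF _ measure_nonneg])
  next
    fix a :: real assume "0 < a"
    then have "\<forall>\<^sub>F m in sequentially. ?p m \<le> a / 2" by (intro main) simp
    then show "\<forall>\<^sub>F m in sequentially. ?p m < a" by eventually_elim (use \<open>0 < a\<close> in simp)
  qed
qed

end

theorem theorem1p7:
  fixes T :: real and M :: "'a measure" and F :: "real \<Rightarrow> 'a measure" and S :: "real \<Rightarrow> 'a \<Rightarrow> real"
  assumes "T > 0"
    and "usual_filtered_prob_space M F T"
    and "cadlag_process M T S"
    and "adapted_upto F T S"
  shows "(\<forall>H :: nat \<Rightarrow> 'a simple_rep.
            (\<forall>n. simple_integrand M F T (H n)) \<and>
            (\<lambda>n. sup_norm M T (integrand_process (H n))) \<longlonglongrightarrow> 0 \<and>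
            tendsto_in_prob M (\<lambda>n \<omega>. SUP t\<in>{0..T}. neg_part (stoch_integral (H n) S t \<omega>)) (\<lambda>_. 0)
            \<longrightarrow> tendsto_in_prob M (\<lambda>n \<omega>. pos_part (stoch_integral (H n) S T \<omega>)) (\<lambda>_. 0))
         \<longleftrightarrow> semimartingale M F T S"
proof -
  interpret usual_filtered_prob_space M F T by (rule assms(2))
  interpret horizon M F T by unfold_locales (rule assms(1))
  show ?thesis
    using no_gain_imp_semimartingale[OF assms(4,3)] semimartingale_imp_no_gain[OF _ assms(3,4)] by blast
qed

end
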